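(* Let $\mathcal{L}\subseteq\mathbb{C}^{[n]}$ be a diagonal linear concentration model (i.e. a linear subspace) of dimension $r$ that is not contained in any coordinate hyperplane, and let $M$ be the associated (loopless) matroid of rank $r$ on $[n]$, with characteristic polynomial $\chi_M$. Then the reciprocal maximum likelihood degree of $\mathcal{L}$ satisfies $$\operatorname{rmld}(\mathcal{L})=(-2)^r\,\chi_M\!\left(\tfrac12\right).$$
   Context: Let $[n]=\{1,\dots,n\}$. Let $\mathbb{S}^n$ be the space of symmetric $n\times n$ matrices and $\mathbb{S}^n_{>0}$ the set of real positive definite ones. For fixed $S\in\mathbb{S}^n_{>0}$ the log-likelihood function is $\ell_S(K)=\log\det K-\operatorname{trace}(S\cdot K)$; on invertible complex symmetric matrices its differential is a well-defined (algebraic) $1$-form, so one can speak of its complex critical points on smooth subvarieties. For a subvariety $\mathcal{L}\subseteq\mathbb{S}^n$, let $\mathcal{L}^{-1}\subseteq\mathbb{S}^n$ be the Zariski closure of $\{K^{-1} : K\in\mathcal{L}\text{ invertible}\}$. The reciprocal maximum likelihood degree $\operatorname{rmld}(\mathcal{L})$ is the number of invertible complex critical points of $\ell_S$ on the smooth locus of $\mathcal{L}^{-1}$, counted with multiplicity, for a general choice of $S$. A diagonal linear concentration model is a linear subspace $\mathcal{L}\subseteq\mathbb{C}^{[n]}$, where $\mathbb{C}^{[n]}$ is identified with the space of diagonal matrices in $\mathbb{S}^n$. The matroid $M$ associated to $\mathcal{L}$ is the matroid on $[n]$ whose independent sets are the $I\subseteq[n]$ such that the composition $\mathbb{C}^I\hookrightarrow\mathbb{C}^{[n]}\twoheadrightarrow\mathcal{L}^\vee$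 is injective; equivalently, it is the matroid of the columns of any $r\times n$ matrix whose row span is $\mathcal{L}$. It is loopless if and only if $\mathcal{L}$ is not contained in a coordinate hyperplane. Its characteristic polynomial is $\chi_M(q)=\sum_{A\subseteq[n]}(-1)^{|A|}q^{\,r-\operatorname{rk}_M(A)}$, which for loopless $M$ equals $\sum_{F}\mu(\emptyset,F)\,q^{\,r-\operatorname{rk}F}$, the sum being over flats $F$ of $M$ and $\mu$ the Möbius function of the lattice of flats. *)

theory Defs
  imports "HOL-Analysis.Analysis" "HOL-Computational_Algebra.Polynomial"
begin

section \<open>Zariski topology on complex matrices\<close>

text \<open>
  Varieties of symmetric matrices are treated as Zariski closed subsets of the space of all
  complex square matrices.  The symmetric matrices form a linear subspace, so closures, tangent
  spaces, dimensions and local rings are the same whether computed in the subspace or in the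
  ambient space; the equations of symmetry just become members of the vanishing ideals.
\<close>

inductive poly_fun :: "(complex^'n^'n \<Rightarrow> complex) \<Rightarrow> bool" where
  const: "poly_fun (\<lambda>K. c)"
| coord: "poly_fun (\<lambda>K. K $ i $ j)"
| add: "poly_fun f \<Longrightarrow> poly_fun g \<Longrightarrow> poly_fun (\<lambda>K. f K + g K)"
| mult: "poly_fun f \<Longrightarrow> poly_fun g \<Longrightarrow> poly_fun (\<lambda>K. f K * g K)"

definition vanishing_ideal :: "(complex^'n^'n) set \<Rightarrow> (complex^'n^'n \<Rightarrow> complex) set" where
  "vanishing_ideal X = {f. poly_fun f \<and> (\<forall>K\<in>X. f K = 0)}"

definition zariski_closure :: "(complex^'n^'n) set \<Rightarrow> (complex^'n^'n) set" where
  "zariski_closure X = {K. \<forall>f\<in>vanishing_ideal X. f K = 0}"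

definition zariski_closed :: "(complex^'n^'n) set \<Rightarrow> bool" where
  "zariski_closed X \<longleftrightarrow> zariski_closure X = X"

definition irreducible_closed :: "(complex^'n^'n) set \<Rightarrow> bool" where
  "irreducible_closed Z \<longleftrightarrow> zariski_closed Z \<and> Z \<noteq> {} \<and>
     (\<forall>A B. zariski_closed A \<and> zariski_closed B \<and> Z = A \<union> B \<longrightarrow> Z = A \<or> Z = B)"

text \<open>The Krull dimension of the local ring of \<open>X\<close> at \<open>K\<close>: chains of irreducible closed
  subsets through \<open>K\<close>.\<close>

definition local_dim :: "(complex^'n^'n) set \<Rightarrow> complex^'n^'n \<Rightarrow> enat" where
  "local_dim X K = Sup {enat m | m. \<exists>Z.
     (\<forall>i\<le>m. irreducible_closed (Z i) \<and> K \<in> Z i \<and> Z i \<subseteq> X) \<and> (\<forall>i<m. Z i \<subset> Z (Suc i))}"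


section \<open>Tangent spaces and smooth points\<close>

definition cscale :: "complex \<Rightarrow> complex^'n^'n \<Rightarrow> complex^'n^'n" where
  "cscale c K = map_matrix (\<lambda>x. c * x) K"

interpretation cmat: vector_space "cscale :: complex \<Rightarrow> complex^'n^'n \<Rightarrow> complex^'n^'n"
  by standard (simp_all add: cscale_def vec_eq_iff algebra_simps)

definition dir_deriv ::
    "(complex^'n^'n \<Rightarrow> complex) \<Rightarrow> complex^'n^'n \<Rightarrow> complex^'n^'n \<Rightarrow> complex" where
  "dir_deriv f K V = deriv (\<lambda>t. f (K + cscale t V)) 0"

definition tangent_space :: "(complex^'n^'n) set \<Rightarrow> complex^'n^'n \<Rightarrow> (complex^'n^'n) set" where
  "tangent_space X K = {V. \<forall>f\<in>vanishing_ideal X. dir_deriv f K V = 0}"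

definition smooth_locus :: "(complex^'n^'n) set \<Rightarrow> (complex^'n^'n) set" where
  "smooth_locus X = {K \<in> X. enat (cmat.dim (tangent_space X K)) = local_dim X K}"


section \<open>Critical points of the log-likelihood function\<close>

text \<open>The differential of \<open>log det K - trace (S K)\<close> at \<open>K\<close> in direction \<open>V\<close>, where
  \<open>d (log det) = d det / det\<close> avoids the choice of a branch of the logarithm.\<close>

definition dloglik :: "complex^'n^'n \<Rightarrow> complex^'n^'n \<Rightarrow> complex^'n^'n \<Rightarrow> complex" where
  "dloglik S K V = dir_deriv det K V / det K - trace (S ** V)"

definition critical_points :: "(complex^'n^'n) set \<Rightarrow> complex^'n^'n \<Rightarrow> (complex^'n^'n) set" where
  "critical_points X S =
     {K \<in> smooth_locus X. invertible K \<and> (\<forall>V\<in>tangent_space X K. dloglik S K V = 0)}"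

definition tangent_fields :: "(complex^'n^'n) set \<Rightarrow> (complex^'n^'n \<Rightarrow> complex^'n^'n) set" where
  "tangent_fields X = {\<theta>. (\<forall>i j. poly_fun (\<lambda>K. \<theta> K $ i $ j)) \<and>
     (\<forall>K\<in>X. \<theta> K \<in> tangent_space X K)}"

definition ideal_generated ::
    "(complex^'n^'n \<Rightarrow> complex) set \<Rightarrow> (complex^'n^'n \<Rightarrow> complex) set" where
  "ideal_generated G = {\<lambda>K. \<Sum>g\<in>F. a g K * g K | F a.
     finite F \<and> F \<subseteq> G \<and> (\<forall>g\<in>F. poly_fun (a g))}"

text \<open>
  The zero scheme on \<open>X\<close> of the \<open>1\<close>-form \<open>dloglik S\<close> is cut out by its contractions with the
  derivations of the coordinate ring of \<open>X\<close>, i.e. with the polynomial vector fields tangent to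
  \<open>X\<close>; derivations of the local rings are localizations of these.  The contractions are
  multiplied by \<open>det K\<close>, a unit at invertible points, to clear denominators.
\<close>

definition critical_ideal ::
    "(complex^'n^'n) set \<Rightarrow> complex^'n^'n \<Rightarrow> (complex^'n^'n \<Rightarrow> complex) set" where
  "critical_ideal X S = ideal_generated (vanishing_ideal X \<union>
     {\<lambda>K. dir_deriv det K (\<theta> K) - det K * trace (S ** \<theta> K) | \<theta>. \<theta> \<in> tangent_fields X})"

text \<open>The contraction to the polynomial ring of the extension of \<open>J\<close> to the local ring at \<open>K\<close>.\<close>

definition localized_ideal ::
    "(complex^'n^'n \<Rightarrow> complex) set \<Rightarrow> complex^'n^'n \<Rightarrow> (complex^'n^'n \<Rightarrow> complex) set" where
  "localized_ideal J K =
     {f. poly_fun f \<and> (\<exists>g. poly_fun g \<and> g K \<noteq> 0 \<and> (\<lambda>P. g P * f P) \<in> J)}"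

text \<open>The complex dimension of the polynomial ring modulo \<open>Q\<close>: the supremum of the sizes of
  finite sets of polynomials that are linearly independent modulo \<open>Q\<close>.\<close>

definition colength :: "(complex^'n^'n \<Rightarrow> complex) set \<Rightarrow> enat" where
  "colength Q = Sup {enat (card B) | B. finite B \<and> (\<forall>b\<in>B. poly_fun b) \<and>
     (\<forall>c. (\<lambda>K. \<Sum>b\<in>B. c b * b K) \<in> Q \<longrightarrow> (\<forall>b\<in>B. c b = 0))}"

text \<open>The length of the local ring of the critical scheme at \<open>K\<close>.  The polynomial ring modulo the
  contracted ideal embeds into that local ring, and the two coincide as soon as either is finite
  dimensional.\<close>

definition critical_mult :: "(complex^'n^'n) set \<Rightarrow> complex^'n^'n \<Rightarrow> complex^'n^'n \<Rightarrow> enat" where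
  "critical_mult X S K = colength (localized_ideal (critical_ideal X S) K)"

definition critical_count :: "(complex^'n^'n) set \<Rightarrow> complex^'n^'n \<Rightarrow> enat" where
  "critical_count X S = (if finite (critical_points X S)
     then \<Sum>K\<in>critical_points X S. critical_mult X S K else \<infinity>)"


section \<open>Reciprocal maximum likelihood degree\<close>

definition pos_def :: "real^'n^'n \<Rightarrow> bool" where
  "pos_def S \<longleftrightarrow> transpose S = S \<and> (\<forall>x. x \<noteq> 0 \<longrightarrow> 0 < x \<bullet> (S *v x))"

text \<open>\<open>P\<close> holds on a nonempty Zariski open set of symmetric matrices, as far as this set meets
  the real positive definite cone (which is Zariski dense in the symmetric matrices).\<close>

definition for_general_pos_def :: "(real^'n^'n \<Rightarrow> bool) \<Rightarrow> bool" where
  "for_general_pos_def P \<longleftrightarrow> (\<exists>h. poly_fun h \<and> (\<exists>T. transpose T = T \<and> h T \<noteq> 0) \<and>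
     (\<forall>S. pos_def S \<and> h (map_matrix complex_of_real S) \<noteq> 0 \<longrightarrow> P S))"

definition reciprocal_variety :: "(complex^'n^'n) set \<Rightarrow> (complex^'n^'n) set" where
  "reciprocal_variety L = zariski_closure {matrix_inv K | K. K \<in> L \<and> invertible K}"

definition has_rmld :: "(complex^'n^'n) set \<Rightarrow> nat \<Rightarrow> bool" where
  "has_rmld L d \<longleftrightarrow> for_general_pos_def (\<lambda>S.
     critical_count (reciprocal_variety L) (map_matrix complex_of_real S) = enat d)"

definition rmld :: "(complex^'n^'n) set \<Rightarrow> nat" where
  "rmld L = (THE d. has_rmld L d)"


section \<open>The matroid of a linear subspace\<close>

definition diag_mat :: "complex^'n \<Rightarrow> complex^'n^'n" where
  "diag_mat v = (\<chi> i j. if i = j then v $ i else 0)"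

text \<open>\<open>I\<close> is independent iff sending \<open>c\<close>, supported on \<open>I\<close>, to the functional
  \<open>v \<mapsto> \<Sum>i. c\<^sub>i v\<^sub>i\<close> on \<open>L\<close> is injective.\<close>

definition matroid_indep :: "(complex^'n) set \<Rightarrow> 'n set \<Rightarrow> bool" where
  "matroid_indep L I \<longleftrightarrow> (\<forall>c :: complex^'n. (\<forall>i. i \<notin> I \<longrightarrow> c $ i = 0) \<and>
     (\<forall>v\<in>L. (\<Sum>i\<in>UNIV. c $ i * v $ i) = 0) \<longrightarrow> c = 0)"

definition matroid_rank :: "('n::finite set \<Rightarrow> bool) \<Rightarrow> 'n set \<Rightarrow> nat" where
  "matroid_rank indep A = Max (card ` {I. I \<subseteq> A \<and> indep I})"

definition characteristic_poly :: "('n::finite set \<Rightarrow> bool) \<Rightarrow> int poly" where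
  "characteristic_poly indep = (\<Sum>A\<in>UNIV.
     monom ((- 1) ^ card A) (matroid_rank indep UNIV - matroid_rank indep A))"

end

theory Submission
  imports Defs
begin

text \<open>
  An invertible point of the reciprocal variety is \<open>inv_diag y\<close> with \<open>y \<in> L\<close>, and it is critical
  iff \<open>w\<^sub>i = s\<^sub>i / y\<^sub>i\<^sup>2 - 1 / y\<^sub>i\<close>, where \<open>s\<close> is the diagonal of \<open>S\<close>, lies in the orthogonal complement of
  \<open>L\<close>.  So one counts the preimages of a general \<open>s\<close> under the map
  \<open>(y, w) \<mapsto> (a\<^sub>i y\<^sub>i + y\<^sub>i\<^sup>2 w\<^sub>i)\<^sub>i\<close> on the \<open>n\<close>-dimensional space of pairs with \<open>y \<in> L\<close> and \<open>w\<close> orthogonal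
  to \<open>L\<close>, with \<open>a = 1\<close>.

  Away from a hypersurface of values \<open>s\<close>, this map is proper and its fibres are nondegenerate, so
  their cardinality is locally constant; as the complement of a complex hypersurface is connected,
  a generic cardinality exists, and it is the same for all real weights \<open>a \<ge> 0\<close> that do not vanish
  on the support of a nonzero vector of \<open>L\<close>.  Hence one may pass to \<open>a\<^sub>e = 0\<close>.  As \<open>s\<^sub>e\<close> then tends to \<open>0\<close>, some
  solutions keep \<open>y\<^sub>e\<close> away from \<open>0\<close> and converge to those of the deletion of \<open>e\<close>, whereas the others
  have \<open>y\<^sub>e\<close> proportional to \<open>\<plusminus> sqrt s\<^sub>e\<close> and converge in pairs to those of the contraction.  The recursion
  \<open>d (M) = d (M - e) + 2 d (M / e)\<close> is the one satisfied by \<open>(-2)\<^sup>r \<chi>\<^sub>M(1/2)\<close>.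

  Nondegeneracy of a solution makes the corresponding critical point reduced, by Cramer's rule applied
  to explicit elements of the critical ideal.
\<close>

section \<open>Algebraic dependence\<close>

text \<open>The weights \<open>a\<close> exist because letting \<open>s_e\<close> tend to 0 at
  \<open>a_e = 1\<close> is useless: \<open>y_e (1 + y_e w_e) = 0\<close> does not describe two
  minors. At \<open>a_e = 0\<close> the limit equation is \<open>y_e\<^sup>2 w_e = 0\<close>; its
  branch \<open>w_e = 0\<close> is the deletion and its branch \<open>y_e = 0\<close> the
  contraction, reached through two square roots. Properness tolerates weights whose sum over the
  support of each nonzero vector is nonzero, and real nonnegative weights keep this property along a
  whole segment, which transports the count. With positive weights elsewhere, \<open>a_e = 0\<close>
  is excluded only for a coloop, so the recursion ends at a loop, without solutions, or when all
  elements are coloops, where the system is linear. The main obstacle is compactness. Solutions can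
  escape with \<open>y\<close> going to infinity, which the weights exclude, or with some
  \<open>y_i\<close> going to 0, which genericity of \<open>s\<close> excludes. Genericity rests on
  one fact, proved by counting monomials: a polynomial map of affine space to itself sends a
  hypersurface into some hypersurface.\<close>

inductive pfun :: "('k \<Rightarrow> 'p \<Rightarrow> complex) \<Rightarrow> 'k set \<Rightarrow> ('p \<Rightarrow> complex) \<Rightarrow> bool"
  for x :: "'k \<Rightarrow> 'p \<Rightarrow> complex" and K :: "'k set" where
  const: "pfun x K (\<lambda>p. c)"
| gen: "i \<in> K \<Longrightarrow> pfun x K (x i)"
| add: "pfun x K f \<Longrightarrow> pfun x K g \<Longrightarrow> pfun x K (\<lambda>p. f p + g p)"
| mult: "pfun x K f \<Longrightarrow> pfun x K g \<Longrightarrow> pfun x K (\<lambda>p. f p * g p)"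

lemma pfun_cong: "pfun x K f \<Longrightarrow> (\<And>p. f p = g p) \<Longrightarrow> pfun x K g"
  by (metis ext)

lemma pfun_uminus: "pfun x K f \<Longrightarrow> pfun x K (\<lambda>p. - f p)"
  using pfun.mult[OF pfun.const[of x K "-1"]] by (auto intro: pfun_cong)

lemma pfun_diff: "pfun x K f \<Longrightarrow> pfun x K g \<Longrightarrow> pfun x K (\<lambda>p. f p - g p)"
  using pfun.add[OF _ pfun_uminus] by fastforce

lemma pfun_sum: "(\<And>i. i \<in> A \<Longrightarrow> pfun x K (f i)) \<Longrightarrow> pfun x K (\<lambda>p. \<Sum>i\<in>A. f i p)"
  by (induction A rule: infinite_finite_induct) (auto intro: pfun.intros)

lemma pfun_prod: "(\<And>i. i \<in> A \<Longrightarrow> pfun x K (f i)) \<Longrightarrow> pfun x K (\<lambda>p. \<Prod>i\<in>A. f i p)"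
  by (induction A rule: infinite_finite_induct) (auto intro: pfun.intros)

lemma pfun_power: "pfun x K f \<Longrightarrow> pfun x K (\<lambda>p. f p ^ m)"
  by (induction m) (auto intro: pfun.intros)

lemma pfun_poly: "pfun x K f \<Longrightarrow> pfun x K (\<lambda>p. poly q (f p))"
  by (induction q) (auto intro: pfun.intros)

lemma pfun_if: "(P \<Longrightarrow> pfun x K f) \<Longrightarrow> (\<not> P \<Longrightarrow> pfun x K g) \<Longrightarrow> pfun x K (\<lambda>p. if P then f p else g p)"
  by (cases P) auto

lemmas pfun_intros = pfun.const pfun.add pfun.mult pfun_uminus pfun_diff pfun_sum pfun_prod
  pfun_power pfun_poly pfun_if

text \<open>The generators are an arbitrary family of functions on an arbitrary type, so that one
  notion serves for coordinates of a vector, entries of a matrix, a subset of the parameters and a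
  single variable; substitution moves between them.\<close>

lemma pfun_comp:
  assumes "pfun x K f" and "\<And>i. i \<in> K \<Longrightarrow> pfun y L (\<lambda>p. x i (\<phi> p))"
  shows "pfun y L (\<lambda>p. f (\<phi> p))"
  using assms(1) by induction (auto intro: pfun.intros assms(2))

text \<open>Questions in many variables are reduced to restrictions to lines, where a nonzero
  polynomial has finitely many roots.\<close>

lemma pfun_line:
  assumes "pfun x K f" and "\<And>i. i \<in> K \<Longrightarrow> \<exists>q. \<forall>t. x i (\<gamma> t) = poly q t"
  shows "\<exists>q. \<forall>t. f (\<gamma> t) = poly q t"
  using assms(1)
proof induction
  case (const c) show ?case by (rule exI[of _ "[:c:]"]) simp
next
  case (gen i) then show ?case by (rule assms(2))
next
  case (add f g) then show ?case by (metis poly_add)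
next
  case (mult f g) then show ?case by (metis poly_mult)
qed

text \<open>The bound is on each exponent separately: the monomials then number
  \<open>(D + 1) ^ card K\<close>, and under products the bounds add, which is what the count in
  \<open>algebraic_dependence\<close> needs.\<close>

inductive mspan :: "('k \<Rightarrow> 'p \<Rightarrow> complex) \<Rightarrow> 'k set \<Rightarrow> nat \<Rightarrow> ('p \<Rightarrow> complex) \<Rightarrow> bool"
  for x :: "'k \<Rightarrow> 'p \<Rightarrow> complex" and K :: "'k set" and D :: nat where
  mono: "\<forall>i\<in>K. e i \<le> D \<Longrightarrow> mspan x K D (\<lambda>p. \<Prod>i\<in>K. x i p ^ e i)"
| scale: "mspan x K D f \<Longrightarrow> mspan x K D (\<lambda>p. c * f p)"
| add: "mspan x K D f \<Longrightarrow> mspan x K D g \<Longrightarrow> mspan x K D (\<lambda>p. f p + g p)"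

lemma mspan_mono: "mspan x K D f \<Longrightarrow> D \<le> D' \<Longrightarrow> mspan x K D' f"
  by (induction rule: mspan.induct) (auto intro!: mspan.intros dest: order_trans)

lemma mspan_mult:
  assumes "mspan x K D f" "mspan x K D' g"
  shows "mspan x K (D + D') (\<lambda>p. f p * g p)"
  using assms(1)
proof induction
  case (mono e)
  show ?case using assms(2)
  proof induction
    case (mono e')
    have "mspan x K (D + D') (\<lambda>p. \<Prod>i\<in>K. x i p ^ (e i + e' i))"
      using mono \<open>\<forall>i\<in>K. e i \<le> D\<close> by (intro mspan.mono) (auto intro: add_mono)
    then show ?case by (simp add: power_add prod.distrib)
  next
    case (scale f c)
    from mspan.scale[OF scale.IH, of c] show ?case by (simp add: ac_simps)
  next
    case (add f g)
    from mspan.add[OF add.IH] show ?case by (simp add: algebra_simps)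
  qed
next
  case (scale f c)
  from mspan.scale[OF scale.IH, of c] show ?case by (simp add: ac_simps)
next
  case (add f g)
  from mspan.add[OF add.IH] show ?case by (simp add: algebra_simps)
qed

lemma mspan_const: "mspan x K D (\<lambda>p. c)"
  using mspan.scale[OF mspan.mono[of K "\<lambda>_. 0" D x], of c] by simp

lemma mspan_sum: "(\<And>i. i \<in> A \<Longrightarrow> mspan x K D (f i)) \<Longrightarrow> mspan x K D (\<lambda>p. \<Sum>i\<in>A. f i p)"
  by (induction A rule: infinite_finite_induct) (auto intro: mspan.intros mspan_const)

lemma mspan_power: "mspan x K D f \<Longrightarrow> mspan x K (m * D) (\<lambda>p. f p ^ m)"
  by (induction m) (auto intro: mspan_const mspan_mult)

lemma mspan_prod:
  "(\<And>i. i \<in> A \<Longrightarrow> mspan x K D (f i)) \<Longrightarrow> mspan x K (card A * D) (\<lambda>p. \<Prod>i\<in>A. f i p)"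
  by (induction A rule: infinite_finite_induct) (auto intro: mspan_const mspan_mult)

lemma pfun_mspan:
  assumes "pfun x K f" "finite K" shows "\<exists>D. mspan x K D f"
  using assms(1)
proof induction
  case (const c) show ?case by (blast intro: mspan_const)
next
  case (gen i)
  have "mspan x K 1 (\<lambda>p. \<Prod>j\<in>K. x j p ^ (if j = i then 1 else 0))"
    by (rule mspan.mono) auto
  moreover have "(\<Prod>j\<in>K. x j p ^ (if j = i then 1 else 0)) = x i p" for p
    using gen \<open>finite K\<close> by (subst prod.remove[of _ i]) (auto intro: prod.neutral)
  ultimately show ?case by auto
next
  case (add f g)
  then obtain D D' where "mspan x K D f" "mspan x K D' g" by auto
  then have "mspan x K (max D D') f" "mspan x K (max D D') g" by (auto intro: mspan_mono)
  then show ?case by (blast intro: mspan.add)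
next
  case (mult f g) then show ?case by (blast intro: mspan_mult)
qed

lemma mspan_coeffs:
  assumes "mspan x K D f" "finite K"
  shows "\<exists>c. \<forall>p. f p = (\<Sum>e\<in>PiE K (\<lambda>_. {..D}). c e * (\<Prod>i\<in>K. x i p ^ e i))"
  using assms(1)
proof induction
  case (mono e)
  have "finite (PiE K (\<lambda>_. {..D}))" using \<open>finite K\<close> by (auto intro: finite_PiE)
  moreover have "restrict e K \<in> PiE K (\<lambda>_. {..D})" using mono by auto
  ultimately have "(\<Prod>i\<in>K. x i p ^ e i)
      = (\<Sum>e'\<in>PiE K (\<lambda>_. {..D}). (if e' = restrict e K then 1 else 0) * (\<Prod>i\<in>K. x i p ^ e' i))" for p
    by (subst sum.remove[of _ "restrict e K"]) (auto intro: sum.neutral)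
  then show ?case by (intro exI[of _ "\<lambda>e'. if e' = restrict e K then 1 else 0"]) auto
next
  case (scale f c)
  then obtain d where "\<forall>p. f p = (\<Sum>e\<in>PiE K (\<lambda>_. {..D}). d e * (\<Prod>i\<in>K. x i p ^ e i))" by auto
  then show ?case by (intro exI[of _ "\<lambda>e. c * d e"]) (simp add: sum_distrib_left mult.assoc)
next
  case (add f g)
  then obtain d d' where "\<forall>p. f p = (\<Sum>e\<in>PiE K (\<lambda>_. {..D}). d e * (\<Prod>i\<in>K. x i p ^ e i))"
    "\<forall>p. g p = (\<Sum>e\<in>PiE K (\<lambda>_. {..D}). d' e * (\<Prod>i\<in>K. x i p ^ e i))" by auto
  then show ?case by (intro exI[of _ "\<lambda>e. d e + d' e"]) (simp add: sum.distrib algebra_simps)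
qed

text \<open>Elimination: an unknown \<open>j\<close> with nonzero coefficient in the equation
  \<open>s\<close> is solved for and substituted, which leaves one equation and one unknown
  fewer.\<close>

lemma homogeneous_system_nontrivial:
  fixes m :: "'a \<Rightarrow> 'b \<Rightarrow> 'c::field"
  assumes "finite S" "finite I" "card S < card I"
  shows "\<exists>c. (\<exists>i\<in>I. c i \<noteq> 0) \<and> (\<forall>s\<in>S. (\<Sum>i\<in>I. c i * m i s) = 0)"
  using assms
proof (induction S arbitrary: I m rule: finite_induct)
  case empty
  then obtain i where "i \<in> I" by fastforce
  then show ?case by (intro exI[of _ "\<lambda>_. 1"]) auto
next
  case (insert s S)
  show ?case
  proof (cases "\<forall>i\<in>I. m i s = 0")
    case True
    have "card S < card I" using insert by simp
    from insert.IH[OF \<open>finite I\<close> this, of m] show ?thesis using True by auto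
  next
    case False
    then obtain j where j: "j \<in> I" "m j s \<noteq> 0" by auto
    let ?I = "I - {j}"
    have "card S < card ?I" using insert j by (simp add: card_Diff_singleton)
    from insert.IH[OF _ this, of "\<lambda>i t. m i t - m i s / m j s * m j t"]
    obtain c where c: "\<exists>i\<in>?I. c i \<noteq> 0"
      "\<forall>t\<in>S. (\<Sum>i\<in>?I. c i * (m i t - m i s / m j s * m j t)) = 0"
      using insert by auto
    define d where "d i = (if i = j then - (\<Sum>i\<in>?I. c i * m i s / m j s) else c i)" for i
    have sum: "(\<Sum>i\<in>I. d i * m i t) = (\<Sum>i\<in>?I. c i * (m i t - m i s / m j s * m j t))" for t
    proof -
      have "(\<Sum>i\<in>I. d i * m i t) = d j * m j t + (\<Sum>i\<in>?I. c i * m i t)"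
        using insert.prems j by (subst sum.remove[of _ j]) (auto simp: d_def)
      then show ?thesis
        by (simp add: d_def algebra_simps sum_subtractf sum_distrib_left sum_distrib_right)
    qed
    have "\<exists>i\<in>I. d i \<noteq> 0" using c(1) by (auto simp: d_def)
    moreover have "(\<Sum>i\<in>I. d i * m i s) = 0"
      unfolding sum using j by (intro sum.neutral) auto
    ultimately show ?thesis using c(2) sum by (intro exI[of _ d]) auto
  qed
qed

text \<open>The exponents up to \<open>M\<close> outnumber the monomials needed to express the corresponding
  products once \<open>M\<close> is large, since the former grow like \<open>M ^ card J\<close> and the latter
  like \<open>M ^ card K\<close>.\<close>

lemma algebraic_dependence:
  fixes F :: "'j \<Rightarrow> 'p \<Rightarrow> complex"
  assumes "finite K" "finite J" "card K < card J"
    and "pfun x K \<delta>" and F: "\<And>i. i \<in> J \<Longrightarrow> pfun x K (\<lambda>p. F i p * \<delta> p)"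
  shows "\<exists>M. \<forall>b. (\<forall>i\<in>J. \<forall>k\<le>M. degree (b i k) \<le> M) \<longrightarrow>
     (\<exists>c. (\<exists>e\<in>PiE J (\<lambda>_. {..M}). c e \<noteq> 0) \<and>
       (\<forall>p. \<delta> p \<noteq> 0 \<longrightarrow> (\<Sum>e\<in>PiE J (\<lambda>_. {..M}). c e * (\<Prod>i\<in>J. poly (b i (e i)) (F i p))) = 0))"
proof -
  have "\<exists>D. mspan x K D \<delta> \<and> (\<forall>i\<in>J. mspan x K D (\<lambda>p. F i p * \<delta> p))"
  proof -
    obtain D0 where "mspan x K D0 \<delta>" using pfun_mspan assms by blast
    moreover have "\<forall>i\<in>J. \<exists>D. mspan x K D (\<lambda>p. F i p * \<delta> p)" using pfun_mspan assms by blast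
    then obtain D1 where D1: "\<forall>i\<in>J. mspan x K (D1 i) (\<lambda>p. F i p * \<delta> p)" by metis
    moreover have "D1 i \<le> D0 + sum D1 J" if "i \<in> J" for i
      using member_le_sum[OF that, of D1] \<open>finite J\<close> by auto
    ultimately show ?thesis
      by (intro exI[of _ "D0 + sum D1 J"]) (meson mspan_mono le_add1)
  qed
  then obtain D where D: "mspan x K D \<delta>" "\<And>i. i \<in> J \<Longrightarrow> mspan x K D (\<lambda>p. F i p * \<delta> p)" by auto
  let ?m = "card J"
  \<comment> \<open>There are at most \<open>((?m * D + 1) * (M + 1)) ^ card K\<close> target
    monomials. With the constant factor itself taken as \<open>M\<close>, one extra factor
    \<open>M + 1\<close>, available as \<open>card K < card J\<close>, outweighs it.\<close>
  define M where "M = (?m * D + 1) ^ card K"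
  have count: "(?m * (M * D) + 1) ^ card K < (M + 1) ^ ?m"
  proof -
    have "(?m * (M * D) + 1) ^ card K \<le> ((?m * D + 1) * (M + 1)) ^ card K"
      by (intro power_mono) (auto simp: algebra_simps)
    also have "\<dots> = M * (M + 1) ^ card K" by (simp only: M_def power_mult_distrib)
    also have "\<dots> < (M + 1) * (M + 1) ^ card K" by simp
    also have "\<dots> = (M + 1) ^ Suc (card K)" by simp
    also have "\<dots> \<le> (M + 1) ^ ?m" using assms by (intro power_increasing) auto
    finally show ?thesis .
  qed
  show ?thesis
  proof (intro exI[of _ M] allI impI)
    \<comment> \<open>\<open>M\<close> is chosen before the family \<open>b\<close>, so that
      \<open>b\<close> may be built from \<open>M\<close>, as the Lagrange polynomials below
      are.\<close>
    fix b :: "'j \<Rightarrow> nat \<Rightarrow> complex poly"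
    assume b: "\<forall>i\<in>J. \<forall>k\<le>M. degree (b i k) \<le> M"
    let ?E = "PiE J (\<lambda>_. {..M})" and ?S = "PiE K (\<lambda>_. {..?m * (M * D)})"
    \<comment> \<open>Multiplication by \<open>\<delta> p ^ M\<close> homogenizes: a term of degree
      \<open>l\<close> absorbs \<open>l\<close> copies of \<open>\<delta>\<close> into the products
      \<open>F i * \<delta>\<close> and keeps \<open>M - l\<close> of them.\<close>
    have poly_M: "mspan x K (M * D) (\<lambda>p. poly (b i k) (F i p) * \<delta> p ^ M)" if "i \<in> J" "k \<le> M" for i k
    proof -
      have deg: "degree (b i k) \<le> M" using b that by auto
      have "mspan x K (M * D) (\<lambda>p. \<Sum>l\<le>degree (b i k). coeff (b i k) l * ((F i p * \<delta> p) ^ l * \<delta> p ^ (M - l)))"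
      proof (intro mspan_sum mspan.scale)
        fix l assume "l \<in> {..degree (b i k)}"
        then have "l * D + (M - l) * D = M * D" using deg by (simp flip: add_mult_distrib)
        then show "mspan x K (M * D) (\<lambda>p. (F i p * \<delta> p) ^ l * \<delta> p ^ (M - l))"
          using mspan_mult[OF mspan_power[OF D(2)[OF \<open>i \<in> J\<close>], of l] mspan_power[OF D(1), of "M - l"]] by simp
      qed
      moreover have "(\<Sum>l\<le>degree (b i k). coeff (b i k) l * ((F i p * \<delta> p) ^ l * \<delta> p ^ (M - l)))
          = poly (b i k) (F i p) * \<delta> p ^ M" for p
        unfolding poly_altdef sum_distrib_right using deg
        by (intro sum.cong) (auto simp: power_mult_distrib mult.assoc simp flip: power_add)
      ultimately show ?thesis by simp
    qed
    have "mspan x K (?m * (M * D)) (\<lambda>p. \<Prod>i\<in>J. poly (b i (e i)) (F i p) * \<delta> p ^ M)" if "e \<in> ?E" for e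
      using that by (intro mspan_prod poly_M) auto
    from mspan_coeffs[OF this \<open>finite K\<close>] have "\<forall>e\<in>?E. \<exists>c. \<forall>p. (\<Prod>i\<in>J. poly (b i (e i)) (F i p) * \<delta> p ^ M)
        = (\<Sum>d\<in>?S. c d * (\<Prod>i\<in>K. x i p ^ d i))"
      by (intro ballI)
    from bchoice[OF this] obtain mm where mm: "\<forall>e\<in>?E. \<forall>p. (\<Prod>i\<in>J. poly (b i (e i)) (F i p) * \<delta> p ^ M)
        = (\<Sum>d\<in>?S. mm e d * (\<Prod>i\<in>K. x i p ^ d i))" ..
    have "card ?S < card ?E" using count assms by (simp add: card_PiE)
    then obtain c where c: "\<exists>e\<in>?E. c e \<noteq> 0" "\<forall>d\<in>?S. (\<Sum>e\<in>?E. c e * mm e d) = 0"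
      using homogeneous_system_nontrivial[of ?S ?E mm] assms by (auto intro!: finite_PiE)
    have "(\<Sum>e\<in>?E. c e * (\<Prod>i\<in>J. poly (b i (e i)) (F i p))) = 0" if "\<delta> p \<noteq> 0" for p
    proof -
      have "(\<Sum>e\<in>?E. c e * (\<Prod>i\<in>J. poly (b i (e i)) (F i p))) * (\<delta> p ^ M) ^ ?m
          = (\<Sum>e\<in>?E. c e * (\<Prod>i\<in>J. poly (b i (e i)) (F i p) * \<delta> p ^ M))"
        by (simp add: sum_distrib_right prod.distrib mult.assoc)
      also have "\<dots> = (\<Sum>e\<in>?E. \<Sum>d\<in>?S. c e * mm e d * (\<Prod>i\<in>K. x i p ^ d i))"
        by (intro sum.cong refl) (simp add: mm sum_distrib_left mult.assoc)
      also have "\<dots> = (\<Sum>d\<in>?S. (\<Sum>e\<in>?E. c e * mm e d) * (\<Prod>i\<in>K. x i p ^ d i))"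
        by (subst sum.swap) (simp add: sum_distrib_right)
      also have "\<dots> = 0" using c by simp
      finally show ?thesis using that by simp
    qed
    then show "\<exists>c. (\<exists>e\<in>?E. c e \<noteq> 0) \<and>
       (\<forall>p. \<delta> p \<noteq> 0 \<longrightarrow> (\<Sum>e\<in>?E. c e * (\<Prod>i\<in>J. poly (b i (e i)) (F i p))) = 0)"
      using c(1) by blast
  qed
qed

section \<open>Generic points\<close>

abbreviation vpoly :: "(complex^'n \<Rightarrow> complex) \<Rightarrow> bool" where
  "vpoly \<equiv> pfun (\<lambda>i s. s $ i) UNIV"

lemma vpoly_nth: "vpoly (\<lambda>s. s $ i)"
  by (rule pfun.gen) simp

lemma vpoly_matrix: "vpoly (\<lambda>z. (A *v z) $ i)"
  unfolding matrix_vector_mult_def by (auto intro!: pfun_intros vpoly_nth)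

lemma vpoly_line:
  assumes "vpoly h" shows "\<exists>q. \<forall>t. h (u + t *s v) = poly q t"
  by (rule pfun_line[OF assms]) (auto intro!: exI[of _ "[:u $ _, v $ _:]"] simp: mult.commute)

lemma poly_nonzero_on_infinite:
  fixes p :: "complex poly"
  assumes "p \<noteq> 0" "infinite A" obtains t where "t \<in> A" "poly p t \<noteq> 0"
  using poly_roots_finite[OF assms(1)] finite_subset[of A "{t. poly p t = 0}"] assms(2) by auto

lemma continuous_on_line: "continuous_on S (\<lambda>t. u + t *s (v :: complex^'n))"
  unfolding vector_scalar_mult_def by (intro continuous_intros)

text \<open>The line through the two witnesses carries two nonzero polynomials in one variable,
  whose product has a non-root. This is the irreducibility of affine space in the form used
  here.\<close>

lemma vpoly_common_nonzero:
  assumes "vpoly g" "vpoly h" "g u \<noteq> 0" "h v \<noteq> 0"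
  shows "\<exists>s. g s \<noteq> 0 \<and> h s \<noteq> 0"
proof -
  obtain p q where p: "\<And>t. g (u + t *s (v - u)) = poly p t"
    and q: "\<And>t. h (u + t *s (v - u)) = poly q t"
    using vpoly_line assms(1,2) by metis
  have "p \<noteq> 0" "q \<noteq> 0" using p[of 0] q[of 1] assms(3,4) by auto
  then obtain t where "poly (p * q) t \<noteq> 0"
    using poly_nonzero_on_infinite[of "p * q" UNIV] infinite_UNIV_char_0 by auto
  then show ?thesis using p[of t] q[of t] by (intro exI[of _ "u + t *s (v - u)"]) auto
qed

definition generic :: "(complex^'n \<Rightarrow> bool) \<Rightarrow> bool" where
  "generic P \<longleftrightarrow> (\<exists>h. vpoly h \<and> (\<exists>s. h s \<noteq> 0) \<and> (\<forall>s. h s \<noteq> 0 \<longrightarrow> P s))"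

lemma genericI: "vpoly h \<Longrightarrow> h u \<noteq> 0 \<Longrightarrow> (\<And>s. h s \<noteq> 0 \<Longrightarrow> P s) \<Longrightarrow> generic P"
  unfolding generic_def by blast

lemma generic_mono: "generic P \<Longrightarrow> (\<And>s. P s \<Longrightarrow> Q s) \<Longrightarrow> generic Q"
  unfolding generic_def by blast

lemma generic_True: "generic (\<lambda>s. True)"
  by (rule genericI[OF pfun.const, of 1]) auto

lemma generic_conj:
  assumes "generic P" "generic Q" shows "generic (\<lambda>s. P s \<and> Q s)"
proof -
  obtain g h u v where gh: "vpoly g" "vpoly h" "g u \<noteq> 0" "h v \<noteq> 0"
    "\<And>s. g s \<noteq> 0 \<Longrightarrow> P s" "\<And>s. h s \<noteq> 0 \<Longrightarrow> Q s"
    using assms unfolding generic_def by blast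
  then obtain s where "g s \<noteq> 0" "h s \<noteq> 0" using vpoly_common_nonzero by blast
  then show ?thesis using gh by (intro genericI[of "\<lambda>s. g s * h s" s]) (auto intro: pfun.mult)
qed

lemma generic_all_finite:
  "finite A \<Longrightarrow> (\<And>x. x \<in> A \<Longrightarrow> generic (P x)) \<Longrightarrow> generic (\<lambda>s. \<forall>x\<in>A. P x s)"
  by (induction A rule: finite_induct) (auto intro: generic_True generic_conj)

lemma generic_nth_nonzero: "generic (\<lambda>s. \<forall>i\<in>A. s $ i \<noteq> 0)"
proof (rule generic_all_finite)
  show "generic (\<lambda>s. s $ i \<noteq> 0)" for i
    by (rule genericI[OF vpoly_nth, of 1 i]) auto
qed simp

text \<open>On the line from \<open>u\<close> to a point where \<open>h\<close> is nonzero only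
  finitely many parameters are bad, whereas infinitely many near 0 stay in \<open>U\<close>. Zariski
  open conditions can thus be combined with Euclidean neighbourhoods.\<close>

lemma generic_dense:
  assumes "generic P" "open U" "u \<in> U"
  obtains s where "s \<in> U" "P s"
proof -
  obtain h v where h: "vpoly h" "h v \<noteq> 0" "\<And>s. h s \<noteq> 0 \<Longrightarrow> P s"
    using assms unfolding generic_def by blast
  obtain q where q: "\<And>t. h (u + t *s (v - u)) = poly q t" using vpoly_line h by metis
  have "q \<noteq> 0" using q[of 1] h by auto
  have "open ((\<lambda>t. u + t *s (v - u)) -` U)"
    by (rule open_vimage[OF assms(2) continuous_on_line])
  moreover have "0 \<in> (\<lambda>t. u + t *s (v - u)) -` U" using assms by simp
  then have "infinite ((\<lambda>t. u + t *s (v - u)) -` U)"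
    using \<open>open ((\<lambda>t. u + t *s (v - u)) -` U)\<close>
      interior_limit_point[of 0] islimpt_finite interior_open by metis
  with \<open>q \<noteq> 0\<close> obtain t where "t \<in> (\<lambda>t. u + t *s (v - u)) -` U" "poly q t \<noteq> 0"
    by (rule poly_nonzero_on_infinite)
  then show thesis using that[of "u + t *s (v - u)"] q[of t] h(3) by auto
qed

text \<open>Two points are joined inside the complex line through them with the finitely many zeros
  of \<open>h\<close> removed; a plane minus finitely many points is connected. Over the reals a
  hypersurface could separate.\<close>

lemma connected_vpoly_nonzero:
  assumes "vpoly h" shows "connected {s. h s \<noteq> 0}"
proof -
  have pair: "\<exists>T. connected T \<and> T \<subseteq> {s. h s \<noteq> 0} \<and> u \<in> T \<and> v \<in> T" if "h u \<noteq> 0" "h v \<noteq> 0" for u v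
  proof -
    obtain q where q: "\<And>t. h (u + t *s (v - u)) = poly q t" using vpoly_line assms by metis
    have "q \<noteq> 0" using q[of 0] that by auto
    then have "path_connected (- {t. poly q t = 0})"
      by (intro path_connected_complement_countable countable_finite poly_roots_finite) auto
    then have "connected ((\<lambda>t. u + t *s (v - u)) ` (- {t. poly q t = 0}))" (is "connected ?T")
      by (intro connected_continuous_image path_connected_imp_connected continuous_on_line)
    moreover have "?T \<subseteq> {s. h s \<noteq> 0}" using q by auto
    moreover have "u \<in> ?T" by (rule image_eqI[of _ _ 0]) (use q[of 0] that in auto)
    moreover have "v \<in> ?T" by (rule image_eqI[of _ _ 1]) (use q[of 1] that in auto)
    ultimately show ?thesis by blast
  qed
  show ?thesis
    by (subst connected_iff_connected_component, intro ballI)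
      (unfold connected_component_def, simp add: pair)
qed

lemma vpoly_cancel:
  assumes "vpoly f" "vpoly g" "g u \<noteq> 0" "\<And>z. g z \<noteq> 0 \<Longrightarrow> f z = 0"
  shows "f z = 0"
  using vpoly_common_nonzero[OF assms(1,2) _ assms(3)] assms(4) by blast

section \<open>Images of hypersurfaces under polynomial maps\<close>

definition lagrange_poly :: "nat \<Rightarrow> nat \<Rightarrow> complex poly" where
  "lagrange_poly M k = (\<Prod>l\<in>{..M} - {k}. smult (1 / (of_nat k - of_nat l)) [:- of_nat l, 1:])"

lemma degree_lagrange_poly: "k \<le> M \<Longrightarrow> degree (lagrange_poly M k) \<le> M"
proof -
  assume "k \<le> M"
  have "degree (lagrange_poly M k)
      \<le> (\<Sum>l\<in>{..M} - {k}. degree (smult (1 / (of_nat k - of_nat l)) [:- of_nat l, 1:] :: complex poly))"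
    unfolding lagrange_poly_def by (rule order_trans[OF degree_prod_sum_le]) (auto simp: o_def)
  also have "\<dots> \<le> (\<Sum>l\<in>{..M} - {k}. 1)" by (intro sum_mono) (auto intro: degree_smult_le[THEN order_trans])
  also have "\<dots> = M" using \<open>k \<le> M\<close> by simp
  finally show ?thesis .
qed

lemma poly_lagrange_poly:
  assumes "k \<le> M" "l \<le> M" shows "poly (lagrange_poly M k) (of_nat l) = (if l = k then 1 else 0)"
  using assms unfolding lagrange_poly_def
  by (auto simp: poly_prod simp flip: diff_divide_distrib intro!: prod.neutral)

text \<open>A polynomial relation between \<open>G\<close> and \<open>g\<close>, divided by the highest possible power of \<open>g\<close>,
  restricts on \<open>g = 0\<close> to a nontrivial relation between the coordinates of \<open>G\<close>.\<close>

theorem generic_avoids_hypersurface_image: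
  fixes G :: "complex^'n \<Rightarrow> complex^'n"
  assumes G: "\<And>i. vpoly (\<lambda>z. G z $ i)" and g: "vpoly g" "g u \<noteq> 0"
  shows "generic (\<lambda>s. \<forall>z. G z = s \<longrightarrow> g z \<noteq> 0)"
proof -
  \<comment> \<open>One function more than there are variables: \<open>None\<close> stands for
    \<open>g\<close>, \<open>Some i\<close> for the coordinates of \<open>G\<close>.\<close>
  define F where "F i z = (case i of None \<Rightarrow> g z | Some i \<Rightarrow> G z $ i)" for i z
  have "vpoly (\<lambda>z. F i z * 1)" for i using G g by (cases i) (auto simp: F_def)
  then have "\<exists>M. \<forall>b. (\<forall>i\<in>UNIV. \<forall>k\<le>M. degree (b i k) \<le> M) \<longrightarrow>
     (\<exists>c. (\<exists>e\<in>PiE (UNIV :: 'n option set) (\<lambda>_. {..M}). c e \<noteq> 0) \<and>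
       (\<forall>p::complex^'n. 1 \<noteq> (0::complex) \<longrightarrow>
         (\<Sum>e\<in>PiE UNIV (\<lambda>_. {..M}). c e * (\<Prod>i\<in>UNIV. poly (b i (e i)) (F i p))) = 0))"
    by (intro algebraic_dependence[where x = "\<lambda>i s. s $ i" and K = UNIV]) (auto intro: pfun.const)
  then obtain M where M: "\<And>b. (\<And>i k. k \<le> M \<Longrightarrow> degree (b i k) \<le> M) \<Longrightarrow>
     (\<exists>c. (\<exists>e\<in>PiE (UNIV :: 'n option set) (\<lambda>_. {..M}). c e \<noteq> 0) \<and>
       (\<forall>p::complex^'n. (\<Sum>e\<in>PiE UNIV (\<lambda>_. {..M}). c e * (\<Prod>i\<in>UNIV. poly (b i (e i)) (F i p))) = 0))"
    by auto
  let ?E = "PiE (UNIV :: 'n option set) (\<lambda>_. {..M})"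
  \<comment> \<open>Monomials for \<open>g\<close>, because powers of \<open>g\<close> have to be
    cancelled. For the coordinates of \<open>G\<close> the Lagrange basis at the nodes
    \<open>0, ..., M\<close>: its products are 0 or 1 on the integer grid, so the surviving
    coefficient \<open>P k\<close> is seen to be nonzero by its value at a grid point.\<close>
  define b where "b i k = (case i of None \<Rightarrow> monom 1 k | Some (_::'n) \<Rightarrow> lagrange_poly M k)" for i k
  have "degree (b i k) \<le> M" if "k \<le> M" for i k
    using that by (auto simp: b_def degree_lagrange_poly degree_monom_eq split: option.split)
  from M[of b, OF this] obtain c where c: "\<exists>e\<in>?E. c e \<noteq> 0"
    "\<And>p::complex^'n. (\<Sum>e\<in>?E. c e * (\<Prod>i\<in>UNIV. poly (b i (e i)) (F i p))) = 0" by blast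
  have finE: "finite ?E" by (auto intro: finite_PiE)
  define P where "P j s = (\<Sum>e\<in>{e\<in>?E. e None = j}. c e * (\<Prod>i\<in>UNIV. poly (lagrange_poly M (e (Some i))) (s $ i)))"
    for j and s :: "complex^'n"
  have vP: "vpoly (P j)" for j unfolding P_def by (intro pfun_intros vpoly_nth)
  have prod_opt: "(\<Prod>i\<in>UNIV. f i) = f None * (\<Prod>i\<in>UNIV. f (Some i))" for f :: "'n option \<Rightarrow> complex"
    unfolding UNIV_option_conv by (simp add: prod.reindex)
  have sumP: "(\<Sum>j\<le>M. P j (G z) * g z ^ j) = 0" for z
  proof -
    have "0 = (\<Sum>e\<in>?E. c e * (\<Prod>i\<in>UNIV. poly (b i (e i)) (F i z)))" using c(2) by simp
    also have "\<dots> = (\<Sum>j\<le>M. \<Sum>e\<in>{e\<in>?E. e None = j}. c e * (\<Prod>i\<in>UNIV. poly (b i (e i)) (F i z)))"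
      by (rule sum.group[symmetric]) (use finE in auto)
    also have "\<dots> = (\<Sum>j\<le>M. P j (G z) * g z ^ j)"
      unfolding P_def sum_distrib_right
      by (intro sum.cong refl) (auto simp: prod_opt b_def F_def poly_monom)
    finally show ?thesis by simp
  qed
  \<comment> \<open>The lowest power of \<open>g\<close> in the relation. Dividing it off leaves
    \<open>R\<close>, which is zero wherever \<open>g\<close> is not, hence everywhere; on
    \<open>g = 0\<close> only the term \<open>P k (G z)\<close> remains.\<close>
  define k where "k = (LEAST j. \<exists>e\<in>?E. e None = j \<and> c e \<noteq> 0)"
  have "\<exists>j. \<exists>e\<in>?E. e None = j \<and> c e \<noteq> 0" using c(1) by blast
  then have "\<exists>e\<in>?E. e None = k \<and> c e \<noteq> 0" unfolding k_def by (rule LeastI_ex)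
  then obtain d where d: "d \<in> ?E" "d None = k" "c d \<noteq> 0" by blast
  have kM: "k \<le> M" using d by auto
  have P0: "P j s = 0" if "j < k" for j s
    using not_less_Least[OF that[unfolded k_def]] unfolding P_def by (intro sum.neutral) auto
  define R where "R z = (\<Sum>j=k..M. P j (G z) * g z ^ (j - k))" for z
  have vR: "vpoly R" unfolding R_def
    by (intro pfun_intros g pfun_comp[OF vP]) (use G in auto)
  have "R z = 0" if "g z \<noteq> 0" for z
  proof -
    have "0 = (\<Sum>j\<le>M. P j (G z) * g z ^ j)" using sumP by simp
    also have "\<dots> = (\<Sum>j=k..M. P j (G z) * g z ^ j)"
      by (rule sum.mono_neutral_right) (auto simp: P0 not_le)
    also have "\<dots> = R z * g z ^ k"
      unfolding R_def sum_distrib_right by (intro sum.cong) (auto simp flip: power_add)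
    finally show ?thesis using that by simp
  qed
  then have R0: "R z = 0" for z using vpoly_cancel[OF vR g] by blast
  have vanish: "P k (G z) = 0" if "g z = 0" for z
  proof -
    have "R z = P k (G z)"
      unfolding R_def using kM that by (subst sum.remove[of _ k]) (auto intro!: sum.neutral)
    then show ?thesis using R0 by simp
  qed
  have value_d: "P k (\<chi> i. of_nat (d (Some i))) = c d"
  proof -
    have "(\<Prod>i\<in>UNIV. poly (lagrange_poly M (e (Some i))) ((\<chi> i. of_nat (d (Some i))) $ i)) =
        (if e = d then 1 else 0 :: complex)" if eE: "e \<in> ?E" "e None = k" for e
    proof (cases "e = d")
      case True
      have "d (Some i) \<le> M" for i using d by auto
      then show ?thesis using True by (simp add: poly_lagrange_poly)
    next
      case False
      then obtain o' where "e o' \<noteq> d o'" by blast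
      then obtain i where "e (Some i) \<noteq> d (Some i)"
        using d(2) eE(2) by (cases o') auto
      moreover have "e (Some i) \<le> M" "d (Some i) \<le> M" using d eE by auto
      ultimately have "poly (lagrange_poly M (e (Some i))) ((\<chi> i. of_nat (d (Some i))) $ i) = 0"
        by (simp add: poly_lagrange_poly)
      then show ?thesis using False by (subst prod_zero) auto
    qed
    then have "P k (\<chi> i. of_nat (d (Some i))) = (\<Sum>e\<in>{e\<in>?E. e None = k}. c e * (if e = d then 1 else 0))"
      unfolding P_def by (intro sum.cong) auto
    also have "\<dots> = c d" using d finE by (subst sum.remove[of _ d]) (auto intro!: sum.neutral)
    finally show ?thesis .
  qed
  show ?thesis
  proof (rule genericI[OF vP])
    show "P k (\<chi> i. of_nat (d (Some i))) \<noteq> 0" using value_d d(3) by simp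
    show "\<forall>z. G z = s \<longrightarrow> g z \<noteq> 0" if "P k s \<noteq> 0" for s
      using that vanish by metis
  qed
qed

section \<open>Cardinality of fibres\<close>

text \<open>An injective linear endomorphism of a finite-dimensional space is invertible, so the
  inverse function theorem applies. The conclusion speaks of open images because these are
  intersected later over all points of a fibre.\<close>

lemma local_open_embedding:
  fixes f :: "'a::euclidean_space \<Rightarrow> 'a"
  assumes "open \<Omega>" and der: "\<And>x. x \<in> \<Omega> \<Longrightarrow> (f has_derivative f' x) (at x)"
    and cont: "\<And>h. continuous_on \<Omega> (\<lambda>x. f' x h)"
    and "x0 \<in> \<Omega>" "inj (f' x0)"
  obtains U where "open U" "x0 \<in> U" "U \<subseteq> \<Omega>" "inj_on f U" "\<And>W. open W \<Longrightarrow> W \<subseteq> U \<Longrightarrow> open (f ` W)"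
proof -
  have bl: "bounded_linear (f' x)" if "x \<in> \<Omega>" for x
    using der[OF that] by (rule has_derivative_bounded_linear)
  let ?F = "\<lambda>x. Blinfun (f' x)"
  have apply_F: "blinfun_apply (?F x) = f' x" if "x \<in> \<Omega>" for x
    using bl[OF that] by (rule bounded_linear_Blinfun_apply)
  have contF: "continuous_on \<Omega> ?F"
  proof (rule continuous_on_blinfun_componentwise)
    fix i :: 'a
    show "continuous_on \<Omega> (\<lambda>x. blinfun_apply (?F x) i)"
      using cont[of i] by (rule continuous_on_eq) (simp add: apply_F)
  qed
  have "linear (f' x0)" using bl[OF \<open>x0 \<in> \<Omega>\<close>] by (rule bounded_linear.linear)
  then obtain g where g: "linear g" "g \<circ> f' x0 = id"
    using linear_injective_left_inverse \<open>inj (f' x0)\<close> by blast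
  have blg: "bounded_linear g" using g(1) by (simp add: linear_conv_bounded_linear)
  have inv: "Blinfun g o\<^sub>L ?F x0 = id_blinfun"
  proof (rule blinfun_eqI)
    fix i
    show "blinfun_apply (Blinfun g o\<^sub>L ?F x0) i = blinfun_apply id_blinfun i"
      using g(2) by (simp add: apply_F[OF \<open>x0 \<in> \<Omega>\<close>] bounded_linear_Blinfun_apply[OF blg] o_def fun_eq_iff)
  qed
  have der': "(f has_derivative blinfun_apply (?F x)) (at x)" if "x \<in> \<Omega>" for x
    using der[OF that] apply_F[OF that] by simp
  obtain U V g' gg where U: "open U" "U \<subseteq> \<Omega>" "x0 \<in> U" "open V" "homeomorphism U V f gg"
    by (rule inverse_function_theorem[OF \<open>open \<Omega>\<close> der' contF \<open>x0 \<in> \<Omega>\<close> inv])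
  have "inj_on f U" using U(5) by (metis homeomorphism_apply1 inj_on_inverseI)
  moreover have "open (f ` W)" if "open W" "W \<subseteq> U" for W
  proof -
    have "openin (top_of_set U) W" using that by (meson open_subset)
    then have "openin (top_of_set V) (f ` W)" by (rule homeomorphism_imp_open_map[OF U(5)])
    then show ?thesis using \<open>open V\<close> openin_open_trans by blast
  qed
  ultimately show thesis using that U by blast
qed

text \<open>Each point of the fibre has a neighbourhood mapped injectively onto an open set, so a
  nearby value is hit exactly once in each; sequential properness over \<open>q\<close> shows that
  it is hit nowhere else.\<close>

theorem fibre_card_locally_constant:
  fixes f :: "'a::euclidean_space \<Rightarrow> 'a"
  assumes "open \<Omega>" and der: "\<And>x. x \<in> \<Omega> \<Longrightarrow> (f has_derivative f' x) (at x)"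
    and cont: "\<And>h. continuous_on \<Omega> (\<lambda>x. f' x h)"
    and inj: "\<And>x. x \<in> \<Omega> \<Longrightarrow> f x = q \<Longrightarrow> inj (f' x)"
    and proper: "\<And>X. (\<And>k. X k \<in> \<Omega>) \<Longrightarrow> (\<lambda>k. f (X k)) \<longlonglongrightarrow> q \<Longrightarrow> \<exists>l\<in>\<Omega>. \<exists>r. strict_mono r \<and> (X \<circ> r) \<longlonglongrightarrow> l"
  shows "finite {x\<in>\<Omega>. f x = q}"
    and "\<exists>V. open V \<and> q \<in> V \<and> (\<forall>p\<in>V. finite {x\<in>\<Omega>. f x = p} \<and> card {x\<in>\<Omega>. f x = p} = card {x\<in>\<Omega>. f x = q})"
proof -
  let ?F = "{x\<in>\<Omega>. f x = q}"
  have isC: "isCont f x" if "x \<in> \<Omega>" for x using der[OF that] by (rule has_derivative_continuous)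
  have lim: "\<exists>l\<in>?F. \<exists>r. strict_mono r \<and> (X \<circ> r) \<longlonglongrightarrow> l"
    if X: "\<And>k. X k \<in> \<Omega>" "(\<lambda>k. f (X k)) \<longlonglongrightarrow> q" for X
  proof -
    obtain l r where l: "l \<in> \<Omega>" "strict_mono r" "(X \<circ> r) \<longlonglongrightarrow> l" using proper[OF X] by blast
    have "(\<lambda>k. f ((X \<circ> r) k)) \<longlonglongrightarrow> f l" using isCont_tendsto_compose[OF isC[OF l(1)] l(3)] .
    moreover have "(\<lambda>k. f ((X \<circ> r) k)) \<longlonglongrightarrow> q"
      using LIMSEQ_subseq_LIMSEQ[OF X(2) l(2)] by (simp add: o_def)
    ultimately have "f l = q" by (rule LIMSEQ_unique)
    then show ?thesis using l by blast
  qed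
  have "\<exists>U. open U \<and> x \<in> U \<and> U \<subseteq> \<Omega> \<and> inj_on f U \<and> (\<forall>W. open W \<longrightarrow> W \<subseteq> U \<longrightarrow> open (f ` W))" if "x \<in> ?F" for x
  proof -
    have x: "x \<in> \<Omega>" "f x = q" using that by auto
    show ?thesis
      by (rule local_open_embedding[OF \<open>open \<Omega>\<close> der cont x(1) inj[OF x]]) blast+
  qed
    then have "\<forall>x\<in>?F. \<exists>U. open U \<and> x \<in> U \<and> U \<subseteq> \<Omega> \<and> inj_on f U \<and> (\<forall>W. open W \<longrightarrow> W \<subseteq> U \<longrightarrow> open (f ` W))"
    by (intro ballI)
  from bchoice[OF this] obtain U where "\<forall>x\<in>?F. open (U x) \<and> x \<in> U x \<and> U x \<subseteq> \<Omega> \<and> inj_on f (U x)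
      \<and> (\<forall>W. open W \<longrightarrow> W \<subseteq> U x \<longrightarrow> open (f ` W))" ..
  then have U: "\<And>x. x \<in> ?F \<Longrightarrow> open (U x)" "\<And>x. x \<in> ?F \<Longrightarrow> x \<in> U x" "\<And>x. x \<in> ?F \<Longrightarrow> U x \<subseteq> \<Omega>"
    "\<And>x. x \<in> ?F \<Longrightarrow> inj_on f (U x)" "\<And>x W. x \<in> ?F \<Longrightarrow> open W \<Longrightarrow> W \<subseteq> U x \<Longrightarrow> open (f ` W)"
    by simp_all
  \<comment> \<open>An infinite fibre would accumulate at one of its points by properness, against
    local injectivity there.\<close>
  show fin: "finite ?F"
  proof (rule ccontr)
    assume "infinite ?F"
    then obtain X :: "nat \<Rightarrow> 'a" where X: "inj X" "range X \<subseteq> ?F" using infinite_countable_subset by blast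
    then have XF: "X k \<in> \<Omega>" "f (X k) = q" for k by auto
    obtain l r where l: "l \<in> ?F" "strict_mono r" "(X \<circ> r) \<longlonglongrightarrow> l"
      using lim[of X] XF by auto
    have "\<forall>\<^sub>F k in sequentially. (X \<circ> r) k \<in> U l"
      using topological_tendstoD[OF l(3) U(1,2)[OF l(1)]] .
    then obtain N where N: "\<And>k. k \<ge> N \<Longrightarrow> X (r k) \<in> U l" by (auto simp: eventually_sequentially)
    have "X (r k) = l" if "k \<ge> N" for k
      using inj_onD[OF U(4)[OF l(1)], of "X (r k)" l] N[OF that] U(2)[OF l(1)] XF l(1) by auto
    then have "X (r N) = X (r (Suc N))" by simp
    then have "r N = r (Suc N)" using X(1) by (simp add: inj_eq)
    then show False using l(2) by (metis lessI less_irrefl strict_mono_less)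
  qed
  have "\<exists>d>0. \<forall>x\<in>?F. \<forall>y\<in>?F. x \<noteq> y \<longrightarrow> d \<le> dist x y"
  proof -
    have "\<forall>x\<in>?F. \<exists>d>0. \<forall>y\<in>?F. x \<noteq> y \<longrightarrow> d \<le> dist x y"
      using finite_set_avoid[OF fin] by (metis (no_types, lifting))
    from bchoice[OF this] obtain d where
      "\<forall>x\<in>?F. d x > 0 \<and> (\<forall>y\<in>?F. x \<noteq> y \<longrightarrow> d x \<le> dist x y)" ..
    then have d: "\<And>x. x \<in> ?F \<Longrightarrow> d x > 0" "\<And>x y. x \<in> ?F \<Longrightarrow> y \<in> ?F \<Longrightarrow> x \<noteq> y \<Longrightarrow> d x \<le> dist x y"
      by simp_all
    let ?m = "Min (insert 1 (d ` ?F))"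
    have "?m > 0" using fin d(1) by (subst Min_gr_iff) auto
    moreover have "?m \<le> d x" if "x \<in> ?F" for x using fin that by (intro Min_le) auto
    ultimately show ?thesis using d(2) by (intro exI[of _ ?m]) (auto intro: order_trans)
  qed
  then obtain d where d: "d > 0" "\<And>x y. x \<in> ?F \<Longrightarrow> y \<in> ?F \<Longrightarrow> x \<noteq> y \<Longrightarrow> d \<le> dist x y" by blast
  \<comment> \<open>Half the minimal distance \<open>d\<close> within the fibre as radius makes the
    neighbourhoods disjoint.\<close>
  define U' where "U' x = U x \<inter> ball x (d / 2)" for x
  have U': "open (U' x)" "x \<in> U' x" "U' x \<subseteq> \<Omega>" "inj_on f (U' x)" if "x \<in> ?F" for x
    using U[OF that] d(1) unfolding U'_def by (auto intro: inj_on_subset)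
  have U'_open: "open (f ` U' x)" if "x \<in> ?F" for x
    using U(5)[OF that U'(1)[OF that]] unfolding U'_def by simp
  have disj: "x = y" if "x \<in> ?F" "y \<in> ?F" "z \<in> U' x" "z \<in> U' y" for x y z
  proof (rule ccontr)
    assume "x \<noteq> y"
    then have "d \<le> dist x y" using d(2) that by blast
    also have "\<dots> \<le> dist x z + dist y z" by (metis dist_commute dist_triangle)
    also have "\<dots> < d" using that(3,4) by (auto simp: U'_def)
    finally show False by simp
  qed
  \<comment> \<open>Otherwise a sequence outside all the neighbourhoods, with values tending to
    \<open>q\<close>, would subconverge to a point of the fibre, hence enter one of them.\<close>
  have "\<exists>n. \<forall>x\<in>\<Omega>. dist (f x) q < 1 / real (Suc n) \<longrightarrow> (\<exists>y\<in>?F. x \<in> U' y)"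
  proof (rule ccontr)
    assume "\<not> ?thesis"
    then have "\<forall>n. \<exists>x. x \<in> \<Omega> \<and> dist (f x) q < 1 / real (Suc n) \<and> (\<forall>y\<in>?F. x \<notin> U' y)" by blast
    from choice[OF this] obtain X where
      "\<forall>n. X n \<in> \<Omega> \<and> dist (f (X n)) q < 1 / real (Suc n) \<and> (\<forall>y\<in>?F. X n \<notin> U' y)" ..
    then have X: "\<And>n. X n \<in> \<Omega>" "\<And>n. dist (f (X n)) q < 1 / real (Suc n)"
      "\<And>n y. y \<in> ?F \<Longrightarrow> X n \<notin> U' y" by simp_all
    have "(\<lambda>n. f (X n)) \<longlonglongrightarrow> q"
    proof (subst tendsto_dist_iff, rule Lim_null_comparison[OF always_eventually LIMSEQ_inverse_real_of_nat], intro allI)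
      show "norm (dist (f (X n)) q) \<le> inverse (real (Suc n))" for n
        using less_imp_le[OF X(2)[of n]] by (simp only: real_norm_def abs_of_nonneg[OF zero_le_dist] inverse_eq_divide)
    qed
    from lim[OF X(1) this] obtain l r where l: "l \<in> ?F" "strict_mono r" "(X \<circ> r) \<longlonglongrightarrow> l" by auto
    have "\<forall>\<^sub>F k in sequentially. (X \<circ> r) k \<in> U' l"
      using topological_tendstoD[OF l(3) U'(1,2)[OF l(1)]] .
    then obtain k where "(X \<circ> r) k \<in> U' l" by (auto simp: eventually_sequentially)
    then show False using X(3)[OF l(1)] by simp
  qed
  then obtain n where n: "\<And>x. x \<in> \<Omega> \<Longrightarrow> dist (f x) q < 1 / real (Suc n) \<Longrightarrow> \<exists>y\<in>?F. x \<in> U' y" by auto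
  define V where "V = (\<Inter>x\<in>?F. f ` U' x) \<inter> ball q (1 / real (Suc n))"
  have "open V" unfolding V_def using fin U'_open by (intro open_Int open_INT) auto
  moreover have "q \<in> V" unfolding V_def using U'(2) by force
  moreover have "finite {x\<in>\<Omega>. f x = p} \<and> card {x\<in>\<Omega>. f x = p} = card ?F" if "p \<in> V" for p
  proof -
    define h where "h x = inv_into (U' x) f p" for x
    have h: "h x \<in> U' x" "f (h x) = p" if "x \<in> ?F" for x
      using that \<open>p \<in> V\<close> unfolding h_def V_def by (auto intro: inv_into_into f_inv_into_f)
    have "bij_betw h ?F {x\<in>\<Omega>. f x = p}"
    proof (rule bij_betw_imageI)
      show "inj_on h ?F"
      proof (rule inj_onI)
        fix x y assume xy: "x \<in> ?F" "y \<in> ?F" "h x = h y"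
        show "x = y" using disj[OF xy(1,2) h(1)[OF xy(1)]] h(1)[OF xy(2)] xy(3) by simp
      qed
      show "h ` ?F = {x\<in>\<Omega>. f x = p}"
      proof (intro equalityI subsetI)
        fix y assume "y \<in> h ` ?F"
        then obtain x where "x \<in> ?F" "y = h x" by auto
        then show "y \<in> {x\<in>\<Omega>. f x = p}" using h[of x] U'(3)[of x] by auto
      next
        fix y assume y: "y \<in> {x\<in>\<Omega>. f x = p}"
        have "dist p q < 1 / real (Suc n)" using \<open>p \<in> V\<close> by (simp add: V_def dist_commute)
        then obtain x where x: "x \<in> ?F" "y \<in> U' x" using n[of y] y by force
        have "h x = y" using inj_onD[OF U'(4)[OF x(1)], of "h x" y] h[OF x(1)] x(2) y by auto
        then show "y \<in> h ` ?F" using x(1) by blast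
      qed
    qed
    from bij_betw_finite[OF this] bij_betw_same_card[OF this] fin show ?thesis by simp
  qed
  ultimately show "\<exists>V. open V \<and> q \<in> V \<and> (\<forall>p\<in>V. finite {x\<in>\<Omega>. f x = p} \<and> card {x\<in>\<Omega>. f x = p} = card ?F)"
    by (intro exI[of _ V] conjI[of "open V"] conjI[of "q \<in> V"] ballI)
qed

section \<open>Orthogonal complements\<close>

text \<open>Bilinear, without conjugation: \<open>orth V\<close> is the algebraic annihilator, which
  may meet \<open>V\<close> nontrivially. A pair from \<open>V \<times> orth V\<close> can therefore
  not be coded as the sum of its entries.\<close>

definition bil :: "complex^'n \<Rightarrow> complex^'n \<Rightarrow> complex" where
  "bil u v = (\<Sum>i\<in>UNIV. u $ i * v $ i)"

definition orth :: "(complex^'n) set \<Rightarrow> (complex^'n) set" where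
  "orth V = {w. \<forall>v\<in>V. bil v w = 0}"

definition res :: "'n set \<Rightarrow> complex^'n \<Rightarrow> complex^'n" where
  "res I v = (\<chi> i. if i \<in> I then v $ i else 0)"

lemma res_nth: "res I v $ i = (if i \<in> I then v $ i else 0)"
  by (simp add: res_def)

lemma bil_commute: "bil u v = bil v u"
  by (simp add: bil_def mult.commute)

lemma bil_add_left: "bil (u + v) w = bil u w + bil v w"
  and bil_add_right: "bil w (u + v) = bil w u + bil w v"
  and bil_diff_left: "bil (u - v) w = bil u w - bil v w"
  and bil_diff_right: "bil w (u - v) = bil w u - bil w v"
  and bil_scale_left: "bil (c *s u) w = c * bil u w"
  and bil_scale_right: "bil w (c *s u) = c * bil w u"
  by (simp_all add: bil_def algebra_simps sum.distrib sum_subtractf sum_distrib_left)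

lemma bil_zero: "bil 0 w = 0" "bil w 0 = 0"
  by (simp_all add: bil_def)

lemma bil_axis: "bil v (axis i c) = v $ i * c"
  by (simp add: bil_def axis_def if_distrib[of "(*) _"] cong: if_cong)

lemma subspace_orth: "vec.subspace (orth V)"
  by (auto simp: vec.subspace_def orth_def bil_add_right bil_scale_right bil_zero)

lemma linear_res: "Vector_Spaces.linear (*s) (*s) (res I)"
  by (simp add: Vector_Spaces.linear_iff vec.vector_space_axioms vec_eq_iff res_nth)

lemma subspace_res: "vec.subspace V \<Longrightarrow> vec.subspace (res I ` V)"
  using vec.linear_subspace_image linear_res by blast

lemma bil_matrix: "bil (A *v u) v = bil u (transpose A *v v)"
proof -
  have "bil (A *v u) v = (\<Sum>i\<in>UNIV. \<Sum>j\<in>UNIV. A $ i $ j * u $ j * v $ i)"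
    by (simp add: bil_def matrix_vector_mult_def sum_distrib_right)
  also have "\<dots> = (\<Sum>j\<in>UNIV. \<Sum>i\<in>UNIV. A $ i $ j * u $ j * v $ i)" by (rule sum.swap)
  also have "\<dots> = bil u (transpose A *v v)"
    by (simp add: bil_def matrix_vector_mult_def sum_distrib_left transpose_def algebra_simps)
  finally show ?thesis .
qed

lemma transpose_inverse_mult:
  fixes Q R :: "complex^'n^'n"
  assumes "R ** Q = mat 1" shows "transpose Q *v (transpose R *v x) = x"
  by (metis assms matrix_transpose_mul matrix_vector_mul_assoc transpose_mat matrix_vector_mul_lid)

text \<open>A basis of \<open>V\<close> is extended to a basis of the whole space, the columns of
  \<open>Q\<close>. The rows of \<open>R\<close> are the dual basis, and those outside
  \<open>I\<close> span the annihilator.\<close>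

lemma subspace_adapted_basis:
  fixes V :: "(complex^'n) set"
  assumes V: "vec.subspace V"
  obtains Q R :: "complex^'n^'n" and I where "Q ** R = mat 1" "R ** Q = mat 1" "card I = vec.dim V"
    "V = (*v) Q ` {z. \<forall>i. i \<notin> I \<longrightarrow> z $ i = 0}"
    "orth V = (*v) (transpose R) ` {z. \<forall>i\<in>I. z $ i = 0}"
proof -
  obtain B where B: "B \<subseteq> V" "vec.independent B" "V \<subseteq> vec.span B" "card B = vec.dim V"
    by (rule vec.basis_exists)
  let ?E = "vec.extend_basis B"
  have E: "B \<subseteq> ?E" "vec.independent ?E" "vec.span ?E = UNIV"
    using vec.extend_basis_superset[OF B(2)] vec.independent_extend_basis[OF B(2)]
      vec.span_extend_basis[OF B(2)] by auto
  have "card ?E = CARD('n)"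
    using vec.dim_span_eq_card_independent[OF E(2)] E(3) by (simp only: vec_dim_card)
  moreover have finE: "finite ?E" using E(2) by (rule vec.finiteI_independent)
  ultimately obtain \<phi> :: "'n \<Rightarrow> complex^'n" where \<phi>: "bij_betw \<phi> UNIV ?E"
    by (metis bij_betw_iff_card finite)
  define Q :: "complex^'n^'n" where "Q = (\<chi> j i. \<phi> i $ j)"
  define I where "I = {i. \<phi> i \<in> B}"
  have Qv: "Q *v z = (\<Sum>i\<in>UNIV. z $ i *s \<phi> i)" for z
    by (simp add: Q_def matrix_vector_mult_def vec_eq_iff sum_component mult.commute)
  have spanQ: "(*v) Q ` {z. \<forall>i. i \<notin> J \<longrightarrow> z $ i = 0} = vec.span (\<phi> ` J)" for J
  proof (intro equalityI subsetI)
    fix v assume "v \<in> (*v) Q ` {z. \<forall>i. i \<notin> J \<longrightarrow> z $ i = 0}"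
    then obtain z where z: "\<And>i. i \<notin> J \<Longrightarrow> z $ i = 0" "v = Q *v z" by blast
    have "z $ i *s \<phi> i \<in> vec.span (\<phi> ` J)" for i
      using z(1)[of i] by (cases "i \<in> J") (auto intro: vec.span_scale vec.span_base vec.span_zero)
    then show "v \<in> vec.span (\<phi> ` J)" unfolding z(2) Qv by (intro vec.span_sum)
  next
    fix v assume "v \<in> vec.span (\<phi> ` J)"
    then obtain u where u: "v = (\<Sum>x\<in>\<phi> ` J. u x *s x)"
      using vec.span_finite[of "\<phi> ` J"] by auto
    have "inj_on \<phi> J" using \<phi> bij_betw_imp_inj_on inj_on_subset by blast
    then have "v = (\<Sum>i\<in>J. u (\<phi> i) *s \<phi> i)" unfolding u by (simp add: sum.reindex)
    also have "\<dots> = Q *v (\<chi> i. if i \<in> J then u (\<phi> i) else 0)"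
      unfolding Qv by (rule sum.mono_neutral_cong_left) auto
    finally show "v \<in> (*v) Q ` {z. \<forall>i. i \<notin> J \<longrightarrow> z $ i = 0}" by auto
  qed
  have "\<phi> ` UNIV = ?E" using \<phi> by (simp add: bij_betw_def)
  then have "surj ((*v) Q)" using spanQ[of UNIV] E(3) by auto
  then obtain R where QR: "Q ** R = mat 1" using matrix_right_invertible_surjective by blast
  then have RQ: "R ** Q = mat 1" by (simp add: matrix_left_right_inverse)
  have \<phi>I: "\<phi> ` I = B" using \<open>\<phi> ` UNIV = ?E\<close> E(1) by (auto simp: I_def)
  have "card I = vec.dim V"
    using B(4) \<phi>I \<phi> by (metis bij_betw_imp_inj_on card_image inj_on_subset subset_UNIV)
  moreover have VI: "V = (*v) Q ` {z. \<forall>i. i \<notin> I \<longrightarrow> z $ i = 0}"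
    unfolding spanQ \<phi>I using B V by (simp add: vec.span_eq_iff subset_antisym vec.span_minimal)
  moreover have "orth V = (*v) (transpose R) ` {z. \<forall>i\<in>I. z $ i = 0}"
  proof (intro equalityI subsetI)
    fix w assume w: "w \<in> orth V"
    let ?z = "transpose Q *v w"
    have "transpose R *v ?z = w"
      by (rule transpose_inverse_mult[OF QR])
    moreover have "?z $ i = 0" if "i \<in> I" for i
    proof -
      have "Q *v axis i 1 \<in> V" unfolding VI using that by (auto simp: axis_def)
      then have "bil (Q *v axis i 1) w = 0" using w by (auto simp: orth_def)
      then show ?thesis by (simp add: bil_matrix bil_commute[of "axis i 1"] bil_axis del: transpose_matrix_vector)
    qed
    ultimately show "w \<in> (*v) (transpose R) ` {z. \<forall>i\<in>I. z $ i = 0}"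
      by (intro image_eqI[of _ _ ?z]) auto
  next
    fix w assume "w \<in> (*v) (transpose R) ` {z. \<forall>i\<in>I. z $ i = 0}"
    then obtain u where u: "\<And>i. i \<in> I \<Longrightarrow> u $ i = 0" "w = transpose R *v u" by blast
    have "bil (Q *v z) w = 0" if "\<And>i. i \<notin> I \<Longrightarrow> z $ i = 0" for z
    proof -
      have "bil (Q *v z) w = bil z (transpose Q *v (transpose R *v u))" by (simp add: bil_matrix u del: transpose_matrix_vector)
      also have "\<dots> = bil z u"
        by (simp add: transpose_inverse_mult[OF RQ] del: transpose_matrix_vector)
      also have "\<dots> = 0" unfolding bil_def using u that by (intro sum.neutral) fastforce
      finally show ?thesis .
    qed
    then show "w \<in> orth V" unfolding orth_def VI by auto
  qed
  ultimately show thesis using that QR RQ by blast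
qed

text \<open>The pairs form a space of the ambient dimension, so a linear chart turns systems on
  \<open>V \<times> orth V\<close> into polynomial maps of the ambient space to itself, the setting
  of both the hypersurface theorem and the fibre count. \<open>C\<close> and \<open>D\<close>
  recover the parameter and carry convergence of pairs back to the chart.\<close>

lemma subspace_pair_parametrization:
  fixes V :: "(complex^'n) set"
  assumes V: "vec.subspace V"
  obtains A B C D :: "complex^'n^'n" where "bij_betw (\<lambda>z. (A *v z, B *v z)) UNIV (V \<times> orth V)"
    "\<forall>z. C *v (A *v z) + D *v (B *v z) = z"
proof -
  obtain Q R :: "complex^'n^'n" and I where QR: "Q ** R = mat 1" "R ** Q = mat 1"
    and VI: "V = (*v) Q ` {z. \<forall>i. i \<notin> I \<longrightarrow> z $ i = 0}"
    and WI: "orth V = (*v) (transpose R) ` {z. \<forall>i\<in>I. z $ i = 0}"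
    by (rule subspace_adapted_basis[OF V])
  define A where "A = Q ** matrix (res I)"
  define B where "B = transpose R ** matrix (res (- I))"
  have A: "A *v z = Q *v res I z" and B: "B *v z = transpose R *v res (- I) z" for z
    by (simp_all add: A_def B_def matrix_works[OF linear_res] flip: matrix_vector_mul_assoc)
  have RA: "R *v (A *v z) = res I z" and QB: "transpose Q *v (B *v z) = res (- I) z" for z
    by (simp_all only: A B transpose_inverse_mult[OF QR(2)]) (simp add: matrix_vector_mul_assoc QR)
  have "bij_betw (\<lambda>z. (A *v z, B *v z)) UNIV (V \<times> orth V)"
  proof (rule bij_betw_imageI)
    show "inj (\<lambda>z. (A *v z, B *v z))"
    proof (rule injI)
      fix z z' assume "(A *v z, B *v z) = (A *v z', B *v z')"
      then have "res I z = res I z'" "res (- I) z = res (- I) z'"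
        using RA QB by (metis prod.inject)+
      then show "z = z'" by (simp add: vec_eq_iff res_nth) metis
    qed
    show "range (\<lambda>z. (A *v z, B *v z)) = V \<times> orth V"
    proof (intro equalityI subsetI)
      fix p assume "p \<in> range (\<lambda>z. (A *v z, B *v z))"
      then obtain z where p: "p = (A *v z, B *v z)" by auto
      have "A *v z \<in> V" unfolding VI A by (intro imageI) (auto simp: res_nth)
      moreover have "B *v z \<in> orth V" unfolding WI B by (intro imageI) (auto simp: res_nth)
      ultimately show "p \<in> V \<times> orth V" by (simp add: p)
    next
      fix p assume "p \<in> V \<times> orth V"
      then obtain y w where yw: "p = (y, w)" "y \<in> V" "w \<in> orth V" by blast
      from yw(2) obtain u where u: "\<And>i. i \<notin> I \<Longrightarrow> u $ i = 0" "y = Q *v u" by (subst (asm) VI) auto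
      from yw(3) obtain v where v: "\<And>i. i \<in> I \<Longrightarrow> v $ i = 0" "w = transpose R *v v"
        by (subst (asm) WI) auto
      have "res I (u + v) = u" "res (- I) (u + v) = v" using u v by (auto simp: vec_eq_iff res_nth)
      then have "p = (A *v (u + v), B *v (u + v))" unfolding yw(1) u(2) v(2) A B by simp
      then show "p \<in> range (\<lambda>z. (A *v z, B *v z))" by (intro image_eqI[of _ _ "u + v"]) auto
    qed
  qed
  moreover have "\<forall>z. R *v (A *v z) + transpose Q *v (B *v z) = z"
    unfolding RA QB by (simp add: vec_eq_iff res_nth)
  ultimately show thesis by (rule that)
qed

lemma orth_orth:
  fixes V :: "(complex^'n) set"
  shows "vec.subspace V \<Longrightarrow> orth (orth V) = V"
proof (intro equalityI subsetI)
  fix v assume V: "vec.subspace V" and v: "v \<in> orth (orth V)"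
  obtain Q R :: "complex^'n^'n" and I where QR: "Q ** R = mat 1" "R ** Q = mat 1"
    and VI: "V = (*v) Q ` {z. \<forall>i. i \<notin> I \<longrightarrow> z $ i = 0}"
    and WI: "orth V = (*v) (transpose R) ` {z. \<forall>i\<in>I. z $ i = 0}"
    by (rule subspace_adapted_basis[OF V])
  have "(R *v v) $ i = 0" if "i \<notin> I" for i
  proof -
    have "transpose R *v axis i 1 \<in> orth V" unfolding WI using that by (auto simp: axis_def)
    then have "bil (transpose R *v axis i 1) v = 0" using v by (auto simp: orth_def)
    then show ?thesis by (simp add: bil_matrix bil_commute[of "axis i 1"] bil_axis del: transpose_matrix_vector)
  qed
  moreover have "v = Q *v (R *v v)" by (simp add: matrix_vector_mul_assoc QR)
  ultimately show "v \<in> V" unfolding VI by blast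
qed (auto simp: orth_def bil_commute)

section \<open>Properness of the likelihood equations\<close>

text \<open>\<open>B\<close> is the ground set of a minor, and all minors live in the same ambient
  space: if \<open>V\<close> vanishes outside \<open>B\<close>, the coordinates of \<open>w\<close>
  outside \<open>B\<close> are free, and the equations \<open>w_i = s_i\<close> fix them, so that
  unknowns and equations always balance.\<close>

definition phi :: "'n set \<Rightarrow> complex^'n \<Rightarrow> complex^'n \<Rightarrow> complex^'n \<Rightarrow> complex^'n" where
  "phi B a y w = (\<chi> i. if i \<in> B then a $ i * y $ i + (y $ i)\<^sup>2 * w $ i else w $ i)"

definition sol :: "'n set \<Rightarrow> (complex^'n) set \<Rightarrow> complex^'n \<Rightarrow> complex^'n \<Rightarrow> ((complex^'n) \<times> (complex^'n)) set" where
  "sol B V a s = {(y, w). y \<in> V \<and> w \<in> orth V \<and> phi B a y w = s}"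

text \<open>Injectivity on \<open>V \<times> orth V\<close> of the differential of
  \<open>phi B a\<close> at \<open>(y, w)\<close>.\<close>

definition nondeg :: "'n set \<Rightarrow> (complex^'n) set \<Rightarrow> complex^'n \<Rightarrow> complex^'n \<Rightarrow> complex^'n \<Rightarrow> bool" where
  "nondeg B V a y w \<longleftrightarrow> (\<forall>dy\<in>V. \<forall>dw\<in>orth V.
     (\<forall>i\<in>B. (a $ i + 2 * y $ i * w $ i) * dy $ i + (y $ i)\<^sup>2 * dw $ i = 0) \<and> (\<forall>i. i \<notin> B \<longrightarrow> dw $ i = 0)
     \<longrightarrow> dy = 0 \<and> dw = 0)"

definition supp :: "complex^'n \<Rightarrow> 'n set" where
  "supp v = {i. v $ i \<noteq> 0}"

definition admissible :: "(complex^'n) set \<Rightarrow> complex^'n \<Rightarrow> bool" where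
  "admissible V a \<longleftrightarrow> (\<forall>v\<in>V. v \<noteq> 0 \<longrightarrow> (\<Sum>i\<in>supp v. a $ i) \<noteq> 0)"

text \<open>The subspace of a matroid minor: the elements of \<open>N\<close> are contracted, then
  everything outside \<open>D\<close> is deleted.\<close>

definition cut :: "(complex^'n) set \<Rightarrow> 'n set \<Rightarrow> 'n set \<Rightarrow> (complex^'n) set" where
  "cut V D N = res D ` {z\<in>V. \<forall>i\<in>N. z $ i = 0}"

text \<open>A sequence of solutions in which \<open>w\<close> is unbounded yields such a pair \<open>(\<eta>, w)\<close>: \<open>D\<close> is the set of
  coordinates in which \<open>y\<close> tends to \<open>0\<close> at the slowest rate, and \<open>\<eta>\<close> is the limit of \<open>y\<close> divided by
  this rate.\<close>

definition no_degeneration :: "(complex^'n) set \<Rightarrow> 'n set \<Rightarrow> complex^'n \<Rightarrow> bool" where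
  "no_degeneration V Z s \<longleftrightarrow> (\<forall>D N. D \<noteq> {} \<and> D \<inter> Z = {} \<longrightarrow>
     \<not> (\<exists>\<eta>\<in>cut V D N. \<exists>w\<in>orth (cut V D N). \<forall>i\<in>D. \<eta> $ i \<noteq> 0 \<and> s $ i = (\<eta> $ i)\<^sup>2 * w $ i))"

lemma vec_subspace_imp_subspace: "vec.subspace (V :: (complex^'n) set) \<Longrightarrow> subspace V"
  unfolding subspace_def vec.subspace_def
  by (auto simp: scaleR_conv_of_real vec_eq_iff vector_scalar_mult_def scaleR_vec_def)

lemma closed_vec_subspace: "vec.subspace (V :: (complex^'n) set) \<Longrightarrow> closed V"
  by (rule closed_subspace[OF vec_subspace_imp_subspace])

lemma normalized_subsequence:
  fixes x :: "nat \<Rightarrow> complex^'n"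
  assumes "vec.subspace V" "\<And>k. x k \<in> V" "\<And>k. x k \<noteq> 0"
  obtains r \<xi> where "strict_mono r" "\<xi> \<in> V" "\<xi> \<noteq> 0" "(\<lambda>k. inverse (norm (x (r k))) *\<^sub>R x (r k)) \<longlonglongrightarrow> \<xi>"
proof -
  let ?u = "\<lambda>k. inverse (norm (x k)) *\<^sub>R x k"
  have n: "norm (?u k) = 1" for k using assms(3) by simp
  have "bounded (range ?u)" using n by (intro boundedI[of _ 1]) auto
  then obtain \<xi> r where r: "strict_mono r" "(?u \<circ> r) \<longlonglongrightarrow> \<xi>"
    using bounded_imp_convergent_subsequence by blast
  have "?u k \<in> V" for k
    using subspace_scale[OF vec_subspace_imp_subspace[OF assms(1)] assms(2)] .
  then have "\<xi> \<in> V" using closed_sequentially[OF closed_vec_subspace[OF assms(1)] _ r(2)] by simp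
  moreover have "(\<lambda>k. norm ((?u \<circ> r) k)) \<longlonglongrightarrow> norm \<xi>" by (rule tendsto_norm[OF r(2)])
  then have "norm \<xi> = 1" using n LIMSEQ_unique[OF _ tendsto_const] by (simp add: o_def)
  then have "\<xi> \<noteq> 0" by auto
  ultimately show thesis using that r by (simp add: o_def)
qed

lemma subspace_cut: "vec.subspace V \<Longrightarrow> vec.subspace (cut V D N)"
  unfolding cut_def by (rule subspace_res) (auto simp: vec.subspace_def)

text \<open>The pairs \<open>(\<eta>, w)\<close> may be rescaled to \<open>(t \<eta>, w / t\<^sup>2)\<close>, so the values \<open>\<eta>\<^sup>2 w\<close> are already
  attained on the hypersurface where one coordinate of \<open>\<eta>\<close> is \<open>1\<close>.\<close>

lemma generic_not_homogeneous:
  fixes U :: "(complex^'n) set"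
  assumes U: "vec.subspace U" and supp: "\<And>v i. v \<in> U \<Longrightarrow> i \<notin> D \<Longrightarrow> v $ i = 0" and j: "j \<in> D"
  shows "generic (\<lambda>s. \<not> (\<exists>\<eta>\<in>U. \<exists>w\<in>orth U. \<forall>i\<in>D. \<eta> $ i \<noteq> 0 \<and> s $ i = (\<eta> $ i)\<^sup>2 * w $ i))"
proof -
  obtain A B C' D' :: "complex^'n^'n" where AB: "bij_betw (\<lambda>z. (A *v z, B *v z)) UNIV (U \<times> orth U)"
    by (rule subspace_pair_parametrization[OF U])
  define G where "G z = phi D 0 (A *v z) (B *v z)" for z
  have vG: "vpoly (\<lambda>z. G z $ i)" for i
    unfolding G_def phi_def by (cases "i \<in> D") (auto intro!: pfun_intros vpoly_matrix)
  have "generic (\<lambda>s. \<forall>z. G z = s \<longrightarrow> (A *v z) $ j - 1 \<noteq> 0)"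
    by (rule generic_avoids_hypersurface_image[OF vG, where u = 0])
      (auto intro!: pfun_diff vpoly_matrix pfun.const)
  then show ?thesis
  proof (rule generic_mono)
    show "\<not> (\<exists>\<eta>\<in>U. \<exists>w\<in>orth U. \<forall>i\<in>D. \<eta> $ i \<noteq> 0 \<and> s $ i = (\<eta> $ i)\<^sup>2 * w $ i)"
      if s: "\<forall>z. G z = s \<longrightarrow> (A *v z) $ j - 1 \<noteq> 0" for s
    proof
    assume "\<exists>\<eta>\<in>U. \<exists>w\<in>orth U. \<forall>i\<in>D. \<eta> $ i \<noteq> 0 \<and> s $ i = (\<eta> $ i)\<^sup>2 * w $ i"
    then obtain \<eta> w where \<eta>: "\<eta> \<in> U" "w \<in> orth U"
      "\<And>i. i \<in> D \<Longrightarrow> \<eta> $ i \<noteq> 0" "\<And>i. i \<in> D \<Longrightarrow> s $ i = (\<eta> $ i)\<^sup>2 * w $ i" by blast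
    let ?y = "(1 / \<eta> $ j) *s \<eta>"
    \<comment> \<open>Outside \<open>D\<close> the entries do not affect orthogonality to
      \<open>U\<close>; the values \<open>s $ i\<close> there satisfy the remaining equations of
      \<open>phi D 0\<close>.\<close>
    let ?w = "\<chi> i. if i \<in> D then (\<eta> $ j)\<^sup>2 * w $ i else s $ i"
    have "?y \<in> U" using U \<eta>(1) by (rule vec.subspace_scale)
    moreover have "?w \<in> orth U"
    proof -
      have "bil v ?w = (\<eta> $ j)\<^sup>2 * bil v w" if "v \<in> U" for v
        unfolding bil_def sum_distrib_left using supp[OF that] by (intro sum.cong) auto
      then show ?thesis using \<eta>(2) by (simp add: orth_def)
    qed
    ultimately have "(?y, ?w) \<in> range (\<lambda>z. (A *v z, B *v z))" using AB by (simp add: bij_betw_def)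
    then obtain z where z: "A *v z = ?y" "B *v z = ?w" by auto
    have "G z = s"
      unfolding G_def z phi_def using \<eta>(3,4) \<eta>(3)[OF j] by (auto simp: vec_eq_iff power_divide)
    moreover have "(A *v z) $ j - 1 = 0" using \<eta>(3)[OF j] unfolding z by simp
    ultimately show False using s by blast
    qed
  qed
qed

lemma generic_no_degeneration:
  fixes V :: "(complex^'n) set"
  assumes "vec.subspace V" shows "generic (no_degeneration V Z)"
proof -
  have "generic (\<lambda>s. \<forall>(D, N)\<in>{D. D \<noteq> {} \<and> D \<inter> Z = {}} \<times> UNIV.
     \<not> (\<exists>\<eta>\<in>cut V D N. \<exists>w\<in>orth (cut V D N). \<forall>i\<in>D. \<eta> $ i \<noteq> 0 \<and> s $ i = (\<eta> $ i)\<^sup>2 * w $ i))"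
  proof (rule generic_all_finite, simp, clarify)
    fix D N :: "'n set" assume "D \<noteq> {}"
    then obtain j where "j \<in> D" by blast
    then show "generic (\<lambda>s. \<not> (\<exists>\<eta>\<in>cut V D N. \<exists>w\<in>orth (cut V D N). \<forall>i\<in>D. \<eta> $ i \<noteq> 0 \<and> s $ i = (\<eta> $ i)\<^sup>2 * w $ i))"
      by (intro generic_not_homogeneous[OF subspace_cut[OF assms]]) (auto simp: cut_def res_nth)
  qed
  then show ?thesis by (rule generic_mono) (auto simp: no_degeneration_def)
qed

lemma no_degeneration_mono: "no_degeneration V Z s \<Longrightarrow> Z \<subseteq> Z' \<Longrightarrow> no_degeneration V Z' s"
  unfolding no_degeneration_def by (meson disjoint_iff in_mono)

lemma no_degeneration_cong:
  fixes V :: "(complex^'n) set"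
  assumes "no_degeneration V Z s" "\<And>i. i \<notin> Z \<Longrightarrow> s $ i = s' $ i" shows "no_degeneration V Z s'"
  unfolding no_degeneration_def
proof (intro allI impI notI)
  fix D N :: "'n set" assume D: "D \<noteq> {} \<and> D \<inter> Z = {}"
  assume "\<exists>\<eta>\<in>cut V D N. \<exists>w\<in>orth (cut V D N). \<forall>i\<in>D. \<eta> $ i \<noteq> 0 \<and> s' $ i = (\<eta> $ i)\<^sup>2 * w $ i"
  moreover have "s' $ i = s $ i" if "i \<in> D" for i using D that assms(2) by force
  ultimately have "\<exists>\<eta>\<in>cut V D N. \<exists>w\<in>orth (cut V D N). \<forall>i\<in>D. \<eta> $ i \<noteq> 0 \<and> s $ i = (\<eta> $ i)\<^sup>2 * w $ i"
    by simp
  then show False using assms(1) D unfolding no_degeneration_def by blast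
qed

text \<open>\<open>Z\<close> is empty or consists of one element whose equation degenerates to \<open>y\<^sup>2 w = 0\<close>.\<close>

locale solution_sequence =
  fixes B :: "'n::finite set" and V :: "(complex^'n) set" and a s :: "complex^'n"
    and ak sk y w :: "nat \<Rightarrow> complex^'n" and Z :: "'n set" and e :: 'n
  assumes V: "vec.subspace V" and VB: "\<And>v i. v \<in> V \<Longrightarrow> i \<notin> B \<Longrightarrow> v $ i = 0"
    and adm: "admissible V a" and ak: "ak \<longlonglongrightarrow> a" and sk: "sk \<longlonglongrightarrow> s"
    and s_nz: "\<And>i. i \<in> B - Z \<Longrightarrow> s $ i \<noteq> 0" and no_degeneration: "no_degeneration V Z s"
    and Z: "Z \<subseteq> {e}" "\<And>k i. i \<in> Z \<Longrightarrow> ak k $ i = 0" "\<And>i. i \<in> Z \<Longrightarrow> s $ i = 0"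
      "\<And>i. i \<in> Z \<Longrightarrow> \<exists>v\<in>V. v $ i \<noteq> 0"
    and sol: "\<And>k. (y k, w k) \<in> sol B V (ak k) (sk k)"
begin

lemma yw: "y k \<in> V" "w k \<in> orth V" "phi B (ak k) (y k) (w k) = sk k"
  using sol[of k] by (auto simp: sol_def)

lemma eq: "i \<in> B \<Longrightarrow> ak k $ i * y k $ i + (y k $ i)\<^sup>2 * w k $ i = sk k $ i"
  using yw(3)[of k] by (auto simp: phi_def vec_eq_iff split: if_splits)

lemma bil0: "v \<in> V \<Longrightarrow> (\<Sum>i\<in>UNIV. v $ i * w k $ i) = 0"
  using yw(2)[of k] by (simp add: orth_def bil_def)

lemma w_eq: "i \<in> B \<Longrightarrow> y k $ i \<noteq> 0 \<Longrightarrow> w k $ i = (sk k $ i - ak k $ i * y k $ i) / (y k $ i)\<^sup>2"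
  using eq[of i k] by (simp add: field_simps)

lemma subseq: "strict_mono r \<Longrightarrow> solution_sequence B V a s (ak \<circ> r) (sk \<circ> r) (y \<circ> r) (w \<circ> r) Z e"
  using V VB adm s_nz no_degeneration Z sol LIMSEQ_subseq_LIMSEQ[OF ak] LIMSEQ_subseq_LIMSEQ[OF sk]
  by unfold_locales auto

text \<open>If \<open>\<xi>\<close> is the limit direction of \<open>y\<close> and \<open>n\<close>
  its norm, the equations give \<open>n \<xi>_i w_i \<longrightarrow> - a_i\<close> on the support
  of \<open>\<xi>\<close>. As \<open>w\<close> is orthogonal to \<open>\<xi>\<close>, the sum of
  \<open>a\<close> over this support would be 0, which \<open>admissible\<close> excludes.\<close>

lemma not_norm_y_at_top: "\<not> filterlim (\<lambda>k. norm (y k)) at_top sequentially"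
proof
  assume top: "filterlim (\<lambda>k. norm (y k)) at_top sequentially"
  then obtain K where K: "\<And>k. k \<ge> K \<Longrightarrow> norm (y k) \<ge> 1"
    unfolding filterlim_at_top eventually_sequentially by blast
  define x where "x k = y (k + K)" for k
  have x: "x k \<in> V" "x k \<noteq> 0" for k
    using yw(1) K[of "k + K"] by (auto simp: x_def)
  obtain r \<xi> where r: "strict_mono r" "\<xi> \<in> V" "\<xi> \<noteq> 0"
    and lim: "(\<lambda>k. inverse (norm (x (r k))) *\<^sub>R x (r k)) \<longlonglongrightarrow> \<xi>"
    using normalized_subsequence[of V x, OF V x] by blast
  define q where "q k = r k + K" for k
  have q: "strict_mono q" using r(1) by (auto simp: strict_mono_def q_def)
  define n where "n k = complex_of_real (norm (y (q k)))" for k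
  have "filterlim (\<lambda>k. norm (y (q k))) at_top sequentially"
    using filterlim_compose[OF top filterlim_subseq[OF q]] .
  then have "(\<lambda>k. inverse (norm (y (q k)))) \<longlonglongrightarrow> 0" by (rule tendsto_inverse_0_at_top)
  then have "(\<lambda>k. complex_of_real (inverse (norm (y (q k))))) \<longlonglongrightarrow> of_real 0" by (rule tendsto_of_real)
  then have n0: "(\<lambda>k. inverse (n k)) \<longlonglongrightarrow> 0" by (simp add: n_def)
  have nnz: "n k \<noteq> 0" for k using x(2)[of "r k"] by (simp add: n_def x_def q_def)
  have comp: "(\<lambda>k. y (q k) $ i / n k) \<longlonglongrightarrow> \<xi> $ i" for i
    using tendsto_vec_nth[OF lim, of i]
    by (simp add: x_def q_def n_def scaleR_conv_of_real[where 'a=complex] divide_inverse mult.commute)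
  have aq: "(\<lambda>k. ak (q k) $ i) \<longlonglongrightarrow> a $ i" and sq: "(\<lambda>k. sk (q k) $ i) \<longlonglongrightarrow> s $ i" for i
    using LIMSEQ_subseq_LIMSEQ[OF tendsto_vec_nth[OF ak] q] LIMSEQ_subseq_LIMSEQ[OF tendsto_vec_nth[OF sk] q]
    by (simp_all add: o_def)
  have "(\<lambda>k. \<Sum>i\<in>supp \<xi>. n k * (\<xi> $ i * w (q k) $ i)) \<longlonglongrightarrow> (\<Sum>i\<in>supp \<xi>. - a $ i)"
  proof (rule tendsto_sum)
    fix i assume "i \<in> supp \<xi>"
    then have i: "\<xi> $ i \<noteq> 0" "i \<in> B" using VB r(2) by (auto simp: supp_def)
    have "(\<lambda>k. \<xi> $ i / (y (q k) $ i / n k) * (sk (q k) $ i * inverse (n k) / (y (q k) $ i / n k) - ak (q k) $ i))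
        \<longlonglongrightarrow> \<xi> $ i / \<xi> $ i * (s $ i * 0 / \<xi> $ i - a $ i)"
      using i by (intro tendsto_intros comp n0 aq sq) auto
    moreover have "\<forall>\<^sub>F k in sequentially. y (q k) $ i / n k \<noteq> 0"
      using tendsto_imp_eventually_ne[OF comp i(1)] .
    then have "\<forall>\<^sub>F k in sequentially.
        \<xi> $ i / (y (q k) $ i / n k) * (sk (q k) $ i * inverse (n k) / (y (q k) $ i / n k) - ak (q k) $ i)
        = n k * (\<xi> $ i * w (q k) $ i)"
    proof eventually_elim
      case (elim k)
      then have "y (q k) $ i \<noteq> 0" by auto
      then show ?case using nnz[of k] by (simp add: eq[OF i(2), symmetric] field_simps power2_eq_square)
    qed
    ultimately show "(\<lambda>k. n k * (\<xi> $ i * w (q k) $ i)) \<longlonglongrightarrow> - a $ i"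
      using i by (simp add: tendsto_cong)
  qed
  moreover have "(\<Sum>i\<in>supp \<xi>. n k * (\<xi> $ i * w (q k) $ i)) = 0" for k
  proof -
    have "(\<Sum>i\<in>supp \<xi>. \<xi> $ i * w (q k) $ i) = (\<Sum>i\<in>UNIV. \<xi> $ i * w (q k) $ i)"
      by (rule sum.mono_neutral_left) (auto simp: supp_def)
    then show ?thesis using bil0[OF r(2)] by (simp flip: sum_distrib_left)
  qed
  ultimately have "(\<lambda>k. 0) \<longlonglongrightarrow> (\<Sum>i\<in>supp \<xi>. - a $ i)" by simp
  then have "(\<Sum>i\<in>supp \<xi>. a $ i) = 0" by (simp add: LIMSEQ_const_iff sum_negf)
  then show False using adm r(2,3) unfolding admissible_def by blast
qed

text \<open>Coordinates tending to 0 are rescaled along a subsequence, and the limit is a pair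
  forbidden by \<open>no_degeneration\<close>. The difficulty is the element of \<open>Z\<close>,
  which may tend to 0 more slowly than all others; it must not enter \<open>D\<close> and has to be
  eliminated.\<close>

lemma limit_nonzero:
  assumes lim: "y \<longlonglongrightarrow> y0" and iB: "i \<in> B - Z"
  shows "y0 $ i \<noteq> 0"
proof
  assume "y0 $ i = 0"
  define F where "F = {i\<in>B. y0 $ i = 0}"
  define F' where "F' = F - Z"
  have F'ne: "i \<in> F'" using iB \<open>y0 $ i = 0\<close> by (simp add: F'_def F_def)
  have yF: "(\<lambda>k. res J (y k)) \<longlonglongrightarrow> 0" if "J \<subseteq> F" for J
  proof (rule vec_tendstoI)
    fix i
    show "(\<lambda>k. res J (y k) $ i) \<longlonglongrightarrow> 0 $ i"
      using tendsto_vec_nth[OF lim, of i] that by (cases "i \<in> J") (auto simp: res_nth F_def)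
  qed
  \<comment> \<open>The passage to the limit common to both cases. On \<open>D\<close> the numbers
    \<open>(\<rho> k)\<^sup>2 * w\<close> tend to \<open>s / \<xi>\<^sup>2\<close>. When
    \<open>w\<close> is paired with a \<open>z\<close> in \<open>V\<close> that vanishes on
    \<open>N\<close>, the part outside \<open>F\<close> stays bounded and the part on
    \<open>F - D\<close> is controlled by \<open>rest\<close>, so after multiplication by
    \<open>(\<rho> k)\<^sup>2\<close> only \<open>D\<close> survives.\<close>
  have key: False if q: "strict_mono q" and \<rho>: "\<And>k. \<rho> k \<noteq> (0::complex)" "\<rho> \<longlonglongrightarrow> 0"
    and \<xi>: "\<And>i. i \<in> F' \<Longrightarrow> (\<lambda>k. y (q k) $ i / \<rho> k) \<longlonglongrightarrow> \<xi> $ i"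
    and D: "D \<noteq> {}" "D \<subseteq> F'" "\<And>i. i \<in> D \<Longrightarrow> \<xi> $ i \<noteq> 0"
    and v: "v \<in> V" "res D v = res D \<xi>" and N: "N \<subseteq> F - D" "\<And>i. i \<in> N \<Longrightarrow> v $ i = 0"
    and rest: "\<And>z. z \<in> V \<Longrightarrow> (\<And>i. i \<in> N \<Longrightarrow> z $ i = 0)
      \<Longrightarrow> (\<lambda>k. (\<rho> k)\<^sup>2 * (\<Sum>i\<in>F - D. z $ i * w (q k) $ i)) \<longlonglongrightarrow> 0" for q \<rho> \<xi> D N v
  proof -
    have aq: "(\<lambda>k. ak (q k) $ i) \<longlonglongrightarrow> a $ i" and sq: "(\<lambda>k. sk (q k) $ i) \<longlonglongrightarrow> s $ i"
      and yq: "(\<lambda>k. y (q k) $ i) \<longlonglongrightarrow> y0 $ i" for i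
      using LIMSEQ_subseq_LIMSEQ[OF tendsto_vec_nth[OF ak] q] LIMSEQ_subseq_LIMSEQ[OF tendsto_vec_nth[OF sk] q]
        LIMSEQ_subseq_LIMSEQ[OF tendsto_vec_nth[OF lim] q]
      by (simp_all add: o_def)
    let ?w = "\<chi> i. s $ i / (\<xi> $ i)\<^sup>2"
    have "?w \<in> orth (cut V D N)"
    proof -
      have "bil (res D z) ?w = 0" if z: "z \<in> V" "\<And>i. i \<in> N \<Longrightarrow> z $ i = 0" for z
      proof -
        have "(\<lambda>k. \<Sum>i\<in>D. z $ i * ((\<rho> k)\<^sup>2 * w (q k) $ i)) \<longlonglongrightarrow> (\<Sum>i\<in>D. z $ i * (s $ i / (\<xi> $ i)\<^sup>2))"
        proof (intro tendsto_sum tendsto_mult tendsto_const)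
          fix i assume "i \<in> D"
          then have i: "\<xi> $ i \<noteq> 0" "i \<in> B" "i \<in> F'" "y0 $ i = 0" using D by (auto simp: F'_def F_def)
          have "(\<lambda>k. (sk (q k) $ i - ak (q k) $ i * y (q k) $ i) / (y (q k) $ i / \<rho> k)\<^sup>2)
              \<longlonglongrightarrow> (s $ i - a $ i * y0 $ i) / (\<xi> $ i)\<^sup>2"
            using i by (intro tendsto_intros aq sq yq \<xi>) auto
          moreover have "\<forall>\<^sub>F k in sequentially. y (q k) $ i / \<rho> k \<noteq> 0"
            using tendsto_imp_eventually_ne[OF \<xi>[OF i(3)] i(1)] .
          then have "\<forall>\<^sub>F k in sequentially. (sk (q k) $ i - ak (q k) $ i * y (q k) $ i) / (y (q k) $ i / \<rho> k)\<^sup>2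
              = (\<rho> k)\<^sup>2 * w (q k) $ i"
          proof eventually_elim
            case (elim k)
            then have "y (q k) $ i \<noteq> 0" by auto
            then show ?case using w_eq[OF i(2), of "q k"] by (simp add: power_divide)
          qed
          ultimately show "(\<lambda>k. (\<rho> k)\<^sup>2 * w (q k) $ i) \<longlonglongrightarrow> s $ i / (\<xi> $ i)\<^sup>2"
            using i(4) by (simp add: tendsto_cong)
        qed
        moreover have "(\<lambda>k. \<Sum>i\<in>D. z $ i * ((\<rho> k)\<^sup>2 * w (q k) $ i)) \<longlonglongrightarrow> 0"
        proof -
          have out: "(\<lambda>k. \<Sum>i\<in>B - F. z $ i * w (q k) $ i)
              \<longlonglongrightarrow> (\<Sum>i\<in>B - F. z $ i * ((s $ i - a $ i * y0 $ i) / (y0 $ i)\<^sup>2))"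
          proof (intro tendsto_sum tendsto_mult tendsto_const)
            fix i assume "i \<in> B - F"
            then have i: "i \<in> B" "y0 $ i \<noteq> 0" by (auto simp: F_def)
            have "(\<lambda>k. (sk (q k) $ i - ak (q k) $ i * y (q k) $ i) / (y (q k) $ i)\<^sup>2)
              \<longlonglongrightarrow> (s $ i - a $ i * y0 $ i) / (y0 $ i)\<^sup>2"
              using i by (intro tendsto_intros aq sq yq) auto
            moreover have "\<forall>\<^sub>F k in sequentially. (sk (q k) $ i - ak (q k) $ i * y (q k) $ i) / (y (q k) $ i)\<^sup>2
                = w (q k) $ i"
              using tendsto_imp_eventually_ne[OF yq i(2)]
              by eventually_elim (use w_eq[OF i(1)] in auto)
            ultimately show "(\<lambda>k. w (q k) $ i) \<longlonglongrightarrow> (s $ i - a $ i * y0 $ i) / (y0 $ i)\<^sup>2"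
              by (simp add: tendsto_cong)
          qed
          have split: "(\<Sum>i\<in>D. z $ i * ((\<rho> k)\<^sup>2 * w (q k) $ i))
              = - ((\<rho> k)\<^sup>2 * (\<Sum>i\<in>B - F. z $ i * w (q k) $ i)) - (\<rho> k)\<^sup>2 * (\<Sum>i\<in>F - D. z $ i * w (q k) $ i)" for k
          proof -
            have "0 = (\<Sum>i\<in>UNIV. z $ i * w (q k) $ i)" using bil0[OF z(1)] by simp
            also have "\<dots> = (\<Sum>i\<in>B. z $ i * w (q k) $ i)"
              using VB[OF z(1)] by (intro sum.mono_neutral_right) auto
            also have "\<dots> = (\<Sum>i\<in>B - F. z $ i * w (q k) $ i) + (\<Sum>i\<in>F. z $ i * w (q k) $ i)"
              by (rule sum.subset_diff) (auto simp: F_def)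
            also have "(\<Sum>i\<in>F. z $ i * w (q k) $ i) = (\<Sum>i\<in>F - D. z $ i * w (q k) $ i) + (\<Sum>i\<in>D. z $ i * w (q k) $ i)"
              using D(2) by (intro sum.subset_diff) (auto simp: F'_def)
            finally have "(\<Sum>i\<in>D. z $ i * w (q k) $ i)
                = - (\<Sum>i\<in>B - F. z $ i * w (q k) $ i) - (\<Sum>i\<in>F - D. z $ i * w (q k) $ i)"
              by (simp add: algebra_simps eq_neg_iff_add_eq_0)
            moreover have "(\<Sum>i\<in>D. z $ i * ((\<rho> k)\<^sup>2 * w (q k) $ i)) = (\<rho> k)\<^sup>2 * (\<Sum>i\<in>D. z $ i * w (q k) $ i)"
              by (simp add: sum_distrib_left mult.left_commute)
            ultimately show ?thesis by (simp only: right_diff_distrib mult_minus_right)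
          qed
          have "(\<lambda>k. - ((\<rho> k)\<^sup>2 * (\<Sum>i\<in>B - F. z $ i * w (q k) $ i)) - (\<rho> k)\<^sup>2 * (\<Sum>i\<in>F - D. z $ i * w (q k) $ i))
              \<longlonglongrightarrow> - (0\<^sup>2 * (\<Sum>i\<in>B - F. z $ i * ((s $ i - a $ i * y0 $ i) / (y0 $ i)\<^sup>2))) - 0"
            by (intro tendsto_diff tendsto_minus tendsto_mult tendsto_power out \<rho>(2) rest z)
          then show ?thesis unfolding split by simp
        qed
        ultimately have "(\<Sum>i\<in>D. z $ i * (s $ i / (\<xi> $ i)\<^sup>2)) = 0" by (rule LIMSEQ_unique)
        moreover have "bil (res D z) ?w = (\<Sum>i\<in>D. z $ i * (s $ i / (\<xi> $ i)\<^sup>2))"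
          unfolding bil_def by (rule sum.mono_neutral_cong_right) (auto simp: res_nth)
        ultimately show ?thesis by simp
      qed
      then show ?thesis unfolding orth_def cut_def by auto
    qed
    moreover have "res D \<xi> \<in> cut V D N"
      unfolding cut_def v(2)[symmetric] using v(1) N(2) by blast
    moreover have "\<forall>i\<in>D. res D \<xi> $ i \<noteq> 0 \<and> s $ i = (res D \<xi> $ i)\<^sup>2 * ?w $ i"
      using D(3) by (auto simp: res_nth)
    moreover have "D \<inter> Z = {}" using D(2) by (auto simp: F'_def)
    ultimately show False using no_degeneration D(1) unfolding no_degeneration_def by blast
  qed
  \<comment> \<open>As \<open>s $ i\<close> is nonzero, the equation at \<open>i\<close> eventually
    forbids \<open>y k $ i = 0\<close>, so the vectors to be normalized are nonzero.\<close>
  have "\<exists>K. \<forall>k\<ge>K. y k $ i \<noteq> 0"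
  proof -
    have "i \<in> B" "s $ i \<noteq> 0" using iB s_nz by auto
    have "\<forall>\<^sub>F k in sequentially. sk k $ i \<noteq> 0"
      using tendsto_imp_eventually_ne[OF tendsto_vec_nth[OF sk] \<open>s $ i \<noteq> 0\<close>] .
    then have "\<forall>\<^sub>F k in sequentially. y k $ i \<noteq> 0"
    proof eventually_elim
      case (elim k)
      then show ?case using eq[OF \<open>i \<in> B\<close>, of k] by auto
    qed
    then show ?thesis by (simp add: eventually_sequentially)
  qed
  then obtain K where K: "\<And>k. k \<ge> K \<Longrightarrow> y k $ i \<noteq> 0" by blast
  have normalize: "\<exists>q \<rho> \<xi>. strict_mono q \<and> (\<forall>k. \<rho> k \<noteq> (0::complex)) \<and> \<rho> \<longlonglongrightarrow> 0 \<and> \<xi> \<in> res J ` V \<and> \<xi> \<noteq> 0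
      \<and> (\<forall>i\<in>J. (\<lambda>k. y (q k) $ i / \<rho> k) \<longlonglongrightarrow> \<xi> $ i)" if J: "i \<in> J" "J \<subseteq> F" for J
  proof -
    define x where "x k = res J (y (k + K))" for k
    have x: "x k \<in> res J ` V" for k using yw(1) by (simp add: x_def)
    have xnz: "x k \<noteq> 0" for k
    proof
      assume "x k = 0"
      then have "x k $ i = 0" by simp
      then show False using K[of "k + K"] J(1) by (simp add: x_def res_nth)
    qed
    obtain r \<xi> where r: "strict_mono r" "\<xi> \<in> res J ` V" "\<xi> \<noteq> 0"
      and lim': "(\<lambda>k. inverse (norm (x (r k))) *\<^sub>R x (r k)) \<longlonglongrightarrow> \<xi>"
      using normalized_subsequence[of "res J ` V" x, OF subspace_res[OF V] x xnz] by blast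
    define q where "q k = r k + K" for k
    have q: "strict_mono q" using r(1) by (auto simp: strict_mono_def q_def)
    have "(\<lambda>k. res J (y (q k))) \<longlonglongrightarrow> 0"
      using LIMSEQ_subseq_LIMSEQ[OF yF[OF J(2)] q] by (simp add: o_def)
    then have "(\<lambda>k. complex_of_real (norm (x (r k)))) \<longlonglongrightarrow> 0"
      using tendsto_of_real[OF tendsto_norm_zero] by (fastforce simp: x_def q_def)
    moreover have "(\<lambda>k. y (q k) $ i / complex_of_real (norm (x (r k)))) \<longlonglongrightarrow> \<xi> $ i" if "i \<in> J" for i
      using tendsto_vec_nth[OF lim', of i] that
      by (simp add: x_def q_def res_nth scaleR_conv_of_real[where 'a=complex] divide_inverse mult.commute)
    moreover have "complex_of_real (norm (x (r k))) \<noteq> 0" for k using xnz by simp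
    ultimately show ?thesis using q r(2,3)
      by (intro exI[of _ q] exI[of _ "\<lambda>k. complex_of_real (norm (x (r k)))"] exI[of _ \<xi>]) auto
  qed
  have "i \<in> F" "i \<in> F'" "F' \<subseteq> F" using F'ne by (auto simp: F'_def)
  from normalize[OF \<open>i \<in> F\<close> subset_refl] obtain q \<rho> \<xi> where q0: "strict_mono q \<and> (\<forall>k. \<rho> k \<noteq> (0::complex)) \<and> \<rho> \<longlonglongrightarrow> 0 \<and> \<xi> \<in> res F ` V \<and> \<xi> \<noteq> 0
      \<and> (\<forall>i\<in>F. (\<lambda>k. y (q k) $ i / \<rho> k) \<longlonglongrightarrow> \<xi> $ i)" by (elim exE)
  then have q: "strict_mono q" "\<And>k. \<rho> k \<noteq> (0::complex)" "\<rho> \<longlonglongrightarrow> 0" "\<xi> \<in> res F ` V" "\<xi> \<noteq> 0"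
    "\<And>i. i \<in> F \<Longrightarrow> (\<lambda>k. y (q k) $ i / \<rho> k) \<longlonglongrightarrow> \<xi> $ i"
    by blast+
  obtain v where v: "v \<in> V" "\<xi> = res F v" using q(4) by blast
  show False
  proof (cases "\<exists>j\<in>F'. \<xi> $ j \<noteq> 0")
    case True
    define D where "D = {j\<in>F'. \<xi> $ j \<noteq> 0}"
    \<comment> \<open>On \<open>N\<close> the test vectors vanish. A coordinate left in
      \<open>F - D - N\<close> lies in \<open>Z\<close>, where \<open>(\<rho> k)\<^sup>2 * w\<close>
      tends to 0 because the weight and the limit of the right-hand side are 0.\<close>
    define N where "N = {j\<in>F - D. \<xi> $ j = 0}"
    have FDN: "F - D - N \<subseteq> Z" by (auto simp: D_def N_def F'_def)
    show False
    proof (rule key[OF q(1-3), of \<xi> D v N])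
      show "(\<lambda>k. y (q k) $ i / \<rho> k) \<longlonglongrightarrow> \<xi> $ i" if "i \<in> F'" for i
        using q(6)[of i] that by (simp add: F'_def)
      show "D \<noteq> {}" "D \<subseteq> F'" "N \<subseteq> F - D" "v \<in> V" using True v by (auto simp: D_def N_def)
      show "\<xi> $ i \<noteq> 0" if "i \<in> D" for i using that by (simp add: D_def)
      show "res D v = res D \<xi>" unfolding v(2) by (auto simp: vec_eq_iff res_nth D_def F'_def)
      show "v $ i = 0" if "i \<in> N" for i using that v(2) by (auto simp: N_def res_nth)
      fix z assume z: "z \<in> V" "\<And>i. i \<in> N \<Longrightarrow> z $ i = 0"
      have "(\<lambda>k. \<Sum>i\<in>F - D. z $ i * ((\<rho> k)\<^sup>2 * w (q k) $ i)) \<longlonglongrightarrow> (\<Sum>i\<in>F - D. 0)"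
      proof (rule tendsto_sum)
        fix j assume j: "j \<in> F - D"
        show "(\<lambda>k. z $ j * ((\<rho> k)\<^sup>2 * w (q k) $ j)) \<longlonglongrightarrow> 0"
        proof (cases "j \<in> N")
          case True then show ?thesis using z(2) by simp
        next
          case False
          then have jZ: "j \<in> Z" "\<xi> $ j \<noteq> 0" "j \<in> B" "j \<in> F" using j FDN by (auto simp: N_def F_def)
          have "(\<lambda>k. sk (q k) $ j / (y (q k) $ j / \<rho> k)\<^sup>2) \<longlonglongrightarrow> s $ j / (\<xi> $ j)\<^sup>2"
            using jZ LIMSEQ_subseq_LIMSEQ[OF tendsto_vec_nth[OF sk, of j] q(1)]
            by (intro tendsto_divide tendsto_power q(6)) (auto simp: o_def)
          moreover have "\<forall>\<^sub>F k in sequentially. y (q k) $ j / \<rho> k \<noteq> 0"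
            using tendsto_imp_eventually_ne[OF q(6)[OF jZ(4)] jZ(2)] .
          then have "\<forall>\<^sub>F k in sequentially. sk (q k) $ j / (y (q k) $ j / \<rho> k)\<^sup>2 = (\<rho> k)\<^sup>2 * w (q k) $ j"
          proof eventually_elim
            case (elim k)
            then have "y (q k) $ j \<noteq> 0" by auto
            then show ?case using w_eq[OF jZ(3), of "q k"] Z(2)[OF jZ(1)] by (simp add: power_divide)
          qed
          ultimately have "(\<lambda>k. (\<rho> k)\<^sup>2 * w (q k) $ j) \<longlonglongrightarrow> 0"
            using Z(3)[OF jZ(1)] by (simp add: tendsto_cong)
          then show ?thesis using tendsto_mult_right_zero by blast
        qed
      qed
      then show "(\<lambda>k. (\<rho> k)\<^sup>2 * (\<Sum>i\<in>F - D. z $ i * w (q k) $ i)) \<longlonglongrightarrow> 0"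
        by (simp add: sum_distrib_left mult.left_commute)
    qed
  next
    case False
    \<comment> \<open>Only the coordinate in \<open>Z\<close> survives in \<open>\<xi>\<close>, so
      within \<open>F\<close> the vector \<open>v\<close> is supported there. The others are
      normalized again on \<open>F'\<close>, and a multiple of \<open>v\<close> makes the new limit
      vector vanish at \<open>j\<close> without changing it on \<open>F'\<close>.\<close>
    obtain j where j: "\<xi> $ j \<noteq> 0" using q(5) by (auto simp: vec_eq_iff)
    then have "j \<in> F" using v(2) by (auto simp: res_nth split: if_splits)
    then have jZ: "j \<in> Z" using False j by (auto simp: F'_def)
    then have Ze: "Z = {j}" using Z(1) by auto
    have vj: "v $ j \<noteq> 0" "\<And>i. i \<in> F' \<Longrightarrow> v $ i = 0"
      using j False v(2) by (auto simp: res_nth F'_def split: if_splits)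
    from normalize[OF \<open>i \<in> F'\<close> \<open>F' \<subseteq> F\<close>] obtain q \<rho> \<zeta> where "strict_mono q \<and> (\<forall>k. \<rho> k \<noteq> (0::complex)) \<and> \<rho> \<longlonglongrightarrow> 0 \<and> \<zeta> \<in> res F' ` V \<and> \<zeta> \<noteq> 0
      \<and> (\<forall>i\<in>F'. (\<lambda>k. y (q k) $ i / \<rho> k) \<longlonglongrightarrow> \<zeta> $ i)" by (elim exE)
    then have q': "strict_mono q" "\<And>k. \<rho> k \<noteq> (0::complex)" "\<rho> \<longlonglongrightarrow> 0" "\<zeta> \<in> res F' ` V" "\<zeta> \<noteq> 0"
      "\<And>i. i \<in> F' \<Longrightarrow> (\<lambda>k. y (q k) $ i / \<rho> k) \<longlonglongrightarrow> \<zeta> $ i"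
      by blast+
    obtain u where u: "u \<in> V" "\<zeta> = res F' u" using q'(4) by blast
    define D where "D = {j. \<zeta> $ j \<noteq> 0}"
    show False
    proof (rule key[OF q'(1-3,6), of D "u - (u $ j / v $ j) *s v" "F - D"])
      show "D \<noteq> {}" using q'(5) by (auto simp: D_def vec_eq_iff)
      show "D \<subseteq> F'" unfolding D_def u(2) by (auto simp: res_nth split: if_splits)
      then show "res D (u - (u $ j / v $ j) *s v) = res D \<zeta>"
        using vj(2) by (auto simp: vec_eq_iff res_nth u(2))
      show "u - (u $ j / v $ j) *s v \<in> V"
        using V u(1) v(1) by (intro vec.subspace_diff vec.subspace_scale)
      show "\<zeta> $ i \<noteq> 0" if "i \<in> D" for i using that by (simp add: D_def)
      show "(u - (u $ j / v $ j) *s v) $ i = 0" if "i \<in> F - D" for i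
      proof (cases "i = j")
        case True then show ?thesis using vj(1) by simp
      next
        case False
        then have "i \<in> F'" using that Ze by (auto simp: F'_def)
        then show ?thesis using that vj(2) u(2) by (auto simp: D_def res_nth)
      qed
    qed auto
  qed
qed

text \<open>Since \<open>y\<close> is bounded along a subsequence, it has a limit there, and
  \<open>limit_nonzero\<close> lets each equation at an element of \<open>B - Z\<close> be solved
  for \<open>w_i\<close> in the limit. The coordinate in \<open>Z\<close> is not controlled by its
  equation; orthogonality to a vector that is nonzero there expresses it through the others.\<close>

lemma convergent_subsequence:
  "\<exists>r y0 w0. strict_mono r \<and> (y \<circ> r) \<longlonglongrightarrow> y0 \<and> (w \<circ> r) \<longlonglongrightarrow> w0"
proof -
  have "\<exists>C. \<forall>N. \<exists>k\<ge>N. norm (y k) < C"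
    using not_norm_y_at_top unfolding filterlim_at_top eventually_sequentially by (meson not_le)
  then obtain C where C: "\<forall>N. \<exists>k\<ge>N. norm (y k) < C" by blast
  then have "infinite {k. norm (y k) < C}" unfolding infinite_nat_iff_unbounded_le by auto
  then obtain r0 :: "nat \<Rightarrow> nat" where r0: "strict_mono r0" "\<And>k. norm (y (r0 k)) < C"
    using infinite_enumerate by blast
  have "bounded (range (y \<circ> r0))" using r0(2) by (intro boundedI[of _ C]) (auto intro: less_imp_le)
  then obtain y0 r1 where r1: "strict_mono r1" "((y \<circ> r0) \<circ> r1) \<longlonglongrightarrow> y0"
    using bounded_imp_convergent_subsequence by blast
  define r where "r = r0 \<circ> r1"
  have r: "strict_mono r" unfolding r_def using r0(1) r1(1) by (rule strict_mono_o)
  have yr: "(y \<circ> r) \<longlonglongrightarrow> y0" using r1(2) by (simp add: r_def comp_assoc)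
  interpret S: solution_sequence B V a s "ak \<circ> r" "sk \<circ> r" "y \<circ> r" "w \<circ> r" Z e by (rule subseq[OF r])
  have yc: "(\<lambda>k. y (r k) $ i) \<longlonglongrightarrow> y0 $ i" and ac: "(\<lambda>k. ak (r k) $ i) \<longlonglongrightarrow> a $ i"
    and sc: "(\<lambda>k. sk (r k) $ i) \<longlonglongrightarrow> s $ i" for i
    using tendsto_vec_nth[OF yr, of i] tendsto_vec_nth[OF S.ak, of i] tendsto_vec_nth[OF S.sk, of i]
    by (simp_all add: o_def)
  have conv: "convergent (\<lambda>k. w (r k) $ i)" if "i \<notin> Z" for i
  proof (cases "i \<in> B")
    case True
    then have nz: "y0 $ i \<noteq> 0" using S.limit_nonzero[OF yr] that by blast
    have "(\<lambda>k. (sk (r k) $ i - ak (r k) $ i * y (r k) $ i) / (y (r k) $ i)\<^sup>2)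
        \<longlonglongrightarrow> (s $ i - a $ i * y0 $ i) / (y0 $ i)\<^sup>2"
      using nz by (intro tendsto_intros yc ac sc) auto
    moreover have "\<forall>\<^sub>F k in sequentially. (sk (r k) $ i - ak (r k) $ i * y (r k) $ i) / (y (r k) $ i)\<^sup>2 = w (r k) $ i"
      using tendsto_imp_eventually_ne[OF yc nz] by eventually_elim (use w_eq[OF True] in auto)
    ultimately have "(\<lambda>k. w (r k) $ i) \<longlonglongrightarrow> (s $ i - a $ i * y0 $ i) / (y0 $ i)\<^sup>2"
      by (simp add: tendsto_cong)
    then show ?thesis by (rule convergentI)
  next
    case False
    have "w (r k) $ i = sk (r k) $ i" for k
      using arg_cong[OF yw(3)[of "r k"], of "\<lambda>v. v $ i"] False by (simp add: phi_def)
    then show ?thesis using sc[of i] by (auto simp: convergent_def)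
  qed
  have "convergent (\<lambda>k. w (r k) $ i)" if iZ: "i \<in> Z" for i
  proof -
    obtain v where v: "v \<in> V" "v $ i \<noteq> 0" using Z(4)[OF iZ] by blast
    have other: "j \<notin> Z" if "j \<noteq> i" for j using Z(1) iZ that by auto
    have "w (r k) $ i = (\<Sum>j\<in>UNIV - {i}. (- v $ j / v $ i) * w (r k) $ j)" for k
    proof -
      have "0 = v $ i * w (r k) $ i + (\<Sum>j\<in>UNIV - {i}. v $ j * w (r k) $ j)"
        using bil0[OF v(1), of "r k"] by (subst (asm) sum.remove[of _ i]) auto
      then have "v $ i * w (r k) $ i = - (\<Sum>j\<in>UNIV - {i}. v $ j * w (r k) $ j)"
        by (simp add: eq_neg_iff_add_eq_0)
      then have "w (r k) $ i = - (\<Sum>j\<in>UNIV - {i}. v $ j * w (r k) $ j) / v $ i"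
        using v(2) by (simp add: field_simps)
      then show ?thesis by (simp add: sum_negf sum_divide_distrib)
    qed
    moreover have "convergent (\<lambda>k. \<Sum>j\<in>UNIV - {i}. (- v $ j / v $ i) * w (r k) $ j)"
      by (intro convergent_sum convergent_mult convergent_const conv other) auto
    ultimately show ?thesis by simp
  qed
  then have "\<forall>i. \<exists>l. (\<lambda>k. w (r k) $ i) \<longlonglongrightarrow> l" using conv by (auto simp: convergent_def)
  from choice[OF this] obtain l where "\<forall>i. (\<lambda>k. w (r k) $ i) \<longlonglongrightarrow> l i" ..
  then have "(w \<circ> r) \<longlonglongrightarrow> (\<chi> i. l i)" by (intro vec_tendstoI) (simp add: o_def)
  then show ?thesis using r yr by blast
qed

end

section \<open>Local constancy of solution counts in a parameter\<close>

lemma has_derivative_vecI: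
  fixes f :: "'a::real_normed_vector \<Rightarrow> complex^'n"
  assumes "\<And>i. ((\<lambda>x. f x $ i) has_derivative (\<lambda>h. f' h $ i)) (at a)"
  shows "(f has_derivative f') (at a)"
proof (subst has_derivative_componentwise_within, rule ballI)
  fix b :: "complex^'n" assume "b \<in> Basis"
  then obtain i u where b: "b = axis i u" by (auto simp: Basis_vec_def)
  show "((\<lambda>x. f x \<bullet> b) has_derivative (\<lambda>x. f' x \<bullet> b)) (at a)"
    unfolding b inner_axis by (rule has_derivative_inner_left[OF assms])
qed

lemma bounded_linear_matrix_fst_nth:
  fixes M :: "complex^'n^'m"
  shows "bounded_linear (\<lambda>p :: (complex^'n) \<times> complex. (M *v fst p) $ i)"
proof -
  have "linear (\<lambda>p :: (complex^'n) \<times> complex. (M *v fst p) $ i)"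
    by (rule linearI)
      (simp_all add: matrix_vector_mult_def algebra_simps sum.distrib scaleR_sum_right)
  then show ?thesis by (simp add: linear_conv_bounded_linear)
qed

lemmas has_derivative_matrix_fst_nth =
  bounded_linear_imp_has_derivative[OF bounded_linear_matrix_fst_nth]

lemma continuous_on_matrix_fst_nth:
  fixes M :: "complex^'n^'m"
  shows "continuous_on S (\<lambda>p :: (complex^'n) \<times> complex. (M *v fst p) $ i)"
  by (rule linear_continuous_on[OF bounded_linear_matrix_fst_nth])

lemma tendsto_matrix: "(f \<longlongrightarrow> l) F \<Longrightarrow> ((\<lambda>k. M *v (f k :: complex^'n)) \<longlongrightarrow> M *v l) F"
  unfolding matrix_vector_mult_def by (intro tendsto_intros)

text \<open>The parameter \<open>t\<close> is carried along as a coordinate of source and target, so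
  the fibre over \<open>(s, t)\<close> is \<open>S s t\<close>, and a kernel vector of the
  differential has no \<open>t\<close> component; nondegeneracy at fixed \<open>t\<close> suffices.
  The map \<open>m\<close>, the identity at \<open>t = 1\<close>, covers moving weights
  (\<open>E = 0\<close>) as well as the rescaling of the deletion-contraction step;
  \<open>Om\<close> selects part of the solutions.\<close>

theorem solution_count_locally_constant:
  fixes V :: "(complex^'n) set" and E :: "complex^'n^'n" and c0 c1 :: "complex^'n" and B :: "'n set"
    and Om :: "((complex^'n) \<times> (complex^'n) \<times> complex) set"
  assumes V: "vec.subspace V" and Om: "open Om"
  defines "m y t \<equiv> y + (t - 1) *s (E *v y)"
  defines "S s t \<equiv> {(y, w). y \<in> V \<and> w \<in> orth V \<and> (y, w, t) \<in> Om \<and> phi B (c0 + t *s c1) (m y t) w = s}"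
  assumes nondegenerate: "\<And>y w dy dw. (y, w) \<in> S s0 t0 \<Longrightarrow> dy \<in> V \<Longrightarrow> dw \<in> orth V \<Longrightarrow>
      (\<And>i. i \<in> B \<Longrightarrow> ((c0 + t0 *s c1) $ i + 2 * m y t0 $ i * w $ i) * m dy t0 $ i + (m y t0 $ i)\<^sup>2 * dw $ i = 0) \<Longrightarrow>
      (\<And>i. i \<notin> B \<Longrightarrow> dw $ i = 0) \<Longrightarrow> dy = 0 \<and> dw = 0"
  assumes proper: "\<And>y w t. (\<And>k. y k \<in> V) \<Longrightarrow> (\<And>k. w k \<in> orth V) \<Longrightarrow> (\<And>k. (y k, w k, t k) \<in> Om) \<Longrightarrow>
      (\<lambda>k. phi B (c0 + t k *s c1) (m (y k) (t k)) (w k)) \<longlonglongrightarrow> s0 \<Longrightarrow> t \<longlonglongrightarrow> t0 \<Longrightarrow>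
      \<exists>r y0 w0. strict_mono (r :: nat \<Rightarrow> nat) \<and> (y \<circ> r) \<longlonglongrightarrow> y0 \<and> (w \<circ> r) \<longlonglongrightarrow> w0 \<and> (y0, w0, t0) \<in> Om"
  shows "finite (S s0 t0) \<and> (\<exists>W. open W \<and> (s0, t0) \<in> W \<and>
    (\<forall>(s, t)\<in>W. finite (S s t) \<and> card (S s t) = card (S s0 t0)))"
proof -
  obtain A M C D :: "complex^'n^'n" where AM: "bij_betw (\<lambda>z. (A *v z, M *v z)) UNIV (V \<times> orth V)"
    and inv0: "\<forall>z. C *v (A *v z) + D *v (M *v z) = z"
    by (rule subspace_pair_parametrization[OF V])
  have inv: "C *v (A *v z) + D *v (M *v z) = z" for z using inv0 ..
  have AV: "A *v z \<in> V" "M *v z \<in> orth V" for z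
    using bij_betwE[OF AM] by auto
  have m_nth: "m y t $ i = y $ i + (t - 1) * (E *v y) $ i" for y t i
    by (simp only: m_def vector_add_component vector_smult_component)
  define f where "f p = (phi B (c0 + snd p *s c1) (m (A *v fst p) (snd p)) (M *v fst p), snd p)" for p
  define \<Omega> where "\<Omega> = {p. (A *v fst p, M *v fst p, snd p) \<in> Om}"
  define f' where "f' p h = ((\<chi> i. if i \<in> B
      then snd h * c1 $ i * m (A *v fst p) (snd p) $ i
        + ((c0 + snd p *s c1) $ i + 2 * m (A *v fst p) (snd p) $ i * (M *v fst p) $ i)
            * (m (A *v fst h) (snd p) $ i + snd h * (E *v (A *v fst p)) $ i)
        + (m (A *v fst p) (snd p) $ i)\<^sup>2 * (M *v fst h) $ i
      else (M *v fst h) $ i), snd h)" for p h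
  have "continuous_on UNIV (\<lambda>p. (A *v fst p, M *v fst p, snd p))"
    unfolding matrix_vector_mult_def by (intro continuous_intros)
  from open_vimage[OF Om this] have "open \<Omega>" by (simp add: \<Omega>_def vimage_def)
  have der: "(f has_derivative f' p) (at p)" for p
    unfolding f_def f'_def
  proof (rule has_derivative_Pair[OF has_derivative_vecI])
    fix i
    show "((\<lambda>p. phi B (c0 + snd p *s c1) (m (A *v fst p) (snd p)) (M *v fst p) $ i) has_derivative
        (\<lambda>h. (\<chi> i. if i \<in> B
          then snd h * c1 $ i * m (A *v fst p) (snd p) $ i
            + ((c0 + snd p *s c1) $ i + 2 * m (A *v fst p) (snd p) $ i * (M *v fst p) $ i)
                * (m (A *v fst h) (snd p) $ i + snd h * (E *v (A *v fst p)) $ i)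
            + (m (A *v fst p) (snd p) $ i)\<^sup>2 * (M *v fst h) $ i
          else (M *v fst h) $ i) $ i)) (at p)"
    proof (cases "i \<in> B")
      case True
      have "((\<lambda>p. (c0 $ i + snd p * c1 $ i) * ((A *v fst p) $ i + (snd p - 1) * ((E ** A) *v fst p) $ i)
          + ((A *v fst p) $ i + (snd p - 1) * ((E ** A) *v fst p) $ i)\<^sup>2 * (M *v fst p) $ i) has_derivative
        (\<lambda>h. snd h * c1 $ i * ((A *v fst p) $ i + (snd p - 1) * ((E ** A) *v fst p) $ i)
            + (c0 $ i + snd p * c1 $ i + 2 * ((A *v fst p) $ i + (snd p - 1) * ((E ** A) *v fst p) $ i) * (M *v fst p) $ i)
                * ((A *v fst h) $ i + (snd p - 1) * ((E ** A) *v fst h) $ i + snd h * ((E ** A) *v fst p) $ i)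
            + ((A *v fst p) $ i + (snd p - 1) * ((E ** A) *v fst p) $ i)\<^sup>2 * (M *v fst h) $ i)) (at p)"
        by (rule has_derivative_eq_rhs, (rule derivative_intros has_derivative_matrix_fst_nth)+)
          (simp add: fun_eq_iff power2_eq_square algebra_simps)
      then show ?thesis using True by (simp add: phi_def m_nth matrix_vector_mul_assoc)
    next
      case False
      then show ?thesis using has_derivative_matrix_fst_nth[of M i] by (simp add: phi_def)
    qed
  qed (auto intro!: derivative_intros)
  have cont: "continuous_on \<Omega> (\<lambda>p. f' p h)" for h
  proof -
    have "continuous_on \<Omega> (\<lambda>p. if i \<in> B
      then snd h * c1 $ i * m (A *v fst p) (snd p) $ i
        + ((c0 + snd p *s c1) $ i + 2 * m (A *v fst p) (snd p) $ i * (M *v fst p) $ i)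
            * (m (A *v fst h) (snd p) $ i + snd h * (E *v (A *v fst p)) $ i)
        + (m (A *v fst p) (snd p) $ i)\<^sup>2 * (M *v fst h) $ i
      else (M *v fst h) $ i)" for i
      by (cases "i \<in> B")
        (auto simp: m_nth matrix_vector_mul_assoc intro!: continuous_intros continuous_on_matrix_fst_nth)
    then show ?thesis unfolding f'_def by (intro continuous_intros)
  qed
  have fibre: "bij_betw (\<lambda>p. (A *v fst p, M *v fst p)) {p\<in>\<Omega>. f p = (s, t)} (S s t)" for s t
  proof (rule bij_betw_imageI)
    show "inj_on (\<lambda>p. (A *v fst p, M *v fst p)) {p\<in>\<Omega>. f p = (s, t)}"
    proof (rule inj_onI)
      fix p q assume pq: "p \<in> {p\<in>\<Omega>. f p = (s, t)}" "q \<in> {p\<in>\<Omega>. f p = (s, t)}"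
        and eq: "(A *v fst p, M *v fst p) = (A *v fst q, M *v fst q)"
      from eq have eq': "A *v fst p = A *v fst q" "M *v fst p = M *v fst q" by (simp_all only: prod.inject)
      have "fst p = C *v (A *v fst p) + D *v (M *v fst p)" by (rule inv[symmetric])
      also have "\<dots> = fst q" unfolding eq' by (rule inv)
      finally have "fst p = fst q" .
      moreover have "snd p = snd q" using pq by (auto simp: f_def)
      ultimately show "p = q" by (rule prod_eqI)
    qed
    show "(\<lambda>p. (A *v fst p, M *v fst p)) ` {p\<in>\<Omega>. f p = (s, t)} = S s t"
    proof (intro equalityI subsetI)
      fix x assume "x \<in> (\<lambda>p. (A *v fst p, M *v fst p)) ` {p\<in>\<Omega>. f p = (s, t)}"
      then show "x \<in> S s t" using AV by (auto simp: S_def \<Omega>_def f_def)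
    next
      fix x assume x: "x \<in> S s t"
      then have "x \<in> V \<times> orth V" by (auto simp: S_def)
      then obtain z where z: "x = (A *v z, M *v z)" using AM by (auto simp: bij_betw_def)
      have "(z, t) \<in> {p\<in>\<Omega>. f p = (s, t)}" using x by (simp add: S_def z \<Omega>_def f_def)
      then show "x \<in> (\<lambda>p. (A *v fst p, M *v fst p)) ` {p\<in>\<Omega>. f p = (s, t)}"
        unfolding z by (intro image_eqI[of _ _ "(z, t)"]) auto
    qed
  qed
  have inj: "inj (f' p)" if p: "p \<in> \<Omega>" "f p = (s0, t0)" for p
  proof -
    have "linear (f' p)" using der[of p] has_derivative_bounded_linear bounded_linear.linear by blast
    moreover have "h = 0" if h: "f' p h = 0" for h
    proof -
      have h2: "snd h = 0" using h by (simp add: f'_def zero_prod_def)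
      have t: "snd p = t0" using p(2) by (simp add: f_def)
      have comp: "(if i \<in> B then ((c0 + t0 *s c1) $ i + 2 * m (A *v fst p) t0 $ i * (M *v fst p) $ i)
            * m (A *v fst h) t0 $ i + (m (A *v fst p) t0 $ i)\<^sup>2 * (M *v fst h) $ i
          else (M *v fst h) $ i) = 0" for i
        using arg_cong[OF h, of "\<lambda>q. fst q $ i"] by (simp add: f'_def t h2 split: if_splits)
      have "(A *v fst p, M *v fst p) \<in> S s0 t0" using bij_betwE[OF fibre] p by blast
      then have "A *v fst h = 0 \<and> M *v fst h = 0"
      proof (rule nondegenerate[OF _ AV])
        fix i
        show "((c0 + t0 *s c1) $ i + 2 * m (A *v fst p) t0 $ i * (M *v fst p) $ i)
            * m (A *v fst h) t0 $ i + (m (A *v fst p) t0 $ i)\<^sup>2 * (M *v fst h) $ i = 0" if "i \<in> B"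
          using comp[of i] that by simp
        show "(M *v fst h) $ i = 0" if "i \<notin> B" using comp[of i] that by simp
      qed
      then have "fst h = 0" using inv[of "fst h"] by simp
      then show "h = 0" using h2 by (simp add: prod_eq_iff)
    qed
    ultimately show ?thesis by (simp add: linear_injective_0)
  qed
  have subconv: "\<exists>l\<in>\<Omega>. \<exists>r. strict_mono r \<and> (X \<circ> r) \<longlonglongrightarrow> l"
    if X: "\<And>k. X k \<in> \<Omega>" "(\<lambda>k. f (X k)) \<longlonglongrightarrow> (s0, t0)" for X
  proof -
    have lim1: "(\<lambda>k. phi B (c0 + snd (X k) *s c1) (m (A *v fst (X k)) (snd (X k))) (M *v fst (X k))) \<longlonglongrightarrow> s0"
      using tendsto_fst[OF X(2)] by (simp add: f_def)
    have lim2: "(\<lambda>k. snd (X k)) \<longlonglongrightarrow> t0" using tendsto_snd[OF X(2)] by (simp add: f_def)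
    have mem3: "(A *v fst (X k), M *v fst (X k), snd (X k)) \<in> Om" for k using X(1) by (simp add: \<Omega>_def)
    obtain r y0 w0 where r: "strict_mono (r :: nat \<Rightarrow> nat)" "((\<lambda>k. A *v fst (X k)) \<circ> r) \<longlonglongrightarrow> y0"
      "((\<lambda>k. M *v fst (X k)) \<circ> r) \<longlonglongrightarrow> w0" "(y0, w0, t0) \<in> Om"
      using proper[OF AV mem3 lim1 lim2] by blast
    have "(\<lambda>k. C *v (A *v fst (X (r k))) + D *v (M *v fst (X (r k)))) \<longlonglongrightarrow> C *v y0 + D *v w0"
      using r(2,3) by (intro tendsto_add tendsto_matrix) (simp_all add: o_def)
    then have z: "(\<lambda>k. fst (X (r k))) \<longlonglongrightarrow> C *v y0 + D *v w0" by (simp only: inv)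
    have "(\<lambda>k. A *v fst (X (r k))) \<longlonglongrightarrow> A *v (C *v y0 + D *v w0)"
      "(\<lambda>k. M *v fst (X (r k))) \<longlonglongrightarrow> M *v (C *v y0 + D *v w0)" using z by (rule tendsto_matrix)+
    then have "A *v (C *v y0 + D *v w0) = y0" "M *v (C *v y0 + D *v w0) = w0"
      using r(2,3) LIMSEQ_unique by (auto simp: o_def)
    then have "(C *v y0 + D *v w0, t0) \<in> \<Omega>" using r(4) by (simp add: \<Omega>_def)
    moreover have "(\<lambda>k. snd (X (r k))) \<longlonglongrightarrow> t0" using LIMSEQ_subseq_LIMSEQ[OF lim2 r(1)] by (simp add: o_def)
    then have "(\<lambda>k. (fst (X (r k)), snd (X (r k)))) \<longlonglongrightarrow> (C *v y0 + D *v w0, t0)"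
      using z by (intro tendsto_Pair)
    then have "(X \<circ> r) \<longlonglongrightarrow> (C *v y0 + D *v w0, t0)" by (simp add: o_def)
    ultimately show ?thesis using r(1) by blast
  qed
  have card: "finite (S s t) \<longleftrightarrow> finite {p\<in>\<Omega>. f p = (s, t)}" "card (S s t) = card {p\<in>\<Omega>. f p = (s, t)}" for s t
    using bij_betw_finite[OF fibre] bij_betw_same_card[OF fibre] by simp_all
  note main = fibre_card_locally_constant[OF \<open>open \<Omega>\<close> der cont inj subconv]
  show ?thesis unfolding card using main(1) main(2) by (simp add: case_prod_beta)
qed

section \<open>The generic number of solutions\<close>

definition cvec :: "real^'n \<Rightarrow> complex^'n" where
  "cvec \<alpha> = (\<chi> i. complex_of_real (\<alpha> $ i))"

text \<open>Nonnegative reals cannot cancel, so the sums over supports are positive and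
  \<open>admissible\<close> holds; the condition survives convex combinations, which joins any two
  choices by a segment.\<close>

definition weights :: "(complex^'n) set \<Rightarrow> real^'n \<Rightarrow> bool" where
  "weights V \<alpha> \<longleftrightarrow> (\<forall>i. 0 \<le> \<alpha> $ i) \<and> (\<forall>v\<in>V. v \<noteq> 0 \<longrightarrow> (\<exists>i\<in>supp v. 0 < \<alpha> $ i))"

definition supported :: "'n set \<Rightarrow> (complex^'n) set \<Rightarrow> bool" where
  "supported B V \<longleftrightarrow> vec.subspace V \<and> (\<forall>v\<in>V. \<forall>i. i \<notin> B \<longrightarrow> v $ i = 0)"

definition loopless :: "'n set \<Rightarrow> (complex^'n) set \<Rightarrow> bool" where
  "loopless B V \<longleftrightarrow> (\<forall>i\<in>B. \<exists>v\<in>V. v $ i \<noteq> 0)"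

text \<open>Nondegeneracy is part of the notion because it later gives every critical point
  multiplicity one.\<close>

definition gcount :: "'n set \<Rightarrow> (complex^'n) set \<Rightarrow> complex^'n \<Rightarrow> nat \<Rightarrow> bool" where
  "gcount B V a d \<longleftrightarrow> generic (\<lambda>s. finite (sol B V a s) \<and> card (sol B V a s) = d
     \<and> (\<forall>(y, w)\<in>sol B V a s. nondeg B V a y w))"

text \<open>Conditions on a single \<open>s\<close> under which, for admissible weights, the count
  is locally constant near \<open>s\<close>, also when the weights move.\<close>

definition good :: "'n set \<Rightarrow> (complex^'n) set \<Rightarrow> complex^'n \<Rightarrow> complex^'n \<Rightarrow> bool" where
  "good B V a s \<longleftrightarrow> no_degeneration V {} s \<and> (\<forall>i\<in>B. s $ i \<noteq> 0) \<and> (\<forall>(y, w)\<in>sol B V a s. nondeg B V a y w)"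

lemma gcount_unique: "gcount B V a d \<Longrightarrow> gcount B V a d' \<Longrightarrow> d = d'"
proof -
  assume "gcount B V a d" "gcount B V a d'"
  then have "generic (\<lambda>s. (finite (sol B V a s) \<and> card (sol B V a s) = d
     \<and> (\<forall>(y, w)\<in>sol B V a s. nondeg B V a y w)) \<and> (finite (sol B V a s) \<and> card (sol B V a s) = d'
     \<and> (\<forall>(y, w)\<in>sol B V a s. nondeg B V a y w)))"
    unfolding gcount_def by (rule generic_conj)
  then obtain s where "card (sol B V a s) = d" "card (sol B V a s) = d'"
    by (rule generic_dense[OF _ open_UNIV UNIV_I]) blast
  then show ?thesis by simp
qed

lemma sum_cvec_nonzero:
  assumes "0 < (\<Sum>i\<in>A. \<alpha> $ i)" shows "(\<Sum>i\<in>A. cvec \<alpha> $ i) \<noteq> 0"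
proof -
  have "(\<Sum>i\<in>A. cvec \<alpha> $ i) = complex_of_real (\<Sum>i\<in>A. \<alpha> $ i)" by (simp add: cvec_def)
  then show ?thesis using assms by (simp only: of_real_eq_0_iff)
qed

lemma weights_admissible:
  assumes "weights V \<alpha>" shows "admissible V (cvec \<alpha>)"
  unfolding admissible_def
proof (intro ballI impI)
  fix v assume v: "v \<in> V" "v \<noteq> 0"
  obtain i where i: "i \<in> supp v" "0 < \<alpha> $ i" using assms v unfolding weights_def by blast
  have "0 < (\<Sum>i\<in>supp v. \<alpha> $ i)"
    using assms i by (intro sum_pos2[of _ i "\<lambda>i. \<alpha> $ i"]) (auto simp: weights_def)
  then show "(\<Sum>i\<in>supp v. cvec \<alpha> $ i) \<noteq> 0" by (rule sum_cvec_nonzero)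
qed

lemma nowhere_zero_vector:
  fixes V :: "(complex^'n) set"
  assumes V: "vec.subspace V" and "loopless B V"
  obtains b where "b \<in> V" "\<forall>i\<in>B. b $ i \<noteq> 0"
proof -
  obtain A M C D :: "complex^'n^'n" where AM: "bij_betw (\<lambda>z. (A *v z, M *v z)) UNIV (V \<times> orth V)"
    by (rule subspace_pair_parametrization[OF V])
  have AV: "A *v z \<in> V" for z using bij_betwE[OF AM] by auto
  have "generic (\<lambda>z. \<forall>i\<in>B. (A *v z) $ i \<noteq> 0)"
  proof (rule generic_all_finite)
    fix i assume "i \<in> B"
    then obtain v where v: "v \<in> V" "v $ i \<noteq> 0" using assms(2) by (auto simp: loopless_def)
    have "(v, 0) \<in> V \<times> orth V" using v by (simp add: orth_def bil_zero)
    then have "(v, 0) \<in> range (\<lambda>z. (A *v z, M *v z))" using AM by (simp add: bij_betw_def)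
    then obtain z where "v = A *v z" by auto
    then show "generic (\<lambda>z. (A *v z) $ i \<noteq> 0)"
      using v(2) by (intro genericI[OF vpoly_matrix[of A i], of z]) auto
  qed simp
  then obtain z where "\<forall>i\<in>B. (A *v z) $ i \<noteq> 0" by (rule generic_dense[OF _ open_UNIV UNIV_I])
  then show thesis using that[of "A *v z"] AV by blast
qed

text \<open>Induction on the dimension: with \<open>y'\<close> as required for the hyperplane section \<open>v\<^sub>j = 0\<close> and
  \<open>b\<close> nowhere zero, the form at \<open>y' + \<epsilon> b\<close> becomes block diagonal as \<open>\<epsilon> \<longrightarrow> 0\<close> after rescaling
  the direction \<open>b\<close> by \<open>\<epsilon>\<close>, with positive second block.\<close>

lemma nondegenerate_form:
  fixes V :: "(complex^'n) set"
  assumes "supported B V" "loopless B V" "weights V \<alpha>"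
  shows "\<exists>y\<in>V. (\<forall>i\<in>B. y $ i \<noteq> 0) \<and>
    (\<forall>u\<in>V. (\<forall>v\<in>V. (\<Sum>i\<in>B. cvec \<alpha> $ i * u $ i * v $ i / (y $ i)\<^sup>2) = 0) \<longrightarrow> u = 0)"
  using assms
proof (induction "vec.dim V" arbitrary: V B rule: less_induct)
  case less
  have V: "vec.subspace V" and VB: "\<And>v i. v \<in> V \<Longrightarrow> i \<notin> B \<Longrightarrow> v $ i = 0"
    using less.prems(1) by (auto simp: supported_def)
  obtain b where b0: "b \<in> V" "\<forall>i\<in>B. b $ i \<noteq> 0"
    by (rule nowhere_zero_vector[OF V less.prems(2)])
  then have b: "b \<in> V" "\<And>i. i \<in> B \<Longrightarrow> b $ i \<noteq> 0" by simp_all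
  show ?case
  proof (cases "V = {0}")
    case True
    then show ?thesis using b by (intro bexI[of _ b]) auto
  next
    case False
    then obtain v0 where "v0 \<in> V" "v0 \<noteq> 0" using V vec.subspace_0 by blast
    \<comment> \<open>Positivity of the weight at \<open>j\<close>, a coordinate that vanishes on
      \<open>V'\<close>, makes the sum of \<open>\<alpha>\<close> over \<open>B - B'\<close>
      positive; this sum is the block belonging to \<open>b\<close>.\<close>
    then obtain j where j: "0 < \<alpha> $ j" "j \<in> supp v0" using less.prems(3) by (auto simp: weights_def)
    have jB: "j \<in> B" using j(2) VB[OF \<open>v0 \<in> V\<close>] by (auto simp: supp_def)
    have bj: "b $ j \<noteq> 0" using b(2) jB by blast
    define V' where "V' = {v\<in>V. v $ j = 0}"
    define B' where "B' = {i\<in>B. \<exists>v\<in>V'. v $ i \<noteq> 0}"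
    have V': "vec.subspace V'" using V unfolding V'_def vec.subspace_def by auto
    have "V' \<subset> V" using bj b(1) by (auto simp: V'_def)
    then have "vec.dim V' < vec.dim V"
      using V V' by (intro vec.dim_psubset) (simp add: vec.span_eq_iff[THEN iffD2])
    moreover have "supported B' V'"
      using V' VB by (auto simp: supported_def B'_def V'_def)
    moreover have "loopless B' V'" by (auto simp: loopless_def B'_def)
    moreover have "weights V' \<alpha>" using less.prems(3) by (auto simp: weights_def V'_def)
    ultimately obtain y' where y': "y' \<in> V'" "\<And>i. i \<in> B' \<Longrightarrow> y' $ i \<noteq> 0"
      and form': "\<And>u. u \<in> V' \<Longrightarrow> (\<And>v. v \<in> V' \<Longrightarrow> (\<Sum>i\<in>B'. cvec \<alpha> $ i * u $ i * v $ i / (y' $ i)\<^sup>2) = 0) \<Longrightarrow> u = 0"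
      using less.hyps[of V' B'] by blast
    have V'0: "v $ i = 0" if "v \<in> V'" "i \<notin> B'" for v i
      using that VB by (auto simp: B'_def V'_def)
    define \<epsilon> where "\<epsilon> k = complex_of_real (inverse (real (Suc k)))" for k
    have \<epsilon>: "\<epsilon> \<longlonglongrightarrow> 0"
      unfolding \<epsilon>_def using tendsto_of_real[OF LIMSEQ_inverse_real_of_nat, where 'a=complex] by (simp only: of_real_0)
    have \<epsilon>nz: "\<epsilon> k \<noteq> 0" for k by (simp add: \<epsilon>_def del: of_nat_Suc)
    define y where "y k = y' + \<epsilon> k *s b" for k
    have yV: "y k \<in> V" for k
      unfolding y_def using V y'(1) b(1) by (intro vec.subspace_add vec.subspace_scale) (auto simp: V'_def)
    have ylim: "(\<lambda>k. y k $ i) \<longlonglongrightarrow> y' $ i" for i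
      using tendsto_add[OF tendsto_const tendsto_mult[OF \<epsilon> tendsto_const], of "y' $ i" "b $ i"] by (simp add: y_def)
    have "\<forall>\<^sub>F k in sequentially. \<forall>i\<in>B'. y k $ i \<noteq> 0"
      by (rule eventually_ball_finite) (use tendsto_imp_eventually_ne[OF ylim] y'(2) in auto)
    then obtain K where K: "\<And>k i. k \<ge> K \<Longrightarrow> i \<in> B' \<Longrightarrow> y k $ i \<noteq> 0" by (auto simp: eventually_sequentially)
    have y_eps: "y k $ i = \<epsilon> k * b $ i" if "i \<in> B - B'" for k i
      using V'0[OF y'(1), of i] that by (simp add: y_def)
    have ynz: "y k $ i \<noteq> 0" if "k \<ge> K" "i \<in> B" for k i
      using K[OF that(1)] y_eps[of i k] \<epsilon>nz[of k] b(2) that(2) by (cases "i \<in> B'") auto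
    show ?thesis
    proof (rule ccontr)
      assume contr: "\<not> ?thesis"
      have "\<exists>u\<in>V. u \<noteq> 0 \<and> (\<forall>v\<in>V. (\<Sum>i\<in>B. cvec \<alpha> $ i * u $ i * v $ i / (y (k + K) $ i)\<^sup>2) = 0)" for k
        using contr yV[of "k + K"] ynz[of "k + K"] by auto
      then have "\<forall>k. \<exists>u. u \<in> V \<and> u \<noteq> 0 \<and> (\<forall>v\<in>V. (\<Sum>i\<in>B. cvec \<alpha> $ i * u $ i * v $ i / (y (k + K) $ i)\<^sup>2) = 0)"
        by blast
      from choice[OF this] obtain x where
        "\<forall>k. x k \<in> V \<and> x k \<noteq> 0 \<and> (\<forall>v\<in>V. (\<Sum>i\<in>B. cvec \<alpha> $ i * x k $ i * v $ i / (y (k + K) $ i)\<^sup>2) = 0)" ..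
      then have x: "\<And>k. x k \<in> V" "\<And>k. x k \<noteq> 0"
        "\<And>k v. v \<in> V \<Longrightarrow> (\<Sum>i\<in>B. cvec \<alpha> $ i * x k $ i * v $ i / (y (k + K) $ i)\<^sup>2) = 0" by simp_all
      define e where "e k = \<epsilon> (k + K)" for k
      define c where "c k = x k $ j / b $ j" for k
      \<comment> \<open>\<open>x k\<close> is split into a vector with coordinate \<open>j\<close>
        equal to 0 and a multiple of \<open>b\<close>; dividing the latter by \<open>e k\<close> is
        the rescaling of the direction \<open>b\<close>.\<close>
      define p where "p k = (x k - c k *s b) + (c k / e k) *s b" for k
      have enz: "e k \<noteq> 0" for k using \<epsilon>nz by (simp add: e_def)
      have pV: "p k \<in> V" for k
        unfolding p_def using V x(1) b(1) by (intro vec.subspace_add vec.subspace_diff vec.subspace_scale)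
      have pj: "p k $ j = c k / e k * b $ j" for k using bj by (simp add: p_def c_def)
      have x_p: "x k = (p k - (p k $ j / b $ j) *s b) + (e k * (p k $ j / b $ j)) *s b" for k
        using bj enz[of k] by (simp add: pj vec_eq_iff) (simp add: p_def)
      have pnz: "p k \<noteq> 0" for k
      proof
        assume "p k = 0"
        then show False using x_p[of k] x(2)[of k] by simp
      qed
      obtain r \<xi> where r: "strict_mono r" "\<xi> \<in> V" "\<xi> \<noteq> 0"
        and lim: "(\<lambda>k. inverse (norm (p (r k))) *\<^sub>R p (r k)) \<longlonglongrightarrow> \<xi>"
        by (rule normalized_subsequence[of V p, OF V pV pnz])
      define n where "n k = complex_of_real (norm (p (r k)))" for k
      have nnz: "n k \<noteq> 0" for k using pnz by (simp add: n_def)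
      have plim: "(\<lambda>k. p (r k) $ i / n k) \<longlonglongrightarrow> \<xi> $ i" for i
        using tendsto_vec_nth[OF lim, of i]
        by (simp add: n_def scaleR_conv_of_real[where 'a=complex] divide_inverse mult.commute)
      have elim: "(\<lambda>k. e (r k)) \<longlonglongrightarrow> 0"
      proof -
        have "e \<longlonglongrightarrow> 0" unfolding e_def using \<epsilon> by (rule LIMSEQ_ignore_initial_segment)
        then show ?thesis using LIMSEQ_subseq_LIMSEQ[OF _ r(1)] by (simp add: o_def)
      qed
      have yr: "(\<lambda>k. y (r k + K) $ i) \<longlonglongrightarrow> y' $ i" for i
        using LIMSEQ_subseq_LIMSEQ[OF LIMSEQ_ignore_initial_segment[OF ylim, of K] r(1)] by (simp add: o_def)
      define \<gamma> where "\<gamma> k = p (r k) $ j / n k / b $ j" for k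
      define \<gamma>0 where "\<gamma>0 = \<xi> $ j / b $ j"
      have \<gamma>: "\<gamma> \<longlonglongrightarrow> \<gamma>0"
        unfolding \<gamma>_def \<gamma>0_def using bj by (intro tendsto_divide plim tendsto_const)
      define u where "u = \<xi> - \<gamma>0 *s b"
      have uV': "u \<in> V'"
        using V r(2) b(1) bj by (auto simp: u_def V'_def \<gamma>0_def intro: vec.subspace_diff vec.subspace_scale)
      have xn: "x (r k) $ i / n k = (p (r k) $ i / n k - \<gamma> k * b $ i) + e (r k) * \<gamma> k * b $ i" for k i
        using nnz[of k] by (subst x_p) (simp add: \<gamma>_def field_simps)
      have xlim: "(\<lambda>k. x (r k) $ i / n k) \<longlonglongrightarrow> u $ i" for i
      proof -
        have "(\<lambda>k. (p (r k) $ i / n k - \<gamma> k * b $ i) + e (r k) * \<gamma> k * b $ i)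
            \<longlonglongrightarrow> (\<xi> $ i - \<gamma>0 * b $ i) + 0 * \<gamma>0 * b $ i"
          by (intro tendsto_add tendsto_diff tendsto_mult plim \<gamma> elim tendsto_const)
        then show ?thesis unfolding xn by (simp add: u_def)
      qed
      have x_test: "(\<Sum>i\<in>B. cvec \<alpha> $ i * (x (r k) $ i / n k) * v $ i / (y (r k + K) $ i)\<^sup>2) = 0" if "v \<in> V" for k v
      proof -
        have "(\<Sum>i\<in>B. cvec \<alpha> $ i * (x (r k) $ i / n k) * v $ i / (y (r k + K) $ i)\<^sup>2)
            = (\<Sum>i\<in>B. cvec \<alpha> $ i * x (r k) $ i * v $ i / (y (r k + K) $ i)\<^sup>2) / n k"
          unfolding sum_divide_distrib by (intro sum.cong) (auto simp: field_simps)
        then show ?thesis using x(3)[OF that] by simp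
      qed
      have B'B: "B' \<subseteq> B" by (auto simp: B'_def)
      have lim_B': "(\<lambda>k. \<Sum>i\<in>B'. cvec \<alpha> $ i * (x (r k) $ i / n k) * v $ i / (y (r k + K) $ i)\<^sup>2)
          \<longlonglongrightarrow> (\<Sum>i\<in>B'. cvec \<alpha> $ i * u $ i * v $ i / (y' $ i)\<^sup>2)" for v :: "complex^'n"
        using y'(2) by (intro tendsto_sum tendsto_divide tendsto_mult tendsto_power tendsto_const xlim yr) auto
      \<comment> \<open>Tests against \<open>V'\<close> see only \<open>B'\<close>, where
        \<open>y\<close> tends to the nonzero entries of \<open>y'\<close>, so in the limit
        \<open>u\<close> lies in the radical of the form of the induction hypothesis.\<close>
      have "u = 0"
      proof (rule form'[OF uV'])
        fix v assume v: "v \<in> V'"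
        then have "v \<in> V" by (simp add: V'_def)
        have "(\<Sum>i\<in>B'. cvec \<alpha> $ i * (x (r k) $ i / n k) * v $ i / (y (r k + K) $ i)\<^sup>2) = 0" for k
          unfolding x_test[OF \<open>v \<in> V\<close>, of k, symmetric]
          using V'0[OF v] B'B by (intro sum.mono_neutral_left) auto
        then show "(\<Sum>i\<in>B'. cvec \<alpha> $ i * u $ i * v $ i / (y' $ i)\<^sup>2) = 0"
          using lim_B'[of v] by (simp add: LIMSEQ_const_iff)
      qed
      have rest: "e (r k) * (\<Sum>i\<in>B - B'. cvec \<alpha> $ i * (x (r k) $ i / n k) * b $ i / (y (r k + K) $ i)\<^sup>2)
          = (\<Sum>i\<in>B - B'. cvec \<alpha> $ i * ((p (r k) $ i / n k - \<gamma> k * b $ i) / (e (r k) * b $ i) + \<gamma> k))" for k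
        unfolding sum_distrib_left
      proof (rule sum.cong)
        fix i assume i: "i \<in> B - B'"
        have yi: "y (r k + K) $ i = e (r k) * b $ i" using y_eps[OF i] by (simp add: e_def)
        show "e (r k) * (cvec \<alpha> $ i * (x (r k) $ i / n k) * b $ i / (y (r k + K) $ i)\<^sup>2) =
            cvec \<alpha> $ i * ((p (r k) $ i / n k - \<gamma> k * b $ i) / (e (r k) * b $ i) + \<gamma> k)"
          unfolding yi xn using enz[of "r k"] b(2)[of i] i by (simp add: field_simps power2_eq_square)
      qed simp
      have pB: "p (r k) $ i / n k - \<gamma> k * b $ i = 0" if "i \<in> B - B'" for k i
      proof -
        have "p (r k) - (p (r k) $ j / b $ j) *s b \<in> V'"
          using V pV b(1) bj by (auto simp: V'_def intro: vec.subspace_diff vec.subspace_scale)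
        then have "p (r k) $ i - p (r k) $ j / b $ j * b $ i = 0" using V'0[of _ i] that by fastforce
        then have "(p (r k) $ i - p (r k) $ j / b $ j * b $ i) / n k = 0" by simp
        then show ?thesis by (simp add: \<gamma>_def diff_divide_distrib)
      qed
      \<comment> \<open>The test against \<open>b\<close>, multiplied by \<open>e (r k)\<close>. On
        \<open>B - B'\<close> the normalized \<open>x\<close> is \<open>e \<gamma> b\<close> and
        \<open>y\<close> is \<open>e b\<close>, so all powers of \<open>e\<close> cancel and the
        weights remain; the part on \<open>B'\<close> tends to 0.\<close>
      have "\<gamma> k * (\<Sum>i\<in>B - B'. cvec \<alpha> $ i)
          = - (e (r k) * (\<Sum>i\<in>B'. cvec \<alpha> $ i * (x (r k) $ i / n k) * b $ i / (y (r k + K) $ i)\<^sup>2))" for k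
      proof -
        have "0 = e (r k) * (\<Sum>i\<in>B. cvec \<alpha> $ i * (x (r k) $ i / n k) * b $ i / (y (r k + K) $ i)\<^sup>2)"
          using x_test[OF b(1)] by simp
        also have "\<dots> = e (r k) * (\<Sum>i\<in>B - B'. cvec \<alpha> $ i * (x (r k) $ i / n k) * b $ i / (y (r k + K) $ i)\<^sup>2)
            + e (r k) * (\<Sum>i\<in>B'. cvec \<alpha> $ i * (x (r k) $ i / n k) * b $ i / (y (r k + K) $ i)\<^sup>2)"
          by (subst sum.subset_diff[OF B'B]) (simp_all add: distrib_left)
        also have "e (r k) * (\<Sum>i\<in>B - B'. cvec \<alpha> $ i * (x (r k) $ i / n k) * b $ i / (y (r k + K) $ i)\<^sup>2)
            = \<gamma> k * (\<Sum>i\<in>B - B'. cvec \<alpha> $ i)"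
          unfolding rest sum_distrib_left[of "\<gamma> k"] by (rule sum.cong) (auto simp: pB)
        finally show ?thesis by (simp add: eq_neg_iff_add_eq_0)
      qed
      moreover have "(\<lambda>k. - (e (r k) * (\<Sum>i\<in>B'. cvec \<alpha> $ i * (x (r k) $ i / n k) * b $ i / (y (r k + K) $ i)\<^sup>2)))
          \<longlonglongrightarrow> - (0 * (\<Sum>i\<in>B'. cvec \<alpha> $ i * u $ i * b $ i / (y' $ i)\<^sup>2))"
        by (intro tendsto_minus tendsto_mult elim lim_B')
      ultimately have "(\<lambda>k. \<gamma> k * (\<Sum>i\<in>B - B'. cvec \<alpha> $ i)) \<longlonglongrightarrow> 0" by simp
      moreover have "(\<lambda>k. \<gamma> k * (\<Sum>i\<in>B - B'. cvec \<alpha> $ i)) \<longlonglongrightarrow> \<gamma>0 * (\<Sum>i\<in>B - B'. cvec \<alpha> $ i)"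
        by (intro tendsto_mult \<gamma> tendsto_const)
      ultimately have "\<gamma>0 * (\<Sum>i\<in>B - B'. cvec \<alpha> $ i) = 0" using LIMSEQ_unique by blast
      moreover have "(\<Sum>i\<in>B - B'. cvec \<alpha> $ i) \<noteq> 0"
      proof -
        have "j \<in> B - B'" using jB by (auto simp: B'_def V'_def)
        then have "0 < (\<Sum>i\<in>B - B'. \<alpha> $ i)"
          using less.prems(3) j(1) by (intro sum_pos2[of _ j "\<lambda>i. \<alpha> $ i"]) (auto simp: weights_def)
        then show ?thesis by (rule sum_cvec_nonzero)
      qed
      ultimately have "\<gamma>0 = 0" by simp
      then show False using \<open>u = 0\<close> r(3) by (simp add: u_def)
    qed
  qed
qed

text \<open>At \<open>w = 0\<close> the linearized equations give
  \<open>dw_i = - a_i dy_i / y_i\<^sup>2\<close> on \<open>B\<close>, and orthogonality of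
  \<open>dw\<close> to \<open>V\<close> says that \<open>dy\<close> lies in the radical of the form
  of \<open>nondegenerate_form\<close>.\<close>

lemma exists_nondeg:
  fixes V :: "(complex^'n) set"
  assumes "supported B V" "loopless B V" "weights V \<alpha>"
  shows "\<exists>y\<in>V. nondeg B V (cvec \<alpha>) y 0"
proof -
  obtain y where y: "y \<in> V" "\<And>i. i \<in> B \<Longrightarrow> y $ i \<noteq> 0"
    and form: "\<And>u. u \<in> V \<Longrightarrow> (\<And>v. v \<in> V \<Longrightarrow> (\<Sum>i\<in>B. cvec \<alpha> $ i * u $ i * v $ i / (y $ i)\<^sup>2) = 0) \<Longrightarrow> u = 0"
    using nondegenerate_form[OF assms] by blast
  have "nondeg B V (cvec \<alpha>) y 0"
    unfolding nondeg_def
  proof (intro ballI impI)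
    fix dy dw assume d: "dy \<in> V" "dw \<in> orth V"
      and eqs: "(\<forall>i\<in>B. (cvec \<alpha> $ i + 2 * y $ i * 0 $ i) * dy $ i + (y $ i)\<^sup>2 * dw $ i = 0) \<and> (\<forall>i. i \<notin> B \<longrightarrow> dw $ i = 0)"
    have dw: "dw $ i = - (cvec \<alpha> $ i * dy $ i / (y $ i)\<^sup>2)" if "i \<in> B" for i
    proof -
      have "cvec \<alpha> $ i * dy $ i + (y $ i)\<^sup>2 * dw $ i = 0" using eqs that by auto
      then show ?thesis using y(2)[OF that] by (simp add: eq_neg_iff_add_eq_0 field_simps)
    qed
    have "dy = 0"
    proof (rule form[OF d(1)])
      fix v assume "v \<in> V"
      have "bil v dw = (\<Sum>i\<in>B. v $ i * dw $ i)"
        unfolding bil_def using eqs by (intro sum.mono_neutral_right) auto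
      also have "\<dots> = - (\<Sum>i\<in>B. cvec \<alpha> $ i * dy $ i * v $ i / (y $ i)\<^sup>2)"
        unfolding sum_negf[symmetric] by (intro sum.cong) (auto simp: dw)
      finally show "(\<Sum>i\<in>B. cvec \<alpha> $ i * dy $ i * v $ i / (y $ i)\<^sup>2) = 0"
        using d(2) \<open>v \<in> V\<close> by (simp add: orth_def)
    qed
    moreover have "dw = 0"
      using dw eqs \<open>dy = 0\<close> by (auto simp: vec_eq_iff)
    ultimately show "dy = 0 \<and> dw = 0" ..
  qed
  then show ?thesis using y(1) by blast
qed

text \<open>In the linear chart nondegeneracy is the nonvanishing of the Jacobian determinant, a
  polynomial that is not identically zero by \<open>exists_nondeg\<close>. General values avoid the
  image of its zero set, a statement of Sard type.\<close>

lemma generic_good: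
  fixes V :: "(complex^'n) set"
  assumes "supported B V" "loopless B V" "weights V \<alpha>"
  shows "generic (good B V (cvec \<alpha>))"
proof -
  let ?a = "cvec \<alpha>"
  have V: "vec.subspace V" using assms(1) by (simp add: supported_def)
  obtain A M C D :: "complex^'n^'n" where AM: "bij_betw (\<lambda>z. (A *v z, M *v z)) UNIV (V \<times> orth V)"
    and inv0: "\<forall>z. C *v (A *v z) + D *v (M *v z) = z"
    by (rule subspace_pair_parametrization[OF V])
  have AV: "A *v z \<in> V" "M *v z \<in> orth V" for z using bij_betwE[OF AM] by auto
  define J where "J z = (\<chi> i j. if i \<in> B
      then (?a $ i + 2 * (A *v z) $ i * (M *v z) $ i) * A $ i $ j + ((A *v z) $ i)\<^sup>2 * M $ i $ j
      else M $ i $ j)" for z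
  have J_mult: "(J z *v h) $ i = (if i \<in> B
      then (?a $ i + 2 * (A *v z) $ i * (M *v z) $ i) * (A *v h) $ i + ((A *v z) $ i)\<^sup>2 * (M *v h) $ i
      else (M *v h) $ i)" for z h i
    unfolding J_def matrix_vector_mult_def
    by (simp add: sum_distrib_left sum.distrib distrib_right mult.assoc)
  have nondeg_iff: "nondeg B V ?a (A *v z) (M *v z) \<longleftrightarrow> det (J z) \<noteq> 0" for z
  proof -
    have "det (J z) \<noteq> 0 \<longleftrightarrow> (\<forall>h. J z *v h = 0 \<longrightarrow> h = 0)"
      by (metis invertible_det_nz invertible_left_inverse matrix_left_invertible_ker)
    also have "\<dots> \<longleftrightarrow> nondeg B V ?a (A *v z) (M *v z)"
    proof
      assume L: "\<forall>h. J z *v h = 0 \<longrightarrow> h = 0"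
      show "nondeg B V ?a (A *v z) (M *v z)"
        unfolding nondeg_def
      proof (intro ballI impI)
        fix dy dw assume d: "dy \<in> V" "dw \<in> orth V"
          and eqs: "(\<forall>i\<in>B. (?a $ i + 2 * (A *v z) $ i * (M *v z) $ i) * dy $ i + ((A *v z) $ i)\<^sup>2 * dw $ i = 0)
            \<and> (\<forall>i. i \<notin> B \<longrightarrow> dw $ i = 0)"
        have "(dy, dw) \<in> range (\<lambda>z. (A *v z, M *v z))" using d AM by (simp add: bij_betw_def)
        then obtain h where h: "dy = A *v h" "dw = M *v h" by auto
        have "J z *v h = 0" using eqs unfolding h by (simp add: vec_eq_iff J_mult)
        then show "dy = 0 \<and> dw = 0" using L h by auto
      qed
    next
      assume R: "nondeg B V ?a (A *v z) (M *v z)"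
      show "\<forall>h. J z *v h = 0 \<longrightarrow> h = 0"
      proof (intro allI impI)
        fix h assume "J z *v h = 0"
        then have "(J z *v h) $ i = 0" for i by simp
        then have eqs: "(if i \<in> B
          then (?a $ i + 2 * (A *v z) $ i * (M *v z) $ i) * (A *v h) $ i + ((A *v z) $ i)\<^sup>2 * (M *v h) $ i
          else (M *v h) $ i) = 0" for i unfolding J_mult .
        have "A *v h = 0 \<and> M *v h = 0"
        proof (rule R[unfolded nondeg_def, rule_format, OF AV], intro conjI ballI allI impI)
          fix i
          show "(?a $ i + 2 * (A *v z) $ i * (M *v z) $ i) * (A *v h) $ i + ((A *v z) $ i)\<^sup>2 * (M *v h) $ i = 0"
            if "i \<in> B" using eqs[of i] that by simp
          show "(M *v h) $ i = 0" if "i \<notin> B" using eqs[of i] that by simp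
        qed
        then show "h = 0" using spec[OF inv0, of h] by simp
      qed
    qed
    finally show ?thesis by simp
  qed
  obtain y0 where "y0 \<in> V" "nondeg B V ?a y0 0" using exists_nondeg[OF assms] by blast
  moreover have "(y0, 0) \<in> V \<times> orth V" using \<open>y0 \<in> V\<close> by (simp add: orth_def bil_zero)
  then have "(y0, 0) \<in> range (\<lambda>z. (A *v z, M *v z))" using AM by (simp add: bij_betw_def)
  then obtain z0 where "y0 = A *v z0" "0 = M *v z0" by auto
  ultimately have det0: "det (J z0) \<noteq> 0" using nondeg_iff[of z0] by simp
  have vJ: "vpoly (\<lambda>z. J z $ i $ j)" for i j
    unfolding J_def by (cases "i \<in> B") (auto intro!: pfun_intros vpoly_matrix)
  have vdet: "vpoly (\<lambda>z. det (J z))"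
    unfolding det_def by (intro pfun_intros vJ)
  define G where "G z = phi B ?a (A *v z) (M *v z)" for z
  have vG: "vpoly (\<lambda>z. G z $ i)" for i
    unfolding G_def phi_def by (cases "i \<in> B") (auto intro!: pfun_intros vpoly_matrix)
  have "generic (\<lambda>s. \<forall>z. G z = s \<longrightarrow> det (J z) \<noteq> 0)"
    by (rule generic_avoids_hypersurface_image[OF vG vdet det0])
  then have "generic (\<lambda>s. no_degeneration V {} s \<and> (\<forall>i\<in>B. s $ i \<noteq> 0) \<and> (\<forall>z. G z = s \<longrightarrow> det (J z) \<noteq> 0))"
    by (intro generic_conj generic_no_degeneration[OF V] generic_nth_nonzero)
  then show ?thesis
  proof (rule generic_mono)
    fix s assume s: "no_degeneration V {} s \<and> (\<forall>i\<in>B. s $ i \<noteq> 0) \<and> (\<forall>z. G z = s \<longrightarrow> det (J z) \<noteq> 0)"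
    have "nondeg B V ?a y w" if "(y, w) \<in> sol B V ?a s" for y w
    proof -
      have "(y, w) \<in> V \<times> orth V" using that by (simp add: sol_def)
      then have "(y, w) \<in> range (\<lambda>z. (A *v z, M *v z))" using AM by (simp add: bij_betw_def)
      then obtain z where z: "y = A *v z" "w = M *v z" by auto
      have "G z = s" using that by (simp add: G_def z sol_def)
      then show ?thesis using s nondeg_iff[of z] by (simp add: z)
    qed
    then show "good B V ?a s" using s by (auto simp: good_def)
  qed
qed

lemma sol_count_locally_constant:
  fixes V :: "(complex^'n) set"
  assumes sup: "supported B V" and adm: "admissible V (c0 + t0 *s c1)" and good: "good B V (c0 + t0 *s c1) s0"
  shows "finite (sol B V (c0 + t0 *s c1) s0) \<and> (\<exists>W. open W \<and> (s0, t0) \<in> W \<and>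
    (\<forall>(s, t)\<in>W. finite (sol B V (c0 + t *s c1) s) \<and> card (sol B V (c0 + t *s c1) s) = card (sol B V (c0 + t0 *s c1) s0)))"
proof -
  have V: "vec.subspace V" and VB: "\<And>v i. v \<in> V \<Longrightarrow> i \<notin> B \<Longrightarrow> v $ i = 0"
    using sup by (auto simp: supported_def)
  let ?S = "\<lambda>s t. {(y, w). y \<in> V \<and> w \<in> orth V \<and> (y, w, t) \<in> UNIV
      \<and> phi B (c0 + t *s c1) (y + (t - 1) *s ((0::complex^'n^'n) *v y)) w = s}"
  have S: "?S s t = sol B V (c0 + t *s c1) s" for s t by (simp add: sol_def)
  have "finite (?S s0 t0) \<and> (\<exists>W. open W \<and> (s0, t0) \<in> W \<and>
    (\<forall>(s, t)\<in>W. finite (?S s t) \<and> card (?S s t) = card (?S s0 t0)))"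
  proof (rule solution_count_locally_constant[OF V open_UNIV])
    fix y w dy dw assume "(y, w) \<in> ?S s0 t0"
    then have "nondeg B V (c0 + t0 *s c1) y w" using good unfolding S good_def by blast
    moreover assume "dy \<in> V" "dw \<in> orth V"
      "\<And>i. i \<in> B \<Longrightarrow> ((c0 + t0 *s c1) $ i + 2 * (y + (t0 - 1) *s ((0::complex^'n^'n) *v y)) $ i * w $ i)
        * (dy + (t0 - 1) *s ((0::complex^'n^'n) *v dy)) $ i
        + ((y + (t0 - 1) *s ((0::complex^'n^'n) *v y)) $ i)\<^sup>2 * dw $ i = 0"
      "\<And>i. i \<notin> B \<Longrightarrow> dw $ i = 0"
    ultimately show "dy = 0 \<and> dw = 0" by (simp add: nondeg_def)
  next
    fix y w :: "nat \<Rightarrow> complex^'n" and t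
    assume "\<And>k. y k \<in> V" "\<And>k. w k \<in> orth V"
      "(\<lambda>k. phi B (c0 + t k *s c1) (y k + (t k - 1) *s ((0::complex^'n^'n) *v y k)) (w k)) \<longlonglongrightarrow> s0" "t \<longlonglongrightarrow> t0"
    then have yw: "\<And>k. y k \<in> V" "\<And>k. w k \<in> orth V" "t \<longlonglongrightarrow> t0"
      and sk: "(\<lambda>k. phi B (c0 + t k *s c1) (y k) (w k)) \<longlonglongrightarrow> s0"
      by simp_all
    have ak: "(\<lambda>k. c0 + t k *s c1) \<longlonglongrightarrow> c0 + t0 *s c1"
      using yw(3) by (intro vec_tendstoI) (auto intro!: tendsto_intros)
    \<comment> \<open>\<open>Z\<close> is empty here, so the distinguished element is
      arbitrary.\<close>
    interpret solution_sequence B V "c0 + t0 *s c1" s0 "\<lambda>k. c0 + t k *s c1"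
      "\<lambda>k. phi B (c0 + t k *s c1) (y k) (w k)" y w "{}" undefined
      using V VB adm good
      by unfold_locales (simp_all add: good_def sol_def ak sk yw)
    show "\<exists>r y0 w0. strict_mono r \<and> (y \<circ> r) \<longlonglongrightarrow> y0 \<and> (w \<circ> r) \<longlonglongrightarrow> w0 \<and> (y0, w0, t0) \<in> UNIV"
      using convergent_subsequence by simp
  qed
  then show ?thesis unfolding S .
qed

lemma gcount_exists:
  fixes V :: "(complex^'n) set"
  assumes "supported B V" "loopless B V" "weights V \<alpha>"
  obtains d where "gcount B V (cvec \<alpha>) d"
proof -
  let ?a = "cvec \<alpha>"
  obtain h u where h: "vpoly h" "h u \<noteq> 0" "\<And>s. h s \<noteq> 0 \<Longrightarrow> good B V ?a s"
    using generic_good[OF assms] unfolding generic_def by blast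
  have a: "?a = ?a + t *s 0" for t :: complex by simp
  let ?N = "\<lambda>s. card (sol B V ?a s)"
  have loc: "finite (sol B V ?a s) \<and> (\<exists>W. open W \<and> (s, 0::complex) \<in> W \<and> (\<forall>(s', t)\<in>W. finite (sol B V ?a s') \<and> ?N s' = ?N s))"
    if "h s \<noteq> 0" for s
    using sol_count_locally_constant[of B V ?a 0 0 s] assms(1) weights_admissible[OF assms(3)] h(3)[OF that] by simp
  have "?N constant_on {s. h s \<noteq> 0}"
  proof (rule locally_constant_imp_constant[OF connected_vpoly_nonzero[OF h(1)]])
    fix s assume s: "s \<in> {s. h s \<noteq> 0}"
    then obtain W where W: "open W" "(s, 0::complex) \<in> W" "\<And>s' t. (s', t) \<in> W \<Longrightarrow> ?N s' = ?N s"
      using loc[of s] by auto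
    have "open ((\<lambda>s. (s, 0::complex)) -` W)" by (rule open_vimage[OF W(1)]) (intro continuous_intros)
    then have "openin (top_of_set {s. h s \<noteq> 0}) ({s. h s \<noteq> 0} \<inter> (\<lambda>s. (s, 0::complex)) -` W)"
      by (rule openin_open_Int)
    moreover have "s \<in> {s. h s \<noteq> 0} \<inter> (\<lambda>s. (s, 0::complex)) -` W" using s W(2) by simp
    moreover have "\<forall>s'\<in>{s. h s \<noteq> 0} \<inter> (\<lambda>s. (s, 0::complex)) -` W. ?N s' = ?N s"
    proof
      fix s' assume "s' \<in> {s. h s \<noteq> 0} \<inter> (\<lambda>s. (s, 0::complex)) -` W"
      then have "(s', 0) \<in> W" by simp
      then show "?N s' = ?N s" by (rule W(3))
    qed
    ultimately show "\<exists>T. openin (top_of_set {s. h s \<noteq> 0}) T \<and> s \<in> T \<and> (\<forall>s'\<in>T. ?N s' = ?N s)"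
      by (intro exI conjI)
  qed
  then obtain d where d: "\<And>s. h s \<noteq> 0 \<Longrightarrow> ?N s = d" by (auto simp: constant_on_def)
  have "gcount B V ?a d" unfolding gcount_def
  proof (rule genericI[OF h(1,2)])
    fix s assume "h s \<noteq> 0"
    then show "finite (sol B V ?a s) \<and> ?N s = d \<and> (\<forall>(y, w)\<in>sol B V ?a s. nondeg B V ?a y w)"
      using loc[of s] d[of s] h(3)[of s] unfolding good_def by blast
  qed
  then show thesis by (rule that)
qed

text \<open>The generic locus depends on the weights, so counts for different \<open>t\<close> have
  to be compared at a common value: near a good \<open>s0\<close> for \<open>t0\<close> the count is
  constant in \<open>(s, t)\<close>, and by density each nearby \<open>t\<close> has a generic
  \<open>s\<close> close to \<open>s0\<close>.\<close>

lemma gcount_weights_eq: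
  fixes V :: "(complex^'n) set"
  assumes sup: "supported B V" and "loopless B V" and w0: "weights V \<alpha>" and w1: "weights V \<beta>"
    and d0: "gcount B V (cvec \<alpha>) d" and d1: "gcount B V (cvec \<beta>) d'"
  shows "d = d'"
proof -
  define \<gamma> where "\<gamma> t = (1 - t) *\<^sub>R \<alpha> + t *\<^sub>R \<beta>" for t :: real
  have cvec_\<gamma>: "cvec (\<gamma> t) = cvec \<alpha> + complex_of_real t *s (cvec \<beta> - cvec \<alpha>)" for t
    by (simp add: \<gamma>_def cvec_def vec_eq_iff algebra_simps)
  have w: "weights V (\<gamma> t)" if "t \<in> {0..1}" for t
  proof -
    have nn: "0 \<le> \<alpha> $ i" "0 \<le> \<beta> $ i" for i using w0 w1 by (auto simp: weights_def)
    have "\<exists>i\<in>supp v. 0 < \<gamma> t $ i" if v: "v \<in> V" "v \<noteq> 0" for v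
    proof (cases "t = 0")
      case True then show ?thesis using w0 v by (auto simp: weights_def \<gamma>_def)
    next
      case False
      then obtain i where "i \<in> supp v" "0 < \<beta> $ i" using w1 v by (auto simp: weights_def)
      then have "0 < \<gamma> t $ i"
        using False \<open>t \<in> {0..1}\<close> nn[of i] by (auto simp: \<gamma>_def intro!: add_nonneg_pos)
      then show ?thesis using \<open>i \<in> supp v\<close> by blast
    qed
    then show ?thesis using nn \<open>t \<in> {0..1}\<close> by (auto simp: weights_def \<gamma>_def)
  qed
  have "\<forall>t\<in>{0..1}. \<exists>d. gcount B V (cvec (\<gamma> t)) d"
    using gcount_exists[OF sup assms(2) w] by blast
  from bchoice[OF this] obtain N where N: "\<forall>t\<in>{0..1}. gcount B V (cvec (\<gamma> t)) (N t)" ..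
  have "N constant_on {0..1}"
  proof (rule locally_constant_imp_constant)
    show "connected {0..1::real}" by simp
    fix t0 :: real assume t0: "t0 \<in> {0..1}"
    have gg: "generic (\<lambda>s. good B V (cvec (\<gamma> t0)) s \<and> (finite (sol B V (cvec (\<gamma> t0)) s) \<and> card (sol B V (cvec (\<gamma> t0)) s) = N t0
       \<and> (\<forall>(y, w)\<in>sol B V (cvec (\<gamma> t0)) s. nondeg B V (cvec (\<gamma> t0)) y w)))"
      using generic_good[OF sup assms(2) w[OF t0]] bspec[OF N t0] unfolding gcount_def by (rule generic_conj)
    obtain s0 where s0: "good B V (cvec (\<gamma> t0)) s0" "card (sol B V (cvec (\<gamma> t0)) s0) = N t0"
      by (rule generic_dense[OF gg open_UNIV UNIV_I]) blast
    obtain W where W: "open W" "(s0, complex_of_real t0) \<in> W"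
      "\<And>s t. (s, t) \<in> W \<Longrightarrow> card (sol B V (cvec \<alpha> + t *s (cvec \<beta> - cvec \<alpha>)) s) = N t0"
      using sol_count_locally_constant[OF sup, of "cvec \<alpha>" "complex_of_real t0" "cvec \<beta> - cvec \<alpha>" s0]
        weights_admissible[OF w[OF t0]] s0 unfolding cvec_\<gamma> by auto
    have "open ((\<lambda>t. (s0, complex_of_real t)) -` W)" by (rule open_vimage[OF W(1)]) (intro continuous_intros)
    then have "openin (top_of_set {0..1}) ({0..1} \<inter> (\<lambda>t. (s0, complex_of_real t)) -` W)"
      by (rule openin_open_Int)
    moreover have "t0 \<in> {0..1} \<inter> (\<lambda>t. (s0, complex_of_real t)) -` W" using t0 W(2) by simp
    moreover have Nt: "N t = N t0" if t: "t \<in> {0..1}" "(s0, complex_of_real t) \<in> W" for t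
    proof -
      have "open ((\<lambda>s. (s, complex_of_real t)) -` W)" by (rule open_vimage[OF W(1)]) (intro continuous_intros)
      moreover have "s0 \<in> (\<lambda>s. (s, complex_of_real t)) -` W" using t(2) by simp
      ultimately obtain s where s: "s \<in> (\<lambda>s. (s, complex_of_real t)) -` W" "card (sol B V (cvec (\<gamma> t)) s) = N t"
        using generic_dense[OF bspec[OF N t(1), unfolded gcount_def]] by (metis (no_types, lifting))
      then show ?thesis using W(3)[of s "complex_of_real t"] unfolding cvec_\<gamma> by simp
    qed
    moreover have "\<forall>t\<in>{0..1} \<inter> (\<lambda>t. (s0, complex_of_real t)) -` W. N t = N t0"
      using Nt by (intro ballI) (metis IntD1 IntD2 vimage_eq)
    ultimately show "\<exists>T. openin (top_of_set {0..1}) T \<and> t0 \<in> T \<and> (\<forall>t\<in>T. N t = N t0)"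
      by (intro exI conjI)
  qed
  then have "N 0 = N 1" unfolding constant_on_def by (metis atLeastAtMost_iff order_refl zero_le_one)
  moreover have "gcount B V (cvec \<alpha>) (N 0)" "gcount B V (cvec \<beta>) (N 1)"
    using bspec[OF N, of 0] bspec[OF N, of 1] by (simp_all add: \<gamma>_def)
  then have "N 0 = d" "N 1 = d'" using d0 d1 gcount_unique by blast+
  ultimately show ?thesis by simp
qed

section \<open>Deletion and contraction\<close>

definition upd :: "'n \<Rightarrow> complex^'n \<Rightarrow> complex \<Rightarrow> complex^'n" where
  "upd e v c = (\<chi> i. if i = e then c else v $ i)"

lemma upd_nth: "upd e v c $ i = (if i = e then c else v $ i)"
  by (simp add: upd_def)

lemma upd_upd: "upd e (upd e v c) d = upd e v d"
  by (simp add: vec_eq_iff upd_nth)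

lemma upd_self: "v $ e = c \<Longrightarrow> upd e v c = v"
  by (auto simp: vec_eq_iff upd_nth)

lemma tendsto_upd:
  "(f \<longlongrightarrow> v) F \<Longrightarrow> (g \<longlongrightarrow> c) F \<Longrightarrow> ((\<lambda>x. upd e (f x) (g x)) \<longlongrightarrow> upd e v c) F"
  by (rule vec_tendstoI) (auto simp: upd_nth intro: tendsto_vec_nth)

lemma continuous_on_upd:
  "continuous_on S f \<Longrightarrow> continuous_on S g \<Longrightarrow> continuous_on S (\<lambda>x. upd e (f x) (g x))"
  unfolding continuous_on_def by (auto intro: tendsto_upd)

lemma bil_upd: "bil v (upd e w c) = bil v w + v $ e * (c - w $ e)"
proof -
  have "bil v (upd e w c) = v $ e * c + (\<Sum>i\<in>UNIV - {e}. v $ i * w $ i)"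
    unfolding bil_def by (subst sum.remove[of _ e]) (auto simp: upd_nth intro!: sum.cong)
  moreover have "bil v w = v $ e * w $ e + (\<Sum>i\<in>UNIV - {e}. v $ i * w $ i)"
    unfolding bil_def by (rule sum.remove) auto
  ultimately show ?thesis by (simp add: algebra_simps)
qed

lemma phi_eq_iff: "phi B a y w = s \<longleftrightarrow>
    (\<forall>i. (if i \<in> B then a $ i * y $ i + (y $ i)\<^sup>2 * w $ i else w $ i) = s $ i)"
  by (simp add: phi_def vec_eq_iff)

lemma tendsto_phi:
  assumes "(a \<longlongrightarrow> a0) F" "(y \<longlongrightarrow> y0) F" "(w \<longlongrightarrow> w0) F"
  shows "((\<lambda>k. phi B (a k) (y k) (w k)) \<longlongrightarrow> phi B a0 y0 w0) F"
proof (rule vec_tendstoI)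
  fix i
  show "((\<lambda>k. phi B (a k) (y k) (w k) $ i) \<longlongrightarrow> phi B a0 y0 w0 $ i) F"
    using assms by (cases "i \<in> B") (auto simp: phi_def intro!: tendsto_intros)
qed

lemma sol_limit:
  fixes V :: "(complex^'n) set"
  assumes V: "vec.subspace V" and "\<And>k. y k \<in> V" "\<And>k. w k \<in> orth V"
    and lim: "y \<longlonglongrightarrow> y0" "w \<longlonglongrightarrow> w0" and s: "(\<lambda>k. phi B a (y k) (w k)) \<longlonglongrightarrow> s"
  shows "(y0, w0) \<in> sol B V a s"
proof -
  have "y0 \<in> V" by (rule closed_sequentially[OF closed_vec_subspace[OF V] _ lim(1)]) (use assms in auto)
  moreover have "w0 \<in> orth V"
    by (rule closed_sequentially[OF closed_vec_subspace[OF subspace_orth] _ lim(2)]) (use assms in auto)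
  moreover have "phi B a y0 w0 = s"
    using LIMSEQ_unique[OF tendsto_phi[OF tendsto_const lim] s] .
  ultimately show ?thesis by (simp add: sol_def)
qed

text \<open>A linear form not vanishing identically on the pairs cuts out a hypersurface in the
  chart, and general values have no preimage on it.\<close>

lemma generic_avoid_linear:
  fixes V :: "(complex^'n) set"
  assumes V: "vec.subspace V" and "y0 \<in> V" "w0 \<in> orth V" "bil y0 p + bil w0 q \<noteq> 0"
  shows "generic (\<lambda>s. \<forall>(y, w)\<in>sol B V a s. bil y p + bil w q \<noteq> 0)"
proof -
  obtain A M C D :: "complex^'n^'n" where AM: "bij_betw (\<lambda>z. (A *v z, M *v z)) UNIV (V \<times> orth V)"
    by (rule subspace_pair_parametrization[OF V])
  have onto: "\<exists>z. y = A *v z \<and> w = M *v z" if "y \<in> V" "w \<in> orth V" for y w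
  proof -
    have "(y, w) \<in> range (\<lambda>z. (A *v z, M *v z))" using that AM by (simp add: bij_betw_def)
    then show ?thesis by auto
  qed
  have vG: "vpoly (\<lambda>z. phi B a (A *v z) (M *v z) $ i)" for i
    unfolding phi_def by (cases "i \<in> B") (auto intro!: pfun_intros vpoly_matrix)
  have vg: "vpoly (\<lambda>z. bil (A *v z) p + bil (M *v z) q)"
    unfolding bil_def by (intro pfun_intros vpoly_matrix)
  obtain z0 where z0: "y0 = A *v z0" "w0 = M *v z0" using onto assms by blast
  have "generic (\<lambda>s. \<forall>z. phi B a (A *v z) (M *v z) = s \<longrightarrow> bil (A *v z) p + bil (M *v z) q \<noteq> 0)"
    by (rule generic_avoids_hypersurface_image[OF vG vg, of z0]) (use assms(4) z0 in simp)
  then show ?thesis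
  proof (rule generic_mono)
    fix s assume s: "\<forall>z. phi B a (A *v z) (M *v z) = s \<longrightarrow> bil (A *v z) p + bil (M *v z) q \<noteq> 0"
    show "\<forall>(y, w)\<in>sol B V a s. bil y p + bil w q \<noteq> 0"
    proof clarify
      fix y w assume yw: "(y, w) \<in> sol B V a s" "bil y p + bil w q = 0"
      then obtain z where "y = A *v z" "w = M *v z" using onto[of y w] by (auto simp: sol_def)
      then show False using s yw by (auto simp: sol_def)
    qed
  qed
qed

text \<open>The section of \<open>V\<close> by \<open>v $ e = 0\<close> belongs to the contraction
  of \<open>e\<close>, the projection of \<open>V\<close> to \<open>B - {e}\<close> to its deletion,
  and \<open>s\<close> is general for both at once. \<open>avoid1\<close> keeps the coordinate
  \<open>e\<close> of \<open>w\<close> nonzero when a solution of the contraction is lifted,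
  \<open>avoid2\<close> that of \<open>y\<close> when a solution of the deletion is lifted.\<close>

locale deletion_contraction =
  fixes B :: "'n::finite set" and V :: "(complex^'n) set" and \<alpha> :: "real^'n" and e :: 'n and b s :: "complex^'n"
  assumes sup: "supported B V" and eB: "e \<in> B" and b: "b \<in> V" "b $ e = 1" and coloop: "axis e 1 \<notin> V"
    and \<alpha>: "weights V \<alpha>" "\<alpha> $ e = 0"
    and no_degeneration: "no_degeneration V {} s" and s_nz: "\<And>i. i \<in> B \<Longrightarrow> s $ i \<noteq> 0"
    and fin1: "finite (sol (B - {e}) {v\<in>V. v $ e = 0} (cvec \<alpha>) s)"
    and nd1: "\<And>y w. (y, w) \<in> sol (B - {e}) {v\<in>V. v $ e = 0} (cvec \<alpha>) s \<Longrightarrow> nondeg (B - {e}) {v\<in>V. v $ e = 0} (cvec \<alpha>) y w"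
    and fin2: "finite (sol (B - {e}) (res (B - {e}) ` V) (cvec \<alpha>) s)"
    and nd2: "\<And>y w. (y, w) \<in> sol (B - {e}) (res (B - {e}) ` V) (cvec \<alpha>) s \<Longrightarrow> nondeg (B - {e}) (res (B - {e}) ` V) (cvec \<alpha>) y w"
    and avoid1: "\<And>y w. (y, w) \<in> sol (B - {e}) {v\<in>V. v $ e = 0} (cvec \<alpha>) s \<Longrightarrow> w $ e - bil b w \<noteq> 0"
    and avoid2: "\<And>y w. (y, w) \<in> sol (B - {e}) (res (B - {e}) ` V) (cvec \<alpha>) s \<Longrightarrow> y \<notin> {v\<in>V. v $ e = 0}"
begin

abbreviation "a \<equiv> cvec \<alpha>"
abbreviation "B' \<equiv> B - {e}"
abbreviation "V1 \<equiv> {v\<in>V. v $ e = 0}"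
abbreviation "V2 \<equiv> res B' ` V"
text \<open>\<open>s0\<close> is the degenerate limit. Rescaling by \<open>t\<close> divides the
  coordinate \<open>e\<close> of the right-hand side by \<open>t\<^sup>2\<close>; along
  \<open>s_e = t\<^sup>2\<close> this gives the constant 1, whence \<open>s1\<close>.\<close>

abbreviation "s0 \<equiv> upd e s 0"
abbreviation "s1 \<equiv> upd e s 1"

lemma V: "vec.subspace V" and VB: "v \<in> V \<Longrightarrow> i \<notin> B \<Longrightarrow> v $ i = 0"
  using sup by (auto simp: supported_def)

lemma ae: "a $ e = 0"
  using \<alpha>(2) by (simp add: cvec_def)

lemma orth_V2_iff: "w \<in> orth V2 \<longleftrightarrow> upd e w 0 \<in> orth V"
proof -
  have "bil (res B' v) w = bil v (upd e w 0)" if "v \<in> V" for v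
    unfolding bil_def using VB[OF that] by (intro sum.cong) (auto simp: res_nth upd_nth)
  then show ?thesis by (auto simp: orth_def)
qed

lemma orth_V1: "w \<in> orth V \<Longrightarrow> upd e w c \<in> orth V1"
  by (auto simp: orth_def bil_upd)

text \<open>\<open>V\<close> is spanned by \<open>V1\<close> and \<open>b\<close>. Since
  \<open>b $ e = 1\<close>, the value at \<open>e\<close> can be adjusted to make \<open>w\<close>
  orthogonal to \<open>b\<close>, and this does not affect orthogonality to
  \<open>V1\<close>.\<close>

lemma lift_orth_V1:
  assumes "w \<in> orth V1" shows "upd e w (w $ e - bil b w) \<in> orth V"
  unfolding orth_def
proof (intro CollectI ballI)
  fix v assume v: "v \<in> V"
  have "v - v $ e *s b \<in> V1" using V v b by (auto intro: vec.subspace_diff vec.subspace_scale)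
  then have "bil (v - v $ e *s b) w = 0" using assms by (auto simp: orth_def)
  then show "bil v (upd e w (w $ e - bil b w)) = 0"
    by (simp add: bil_upd bil_diff_left bil_scale_left)
qed

lemma lift_upd: "w \<in> orth V \<Longrightarrow> upd e w c $ e - bil b (upd e w c) = w $ e"
  using b by (auto simp: bil_upd upd_nth orth_def)

lemma only_e_zero: "v \<in> V \<Longrightarrow> (\<And>i. i \<noteq> e \<Longrightarrow> v $ i = 0) \<Longrightarrow> v = 0"
proof (rule ccontr)
  assume v: "v \<in> V" "\<And>i. i \<noteq> e \<Longrightarrow> v $ i = 0" "v \<noteq> 0"
  then have "v $ e \<noteq> 0" by (metis vec_eq_iff zero_index)
  then have "axis e 1 = (1 / v $ e) *s v" using v(2) by (auto simp: vec_eq_iff axis_def)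
  then show False using coloop V v(1) vec.subspace_scale by metis
qed

lemma only_e_zero_orth: "w \<in> orth V \<Longrightarrow> (\<And>i. i \<noteq> e \<Longrightarrow> w $ i = 0) \<Longrightarrow> w = 0"
proof -
  assume w: "w \<in> orth V" "\<And>i. i \<noteq> e \<Longrightarrow> w $ i = 0"
  then have "w = axis e (w $ e)" by (auto simp: vec_eq_iff axis_def)
  moreover have "bil b w = 0" using w(1) b(1) by (simp add: orth_def)
  ultimately have "w $ e = 0" using b(2) by (metis bil_axis mult_1)
  then show "w = 0" using w(2) by (metis vec_eq_iff zero_index)
qed

lemma sol_to_V2:
  assumes "(y, w) \<in> sol B V a s0" "y $ e \<noteq> 0"
  shows "w $ e = 0" "(res B' y, upd e w (s $ e)) \<in> sol B' V2 a s"
proof -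
  have yw: "y \<in> V" "w \<in> orth V" and
    eq: "(if i \<in> B then a $ i * y $ i + (y $ i)\<^sup>2 * w $ i else w $ i) = s0 $ i" for i
    using assms(1) by (auto simp: sol_def phi_eq_iff)
  show we: "w $ e = 0" using eq[of e] eB assms(2) ae by (simp add: upd_nth)
  have "upd e w 0 \<in> orth V" using yw(2) we by (simp add: upd_self)
  moreover have "(if i \<in> B' then a $ i * res B' y $ i + (res B' y $ i)\<^sup>2 * upd e w (s $ e) $ i
      else upd e w (s $ e) $ i) = s $ i" for i
    using eq[of i] eB by (auto simp: res_nth upd_nth split: if_splits)
  ultimately show "(res B' y, upd e w (s $ e)) \<in> sol B' V2 a s"
    using yw(1) by (simp add: sol_def phi_eq_iff orth_V2_iff upd_upd)
qed

text \<open>At \<open>s0\<close> the equation of \<open>e\<close> is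
  \<open>y_e\<^sup>2 w_e = 0\<close>, so \<open>y_e \<noteq> 0\<close> forces
  \<open>w_e = 0\<close>, which puts \<open>w\<close> into the annihilator of \<open>V2\<close>.
  Conversely \<open>res B'\<close> is injective on \<open>V\<close> because \<open>e\<close> is no
  coloop. The coordinate \<open>e\<close> of \<open>w\<close> is reset to \<open>s $ e\<close> since
  \<open>e\<close> lies outside \<open>B'\<close>.\<close>

lemma bij_sol_V2:
  "bij_betw (\<lambda>(y, w). (res B' y, upd e w (s $ e))) {(y, w)\<in>sol B V a s0. y $ e \<noteq> 0} (sol B' V2 a s)"
proof (rule bij_betw_imageI)
  show "inj_on (\<lambda>(y, w). (res B' y, upd e w (s $ e))) {(y, w)\<in>sol B V a s0. y $ e \<noteq> 0}"
  proof (rule inj_onI, clarsimp)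
    fix y w y' w' assume yw: "(y, w) \<in> sol B V a s0" "y $ e \<noteq> 0" "(y', w') \<in> sol B V a s0" "y' $ e \<noteq> 0"
      and eq: "res B' y = res B' y'" "upd e w (s $ e) = upd e w' (s $ e)"
    have in_V: "y \<in> V" "y' \<in> V" using yw by (auto simp: sol_def)
    have "(y - y') $ i = 0" if "i \<noteq> e" for i
    proof (cases "i \<in> B")
      case True
      then show ?thesis using arg_cong[OF eq(1), of "\<lambda>v. v $ i"] that by (simp add: res_nth)
    next
      case False
      then show ?thesis using VB in_V by simp
    qed
    then have "y - y' = 0" using V in_V by (intro only_e_zero vec.subspace_diff)
    moreover have "w $ i = w' $ i" for i
      using arg_cong[OF eq(2), of "\<lambda>v. v $ i"] sol_to_V2(1)[OF yw(1,2)] sol_to_V2(1)[OF yw(3,4)]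
      by (cases "i = e") (auto simp: upd_nth)
    ultimately show "y = y' \<and> w = w'" by (simp add: vec_eq_iff)
  qed
  show "(\<lambda>(y, w). (res B' y, upd e w (s $ e))) ` {(y, w)\<in>sol B V a s0. y $ e \<noteq> 0} = sol B' V2 a s"
  proof (intro equalityI subsetI)
    fix p assume "p \<in> (\<lambda>(y, w). (res B' y, upd e w (s $ e))) ` {(y, w)\<in>sol B V a s0. y $ e \<noteq> 0}"
    then show "p \<in> sol B' V2 a s" using sol_to_V2(2) by auto
  next
    fix p assume p: "p \<in> sol B' V2 a s"
    obtain y2 w2 where p2: "p = (y2, w2)" by fastforce
    obtain v where v: "v \<in> V" "y2 = res B' v" and w2: "upd e w2 0 \<in> orth V"
      and eq: "(if i \<in> B' then a $ i * y2 $ i + (y2 $ i)\<^sup>2 * w2 $ i else w2 $ i) = s $ i" for i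
      using p by (auto simp: p2 sol_def phi_eq_iff orth_V2_iff)
    have "v $ e \<noteq> 0"
    proof
      assume "v $ e = 0"
      then have "y2 = v" using VB[OF v(1)] by (auto simp: v(2) vec_eq_iff res_nth)
      then show False using avoid2 p v(1) \<open>v $ e = 0\<close> p2 by blast
    qed
    moreover have "(if i \<in> B then a $ i * v $ i + (v $ i)\<^sup>2 * upd e w2 0 $ i else upd e w2 0 $ i) = s0 $ i" for i
      using eq[of i] eB ae by (auto simp: v(2) res_nth upd_nth split: if_splits)
    then have "(v, upd e w2 0) \<in> sol B V a s0" using v(1) w2 by (simp add: sol_def phi_eq_iff)
    moreover have "upd e (upd e w2 0) (s $ e) = w2"
      unfolding upd_upd using eq[of e] by (intro upd_self) simp
    ultimately show "p \<in> (\<lambda>(y, w). (res B' y, upd e w (s $ e))) ` {(y, w)\<in>sol B V a s0. y $ e \<noteq> 0}"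
      by (intro image_eqI[of _ _ "(v, upd e w2 0)"]) (auto simp: p2 v(2))
  qed
qed

text \<open>Such a solution gives one of the contraction, and the lift recovers \<open>w_e\<close>
  from it, so \<open>avoid1\<close> applies. This later bounds the rescaled coordinate
  \<open>y_e\<close>.\<close>

lemma ye0_we: "(y, w) \<in> sol B V a s0 \<Longrightarrow> y $ e = 0 \<Longrightarrow> w $ e \<noteq> 0"
proof -
  assume yw: "(y, w) \<in> sol B V a s0" and ye: "y $ e = 0"
  have w: "w \<in> orth V" and "y \<in> V" using yw by (auto simp: sol_def)
  have eq: "(if i \<in> B then a $ i * y $ i + (y $ i)\<^sup>2 * w $ i else w $ i) = s0 $ i" for i
    using yw by (auto simp: sol_def phi_eq_iff)
  have "(if i \<in> B' then a $ i * y $ i + (y $ i)\<^sup>2 * upd e w (s $ e) $ i else upd e w (s $ e) $ i) = s $ i" for i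
    using eq[of i] by (auto simp: upd_nth split: if_splits)
  then have "(y, upd e w (s $ e)) \<in> sol B' V1 a s"
    using \<open>y \<in> V\<close> ye orth_V1[OF w] by (simp add: sol_def phi_eq_iff)
  from avoid1[OF this] show "w $ e \<noteq> 0" unfolding lift_upd[OF w] .
qed

lemma no_degeneration_s0: "no_degeneration V {e} s0"
  using no_degeneration_cong[OF no_degeneration_mono[OF no_degeneration, of "{e}"], of s0] by (simp add: upd_nth)

text \<open>Compactness at the degenerate point itself, with \<open>Z = {e}\<close>: the equation of
  \<open>e\<close> has weight 0 and its right-hand side tends to 0.\<close>

lemma sequence:
  assumes "\<And>k. y k \<in> V" "\<And>k. w k \<in> orth V" "(\<lambda>k. phi B a (y k) (w k)) \<longlonglongrightarrow> s0"
  shows "\<exists>r y0 w0. strict_mono (r :: nat \<Rightarrow> nat) \<and> (y \<circ> r) \<longlonglongrightarrow> y0 \<and> (w \<circ> r) \<longlonglongrightarrow> w0 \<and> (y0, w0) \<in> sol B V a s0"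
proof -
  have "\<exists>v\<in>V. v $ e \<noteq> 0" using b by force
  then interpret solution_sequence B V a s0 "\<lambda>k. a" "\<lambda>k. phi B a (y k) (w k)" y w "{e}" e
    using V VB weights_admissible[OF \<alpha>(1)] no_degeneration_s0 ae s_nz assms
    by unfold_locales (auto simp: upd_nth sol_def)
  obtain r y0 w0 where r: "strict_mono (r :: nat \<Rightarrow> nat)" "(y \<circ> r) \<longlonglongrightarrow> y0" "(w \<circ> r) \<longlonglongrightarrow> w0"
    using convergent_subsequence by blast
  have "(\<lambda>k. phi B a ((y \<circ> r) k) ((w \<circ> r) k)) \<longlonglongrightarrow> s0"
    using LIMSEQ_subseq_LIMSEQ[OF assms(3) r(1)] by (simp add: o_def)
  from sol_limit[OF V _ _ r(2,3) this] assms(1,2) have "(y0, w0) \<in> sol B V a s0" by simp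
  then show ?thesis using r by blast
qed

text \<open>Solutions with \<open>y_e \<noteq> 0\<close> correspond to those of the deletion and are
  finitely many. Half of the smallest modulus, which makes the bound strict, separates them from the
  solutions with \<open>y_e = 0\<close>.\<close>

lemma gap: "\<exists>\<delta>>0. \<forall>(y, w)\<in>sol B V a s0. y $ e \<noteq> 0 \<longrightarrow> \<delta> < norm (y $ e)"
proof -
  let ?N = "{(y, w)\<in>sol B V a s0. y $ e \<noteq> 0}"
  have fin: "finite ?N" using bij_betw_finite[OF bij_sol_V2] fin2 by simp
  let ?m = "Min (insert 1 ((\<lambda>(y, w). norm (y $ e)) ` ?N))"
  have pos: "0 < ?m" using fin by (subst Min_gr_iff) auto
  have le: "?m \<le> norm (y $ e)" if "(y, w) \<in> sol B V a s0" "y $ e \<noteq> 0" for y w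
    using fin that by (intro Min_le) auto
  have "?m / 2 < norm (y $ e)" if "(y, w) \<in> sol B V a s0" "y $ e \<noteq> 0" for y w
    using le[OF that] pos by linarith
  then show ?thesis using pos by (intro exI[of _ "?m / 2"]) auto
qed

text \<open>Passing from \<open>y\<close> to \<open>y + (t - 1) y\<^sub>e b\<close>, which multiplies the coordinate \<open>e\<close> by \<open>t\<close>, blows up the
  solutions with \<open>y\<^sub>e\<close> of the order of \<open>t\<close>; \<open>twist y t\<close> undoes this scaling in the coordinate \<open>e\<close>,
  so that \<open>t = 0\<close> becomes a nondegenerate limit.\<close>

definition E :: "complex^'n^'n" where
  "E = (\<chi> i j. if j = e then (b - axis e 1) $ i else 0)"

definition twist :: "complex^'n \<Rightarrow> complex \<Rightarrow> complex^'n" where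
  "twist y t = y + (t - 1) *s (E *v y)"

lemma twist_nth: "twist y t $ i = (if i = e then y $ e else y $ i + (t - 1) * y $ e * b $ i)"
proof -
  have "(E *v y) $ i = (b - axis e 1) $ i * y $ e"
    unfolding E_def matrix_vector_mult_def by (simp add: if_distrib[of "\<lambda>x. x * _"] cong: if_cong)
  then have "twist y t $ i = y $ i + (t - 1) * ((b - axis e 1) $ i * y $ e)"
    unfolding twist_def vector_add_component vector_smult_component by (rule arg_cong)
  then show ?thesis using b(2) by (auto simp: axis_def)
qed

text \<open>The substitution multiplies \<open>y_e\<close> by \<open>t\<close>. As
  \<open>a_e = 0\<close>, the equation of \<open>e\<close> is purely \<open>y_e\<^sup>2 w_e\<close>
  and scales by exactly \<open>t\<^sup>2\<close>, while the other equations agree with those of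
  \<open>twist\<close>.\<close>

lemma phi_twist:
  "phi B a (y + ((t - 1) * y $ e) *s b) w = upd e (phi B a (twist y t) w) (t\<^sup>2 * phi B a (twist y t) w $ e)"
  using eB ae b(2)
  by (auto simp: vec_eq_iff phi_def twist_nth upd_nth algebra_simps power2_eq_square)

lemma twist_at_0: "i \<noteq> e \<Longrightarrow> twist y 0 $ i = (y - y $ e *s b) $ i"
  by (simp add: twist_nth)

section \<open>Solutions with large and with small coordinate at the chosen element\<close>

context
  fixes \<delta> :: real
  assumes \<delta>: "\<delta> > 0" and gap: "\<And>y w. (y, w) \<in> sol B V a s0 \<Longrightarrow> y $ e \<noteq> 0 \<Longrightarrow> \<delta> < norm (y $ e)"
begin

definition large :: "complex^'n \<Rightarrow> ((complex^'n) \<times> (complex^'n)) set" where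
  "large s' = {(y, w)\<in>sol B V a s'. \<delta> < norm (y $ e)}"

text \<open>Solutions in the rescaled unknown: the original coordinate at \<open>e\<close> is
  \<open>t * y $ e\<close>, hence the form of the bound.\<close>

definition small :: "complex^'n \<Rightarrow> complex \<Rightarrow> ((complex^'n) \<times> (complex^'n)) set" where
  "small s' t = {(y, w). y \<in> V \<and> w \<in> orth V \<and> norm (t * y $ e) < \<delta> \<and> phi B a (twist y t) w = s'}"

lemma large_s0: "large s0 = {(y, w)\<in>sol B V a s0. y $ e \<noteq> 0}"
  using gap \<delta> by (auto simp: large_def)

text \<open>Nondegeneracy comes from the deletion, since \<open>w_e = 0\<close> and
  \<open>y_e \<noteq> 0\<close> give \<open>dw_e = 0\<close>. For properness, a limit satisfies
  \<open>\<delta> \<le> norm (y_e)\<close>, and the gap makes this strict again.\<close>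

lemma large_locally_constant:
  "\<exists>W. open W \<and> s0 \<in> W \<and> (\<forall>s'\<in>W. finite (large s') \<and> card (large s') = card (sol B' V2 a s))"
proof -
  let ?Om = "{(y, w, t). \<delta> < norm (y $ e)} :: ((complex^'n) \<times> (complex^'n) \<times> complex) set"
  let ?m = "\<lambda>y t. y + (t - 1) *s ((0::complex^'n^'n) *v y)"
  let ?S = "\<lambda>s' t. {(y, w). y \<in> V \<and> w \<in> orth V \<and> (y, w, t) \<in> ?Om \<and> phi B (a + t *s 0) (?m y t) w = s'}"
  have S: "?S s' t = large s'" for s' t by (auto simp: large_def sol_def)
  have "open ?Om"
    unfolding case_prod_unfold by (intro open_Collect_less continuous_intros)
  have "finite (?S s0 0) \<and> (\<exists>W. open W \<and> (s0, 0) \<in> W \<and>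
    (\<forall>(s', t)\<in>W. finite (?S s' t) \<and> card (?S s' t) = card (?S s0 0)))"
  proof (rule solution_count_locally_constant[OF V \<open>open ?Om\<close>])
    fix y w dy dw assume "(y, w) \<in> ?S s0 0"
    then have yw: "(y, w) \<in> sol B V a s0" "y $ e \<noteq> 0" unfolding S large_s0 by auto
    assume d: "dy \<in> V" "dw \<in> orth V"
      and eqs0: "\<And>i. i \<in> B \<Longrightarrow> ((a + 0 *s 0) $ i + 2 * ?m y 0 $ i * w $ i) * ?m dy 0 $ i + (?m y 0 $ i)\<^sup>2 * dw $ i = 0"
      and off: "\<And>i. i \<notin> B \<Longrightarrow> dw $ i = 0"
    have eqs: "(a $ i + 2 * y $ i * w $ i) * dy $ i + (y $ i)\<^sup>2 * dw $ i = 0" if "i \<in> B" for i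
      using eqs0[OF that] by simp
    note we = sol_to_V2(1)[OF yw] and nd = nd2[OF sol_to_V2(2)[OF yw]]
    have dwe: "dw $ e = 0" using eqs[OF eB] we ae yw(2) by simp
    have d2: "res B' dy \<in> V2" "dw \<in> orth V2" using d dwe by (simp_all add: orth_V2_iff upd_self)
    have "res B' dy = 0 \<and> dw = 0"
    proof (rule nd[unfolded nondeg_def, rule_format, OF d2], intro conjI ballI allI impI)
      show "(a $ i + 2 * res B' y $ i * upd e w (s $ e) $ i) * res B' dy $ i + (res B' y $ i)\<^sup>2 * dw $ i = 0"
        if "i \<in> B'" for i using eqs[of i] that by (auto simp: res_nth upd_nth)
      show "dw $ i = 0" if "i \<notin> B'" for i using off[of i] dwe that by (cases "i = e") auto
    qed
    then have dw: "dw = 0" and "res B' dy = 0" by auto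
    from this(2) have res_dy: "res B' dy $ i = 0" for i by simp
    have "dy $ i = 0" if "i \<noteq> e" for i
      using res_dy[of i] VB[OF d(1), of i] that by (cases "i \<in> B") (auto simp: res_nth)
    then show "dy = 0 \<and> dw = 0" using only_e_zero[OF d(1)] dw by blast
  next
    fix y w :: "nat \<Rightarrow> complex^'n" and t
    assume yw: "\<And>k. y k \<in> V" "\<And>k. w k \<in> orth V" "\<And>k. (y k, w k, t k) \<in> ?Om"
      and lim: "(\<lambda>k. phi B (a + t k *s 0) (?m (y k) (t k)) (w k)) \<longlonglongrightarrow> s0"
    have "(\<lambda>k. phi B a (y k) (w k)) \<longlonglongrightarrow> s0" using lim by simp
    from sequence[OF yw(1,2) this] obtain r y0 w0 where
      r: "strict_mono (r :: nat \<Rightarrow> nat)" "(y \<circ> r) \<longlonglongrightarrow> y0" "(w \<circ> r) \<longlonglongrightarrow> w0" "(y0, w0) \<in> sol B V a s0" by blast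
    have "(\<lambda>k. norm ((y \<circ> r) k $ e)) \<longlonglongrightarrow> norm (y0 $ e)" by (intro tendsto_norm tendsto_vec_nth r(2))
    then have "\<delta> \<le> norm (y0 $ e)"
      by (rule LIMSEQ_le_const) (use yw(3) in \<open>auto intro: less_imp_le\<close>)
    then have "y0 $ e \<noteq> 0" using \<delta> by auto
    then have "\<delta> < norm (y0 $ e)" by (rule gap[OF r(4)])
    then show "\<exists>r y0 w0. strict_mono (r :: nat \<Rightarrow> nat) \<and> (y \<circ> r) \<longlonglongrightarrow> y0 \<and> (w \<circ> r) \<longlonglongrightarrow> w0 \<and> (y0, w0, 0) \<in> ?Om"
      using r by auto
  qed
  then have "\<exists>W. open W \<and> (s0, 0::complex) \<in> W \<and>
      (\<forall>(s', t)\<in>W. finite (large s') \<and> card (large s') = card (large s0))"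
    unfolding S by (rule conjunct2)
  then obtain W where W: "open W" "(s0, 0::complex) \<in> W"
    "\<forall>(s', t)\<in>W. finite (large s') \<and> card (large s') = card (large s0)" by (elim exE conjE)
  have W': "finite (large s') \<and> card (large s') = card (large s0)" if "s' \<in> (\<lambda>s'. (s', 0::complex)) -` W" for s'
    using bspec[OF W(3), of "(s', 0)"] that by simp
  have card_s0: "card (large s0) = card (sol B' V2 a s)"
    unfolding large_s0 by (rule bij_betw_same_card[OF bij_sol_V2])
  show ?thesis
  proof (intro exI[of _ "(\<lambda>s'. (s', 0::complex)) -` W"] conjI ballI)
    show "open ((\<lambda>s'. (s', 0::complex)) -` W)" by (rule open_vimage[OF W(1)]) (intro continuous_intros)
    show "s0 \<in> (\<lambda>s'. (s', 0::complex)) -` W" using W(2) by simp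
    fix s' assume "s' \<in> (\<lambda>s'. (s', 0::complex)) -` W"
    note Ws' = W'[OF this]
    show "finite (large s')" by (rule conjunct1[OF Ws'])
    show "card (large s') = card (sol B' V2 a s)" by (rule trans[OF conjunct2[OF Ws'] card_s0])
  qed
qed

lemma small_to_V1:
  assumes "(y, w) \<in> small s1 0"
  shows "(y - y $ e *s b, upd e w (s $ e)) \<in> sol B' V1 a s" "(y $ e)\<^sup>2 * w $ e = 1"
proof -
  have yw: "y \<in> V" "w \<in> orth V" and
    eq: "(if i \<in> B then a $ i * twist y 0 $ i + (twist y 0 $ i)\<^sup>2 * w $ i else w $ i) = s1 $ i" for i
    using assms by (auto simp: small_def phi_eq_iff)
  show "(y $ e)\<^sup>2 * w $ e = 1" using eq[of e] eB ae by (simp add: upd_nth twist_nth)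
  have "y - y $ e *s b \<in> V1" using V yw(1) b by (auto intro: vec.subspace_diff vec.subspace_scale)
  moreover have "(if i \<in> B' then a $ i * (y - y $ e *s b) $ i + ((y - y $ e *s b) $ i)\<^sup>2 * upd e w (s $ e) $ i
      else upd e w (s $ e) $ i) = s $ i" for i
    using eq[of i] eB by (cases "i = e"; cases "i \<in> B") (simp_all add: twist_nth upd_nth)
  ultimately show "(y - y $ e *s b, upd e w (s $ e)) \<in> sol B' V1 a s"
    using orth_V1[OF yw(2)] by (simp add: sol_def phi_eq_iff)
qed

text \<open>At \<open>t = 0\<close> the system decouples: off \<open>e\<close> it is the
  contraction, whose solution determines \<open>w_e\<close> through the lift, and at
  \<open>e\<close> it reads \<open>y_e\<^sup>2 w_e = 1\<close>. The two square roots are the factor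
  2 of the recursion.\<close>

lemma card_small_s1: "card (small s1 0) = 2 * card (sol B' V1 a s)"
proof -
  let ?\<mu> = "\<lambda>w. w $ e - bil b w"
  define h where "h = (\<lambda>((y, w), \<sigma>). (y + (\<sigma> / csqrt (?\<mu> w)) *s b, upd e w (?\<mu> w)))"
  have we: "w $ e = s $ e" if "(y, w) \<in> sol B' V1 a s" for y w
    using that by (auto simp: sol_def phi_eq_iff dest: spec[of _ e])
  have he: "(y + c *s b) $ e = c" if "(y, w) \<in> sol B' V1 a s" for y w c
    using that b(2) by (auto simp: sol_def)
  have "bij_betw h (sol B' V1 a s \<times> {1, -1}) (small s1 0)"
  proof (rule bij_betw_imageI)
    show "inj_on h (sol B' V1 a s \<times> {1, -1})"
    proof (rule inj_onI)
      fix p q assume p: "p \<in> sol B' V1 a s \<times> {1, -1}" and q: "q \<in> sol B' V1 a s \<times> {1, -1}" and eq: "h p = h q"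
      obtain y w \<sigma> where p': "p = ((y, w), \<sigma>)" by (metis surj_pair)
      obtain y' w' \<sigma>' where q': "q = ((y', w'), \<sigma>')" by (metis surj_pair)
      have pm: "(y, w) \<in> sol B' V1 a s" and qm: "(y', w') \<in> sol B' V1 a s" using p q by (auto simp: p' q')
      have eq1: "y + (\<sigma> / csqrt (?\<mu> w)) *s b = y' + (\<sigma>' / csqrt (?\<mu> w')) *s b"
        and eq2: "upd e w (?\<mu> w) = upd e w' (?\<mu> w')" using eq by (auto simp: h_def p' q')
      have "w $ i = w' $ i" for i
        using arg_cong[OF eq2, of "\<lambda>v. v $ i"] we[OF pm] we[OF qm] by (cases "i = e") (auto simp: upd_nth)
      then have w: "w = w'" by (simp add: vec_eq_iff)
      have c: "\<sigma> / csqrt (?\<mu> w) = \<sigma>' / csqrt (?\<mu> w')"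
        using arg_cong[OF eq1, of "\<lambda>v. v $ e"] unfolding he[OF pm] he[OF qm] .
      then have "\<sigma> = \<sigma>'" using avoid1[OF pm] by (simp add: w)
      moreover have "y = y'" using eq1 c by simp
      ultimately show "p = q" by (simp add: p' q' w)
    qed
    show "h ` (sol B' V1 a s \<times> {1, -1}) = small s1 0"
    proof (intro equalityI subsetI)
      fix x assume "x \<in> h ` (sol B' V1 a s \<times> {1, -1})"
      then obtain y w \<sigma> where yw: "(y, w) \<in> sol B' V1 a s" and \<sigma>: "\<sigma> \<in> {1, -1}"
        and x: "x = (y + (\<sigma> / csqrt (?\<mu> w)) *s b, upd e w (?\<mu> w))"
        unfolding h_def by auto
      define c where "c = \<sigma> / csqrt (?\<mu> w)"
      have "c\<^sup>2 = \<sigma>\<^sup>2 / ?\<mu> w" by (simp add: c_def power_divide)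
      then have c2: "c\<^sup>2 * ?\<mu> w = 1" using \<sigma> avoid1[OF yw] by auto
      have y: "y \<in> V" "y $ e = 0" and w: "w \<in> orth V1"
        and eq: "(if i \<in> B' then a $ i * y $ i + (y $ i)\<^sup>2 * w $ i else w $ i) = s $ i" for i
        using yw by (auto simp: sol_def phi_eq_iff)
      have tw: "twist (y + c *s b) 0 $ i = (if i = e then c else y $ i)" for i
        using y(2) b(2) by (simp add: twist_nth)
      have "(if i \<in> B then a $ i * twist (y + c *s b) 0 $ i + (twist (y + c *s b) 0 $ i)\<^sup>2 * upd e w (?\<mu> w) $ i
          else upd e w (?\<mu> w) $ i) = s1 $ i" for i
        unfolding tw using eq[of i] eB ae c2 by (cases "i = e"; cases "i \<in> B") (simp_all add: upd_nth)
      moreover have "y + c *s b \<in> V" using V y(1) b(1) by (intro vec.subspace_add vec.subspace_scale)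
      ultimately show "x \<in> small s1 0"
        using lift_orth_V1[OF w] \<delta> unfolding x c_def[symmetric] by (simp add: small_def phi_eq_iff)
    next
      fix x assume "x \<in> small s1 0"
      then obtain y w where x: "x = (y, w)" and yw: "(y, w) \<in> small s1 0" by (cases x) auto
      let ?c = "y $ e" and ?w' = "upd e w (s $ e)"
      have w: "w \<in> orth V" using yw by (simp add: small_def)
      have \<mu>: "?\<mu> ?w' = w $ e" by (rule lift_upd[OF w])
      have c2: "?c\<^sup>2 * w $ e = 1" by (rule small_to_V1(2)[OF yw])
      then have nz: "csqrt (w $ e) \<noteq> 0" by auto
      have "(?c * csqrt (w $ e))\<^sup>2 = 1" using c2 by (simp add: power_mult_distrib)
      then have \<sigma>: "?c * csqrt (w $ e) \<in> {1, -1}" by (simp add: power2_eq_1_iff)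
      have "h ((y - ?c *s b, ?w'), ?c * csqrt (w $ e)) = x"
        unfolding h_def x using nz by (simp add: \<mu> upd_upd upd_self)
      then show "x \<in> h ` (sol B' V1 a s \<times> {1, -1})"
        using small_to_V1(1)[OF yw] \<sigma> by (intro image_eqI[of _ _ "((y - ?c *s b, ?w'), ?c * csqrt (w $ e))"]) auto
    qed
  qed
  from bij_betw_same_card[OF this] show ?thesis by (simp add: card_cartesian_product)
qed

text \<open>Nondegeneracy at \<open>t = 0\<close> is that of the contraction together with
  \<open>2 y_e w_e dy_e = 0\<close>. For properness, undoing the rescaling gives pairs
  \<open>(Y, w)\<close> whose values tend to \<open>s0\<close>; they subconverge by
  \<open>sequence\<close>, and the gap forces the limit to have coordinate 0 at \<open>e\<close>.
  The rescaled \<open>y_e\<close> stays bounded because its square is a convergent sequence divided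
  by \<open>w_e\<close>, whose limit is nonzero by \<open>ye0_we\<close>.\<close>

lemma small_locally_constant:
  "\<exists>W. open W \<and> (s1, 0) \<in> W \<and> (\<forall>(s', t)\<in>W. finite (small s' t) \<and> card (small s' t) = 2 * card (sol B' V1 a s))"
proof -
  let ?Om = "{(y, w, t). norm (t * y $ e) < \<delta>} :: ((complex^'n) \<times> (complex^'n) \<times> complex) set"
  let ?m = "\<lambda>y t. y + (t - 1) *s (E *v y)"
  let ?S = "\<lambda>s' t. {(y, w). y \<in> V \<and> w \<in> orth V \<and> (y, w, t) \<in> ?Om \<and> phi B (a + t *s 0) (?m y t) w = s'}"
  have S: "?S s' t = small s' t" for s' t by (auto simp: small_def twist_def)
  have "open ?Om"
    unfolding case_prod_unfold by (intro open_Collect_less continuous_intros)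
  have "finite (?S s1 0) \<and> (\<exists>W. open W \<and> (s1, 0) \<in> W \<and>
    (\<forall>(s', t)\<in>W. finite (?S s' t) \<and> card (?S s' t) = card (?S s1 0)))"
  proof (rule solution_count_locally_constant[OF V \<open>open ?Om\<close>])
    fix y w dy dw assume "(y, w) \<in> ?S s1 0"
    then have yw: "(y, w) \<in> small s1 0" unfolding S .
    assume d: "dy \<in> V" "dw \<in> orth V"
      and eqs0: "\<And>i. i \<in> B \<Longrightarrow> ((a + 0 *s 0) $ i + 2 * ?m y 0 $ i * w $ i) * ?m dy 0 $ i + (?m y 0 $ i)\<^sup>2 * dw $ i = 0"
      and off: "\<And>i. i \<notin> B \<Longrightarrow> dw $ i = 0"
    have eqs: "(a $ i + 2 * twist y 0 $ i * w $ i) * twist dy 0 $ i + (twist y 0 $ i)\<^sup>2 * dw $ i = 0" if "i \<in> B" for i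
      using eqs0[OF that] by (simp add: twist_def)
    have "dy - dy $ e *s b \<in> V1" using V d(1) b by (auto intro: vec.subspace_diff vec.subspace_scale)
    note d1 = this orth_V1[OF d(2), of 0]
    have "dy - dy $ e *s b = 0 \<and> upd e dw 0 = 0"
    proof (rule nd1[OF small_to_V1(1)[OF yw], unfolded nondeg_def, rule_format, OF d1], intro conjI ballI allI impI)
      show "(a $ i + 2 * (y - y $ e *s b) $ i * upd e w (s $ e) $ i) * (dy - dy $ e *s b) $ i
          + ((y - y $ e *s b) $ i)\<^sup>2 * upd e dw 0 $ i = 0" if "i \<in> B'" for i
        using eqs[of i] that by (simp add: twist_at_0 upd_nth)
      show "upd e dw 0 $ i = 0" if "i \<notin> B'" for i using off[of i] that by (auto simp: upd_nth)
    qed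
    then have 1: "dy = dy $ e *s b" and 2: "upd e dw 0 = 0" by auto
    have "dw $ i = 0" if "i \<noteq> e" for i using arg_cong[OF 2, of "\<lambda>v. v $ i"] that by (simp add: upd_nth)
    then have dw: "dw = 0" using only_e_zero_orth[OF d(2)] by blast
    have "2 * y $ e * w $ e * dy $ e = 0" using eqs[OF eB] ae by (simp add: twist_nth dw)
    moreover have "y $ e \<noteq> 0" "w $ e \<noteq> 0" using small_to_V1(2)[OF yw] by auto
    ultimately have "dy $ e = 0" by simp
    then have "dy = 0" using 1 by simp
    then show "dy = 0 \<and> dw = 0" using dw by simp
  next
    fix y w :: "nat \<Rightarrow> complex^'n" and t
    assume yw: "\<And>k. y k \<in> V" "\<And>k. w k \<in> orth V" "\<And>k. (y k, w k, t k) \<in> ?Om"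
      and lim0: "(\<lambda>k. phi B (a + t k *s 0) (?m (y k) (t k)) (w k)) \<longlonglongrightarrow> s1" and t: "t \<longlonglongrightarrow> 0"
    define \<sigma> where "\<sigma> k = phi B a (twist (y k) (t k)) (w k)" for k
    have \<sigma>: "\<sigma> \<longlonglongrightarrow> s1" using lim0 by (simp add: \<sigma>_def[abs_def] twist_def)
    define Y where "Y k = y k + ((t k - 1) * y k $ e) *s b" for k
    have YV: "Y k \<in> V" for k unfolding Y_def using V yw(1) b(1) by (intro vec.subspace_add vec.subspace_scale)
    have "(\<lambda>k. upd e (\<sigma> k) ((t k)\<^sup>2 * \<sigma> k $ e)) \<longlonglongrightarrow> upd e s1 (0\<^sup>2 * s1 $ e)"
      by (intro tendsto_upd tendsto_mult tendsto_power tendsto_vec_nth \<sigma> t)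
    then have "(\<lambda>k. phi B a (Y k) (w k)) \<longlonglongrightarrow> s0" by (simp add: Y_def phi_twist \<sigma>_def upd_upd)
    from sequence[OF YV yw(2) this] obtain r y0 w0 where
      r: "strict_mono (r :: nat \<Rightarrow> nat)" "(Y \<circ> r) \<longlonglongrightarrow> y0" "(w \<circ> r) \<longlonglongrightarrow> w0" "(y0, w0) \<in> sol B V a s0" by blast
    have Ye: "Y k $ e = t k * y k $ e" for k using b(2) by (simp add: Y_def algebra_simps)
    have "(\<lambda>k. norm ((Y \<circ> r) k $ e)) \<longlonglongrightarrow> norm (y0 $ e)" by (intro tendsto_norm tendsto_vec_nth r(2))
    then have "norm (y0 $ e) \<le> \<delta>"
      by (rule LIMSEQ_le_const2) (use yw(3) in \<open>auto simp: Ye intro: less_imp_le\<close>)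
    then have "y0 $ e = 0" using gap[OF r(4)] by auto
    then have w0e: "w0 $ e \<noteq> 0" by (rule ye0_we[OF r(4)])
    have we: "(\<lambda>k. w (r k) $ e) \<longlonglongrightarrow> w0 $ e" using tendsto_vec_nth[OF r(3), of e] by (simp add: o_def)
    have "(\<lambda>k. \<sigma> (r k) $ e / w (r k) $ e) \<longlonglongrightarrow> 1 / w0 $ e"
      using tendsto_divide[OF tendsto_vec_nth[OF LIMSEQ_subseq_LIMSEQ[OF \<sigma> r(1)], of e] we w0e]
      by (simp add: o_def upd_nth)
    moreover have "\<forall>\<^sub>F k in sequentially. \<sigma> (r k) $ e / w (r k) $ e = (y (r k) $ e)\<^sup>2"
      using tendsto_imp_eventually_ne[OF we w0e]
      by eventually_elim (use eB ae in \<open>simp add: \<sigma>_def phi_def twist_nth\<close>)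
    ultimately have "(\<lambda>k. (y (r k) $ e)\<^sup>2) \<longlonglongrightarrow> 1 / w0 $ e" by (simp add: tendsto_cong)
    then have "Bseq (\<lambda>k. (y (r k) $ e)\<^sup>2)" using convergentI convergent_imp_Bseq by blast
    then obtain C where C: "C > 0" "\<And>k. norm ((y (r k) $ e)\<^sup>2) \<le> C" by (auto simp: Bseq_def)
    have "norm (y (r k) $ e) \<le> sqrt C" for k
      using C(2)[of k] by (intro real_le_rsqrt) (simp add: norm_power)
    then have "bounded (range (\<lambda>k. y (r k) $ e))" by (intro boundedI[of _ "sqrt C"]) auto
    then obtain u q where q: "strict_mono (q :: nat \<Rightarrow> nat)" "((\<lambda>k. y (r k) $ e) \<circ> q) \<longlonglongrightarrow> u"
      using bounded_imp_convergent_subsequence by blast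
    have rq: "strict_mono (r \<circ> q)" using r(1) q(1) by (rule strict_mono_o)
    have Yq: "(\<lambda>k. Y (r (q k))) \<longlonglongrightarrow> y0" and wq: "(w \<circ> (r \<circ> q)) \<longlonglongrightarrow> w0"
      using LIMSEQ_subseq_LIMSEQ[OF r(2) q(1)] LIMSEQ_subseq_LIMSEQ[OF r(3) q(1)] by (simp_all add: o_def)
    have tq: "(\<lambda>k. t (r (q k))) \<longlonglongrightarrow> 0" using LIMSEQ_subseq_LIMSEQ[OF t rq] by (simp add: o_def)
    have uq: "(\<lambda>k. y (r (q k)) $ e) \<longlonglongrightarrow> u" using q(2) by (simp add: o_def)
    have "(\<lambda>k. Y (r (q k)) $ i - (t (r (q k)) - 1) * y (r (q k)) $ e * b $ i) \<longlonglongrightarrow> y0 $ i - (0 - 1) * u * b $ i" for i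
      by (intro tendsto_diff tendsto_mult tendsto_vec_nth[OF Yq] tq uq tendsto_const)
    then have "(y \<circ> (r \<circ> q)) \<longlonglongrightarrow> y0 + u *s b"
      by (intro vec_tendstoI) (simp add: Y_def)
    then show "\<exists>r y0 w0. strict_mono (r :: nat \<Rightarrow> nat) \<and> (y \<circ> r) \<longlonglongrightarrow> y0 \<and> (w \<circ> r) \<longlonglongrightarrow> w0 \<and> (y0, w0, 0) \<in> ?Om"
      using rq wq \<delta> by (intro exI[of _ "r \<circ> q"] exI[of _ "y0 + u *s b"] exI[of _ w0]) auto
  qed
  then show ?thesis unfolding S card_small_s1 by (rule conjunct2)
qed

lemma no_boundary: "\<exists>W. open W \<and> s0 \<in> W \<and> (\<forall>s'\<in>W. \<forall>(y, w)\<in>sol B V a s'. norm (y $ e) \<noteq> \<delta>)"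
proof (rule ccontr)
  assume contr: "\<not> ?thesis"
  have "\<forall>n. \<exists>p. fst p \<in> V \<and> snd p \<in> orth V \<and> norm (fst p $ e) = \<delta> \<and> dist (phi B a (fst p) (snd p)) s0 < inverse (real (Suc n))"
  proof
    fix n
    have "\<not> (\<forall>s'\<in>ball s0 (inverse (real (Suc n))). \<forall>(y, w)\<in>sol B V a s'. norm (y $ e) \<noteq> \<delta>)"
      using contr by (metis open_ball centre_in_ball inverse_positive_iff_positive of_nat_0_less_iff zero_less_Suc)
    then obtain y w where "y \<in> V" "w \<in> orth V" "norm (y $ e) = \<delta>" "phi B a y w \<in> ball s0 (inverse (real (Suc n)))"
      by (auto simp: sol_def)
    then show "\<exists>p. fst p \<in> V \<and> snd p \<in> orth V \<and> norm (fst p $ e) = \<delta> \<and> dist (phi B a (fst p) (snd p)) s0 < inverse (real (Suc n))"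
      by (intro exI[of _ "(y, w)"]) (simp add: dist_commute)
  qed
  from choice[OF this] obtain p where p: "\<forall>n. fst (p n) \<in> V \<and> snd (p n) \<in> orth V \<and> norm (fst (p n) $ e) = \<delta>
      \<and> dist (phi B a (fst (p n)) (snd (p n))) s0 < inverse (real (Suc n))" ..
  have "(\<lambda>n. phi B a (fst (p n)) (snd (p n))) \<longlonglongrightarrow> s0"
  proof (subst tendsto_dist_iff, rule Lim_null_comparison[OF always_eventually LIMSEQ_inverse_real_of_nat], intro allI)
    fix n
    have "dist (phi B a (fst (p n)) (snd (p n))) s0 < inverse (real (Suc n))" using p by blast
    then show "norm (dist (phi B a (fst (p n)) (snd (p n))) s0) \<le> inverse (real (Suc n))" by simp
  qed
  from sequence[OF _ _ this] p obtain r y0 w0 where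
    r: "strict_mono (r :: nat \<Rightarrow> nat)" "((\<lambda>n. fst (p n)) \<circ> r) \<longlonglongrightarrow> y0" "(y0, w0) \<in> sol B V a s0" by blast
  have "(\<lambda>k. norm (((\<lambda>n. fst (p n)) \<circ> r) k $ e)) \<longlonglongrightarrow> norm (y0 $ e)" by (intro tendsto_norm tendsto_vec_nth r(2))
  then have "norm (y0 $ e) = \<delta>" using p by (simp add: LIMSEQ_const_iff)
  then show False using gap[OF r(3)] \<delta> by auto
qed

text \<open>A value with \<open>s_e = \<epsilon>\<^sup>2\<close>, small enough for all three
  neighbourhoods, is moved slightly to a generic one. Its solutions are the large ones and those
  with \<open>norm (y_e) < \<delta>\<close>, and the latter are the rescaled solutions at the
  parameter \<open>\<epsilon>\<close>.\<close>

lemma gcount_sum: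
  assumes "gcount B V a d"
  shows "d = card (sol B' V2 a s) + 2 * card (sol B' V1 a s)"
proof -
  obtain W1 where W1: "open W1" "(s1, 0) \<in> W1"
    "\<And>s' t. (s', t) \<in> W1 \<Longrightarrow> finite (small s' t) \<and> card (small s' t) = 2 * card (sol B' V1 a s)"
    using small_locally_constant by (elim exE conjE) (rule that, auto)
  obtain W2 where W2: "open W2" "s0 \<in> W2" "\<And>s'. s' \<in> W2 \<Longrightarrow> finite (large s') \<and> card (large s') = card (sol B' V2 a s)"
    using large_locally_constant by (elim exE conjE) (rule that, auto)
  obtain W3 where W3: "open W3" "s0 \<in> W3" "\<And>s' y w. s' \<in> W3 \<Longrightarrow> (y, w) \<in> sol B V a s' \<Longrightarrow> norm (y $ e) \<noteq> \<delta>"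
    using no_boundary by (elim exE conjE) (rule that, auto)
  have o1: "open ((\<lambda>\<epsilon>. (s1, \<epsilon>)) -` W1)" by (rule open_vimage[OF W1(1)]) (intro continuous_intros)
  have c: "continuous_on UNIV (\<lambda>\<epsilon>. upd e s (\<epsilon>\<^sup>2))" by (intro continuous_on_upd continuous_intros)
  let ?O = "(\<lambda>\<epsilon>. (s1, \<epsilon>)) -` W1 \<inter> (\<lambda>\<epsilon>. upd e s (\<epsilon>\<^sup>2)) -` (W2 \<inter> W3)"
  have "open ?O" by (intro open_Int o1 open_vimage[OF _ c] W2 W3)
  moreover have "0 \<in> ?O" using W1(2) W2(2) W3(2) by simp
  ultimately obtain \<rho> where \<rho>: "\<rho> > 0" "ball 0 \<rho> \<subseteq> ?O" unfolding open_contains_ball by blast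
  define \<epsilon> where "\<epsilon> = complex_of_real (\<rho> / 2)"
  have \<epsilon>nz: "\<epsilon> \<noteq> 0" using \<rho>(1) by (simp add: \<epsilon>_def)
  have "\<epsilon> \<in> ball 0 \<rho>" using \<rho>(1) by (simp add: \<epsilon>_def)
  then have \<epsilon>O: "\<epsilon> \<in> ?O" using \<rho>(2) by blast
  \<comment> \<open>The rescaled right-hand side. At \<open>upd e s (\<epsilon>\<^sup>2)\<close> it
    equals \<open>s1\<close>, so it stays in the neighbourhood for nearby \<open>s'\<close>.\<close>
  let ?u = "\<lambda>s'. upd e s' (s' $ e / \<epsilon>\<^sup>2)"
  let ?P = "(\<lambda>s'. (?u s', \<epsilon>)) -` W1 \<inter> (W2 \<inter> W3)"
  have "continuous_on UNIV (\<lambda>s'. (?u s', \<epsilon>))"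
    using \<epsilon>nz by (intro continuous_intros continuous_on_upd) auto
  then have P_open: "open ?P" by (intro open_Int open_vimage W1 W2 W3)
  have P_mem: "upd e s (\<epsilon>\<^sup>2) \<in> ?P" using \<epsilon>O \<epsilon>nz by (simp add: upd_upd upd_nth)
  obtain s' where s': "s' \<in> ?P" "finite (sol B V a s') \<and> card (sol B V a s') = d
     \<and> (\<forall>(y, w)\<in>sol B V a s'. nondeg B V a y w)"
    by (rule generic_dense[OF assms[unfolded gcount_def] P_open P_mem])
  let ?Q = "{(y, w)\<in>sol B V a s'. norm (y $ e) < \<delta>}"
  have split: "sol B V a s' = large s' \<union> ?Q"
    using W3(3) s'(1) by (auto simp: large_def) (metis linorder_neqE)
  have "bij_betw (\<lambda>(y, w). (y + ((\<epsilon> - 1) * y $ e) *s b, w)) (small (?u s') \<epsilon>) ?Q"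
  proof (rule bij_betw_byWitness[where f' = "\<lambda>(y, w). (y - ((\<epsilon> - 1) / \<epsilon> * y $ e) *s b, w)"])
    have Ye: "(y + ((\<epsilon> - 1) * y $ e) *s b) $ e = \<epsilon> * y $ e" and Ye': "(y - ((\<epsilon> - 1) / \<epsilon> * y $ e) *s b) $ e = y $ e / \<epsilon>" for y
      using b(2) \<epsilon>nz by (simp_all add: field_simps)
    show "\<forall>p\<in>small (?u s') \<epsilon>. (\<lambda>(y, w). (y - ((\<epsilon> - 1) / \<epsilon> * y $ e) *s b, w))
        ((\<lambda>(y, w). (y + ((\<epsilon> - 1) * y $ e) *s b, w)) p) = p"
      using \<epsilon>nz b(2) by (auto simp: vec_eq_iff field_simps)
    show "\<forall>p\<in>?Q. (\<lambda>(y, w). (y + ((\<epsilon> - 1) * y $ e) *s b, w))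
        ((\<lambda>(y, w). (y - ((\<epsilon> - 1) / \<epsilon> * y $ e) *s b, w)) p) = p"
      using \<epsilon>nz b(2) by (auto simp: vec_eq_iff field_simps)
    show "(\<lambda>(y, w). (y + ((\<epsilon> - 1) * y $ e) *s b, w)) ` small (?u s') \<epsilon> \<subseteq> ?Q"
    proof clarify
      fix y w assume yw: "(y, w) \<in> small (?u s') \<epsilon>"
      have "y + ((\<epsilon> - 1) * y $ e) *s b \<in> V"
        using yw V b(1) by (intro vec.subspace_add vec.subspace_scale) (auto simp: small_def)
      moreover have "phi B a (y + ((\<epsilon> - 1) * y $ e) *s b) w = s'"
        using yw \<epsilon>nz unfolding phi_twist by (simp add: small_def upd_upd upd_nth upd_self)
      ultimately show "(y + ((\<epsilon> - 1) * y $ e) *s b, w) \<in> sol B V a s' \<and> norm ((y + ((\<epsilon> - 1) * y $ e) *s b) $ e) < \<delta>"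
        using yw unfolding Ye by (simp add: small_def sol_def)
    qed
    show "(\<lambda>(y, w). (y - ((\<epsilon> - 1) / \<epsilon> * y $ e) *s b, w)) ` ?Q \<subseteq> small (?u s') \<epsilon>"
    proof clarify
      fix Y w assume Yw: "(Y, w) \<in> sol B V a s'" "norm (Y $ e) < \<delta>"
      define y where "y = Y - ((\<epsilon> - 1) / \<epsilon> * Y $ e) *s b"
      have ye: "y $ e = Y $ e / \<epsilon>" unfolding y_def by (rule Ye')
      have Y: "Y = y + ((\<epsilon> - 1) * y $ e) *s b" unfolding ye by (simp add: y_def)
      have "y \<in> V" unfolding y_def using Yw V b(1) by (intro vec.subspace_diff vec.subspace_scale) (auto simp: sol_def)
      moreover have "upd e (phi B a (twist y \<epsilon>) w) (\<epsilon>\<^sup>2 * phi B a (twist y \<epsilon>) w $ e) = s'"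
        using Yw(1) unfolding phi_twist[symmetric] Y[symmetric] by (simp add: sol_def)
      then have comp: "upd e (phi B a (twist y \<epsilon>) w) (\<epsilon>\<^sup>2 * phi B a (twist y \<epsilon>) w $ e) $ i = s' $ i" for i by simp
      have "phi B a (twist y \<epsilon>) w $ i = ?u s' $ i" for i
        using \<epsilon>nz comp[of i] by (cases "i = e") (auto simp: upd_nth nonzero_eq_divide_eq mult.commute split: if_splits)
      then have "phi B a (twist y \<epsilon>) w = ?u s'" by (simp add: vec_eq_iff)
      ultimately show "(y, w) \<in> small (?u s') \<epsilon>" using Yw \<epsilon>nz by (simp add: small_def sol_def ye)
    qed
  qed
  from bij_betw_same_card[OF this] bij_betw_finite[OF this]
  have "card ?Q = 2 * card (sol B' V1 a s)" "finite ?Q" using W1(3)[of "?u s'" \<epsilon>] s'(1) by auto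
  moreover have "large s' \<inter> ?Q = {}" by (auto simp: large_def)
  ultimately have "card (sol B V a s') = card (sol B' V2 a s) + 2 * card (sol B' V1 a s)"
    using W2(3)[of s'] s'(1) by (subst split, subst card_Un_disjoint) auto
  then show ?thesis using s'(2) by simp
qed

end

end

theorem gcount_deletion_contraction:
  fixes V :: "(complex^'n) set"
  assumes sup: "supported B V" and eB: "e \<in> B" and b: "b \<in> V" "b $ e = 1" and coloop: "axis e 1 \<notin> V"
    and \<alpha>: "weights V \<alpha>" "\<alpha> $ e = 0"
    and d: "gcount B V (cvec \<alpha>) d" and d1: "gcount (B - {e}) {v\<in>V. v $ e = 0} (cvec \<alpha>) d1"
    and d2: "gcount (B - {e}) (res (B - {e}) ` V) (cvec \<alpha>) d2"
  shows "d = d2 + 2 * d1"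
proof -
  let ?V1 = "{v\<in>V. v $ e = 0}" and ?V2 = "res (B - {e}) ` V" and ?a = "cvec \<alpha>" and ?B = "B - {e}"
  have V: "vec.subspace V" and VB: "\<And>v i. v \<in> V \<Longrightarrow> i \<notin> B \<Longrightarrow> v $ i = 0" using sup by (auto simp: supported_def)
  have V1: "vec.subspace ?V1" using V by (auto simp: vec.subspace_def)
  \<comment> \<open>Otherwise \<open>b - res ?B b\<close>, the axis of \<open>e\<close>, would lie
    in \<open>V\<close>. So some functional \<open>c\<close> vanishes on the contraction but not on
    \<open>res ?B b\<close>; avoiding its zeros yields \<open>avoid2\<close>.\<close>
  have "res ?B b \<notin> ?V1"
  proof
    assume "res ?B b \<in> ?V1"
    then have "b - res ?B b \<in> V" using V b(1) by (auto intro: vec.subspace_diff)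
    moreover have "b - res ?B b = axis e 1" using b VB[OF b(1)] by (auto simp: vec_eq_iff res_nth axis_def)
    ultimately show False using coloop by simp
  qed
  then have "res ?B b \<notin> orth (orth ?V1)" using orth_orth[OF V1] by simp
  then obtain c where c: "c \<in> orth ?V1" "bil c (res ?B b) \<noteq> 0" unfolding orth_def[of "orth ?V1"] by blast
  have g2: "generic (\<lambda>s. \<forall>(y, w)\<in>sol ?B ?V2 ?a s. bil y c + bil w 0 \<noteq> 0)"
    by (rule generic_avoid_linear[of _ "res ?B b" 0])
      (use V b(1) c(2) in \<open>auto simp: subspace_res bil_zero bil_commute orth_def\<close>)
  \<comment> \<open>Some \<open>w0\<close> orthogonal to \<open>V\<close> is nonzero at
    \<open>e\<close>. As it is orthogonal to \<open>b\<close>, the linear form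
    \<open>w $ e - bil b w\<close> of \<open>avoid1\<close> does not vanish at
    \<open>w0\<close>.\<close>
  have "axis e 1 \<notin> orth (orth V)" using coloop orth_orth[OF V] by simp
  then obtain w0 where w0: "w0 \<in> orth V" "bil w0 (axis e 1) \<noteq> 0" unfolding orth_def[of "orth V"] by blast
  have bw0: "bil w0 b = 0" using w0(1) b(1) by (simp add: orth_def bil_commute)
  have "w0 \<in> orth ?V1" using w0(1) by (auto simp: orth_def)
  then have g1: "generic (\<lambda>s. \<forall>(y, w)\<in>sol ?B ?V1 ?a s. bil y 0 + bil w (axis e 1 - b) \<noteq> 0)"
    by (intro generic_avoid_linear[OF V1, of 0 w0])
      (use V1 w0(2) bw0 in \<open>auto simp: bil_zero bil_diff_right vec.subspace_0[OF V]\<close>)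
  have "generic (\<lambda>s. no_degeneration V {} s \<and> (\<forall>i\<in>B. s $ i \<noteq> 0) \<and>
      (\<forall>(y, w)\<in>sol ?B ?V2 ?a s. bil y c + bil w 0 \<noteq> 0) \<and>
      (\<forall>(y, w)\<in>sol ?B ?V1 ?a s. bil y 0 + bil w (axis e 1 - b) \<noteq> 0) \<and>
      (finite (sol ?B ?V1 ?a s) \<and> card (sol ?B ?V1 ?a s) = d1 \<and> (\<forall>(y, w)\<in>sol ?B ?V1 ?a s. nondeg ?B ?V1 ?a y w)) \<and>
      (finite (sol ?B ?V2 ?a s) \<and> card (sol ?B ?V2 ?a s) = d2 \<and> (\<forall>(y, w)\<in>sol ?B ?V2 ?a s. nondeg ?B ?V2 ?a y w)))"
    by (intro generic_conj generic_no_degeneration[OF V] generic_nth_nonzero g1 g2 d1[unfolded gcount_def] d2[unfolded gcount_def])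
  then obtain s where s: "no_degeneration V {} s" "\<forall>i\<in>B. s $ i \<noteq> 0"
      "\<forall>(y, w)\<in>sol ?B ?V2 ?a s. bil y c + bil w 0 \<noteq> 0"
      "\<forall>(y, w)\<in>sol ?B ?V1 ?a s. bil y 0 + bil w (axis e 1 - b) \<noteq> 0"
      "finite (sol ?B ?V1 ?a s) \<and> card (sol ?B ?V1 ?a s) = d1 \<and> (\<forall>(y, w)\<in>sol ?B ?V1 ?a s. nondeg ?B ?V1 ?a y w)"
      "finite (sol ?B ?V2 ?a s) \<and> card (sol ?B ?V2 ?a s) = d2 \<and> (\<forall>(y, w)\<in>sol ?B ?V2 ?a s. nondeg ?B ?V2 ?a y w)"
    by (rule generic_dense[OF _ open_UNIV UNIV_I]) (rule that; elim conjE; (intro conjI)?; assumption)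
  have av1: "w $ e - bil b w \<noteq> 0" if "(y, w) \<in> sol ?B ?V1 ?a s" for y w
    using bspec[OF s(4) that] by (simp add: bil_zero bil_diff_right bil_axis bil_commute)
  have av2: "y \<notin> ?V1" if "(y, w) \<in> sol ?B ?V2 ?a s" for y w
    using bspec[OF s(3) that] c(1) by (auto simp: bil_zero orth_def)
  have snz: "s $ i \<noteq> 0" if "i \<in> B" for i using s(2) that ..
  note fin1 = conjunct1[OF s(5)] and fin2 = conjunct1[OF s(6)]
    and card1 = conjunct1[OF conjunct2[OF s(5)]] and card2 = conjunct1[OF conjunct2[OF s(6)]]
  have nd1: "nondeg ?B ?V1 ?a y w" if "(y, w) \<in> sol ?B ?V1 ?a s" for y w
    using bspec[OF conjunct2[OF conjunct2[OF s(5)]] that] by simp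
  have nd2: "nondeg ?B ?V2 ?a y w" if "(y, w) \<in> sol ?B ?V2 ?a s" for y w
    using bspec[OF conjunct2[OF conjunct2[OF s(6)]] that] by simp
  interpret deletion_contraction B V \<alpha> e b s
    by unfold_locales (fact sup eB b coloop \<alpha> s(1) snz fin1 nd1 fin2 nd2 av1 av2)+
  obtain \<delta> where \<delta>: "\<delta> > 0" "\<And>y w. (y, w) \<in> sol B V a s0 \<Longrightarrow> y $ e \<noteq> 0 \<Longrightarrow> \<delta> < norm (y $ e)"
    using gap by blast
  show ?thesis using gcount_sum[OF \<delta> d] unfolding card1 card2 .
qed

section \<open>The characteristic polynomial\<close>

text \<open>For \<open>B = UNIV\<close> this is \<open>(- 2) ^ r\<close> times the characteristic
  polynomial at 1/2, with denominators cleared and ranks written as dimensions of projections; it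
  also makes sense for the minors inside the ambient space.\<close>

definition rank_sum :: "'n set \<Rightarrow> (complex^'n) set \<Rightarrow> int" where
  "rank_sum B V = (- 1) ^ vec.dim V * (\<Sum>A\<in>Pow B. (- 1) ^ card A * 2 ^ vec.dim (res A ` V))"

lemma sum_Pow_insert:
  fixes g :: "'a set \<Rightarrow> int"
  assumes "finite B" "e \<notin> B"
  shows "(\<Sum>A\<in>Pow (insert e B). g A) = (\<Sum>A\<in>Pow B. g A + g (insert e A))"
proof -
  have inj: "inj_on (insert e) (Pow B)" using assms(2) by (auto simp: inj_on_def)
  have "(\<Sum>A\<in>Pow (insert e B). g A) = (\<Sum>A\<in>Pow B. g A) + (\<Sum>A\<in>insert e ` Pow B. g A)"
    unfolding Pow_insert using assms by (intro sum.union_disjoint) auto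
  then show ?thesis by (simp add: sum.reindex[OF inj] sum.distrib)
qed

lemma res_res: "res A (res B v) = res (A \<inter> B) v"
  by (simp add: vec_eq_iff res_nth)

lemma inj_on_res:
  assumes W: "vec.subspace W" and "\<And>x. x \<in> W \<Longrightarrow> res A x = 0 \<Longrightarrow> x = 0"
  shows "inj_on (res A) (vec.span W)"
proof (rule inj_onI)
  fix x y assume "x \<in> vec.span W" "y \<in> vec.span W" and eq: "res A x = res A y"
  then have "x - y \<in> W" using W vec.span_eq_iff vec.subspace_diff by metis
  moreover have "res A (x - y) = res A x - res A y" by (simp add: vec_eq_iff res_nth)
  ultimately show "x = y" using assms(2)[of "x - y"] eq by simp
qed

lemma dim_res_le: "A \<subseteq> B \<Longrightarrow> vec.dim (res A ` V) \<le> vec.dim (res B ` V)"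
proof -
  assume "A \<subseteq> B"
  then have "res A ` V = res A ` (res B ` V)" by (simp add: image_image res_res Int_absorb2)
  then show ?thesis using vec.dim_image_le[OF linear_res] by metis
qed

lemma dim_hyperplane_section:
  fixes W :: "(complex^'n) set"
  assumes W: "vec.subspace W" and w: "w \<in> W" "w $ e \<noteq> 0"
  shows "vec.dim W = Suc (vec.dim {v\<in>W. v $ e = 0})"
proof -
  let ?H = "{v\<in>W. v $ e = 0}"
  have H: "vec.subspace ?H" using W by (auto simp: vec.subspace_def)
  then have spanH: "vec.span ?H = ?H" by (simp add: vec.span_eq_iff)
  have "W \<subseteq> vec.span (insert w ?H)"
  proof
    fix v assume v: "v \<in> W"
    have "v - (v $ e / w $ e) *s w \<in> ?H"
      using W v w by (auto intro: vec.subspace_diff vec.subspace_scale)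
    then show "v \<in> vec.span (insert w ?H)" unfolding vec.span_insert spanH by blast
  qed
  moreover have "vec.span (insert w ?H) \<subseteq> W" using W w by (intro vec.span_minimal) auto
  ultimately have "vec.dim W = vec.dim (insert w ?H)" by (metis subset_antisym vec.dim_span)
  then show ?thesis using w(2) by (simp add: vec.dim_insert spanH)
qed

lemma dim_coordinate_subspace: "vec.dim {v :: complex^'n. \<forall>i. i \<notin> A \<longrightarrow> v $ i = 0} = card A"
proof -
  let ?b = "(\<lambda>i. axis i 1) ` A :: (complex^'n) set"
  have "?b \<subseteq> cart_basis" by (auto simp: cart_basis_def)
  then have ind: "vec.independent ?b" using independent_cart_basis vec.independent_mono by blast
  have sub: "vec.subspace {v :: complex^'n. \<forall>i. i \<notin> A \<longrightarrow> v $ i = 0}" by (simp add: vec.subspace_def)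
  have "{v :: complex^'n. \<forall>i. i \<notin> A \<longrightarrow> v $ i = 0} \<subseteq> vec.span ?b"
  proof
    fix v :: "complex^'n" assume v: "v \<in> {v. \<forall>i. i \<notin> A \<longrightarrow> v $ i = 0}"
    have "v = (\<Sum>i\<in>A. v $ i *s axis i 1)"
      using v by (auto simp: vec_eq_iff sum_component axis_def if_distrib[of "(*) _"] cong: if_cong)
    moreover have "(\<Sum>i\<in>A. v $ i *s axis i 1) \<in> vec.span ?b"
      by (intro vec.span_sum vec.span_scale vec.span_base) auto
    ultimately show "v \<in> vec.span ?b" by simp
  qed
  moreover have "?b \<subseteq> {v. \<forall>i. i \<notin> A \<longrightarrow> v $ i = 0}" by (auto simp: axis_def)
  ultimately have "vec.dim {v :: complex^'n. \<forall>i. i \<notin> A \<longrightarrow> v $ i = 0} = card ?b"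
    using ind by (intro vec.dim_unique) auto
  also have "card ?b = card A" by (intro card_image) (auto simp: inj_on_def axis_eq_axis)
  finally show ?thesis .
qed

text \<open>Toggling the loop changes the sign of a term but not its rank, so the terms cancel in
  pairs.\<close>

lemma rank_sum_loop:
  fixes V :: "(complex^'n) set"
  assumes "e \<in> B" "\<And>v. v \<in> V \<Longrightarrow> v $ e = 0"
  shows "rank_sum B V = 0"
proof -
  have "res (insert e A) ` V = res A ` V" for A
    using assms(2) by (intro image_cong refl) (auto simp: vec_eq_iff res_nth)
  then have "(\<Sum>A\<in>Pow (insert e (B - {e})). (- 1) ^ card A * 2 ^ vec.dim (res A ` V)) = (0::int)"
    by (subst sum_Pow_insert) (auto intro!: sum.neutral simp: card_insert_if dest: finite_subset)
  then show ?thesis using assms(1) by (simp add: rank_sum_def insert_absorb)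
qed

lemma rank_sum_full:
  "rank_sum B {v :: complex^'n. \<forall>i. i \<notin> B \<longrightarrow> v $ i = 0} = 1"
proof -
  let ?V = "{v :: complex^'n. \<forall>i. i \<notin> B \<longrightarrow> v $ i = 0}"
  have "res A ` ?V = {v. \<forall>i. i \<notin> A \<longrightarrow> v $ i = 0}" if "A \<subseteq> B" for A
  proof (intro equalityI subsetI)
    fix v :: "complex^'n" assume v: "v \<in> {v. \<forall>i. i \<notin> A \<longrightarrow> v $ i = 0}"
    then have "v = res A v" "v \<in> ?V" using that by (auto simp: vec_eq_iff res_nth)
    then show "v \<in> res A ` ?V" by blast
  qed (auto simp: res_nth)
  then have "(\<Sum>A\<in>Pow B. (- 1) ^ card A * 2 ^ vec.dim (res A ` ?V)) = (\<Sum>A\<in>Pow B. (- 2) ^ card A :: int)"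
    by (intro sum.cong) (auto simp: dim_coordinate_subspace simp flip: power_mult_distrib)
  also have "\<dots> = (- 1) ^ card B"
  proof (induction B rule: finite_induct[OF finite])
    case (2 e B)
    have "(\<Sum>A\<in>Pow (insert e B). (- 2) ^ card A :: int) = (\<Sum>A\<in>Pow B. (- 2) ^ card A + (- 2) ^ card (insert e A))"
      using 2 by (intro sum_Pow_insert)
    also have "\<dots> = (\<Sum>A\<in>Pow B. - ((- 2) ^ card A))"
    proof (rule sum.cong)
      fix A assume "A \<in> Pow B"
      then have "e \<notin> A" using 2 by auto
      then show "(- 2) ^ card A + (- 2) ^ card (insert e A) = (- ((- 2) ^ card A) :: int)" by simp
    qed simp
    finally show ?case using 2 by (simp add: sum_negf)
  qed simp
  finally show ?thesis by (simp add: rank_sum_def dim_coordinate_subspace flip: power_mult_distrib)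
qed

text \<open>Sets without \<open>e\<close> have the same rank in the deletion; a set with
  \<open>e\<close> has rank one more than its remainder in the contraction. The minus sign from the
  extra element becomes a plus because the contraction lowers the dimension by one, while the
  deletion keeps it as \<open>e\<close> is no coloop.\<close>

lemma rank_sum_deletion_contraction:
  fixes V :: "(complex^'n) set"
  assumes sup: "supported B V" and eB: "e \<in> B" and b: "b \<in> V" "b $ e \<noteq> 0" and coloop: "axis e 1 \<notin> V"
  shows "rank_sum B V = rank_sum (B - {e}) (res (B - {e}) ` V) + 2 * rank_sum (B - {e}) {v\<in>V. v $ e = 0}"
proof -
  let ?B = "B - {e}" and ?V1 = "{v\<in>V. v $ e = 0}"
  have V: "vec.subspace V" and VB: "\<And>v i. v \<in> V \<Longrightarrow> i \<notin> B \<Longrightarrow> v $ i = 0" using sup by (auto simp: supported_def)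
  have dim1: "vec.dim V = Suc (vec.dim ?V1)" by (rule dim_hyperplane_section[OF V b])
  have dim2: "vec.dim (res ?B ` V) = vec.dim V"
  proof (rule vec.dim_image_eq[OF linear_res])
    have "v = 0" if v: "v \<in> V" "res ?B v = 0" for v
    proof (rule ccontr)
      assume "v \<noteq> 0"
      have off: "v $ i = 0" if "i \<noteq> e" for i
        using VB[OF v(1), of i] arg_cong[OF v(2), of "\<lambda>v. v $ i"] that by (auto simp: res_nth split: if_splits)
      then have "v $ e \<noteq> 0" using \<open>v \<noteq> 0\<close> by (metis vec_eq_iff zero_index)
      then have "axis e 1 = (1 / v $ e) *s v" using off by (auto simp: vec_eq_iff axis_def)
      then show False using coloop V v(1) vec.subspace_scale by metis
    qed
    then show "inj_on (res ?B) (vec.span V)" by (rule inj_on_res[OF V])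
  qed
  have dimA: "vec.dim (res (insert e A) ` V) = Suc (vec.dim (res A ` ?V1))" if "e \<notin> A" for A
  proof -
    have "{v \<in> res (insert e A) ` V. v $ e = 0} = res A ` ?V1"
    proof (intro equalityI subsetI)
      fix x assume "x \<in> {v \<in> res (insert e A) ` V. v $ e = 0}"
      then obtain v where "v \<in> V" "x = res (insert e A) v" "v $ e = 0" by (auto simp: res_nth)
      moreover from this have "x = res A v" by (auto simp: vec_eq_iff res_nth)
      ultimately show "x \<in> res A ` ?V1" by blast
    next
      fix x assume "x \<in> res A ` ?V1"
      then obtain v where v: "v \<in> V" "x = res A v" "v $ e = 0" by auto
      then have "x = res (insert e A) v" "x $ e = 0" by (auto simp: vec_eq_iff res_nth)
      then show "x \<in> {v \<in> res (insert e A) ` V. v $ e = 0}" using v(1) by blast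
    qed
    then show ?thesis
      using dim_hyperplane_section[OF subspace_res[OF V], of "res (insert e A) b" "insert e A" e] b
      by (simp add: res_nth)
  qed
  have delA: "res A ` (res ?B ` V) = res A ` V" if "A \<subseteq> ?B" for A
    using that by (simp add: image_image res_res Int_absorb2)
  have "(\<Sum>A\<in>Pow B. (- 1) ^ card A * 2 ^ vec.dim (res A ` V))
      = (\<Sum>A\<in>Pow (insert e ?B). (- 1) ^ card A * (2::int) ^ vec.dim (res A ` V))"
    using eB by (simp add: insert_absorb)
  also have "\<dots> = (\<Sum>A\<in>Pow ?B. (- 1) ^ card A * 2 ^ vec.dim (res A ` V)
      + (- 1) ^ card (insert e A) * 2 ^ vec.dim (res (insert e A) ` V))"
    by (rule sum_Pow_insert) auto
  also have "\<dots> = (\<Sum>A\<in>Pow ?B. (- 1) ^ card A * 2 ^ vec.dim (res A ` (res ?B ` V))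
      - 2 * ((- 1) ^ card A * 2 ^ vec.dim (res A ` ?V1)))"
  proof (rule sum.cong)
    fix A assume A: "A \<in> Pow ?B"
    then have "e \<notin> A" by auto
    then show "(- 1) ^ card A * 2 ^ vec.dim (res A ` V) + (- 1) ^ card (insert e A) * 2 ^ vec.dim (res (insert e A) ` V)
        = (- 1) ^ card A * 2 ^ vec.dim (res A ` (res ?B ` V)) - 2 * ((- 1) ^ card A * (2::int) ^ vec.dim (res A ` ?V1))"
      using A unfolding dimA[OF \<open>e \<notin> A\<close>] by (subst delA) auto
  qed simp
  also have "\<dots> = (\<Sum>A\<in>Pow ?B. (- 1) ^ card A * 2 ^ vec.dim (res A ` (res ?B ` V)))
      - 2 * (\<Sum>A\<in>Pow ?B. (- 1) ^ card A * 2 ^ vec.dim (res A ` ?V1))"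
    by (simp only: sum_subtractf sum_distrib_left)
  finally have S: "(\<Sum>A\<in>Pow B. (- 1) ^ card A * 2 ^ vec.dim (res A ` V))
      = (\<Sum>A\<in>Pow ?B. (- 1) ^ card A * (2::int) ^ vec.dim (res A ` (res ?B ` V)))
      - 2 * (\<Sum>A\<in>Pow ?B. (- 1) ^ card A * 2 ^ vec.dim (res A ` ?V1))" .
  show ?thesis unfolding rank_sum_def dim2 S dim1 by (simp add: algebra_simps)
qed

theorem gcount_rank_sum:
  fixes V :: "(complex^'n) set"
  assumes "supported B V" "weights V \<alpha>"
  shows "\<exists>d. gcount B V (cvec \<alpha>) d \<and> int d = rank_sum B V"
  using assms
proof (induction "card B" arbitrary: B V \<alpha> rule: less_induct)
  case less
  have V: "vec.subspace V" and VB: "\<And>v i. v \<in> V \<Longrightarrow> i \<notin> B \<Longrightarrow> v $ i = 0"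
    using less.prems(1) by (auto simp: supported_def)
  consider (loop) e where "e \<in> B" "\<forall>v\<in>V. v $ e = 0" | (full) "\<forall>e\<in>B. axis e 1 \<in> V"
    | (dc) e where "loopless B V" "e \<in> B" "axis e 1 \<notin> V"
    unfolding loopless_def by blast
  then show ?case
  proof cases
    case (loop e)
    have "gcount B V (cvec \<alpha>) 0" unfolding gcount_def
    proof (rule generic_mono[OF generic_nth_nonzero[of "{e}"]])
      fix s :: "complex^'n" assume s: "\<forall>i\<in>{e}. s $ i \<noteq> 0"
      have "sol B V (cvec \<alpha>) s = {}"
      proof (rule ccontr)
        assume "sol B V (cvec \<alpha>) s \<noteq> {}"
        then obtain y w where yw: "(y, w) \<in> sol B V (cvec \<alpha>) s" by fastforce
        then have "y \<in> V" "phi B (cvec \<alpha>) y w $ e = s $ e" by (auto simp: sol_def)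
        then show False using loop s by (simp add: phi_def)
      qed
      then show "finite (sol B V (cvec \<alpha>) s) \<and> card (sol B V (cvec \<alpha>) s) = 0
        \<and> (\<forall>(y, w)\<in>sol B V (cvec \<alpha>) s. nondeg B V (cvec \<alpha>) y w)" by simp
    qed
    moreover have "rank_sum B V = 0" using loop by (intro rank_sum_loop[of e]) auto
    ultimately show ?thesis by force
  next
    case full
    have "V = {v. \<forall>i. i \<notin> B \<longrightarrow> v $ i = 0}"
    proof (intro equalityI subsetI)
      fix v :: "complex^'n" assume v: "v \<in> {v. \<forall>i. i \<notin> B \<longrightarrow> v $ i = 0}"
      have "v = (\<Sum>i\<in>B. v $ i *s axis i 1)"
        using v by (auto simp: vec_eq_iff sum_component axis_def if_distrib[of "(*) _"] cong: if_cong)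
      moreover have "(\<Sum>i\<in>B. v $ i *s axis i 1) \<in> V"
        using V full by (intro vec.subspace_sum vec.subspace_scale) auto
      ultimately show "v \<in> V" by simp
    qed (use VB in auto)
    then have rs: "rank_sum B V = 1" using rank_sum_full[of B] by simp
    have a: "cvec \<alpha> $ i \<noteq> 0" if "i \<in> B" for i
    proof -
      have "\<exists>j\<in>supp (axis i 1). 0 < \<alpha> $ j"
        using less.prems(2) full that unfolding weights_def by (metis axis_eq_0_iff zero_neq_one)
      then have "0 < \<alpha> $ i" by (auto simp: supp_def axis_def split: if_splits)
      then show ?thesis by (simp add: cvec_def)
    qed
    have w0: "w $ i = 0" if "w \<in> orth V" "i \<in> B" for w i
    proof -
      have "bil (axis i 1) w = 0" using that full by (auto simp: orth_def)
      then show ?thesis by (simp add: bil_commute[of "axis i 1"] bil_axis)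
    qed
    have "gcount B V (cvec \<alpha>) 1" unfolding gcount_def
    proof (rule generic_mono[OF generic_True])
      fix s :: "complex^'n"
      let ?y = "\<chi> i. if i \<in> B then s $ i / cvec \<alpha> $ i else 0" and ?w = "res (- B) s"
      have "sol B V (cvec \<alpha>) s = {(?y, ?w)}"
      proof (intro equalityI subsetI)
        fix p assume p: "p \<in> sol B V (cvec \<alpha>) s"
        obtain y w where yw: "p = (y, w)" by fastforce
        have mem: "y \<in> V" "w \<in> orth V" and
          eq: "(if i \<in> B then cvec \<alpha> $ i * y $ i + (y $ i)\<^sup>2 * w $ i else w $ i) = s $ i" for i
          using p by (auto simp: yw sol_def phi_eq_iff)
        have "y $ i = ?y $ i \<and> w $ i = ?w $ i" for i
          using eq[of i] w0[OF mem(2), of i] VB[OF mem(1), of i] a[of i]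
          by (cases "i \<in> B") (auto simp: res_nth field_simps)
        then show "p \<in> {(?y, ?w)}" by (simp add: yw vec_eq_iff)
      next
        fix p assume "p \<in> {(?y, ?w)}"
        moreover have "?w \<in> orth V"
        proof -
          have "bil v ?w = 0" if "v \<in> V" for v
            unfolding bil_def using VB[OF that] by (intro sum.neutral) (auto simp: res_nth)
          then show ?thesis by (simp add: orth_def)
        qed
        moreover have "?y \<in> V" by (subst \<open>V = _\<close>) simp
        moreover have "phi B (cvec \<alpha>) ?y ?w = s"
          unfolding phi_eq_iff using a by (auto simp: res_nth)
        ultimately show "p \<in> sol B V (cvec \<alpha>) s" by (simp add: sol_def)
      qed
      moreover have "nondeg B V (cvec \<alpha>) ?y ?w"
        unfolding nondeg_def
      proof (intro ballI impI)
        fix dy dw assume d: "dy \<in> V" "dw \<in> orth V" and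
          eqs: "(\<forall>i\<in>B. (cvec \<alpha> $ i + 2 * ?y $ i * ?w $ i) * dy $ i + (?y $ i)\<^sup>2 * dw $ i = 0) \<and> (\<forall>i. i \<notin> B \<longrightarrow> dw $ i = 0)"
        have "dw $ i = 0 \<and> dy $ i = 0" for i
        proof (cases "i \<in> B")
          case True
          then have "(cvec \<alpha> $ i + 2 * ?y $ i * ?w $ i) * dy $ i + (?y $ i)\<^sup>2 * dw $ i = 0" using eqs by blast
          then show ?thesis using w0[OF d(2) True] a[OF True] True by (simp add: res_nth)
        next
          case False
          then show ?thesis using eqs VB[OF d(1)] by blast
        qed
        then show "dy = 0 \<and> dw = 0" by (simp add: vec_eq_iff)
      qed
      ultimately show "finite (sol B V (cvec \<alpha>) s) \<and> card (sol B V (cvec \<alpha>) s) = 1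
        \<and> (\<forall>(y, w)\<in>sol B V (cvec \<alpha>) s. nondeg B V (cvec \<alpha>) y w)" by simp
    qed
    then show ?thesis using rs by force
  next
    case (dc e)
    obtain b0 where b0: "b0 \<in> V" "b0 $ e \<noteq> 0" using dc(1,2) by (auto simp: loopless_def)
    define b where "b = (1 / b0 $ e) *s b0"
    have b: "b \<in> V" "b $ e = 1" using V b0 by (simp_all add: b_def vec.subspace_scale)
    \<comment> \<open>Every nonzero vector of \<open>V\<close> has a nonzero coordinate other than
      \<open>e\<close>, since \<open>e\<close> is no coloop, so weight 0 at \<open>e\<close> is
      permitted.\<close>
    define \<beta> :: "real^'n" where "\<beta> = (\<chi> i. if i = e then 0 else 1)"
    let ?B = "B - {e}" and ?V1 = "{v\<in>V. v $ e = 0}" and ?V2 = "res (B - {e}) ` V"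
    have other: "\<exists>i. i \<noteq> e \<and> v $ i \<noteq> 0" if v: "v \<in> V" "v \<noteq> 0" for v
    proof (rule ccontr)
      assume "\<not> ?thesis"
      then have off: "\<And>i. i \<noteq> e \<Longrightarrow> v $ i = 0" by blast
      then have "v $ e \<noteq> 0" using v(2) by (metis vec_eq_iff zero_index)
      then have "axis e 1 = (1 / v $ e) *s v" using off by (auto simp: vec_eq_iff axis_def)
      then show False using dc(3) V v(1) vec.subspace_scale by metis
    qed
    have \<beta>V: "weights V \<beta>"
      unfolding weights_def using other by (force simp: \<beta>_def supp_def)
    have \<beta>1: "weights ?V1 \<beta>" using \<beta>V by (auto simp: weights_def)
    have \<beta>2: "weights ?V2 \<beta>"
      unfolding weights_def
    proof (intro conjI allI ballI impI)
      show "0 \<le> \<beta> $ i" for i by (simp add: \<beta>_def)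
      fix v assume "v \<in> ?V2" "v \<noteq> 0"
      from \<open>v \<noteq> 0\<close> obtain i where "v $ i \<noteq> 0" by (metis vec_eq_iff zero_index)
      moreover have "v $ e = 0" using \<open>v \<in> ?V2\<close> by (auto simp: res_nth)
      ultimately have "v $ i \<noteq> 0" "i \<noteq> e" by auto
      then show "\<exists>i\<in>supp v. 0 < \<beta> $ i" by (intro bexI[of _ i]) (auto simp: \<beta>_def supp_def)
    qed
    have s1: "supported ?B ?V1" using V VB by (auto simp: supported_def vec.subspace_def)
    have s2: "supported ?B ?V2" using subspace_res[OF V] by (auto simp: supported_def res_nth)
    have "card ?B < card B" using dc(2) by (intro psubset_card_mono) auto
    from less.hyps[OF this s1 \<beta>1] less.hyps[OF this s2 \<beta>2] obtain d1 d2 where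
      d1: "gcount ?B ?V1 (cvec \<beta>) d1" "int d1 = rank_sum ?B ?V1" and
      d2: "gcount ?B ?V2 (cvec \<beta>) d2" "int d2 = rank_sum ?B ?V2" by blast
    obtain d where d: "gcount B V (cvec \<alpha>) d" by (rule gcount_exists[OF less.prems(1) dc(1) less.prems(2)])
    obtain d' where d': "gcount B V (cvec \<beta>) d'" by (rule gcount_exists[OF less.prems(1) dc(1) \<beta>V])
    have "d = d'" by (rule gcount_weights_eq[OF less.prems(1) dc(1) less.prems(2) \<beta>V d d'])
    moreover have "d' = d2 + 2 * d1"
      by (rule gcount_deletion_contraction[OF less.prems(1) dc(2) b dc(3) \<beta>V _ d' d1(1) d2(1)]) (simp add: \<beta>_def)
    moreover have "rank_sum B V = rank_sum ?B ?V2 + 2 * rank_sum ?B ?V1"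
      by (rule rank_sum_deletion_contraction[OF less.prems(1) dc(2) b0 dc(3)])
    ultimately have "int d = rank_sum B V" using d1(2) d2(2) by simp
    then show ?thesis using d by blast
  qed
qed

text \<open>If the projection of \<open>L\<close> to the coordinates in \<open>I\<close> missed a
  vector there, a functional vanishing on the projection but not on that vector would be a
  nontrivial relation on \<open>I\<close>.\<close>

lemma matroid_indep_card_le:
  fixes L :: "(complex^'n) set"
  assumes L: "vec.subspace L" and I: "matroid_indep L I" "I \<subseteq> A"
  shows "card I \<le> vec.dim (res A ` L)"
proof -
  let ?C = "{v :: complex^'n. \<forall>i. i \<notin> I \<longrightarrow> v $ i = 0}"
  have U: "vec.subspace (res I ` L)" by (rule subspace_res[OF L])
  have "?C \<subseteq> res I ` L"
  proof (rule ccontr)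
    assume "\<not> ?C \<subseteq> res I ` L"
    then obtain x where x: "x \<in> ?C" "x \<notin> res I ` L" by blast
    then have "x \<notin> orth (orth (res I ` L))" using orth_orth[OF U] by simp
    then obtain c where c: "c \<in> orth (res I ` L)" "bil c x \<noteq> 0" unfolding orth_def[of "orth _"] by blast
    have "res I c = 0"
    proof (rule I(1)[unfolded matroid_indep_def, rule_format], intro conjI allI impI ballI)
      show "res I c $ i = 0" if "i \<notin> I" for i using that by (simp add: res_nth)
      fix v assume "v \<in> L"
      then have "bil (res I v) c = 0" using c(1) by (simp add: orth_def)
      moreover have "(\<Sum>i\<in>UNIV. res I c $ i * v $ i) = bil (res I v) c"
        unfolding bil_def by (intro sum.cong) (auto simp: res_nth)
      ultimately show "(\<Sum>i\<in>UNIV. res I c $ i * v $ i) = 0" by simp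
    qed
    moreover have "bil (res I c) x = bil c x"
      unfolding bil_def using x(1) by (intro sum.cong) (auto simp: res_nth)
    ultimately show False using c(2) by (simp add: bil_zero)
  qed
  then have "card I \<le> vec.dim (res I ` L)" using vec.dim_subset[of ?C] by (simp add: dim_coordinate_subspace)
  then show ?thesis using dim_res_le[OF I(2), of L] by simp
qed

text \<open>Greedy choice: adding \<open>e\<close> to \<open>A\<close> raises the dimension, by at
  most one, only if some vector of \<open>L\<close> vanishes on \<open>A\<close> but not at
  \<open>e\<close>; this vector then forces the coefficient at \<open>e\<close> of any relation to
  be 0.\<close>

lemma matroid_indep_exists:
  fixes L :: "(complex^'n) set"
  assumes L: "vec.subspace L"
  shows "\<exists>I\<subseteq>A. matroid_indep L I \<and> vec.dim (res A ` L) \<le> card I"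
proof (induction A rule: finite_induct[OF finite])
  case 1
  have "res {} ` L \<subseteq> {0}" by (auto simp: vec_eq_iff res_nth)
  then have "vec.dim (res {} ` L) = 0" by (simp add: vec.dim_eq_0)
  moreover have "matroid_indep L {}" by (auto simp: matroid_indep_def vec_eq_iff)
  ultimately show ?case by auto
next
  case (2 e A)
  then obtain I where I: "I \<subseteq> A" "matroid_indep L I" "vec.dim (res A ` L) \<le> card I" by blast
  show ?case
  proof (cases "\<exists>v\<in>L. (\<forall>i\<in>A. v $ i = 0) \<and> v $ e \<noteq> 0")
    case True
    then obtain v where v: "v \<in> L" "\<And>i. i \<in> A \<Longrightarrow> v $ i = 0" "v $ e \<noteq> 0" by blast
    have "res (insert e A) ` L \<subseteq> vec.span (insert (axis e 1) (res A ` L))"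
    proof
      fix x assume "x \<in> res (insert e A) ` L"
      then obtain u where u: "u \<in> L" "x = res (insert e A) u" by blast
      have "x - u $ e *s axis e 1 = res A u" using 2 u(2) by (auto simp: vec_eq_iff res_nth axis_def)
      then have "x - u $ e *s axis e 1 \<in> vec.span (res A ` L)" using u(1) by (simp add: vec.span_base)
      then show "x \<in> vec.span (insert (axis e 1) (res A ` L))" unfolding vec.span_insert by blast
    qed
    then have "vec.dim (res (insert e A) ` L) \<le> vec.dim (insert (axis e 1) (res A ` L))"
      by (metis vec.dim_subset vec.dim_span)
    also have "\<dots> \<le> Suc (vec.dim (res A ` L))" by (simp add: vec.dim_insert)
    also have "\<dots> \<le> card (insert e I)"
    proof -
      have "e \<notin> I" "finite I" using 2 I(1) by auto
      then show ?thesis using I(3) by simp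
    qed
    finally have "vec.dim (res (insert e A) ` L) \<le> card (insert e I)" .
    moreover have "matroid_indep L (insert e I)"
      unfolding matroid_indep_def
    proof (intro allI impI, elim conjE)
      fix c :: "complex^'n" assume c: "\<forall>i. i \<notin> insert e I \<longrightarrow> c $ i = 0" "\<forall>v\<in>L. (\<Sum>i\<in>UNIV. c $ i * v $ i) = 0"
      have "0 = (\<Sum>i\<in>UNIV. c $ i * v $ i)" using c(2) v(1) by simp
      also have "\<dots> = (\<Sum>i\<in>{e}. c $ i * v $ i)"
        using c(1) v(2) I(1) by (intro sum.mono_neutral_right) auto
      finally have "c $ e = 0" using v(3) by simp
      then have "\<forall>i. i \<notin> I \<longrightarrow> c $ i = 0" using c(1) by (metis insert_iff)
      then show "c = 0" using I(2) c(2) unfolding matroid_indep_def by blast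
    qed
    ultimately show ?thesis using I(1) by (intro exI[of _ "insert e I"]) auto
  next
    case False
    have "vec.dim (res (insert e A) ` L) = vec.dim (res A ` (res (insert e A) ` L))"
    proof (rule vec.dim_image_eq[OF linear_res, symmetric])
      have W: "vec.subspace (res (insert e A) ` L)" by (rule subspace_res[OF L])
      have "x = 0" if x: "x \<in> res (insert e A) ` L" "res A x = 0" for x
      proof -
        obtain u where u: "u \<in> L" "x = res (insert e A) u" using x(1) by blast
        have "u $ i = 0" if "i \<in> A" for i
        proof -
          have "res A x $ i = 0" using x(2) by simp
          then show ?thesis using that u(2) by (simp add: res_nth)
        qed
        moreover from this have "u $ e = 0" using False u(1) by blast
        ultimately show "x = 0" using u(2) by (auto simp: vec_eq_iff res_nth)
      qed
      then show "inj_on (res A) (vec.span (res (insert e A) ` L))" by (rule inj_on_res[OF W])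
    qed
    also have "res A ` (res (insert e A) ` L) = res A ` L"
      by (simp add: image_image res_res Int_absorb2 subset_insertI)
    finally show ?thesis using I by (intro exI[of _ I]) auto
  qed
qed

lemma matroid_rank_eq_dim:
  fixes L :: "(complex^'n) set"
  assumes "vec.subspace L"
  shows "matroid_rank (matroid_indep L) A = vec.dim (res A ` L)"
proof -
  obtain I where I: "I \<subseteq> A" "matroid_indep L I" "vec.dim (res A ` L) \<le> card I"
    using matroid_indep_exists[OF assms] by blast
  have card_I: "vec.dim (res A ` L) = card I" using I(3) matroid_indep_card_le[OF assms I(2,1)] by (rule order_antisym)
  have "vec.dim (res A ` L) \<in> card ` {I. I \<subseteq> A \<and> matroid_indep L I}"
    unfolding card_I by (rule imageI) (simp add: I(1,2))
  moreover have "k \<le> vec.dim (res A ` L)" if "k \<in> card ` {I. I \<subseteq> A \<and> matroid_indep L I}" for k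
    using that matroid_indep_card_le[OF assms] by auto
  ultimately show ?thesis unfolding matroid_rank_def by (intro Max_eqI) auto
qed

lemma characteristic_poly_rank_sum:
  fixes L :: "(complex^'n) set"
  assumes L: "vec.subspace L"
  shows "(- 2) ^ vec.dim L * poly (map_poly real_of_int (characteristic_poly (matroid_indep L))) (1 / 2)
    = real_of_int (rank_sum UNIV L)"
proof -
  let ?r = "vec.dim L" and ?rk = "\<lambda>A. vec.dim (res A ` L)"
  have rU: "?rk UNIV = ?r" by (simp add: res_def)
  have "map_poly real_of_int (characteristic_poly (matroid_indep L))
      = (\<Sum>A\<in>UNIV. monom ((- 1) ^ card A) (?r - ?rk A))"
    unfolding characteristic_poly_def matroid_rank_eq_dim[OF L] rU
    by (rule poly_eqI) (simp add: coeff_map_poly coeff_sum of_int_sum if_distrib[of real_of_int] cong: if_cong)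
  then have "(- 2) ^ ?r * poly (map_poly real_of_int (characteristic_poly (matroid_indep L))) (1 / 2)
      = (\<Sum>A\<in>UNIV. (- 2) ^ ?r * ((- 1) ^ card A * (1 / 2) ^ (?r - ?rk A)))"
    by (simp add: poly_sum poly_monom sum_distrib_left)
  also have "\<dots> = (\<Sum>A\<in>UNIV. (- 1) ^ ?r * ((- 1) ^ card A * 2 ^ ?rk A))"
  proof (rule sum.cong)
    fix A :: "'n set"
    have "?rk A \<le> ?r" using dim_res_le[of A UNIV L] rU by simp
    then have "(2::real) ^ ?r = 2 ^ ?rk A * 2 ^ (?r - ?rk A)" by (simp flip: power_add)
    then have "(- 2 :: real) ^ ?r * (1 / 2) ^ (?r - ?rk A) = (- 1) ^ ?r * 2 ^ ?rk A"
      by (simp add: power_minus[of 2] power_one_over)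
    then show "(- 2) ^ ?r * ((- 1) ^ card A * (1 / 2) ^ (?r - ?rk A)) = (- 1) ^ ?r * ((- 1) ^ card A * (2::real) ^ ?rk A)"
      by (simp add: mult.left_commute)
  qed simp
  also have "\<dots> = real_of_int (rank_sum UNIV L)"
    by (simp add: rank_sum_def sum_distrib_left)
  finally show ?thesis .
qed

section \<open>The reciprocal variety and its tangent spaces\<close>

lemma poly_fun_pfun: "poly_fun f \<longleftrightarrow> pfun (\<lambda>(i, j) K. K $ i $ j) UNIV f"
proof
  assume "poly_fun f"
  then show "pfun (\<lambda>(i, j) K. K $ i $ j) UNIV f"
  proof induction
    case (coord i j)
    show ?case using pfun.gen[of "(i, j)" UNIV "\<lambda>(i, j) K. K $ i $ j"] by simp
  qed (auto intro: pfun.intros)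
next
  assume "pfun (\<lambda>(i, j) K. K $ i $ j) UNIV f"
  then show "poly_fun f"
  proof induction
    case (gen p)
    show ?case by (simp add: case_prod_beta poly_fun.coord)
  qed (auto intro: poly_fun.intros)
qed

lemma poly_fun_diff: "poly_fun f \<Longrightarrow> poly_fun g \<Longrightarrow> poly_fun (\<lambda>K. f K - g K)"
  and poly_fun_sum: "(\<And>i. i \<in> A \<Longrightarrow> poly_fun (h i)) \<Longrightarrow> poly_fun (\<lambda>K. \<Sum>i\<in>A. h i K)"
  and poly_fun_prod: "(\<And>i. i \<in> A \<Longrightarrow> poly_fun (h i)) \<Longrightarrow> poly_fun (\<lambda>K. \<Prod>i\<in>A. h i K)"
  and poly_fun_power: "poly_fun f \<Longrightarrow> poly_fun (\<lambda>K. f K ^ m)"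
  unfolding poly_fun_pfun by (auto intro: pfun_intros)

lemmas poly_fun_intros = poly_fun.intros poly_fun_diff poly_fun_sum poly_fun_prod poly_fun_power

lemma poly_fun_if: "(P \<Longrightarrow> poly_fun f) \<Longrightarrow> (\<not> P \<Longrightarrow> poly_fun g) \<Longrightarrow> poly_fun (\<lambda>K. if P then f K else g K)"
  by (cases P) auto

lemma poly_fun_det:
  assumes "\<And>i j. poly_fun (\<lambda>K. M K $ i $ j)" shows "poly_fun (\<lambda>K. det (M K))"
  unfolding det_def by (intro poly_fun_intros assms)

lemma poly_fun_line:
  fixes f :: "complex^'n^'n \<Rightarrow> complex"
  assumes "poly_fun f" shows "\<exists>q. \<forall>t. f (K + cscale t V) = poly q t"
proof (rule pfun_line[OF assms[unfolded poly_fun_pfun]])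
  fix p :: "'n \<times> 'n"
  show "\<exists>q. \<forall>t. (case p of (i, j) \<Rightarrow> \<lambda>K. K $ i $ j) (K + cscale t V) = poly q t"
    by (intro exI[of _ "[:K $ fst p $ snd p, V $ fst p $ snd p:]"])
      (simp add: cscale_def map_matrix_def case_prod_beta)
qed

lemma cscale_nth: "cscale t V $ i $ j = t * V $ i $ j"
  by (simp add: cscale_def map_matrix_def)

text \<open>Partial derivatives that are again polynomial, with the chain rule along every curve
  with differentiable entries. Lines alone would not suffice, since tangent vectors of the
  reciprocal variety are realized by inverses of lines.\<close>

definition gradient :: "(complex^'n^'n \<Rightarrow> complex) \<Rightarrow> ('n \<Rightarrow> 'n \<Rightarrow> complex^'n^'n \<Rightarrow> complex) \<Rightarrow> bool" where
  "gradient f p \<longleftrightarrow> (\<forall>i j. poly_fun (p i j)) \<and> (\<forall>M V t0. (\<forall>i j. ((\<lambda>t. M t $ i $ j) has_field_derivative V $ i $ j) (at t0)) \<longrightarrow>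
     ((\<lambda>t. f (M t)) has_field_derivative (\<Sum>i\<in>UNIV. \<Sum>j\<in>UNIV. p i j (M t0) * V $ i $ j)) (at t0))"

lemma gradientD:
  assumes "gradient f p"
  shows "poly_fun (p i j)" "(\<forall>i j. ((\<lambda>t. M t $ i $ j) has_field_derivative V $ i $ j) (at t0)) \<Longrightarrow>
     ((\<lambda>t. f (M t)) has_field_derivative (\<Sum>i\<in>UNIV. \<Sum>j\<in>UNIV. p i j (M t0) * V $ i $ j)) (at t0)"
  using assms unfolding gradient_def by simp_all

lemma poly_fun_gradient_exists:
  fixes f :: "complex^'n^'n \<Rightarrow> complex"
  assumes "poly_fun f" shows "\<exists>p. gradient f p"
  using assms
proof induction
  case (const c)
  show ?case unfolding gradient_def by (intro exI[of _ "\<lambda>_ _ _. 0"]) (auto intro: poly_fun.const)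
next
  case (coord a b)
  show ?case unfolding gradient_def
  proof (intro exI[of _ "\<lambda>i j _. if i = a \<and> j = b then 1 else 0"] conjI allI impI)
    show "poly_fun (\<lambda>_. if i = a \<and> j = b then 1 else 0)" for i j by (rule poly_fun.const)
    fix M :: "complex \<Rightarrow> complex^'n^'n" and V t0
    assume M: "\<forall>i j. ((\<lambda>t. M t $ i $ j) has_field_derivative V $ i $ j) (at t0)"
    have "(\<Sum>j\<in>UNIV. (if i = a \<and> j = b then 1 else 0) * V $ i $ j) = (if i = a then V $ a $ b else 0)" for i
      by (cases "i = a") (simp_all add: if_distrib[of "\<lambda>x. x * _"] cong: if_cong)
    then have "(\<Sum>i\<in>UNIV. \<Sum>j\<in>UNIV. (if i = a \<and> j = b then 1 else 0) * V $ i $ j) = V $ a $ b"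
      by simp
    then show "((\<lambda>t. M t $ a $ b) has_field_derivative
        (\<Sum>i\<in>UNIV. \<Sum>j\<in>UNIV. (if i = a \<and> j = b then 1 else 0) * V $ i $ j)) (at t0)"
      using M by (simp only:)
  qed
next
  case (add f g)
  then obtain p q where "gradient f p" "gradient g q" by blast
  note p = gradientD[OF this(1)] and q = gradientD[OF this(2)]
  show ?case unfolding gradient_def
  proof (intro exI[of _ "\<lambda>i j K. p i j K + q i j K"] conjI allI impI)
    show "poly_fun (\<lambda>K. p i j K + q i j K)" for i j using p(1) q(1) by (rule poly_fun.add)
    fix M :: "complex \<Rightarrow> complex^'n^'n" and V t0
    assume M: "\<forall>i j. ((\<lambda>t. M t $ i $ j) has_field_derivative V $ i $ j) (at t0)"
    show "((\<lambda>t. f (M t) + g (M t)) has_field_derivative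
        (\<Sum>i\<in>UNIV. \<Sum>j\<in>UNIV. (p i j (M t0) + q i j (M t0)) * V $ i $ j)) (at t0)"
      using DERIV_add[OF p(2)[OF M] q(2)[OF M]] by (simp add: distrib_right sum.distrib)
  qed
next
  case (mult f g)
  then obtain p q where "gradient f p" "gradient g q" by blast
  note p = gradientD[OF this(1)] and q = gradientD[OF this(2)]
  show ?case unfolding gradient_def
  proof (intro exI[of _ "\<lambda>i j K. p i j K * g K + q i j K * f K"] conjI allI impI)
    show "poly_fun (\<lambda>K. p i j K * g K + q i j K * f K)" for i j
      using p(1) q(1) mult.hyps by (intro poly_fun.add poly_fun.mult)
    fix M :: "complex \<Rightarrow> complex^'n^'n" and V t0
    assume M: "\<forall>i j. ((\<lambda>t. M t $ i $ j) has_field_derivative V $ i $ j) (at t0)"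
    have "(\<Sum>i\<in>UNIV. \<Sum>j\<in>UNIV. (p i j (M t0) * g (M t0) + q i j (M t0) * f (M t0)) * V $ i $ j)
        = (\<Sum>i\<in>UNIV. \<Sum>j\<in>UNIV. p i j (M t0) * V $ i $ j) * g (M t0) + (\<Sum>i\<in>UNIV. \<Sum>j\<in>UNIV. q i j (M t0) * V $ i $ j) * f (M t0)"
      unfolding sum_distrib_right sum.distrib[symmetric] by (intro sum.cong refl) (simp add: algebra_simps)
    then show "((\<lambda>t. f (M t) * g (M t)) has_field_derivative
        (\<Sum>i\<in>UNIV. \<Sum>j\<in>UNIV. (p i j (M t0) * g (M t0) + q i j (M t0) * f (M t0)) * V $ i $ j)) (at t0)"
      using DERIV_mult[OF p(2)[OF M] q(2)[OF M]] by simp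
  qed
qed

lemma has_field_derivative_line:
  "((\<lambda>t. (K + cscale t V) $ i $ j) has_field_derivative V $ i $ j) (at t0)"
  by (auto simp: cscale_nth intro!: derivative_eq_intros)

lemma dir_deriv_gradient:
  fixes f :: "complex^'n^'n \<Rightarrow> complex"
  assumes "poly_fun f"
  obtains p where "\<And>i j. poly_fun (p i j)" "\<And>K V. dir_deriv f K V = (\<Sum>i\<in>UNIV. \<Sum>j\<in>UNIV. p i j K * V $ i $ j)"
    "\<And>M V t0. (\<And>i j. ((\<lambda>t. M t $ i $ j) has_field_derivative V $ i $ j) (at t0)) \<Longrightarrow>
     ((\<lambda>t. f (M t)) has_field_derivative dir_deriv f (M t0) V) (at t0)"
proof -
  obtain p where "gradient f p" using poly_fun_gradient_exists[OF assms] ..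
  note p = gradientD(1)[OF this] and D = gradientD(2)[OF this]
  have eq: "dir_deriv f K V = (\<Sum>i\<in>UNIV. \<Sum>j\<in>UNIV. p i j K * V $ i $ j)" for K V
  proof -
    have z: "K + cscale 0 V = K" by (simp add: vec_eq_iff cscale_nth)
    have "\<forall>i j. ((\<lambda>t. (K + cscale t V) $ i $ j) has_field_derivative V $ i $ j) (at 0)"
      by (intro allI has_field_derivative_line)
    from DERIV_imp_deriv[OF D[OF this]] show ?thesis unfolding dir_deriv_def z .
  qed
  show thesis
  proof (rule that[of p])
    show "poly_fun (p i j)" for i j by (rule p)
    show "((\<lambda>t. f (M t)) has_field_derivative dir_deriv f (M t0) V) (at t0)"
      if "\<And>i j. ((\<lambda>t. M t $ i $ j) has_field_derivative V $ i $ j) (at t0)" for M V t0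
      unfolding eq by (rule D) (intro allI that)
  qed (rule eq)
qed

lemma poly_fun_chain:
  assumes "poly_fun f" "\<And>i j. ((\<lambda>t. M t $ i $ j) has_field_derivative V $ i $ j) (at t0)"
  shows "((\<lambda>t. f (M t)) has_field_derivative dir_deriv f (M t0) V) (at t0)"
  by (rule dir_deriv_gradient[OF assms(1)]) (use assms(2) in blast)

lemma dir_deriv_zero: "dir_deriv f K 0 = 0"
proof -
  have "cscale t 0 = 0" for t by (simp add: vec_eq_iff cscale_nth)
  then show ?thesis by (simp add: dir_deriv_def)
qed

lemma diag_mat_nth: "diag_mat v $ i $ j = (if i = j then v $ i else 0)"
  by (simp add: diag_mat_def)

lemma det_diag_mat: "det (diag_mat v) = (\<Prod>i\<in>UNIV. v $ i)"
  by (subst det_diagonal) (auto simp: diag_mat_nth)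

lemma invertible_diag_mat: "invertible (diag_mat v) \<longleftrightarrow> (\<forall>i. v $ i \<noteq> 0)"
  by (simp add: invertible_det_nz det_diag_mat)

lemma diag_mat_mult: "diag_mat u ** diag_mat v = diag_mat (\<chi> i. u $ i * v $ i)"
  by (simp add: vec_eq_iff matrix_matrix_mult_def diag_mat_nth if_distrib[of "\<lambda>x. x * _"] cong: if_cong)

definition inv_diag :: "complex^'n \<Rightarrow> complex^'n^'n" where
  "inv_diag y = diag_mat (\<chi> i. 1 / y $ i)"

lemma inv_diag_nth: "inv_diag y $ i $ j = (if i = j then 1 / y $ i else 0)"
  by (simp add: inv_diag_def diag_mat_nth)

lemma matrix_inv_diag_mat:
  assumes "\<And>i. y $ i \<noteq> 0" shows "matrix_inv (diag_mat y) = inv_diag y"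
proof -
  have "diag_mat (\<chi> i. 1) = (mat 1 :: complex^'a^'a)" by (simp add: vec_eq_iff diag_mat_nth mat_def)
  then have right: "diag_mat y ** inv_diag y = mat 1"
    using assms by (simp add: inv_diag_def diag_mat_mult)
  have "invertible (diag_mat y)" using assms by (simp add: invertible_diag_mat)
  then have "matrix_inv (diag_mat y) ** diag_mat y = mat 1"
    unfolding invertible_def matrix_inv_def by (rule someI2_ex) simp
  then have "matrix_inv (diag_mat y) ** (diag_mat y ** inv_diag y) = inv_diag y"
    by (simp add: matrix_mul_assoc)
  then show ?thesis by (simp add: right)
qed

lemma inv_diag_inject: "inv_diag y = inv_diag z \<longleftrightarrow> y = z"
proof
  assume "inv_diag y = inv_diag z"
  then have "inv_diag y $ i $ i = inv_diag z $ i $ i" for i by simp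
  then have "1 / y $ i = 1 / z $ i" for i by (simp add: inv_diag_nth)
  then show "y = z" by (simp add: vec_eq_iff)
qed simp

definition torus :: "(complex^'n) set \<Rightarrow> (complex^'n) set" where
  "torus L = {y\<in>L. \<forall>i. y $ i \<noteq> 0}"

lemma zariski_closure_ideal: "vanishing_ideal (zariski_closure G) = vanishing_ideal G"
  by (auto simp: vanishing_ideal_def zariski_closure_def)

lemma zariski_closure_superset: "G \<subseteq> zariski_closure G"
  by (auto simp: vanishing_ideal_def zariski_closure_def)

lemma zariski_closure_mono: "G \<subseteq> H \<Longrightarrow> zariski_closure G \<subseteq> zariski_closure H"
  by (auto simp: vanishing_ideal_def zariski_closure_def)

lemma zariski_closed_closure: "zariski_closed (zariski_closure G)"
  unfolding zariski_closed_def zariski_closure_def[of "zariski_closure G"] zariski_closure_ideal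
  by (rule zariski_closure_def[symmetric])

lemma reciprocal_variety_eq: "reciprocal_variety (diag_mat ` L) = zariski_closure (inv_diag ` torus L)"
proof -
  have "{matrix_inv K | K. K \<in> diag_mat ` L \<and> invertible K} = inv_diag ` torus L"
  proof (intro equalityI subsetI)
    fix P assume "P \<in> {matrix_inv K | K. K \<in> diag_mat ` L \<and> invertible K}"
    then obtain y where y: "P = matrix_inv (diag_mat y)" "y \<in> L" "\<And>i. y $ i \<noteq> 0"
      by (auto simp: invertible_diag_mat)
    then show "P \<in> inv_diag ` torus L" using matrix_inv_diag_mat[OF y(3)] by (auto simp: torus_def)
  next
    fix P assume "P \<in> inv_diag ` torus L"
    then obtain y where y: "P = inv_diag y" "y \<in> L" "\<And>i. y $ i \<noteq> 0" by (auto simp: torus_def)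
    then have "P = matrix_inv (diag_mat y)" using matrix_inv_diag_mat[OF y(3)] by simp
    then show "P \<in> {matrix_inv K | K. K \<in> diag_mat ` L \<and> invertible K}"
      using y(2,3) invertible_diag_mat by blast
  qed
  then show ?thesis by (simp add: reciprocal_variety_def)
qed

locale diagonal_model =
  fixes L :: "(complex^'n::finite) set" and X :: "(complex^'n^'n) set"
  assumes L: "vec.subspace L" and X_def: "X = zariski_closure (inv_diag ` torus L)"
begin

lemma ideal_iff: "f \<in> vanishing_ideal X \<longleftrightarrow> poly_fun f \<and> (\<forall>y\<in>torus L. f (inv_diag y) = 0)"
  unfolding X_def zariski_closure_ideal by (auto simp: vanishing_ideal_def)

lemma ideal_zero: "f \<in> vanishing_ideal X \<Longrightarrow> K \<in> X \<Longrightarrow> f K = 0"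
  by (simp add: vanishing_ideal_def)

lemma inv_diag_in_X: "y \<in> torus L \<Longrightarrow> inv_diag y \<in> X"
  unfolding X_def using zariski_closure_superset by blast

text \<open>The relation \<open>bil c y = 0\<close> in the entries \<open>1 / y_i\<close> with
  denominators cleared. For \<open>c\<close> orthogonal to \<open>L\<close>, and together with the
  off-diagonal entries, these polynomials cut out the invertible points of \<open>X\<close>.\<close>

definition circuit_poly :: "complex^'n \<Rightarrow> complex^'n^'n \<Rightarrow> complex" where
  "circuit_poly c K = (\<Sum>i\<in>UNIV. c $ i * (\<Prod>j\<in>UNIV - {i}. K $ j $ j))"

lemma circuit_poly_inv_diag:
  assumes "\<And>i. y $ i \<noteq> 0" shows "circuit_poly c (inv_diag y) = (\<Prod>j\<in>UNIV. 1 / y $ j) * bil c y"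
proof -
  have "(\<Prod>j\<in>UNIV - {i}. 1 / y $ j) = (\<Prod>j\<in>UNIV. 1 / y $ j) * y $ i" for i
    using assms[of i] by (subst (2) prod.remove[of _ i]) auto
  then show ?thesis
    unfolding circuit_poly_def bil_def by (simp add: inv_diag_nth sum_distrib_left mult_ac)
qed

lemma circuit_poly_ideal: "c \<in> orth L \<Longrightarrow> circuit_poly c \<in> vanishing_ideal X"
  unfolding ideal_iff
proof
  show "poly_fun (circuit_poly c)"
    unfolding circuit_poly_def[abs_def] by (intro poly_fun_intros)
  assume "c \<in> orth L"
  then show "\<forall>y\<in>torus L. circuit_poly c (inv_diag y) = 0"
    by (auto simp: torus_def circuit_poly_inv_diag orth_def bil_commute)
qed

lemma off_diagonal_ideal: "i \<noteq> j \<Longrightarrow> (\<lambda>K. K $ i $ j) \<in> vanishing_ideal X"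
  by (simp add: ideal_iff poly_fun.coord inv_diag_nth)

text \<open>Taking the closure adds only singular matrices: at an invertible point the polynomials
  \<open>circuit_poly c\<close> put the inverse into the double annihilator of \<open>L\<close>,
  which is \<open>L\<close>.\<close>

lemma invertible_in_X:
  assumes "K \<in> X" "invertible K"
  obtains y where "y \<in> torus L" "K = inv_diag y"
proof -
  have off: "K $ i $ j = 0" if "i \<noteq> j" for i j
    using ideal_zero[OF off_diagonal_ideal[OF that] assms(1)] .
  define x where "x = (\<chi> i. K $ i $ i)"
  have K: "K = diag_mat x" using off by (auto simp: vec_eq_iff diag_mat_nth x_def)
  have xnz: "x $ i \<noteq> 0" for i using assms(2) by (simp add: K invertible_diag_mat)
  define y where "y = (\<chi> i. 1 / x $ i)"
  have Ky: "K = inv_diag y" unfolding K by (simp add: inv_diag_def y_def)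
  have ynz: "y $ i \<noteq> 0" for i using xnz by (simp add: y_def)
  have "y \<in> orth (orth L)"
    unfolding orth_def[of "orth L"]
  proof (intro CollectI ballI)
    fix c assume "c \<in> orth L"
    then have "circuit_poly c K = 0" using ideal_zero[OF circuit_poly_ideal assms(1)] by blast
    then show "bil c y = 0" unfolding Ky using ynz by (simp add: circuit_poly_inv_diag)
  qed
  then have "y \<in> torus L" using ynz by (simp add: torus_def orth_orth[OF L])
  then show thesis using Ky by (rule that)
qed

text \<open>The inverse of a line: as \<open>d (1 / y) = - dy / y\<^sup>2\<close>, the direction
  \<open>- y\<^sup>2 v\<close> produces the velocity \<open>v\<close>. This is the origin of the
  factor \<open>(y $ i)\<^sup>2\<close> in the tangent spaces.\<close>

lemma curve_derivative:
  assumes "\<And>i. y $ i \<noteq> 0"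
  shows "((\<lambda>t. inv_diag (\<chi> i. y $ i - t * ((y $ i)\<^sup>2 * v $ i)) $ i $ j) has_field_derivative diag_mat v $ i $ j) (at 0)"
proof (cases "i = j")
  case True
  have "((\<lambda>t. 1 / (y $ i - t * ((y $ i)\<^sup>2 * v $ i))) has_field_derivative v $ i) (at 0)"
    using assms[of i] by (auto intro!: derivative_eq_intros simp: field_simps power2_eq_square)
  then show ?thesis using True by (simp add: inv_diag_nth diag_mat_nth)
qed (simp add: inv_diag_nth diag_mat_nth)

lemma chain_curve:
  assumes "poly_fun f" "\<And>i. y $ i \<noteq> 0"
  shows "((\<lambda>t. f (inv_diag (\<chi> i. y $ i - t * ((y $ i)\<^sup>2 * v $ i)))) has_field_derivative dir_deriv f (inv_diag y) (diag_mat v)) (at 0)"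
  using poly_fun_chain[OF assms(1) curve_derivative[OF assms(2)], of v] by simp

lemma eventually_curve_nonzero:
  assumes "\<And>i. y $ i \<noteq> 0"
  shows "\<forall>\<^sub>F t in nhds (0::complex). \<forall>i. y $ i - t * u $ i \<noteq> 0"
proof -
  have "\<forall>\<^sub>F t in nhds (0::complex). \<forall>i\<in>UNIV. y $ i - t * u $ i \<noteq> 0"
  proof (rule eventually_ball_finite)
    show "\<forall>i\<in>UNIV. \<forall>\<^sub>F t in nhds (0::complex). y $ i - t * u $ i \<noteq> 0"
    proof
      fix i
      have "((\<lambda>t. y $ i - t * u $ i) \<longlongrightarrow> y $ i - 0 * u $ i) (nhds 0)" by (intro tendsto_intros filterlim_ident)
      then show "\<forall>\<^sub>F t in nhds (0::complex). y $ i - t * u $ i \<noteq> 0"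
        by (rule tendsto_imp_eventually_ne) (use assms in simp)
    qed
  qed simp
  then show ?thesis by simp
qed

text \<open>Along the curve the polynomial is a product of inverses times a multiple of
  \<open>t\<close>, because \<open>bil c y = 0\<close>; so only the value of that product at 0
  enters.\<close>

lemma dir_deriv_circuit_poly:
  assumes y: "y \<in> torus L" and c: "c \<in> orth L"
  shows "dir_deriv (circuit_poly c) (inv_diag y) (diag_mat v) = - (\<Prod>j\<in>UNIV. 1 / y $ j) * (\<Sum>i\<in>UNIV. c $ i * ((y $ i)\<^sup>2 * v $ i))"
proof -
  have ynz: "y $ i \<noteq> 0" for i using y by (simp add: torus_def)
  let ?u = "\<chi> i. (y $ i)\<^sup>2 * v $ i"
  let ?y = "\<lambda>t. \<chi> i. y $ i - t * ((y $ i)\<^sup>2 * v $ i)"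
  let ?P = "\<lambda>t. \<Prod>j\<in>UNIV. 1 / ?y t $ j"
  have pf: "poly_fun (circuit_poly c)" using circuit_poly_ideal[OF c] by (simp add: vanishing_ideal_def)
  have cy: "bil c y = 0" using y c unfolding bil_commute[of c y] by (simp add: torus_def orth_def)
  have "\<forall>\<^sub>F t in nhds 0. circuit_poly c (inv_diag (?y t)) = ?P t * (- t * bil c ?u)"
    using eventually_curve_nonzero[OF ynz, of ?u]
  proof eventually_elim
    case (elim t)
    have "?y t = y - t *s ?u" by (simp add: vec_eq_iff)
    then have "bil c (?y t) = - t * bil c ?u" using cy by (simp add: bil_diff_right bil_scale_right)
    then show ?case using circuit_poly_inv_diag[of "?y t" c] elim by simp
  qed
  moreover have "((\<lambda>t. ?P t * (- t * bil c ?u)) has_field_derivative (?P 0 * (- bil c ?u))) (at 0)"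
  proof (subst CARAT_DERIV, intro exI[of _ "\<lambda>t. ?P t * (- bil c ?u)"] conjI allI)
    show "isCont (\<lambda>t. ?P t * (- bil c ?u)) 0" using ynz by (auto intro!: continuous_intros)
  qed (simp_all add: algebra_simps)
  ultimately have "((\<lambda>t. circuit_poly c (inv_diag (?y t))) has_field_derivative (?P 0 * (- bil c ?u))) (at 0)"
    by (subst DERIV_cong_ev[OF refl _ refl])
  from DERIV_unique[OF chain_curve[OF pf ynz] this] show ?thesis by (simp add: bil_def)
qed

text \<open>One inclusion uses the explicit members of the ideal, the other uses curves inside the
  torus, on which every member of the ideal vanishes; generators of the ideal need not be
  known.\<close>

lemma tangent_space_eq:
  assumes y: "y \<in> torus L"
  shows "tangent_space X (inv_diag y) = diag_mat ` {v. (\<chi> i. (y $ i)\<^sup>2 * v $ i) \<in> L}"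
proof (intro equalityI subsetI)
  have ynz: "y $ i \<noteq> 0" for i using y by (simp add: torus_def)
  fix V assume V: "V \<in> tangent_space X (inv_diag y)"
  have off: "V $ i $ j = 0" if "i \<noteq> j" for i j
  proof -
    have "dir_deriv (\<lambda>K. K $ i $ j) (inv_diag y) V = 0"
      using V off_diagonal_ideal[OF that] by (simp add: tangent_space_def)
    moreover have "dir_deriv (\<lambda>K. K $ i $ j) (inv_diag y) V = V $ i $ j"
      unfolding dir_deriv_def by (rule DERIV_imp_deriv[OF has_field_derivative_line])
    ultimately show ?thesis by simp
  qed
  define v where "v = (\<chi> i. V $ i $ i)"
  have Vv: "V = diag_mat v" using off by (auto simp: vec_eq_iff diag_mat_nth v_def)
  have "(\<chi> i. (y $ i)\<^sup>2 * v $ i) \<in> orth (orth L)"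
    unfolding orth_def[of "orth L"]
  proof (intro CollectI ballI)
    fix c assume c: "c \<in> orth L"
    have "dir_deriv (circuit_poly c) (inv_diag y) (diag_mat v) = 0"
      using V circuit_poly_ideal[OF c] unfolding Vv by (simp add: tangent_space_def)
    then show "bil c (\<chi> i. (y $ i)\<^sup>2 * v $ i) = 0"
      unfolding dir_deriv_circuit_poly[OF y c] using ynz by (simp add: bil_def)
  qed
  then show "V \<in> diag_mat ` {v. (\<chi> i. (y $ i)\<^sup>2 * v $ i) \<in> L}" using Vv orth_orth[OF L] by auto
next
  have ynz: "y $ i \<noteq> 0" for i using y by (simp add: torus_def)
  fix V assume "V \<in> diag_mat ` {v. (\<chi> i. (y $ i)\<^sup>2 * v $ i) \<in> L}"
  then obtain v where V: "V = diag_mat v" and v: "(\<chi> i. (y $ i)\<^sup>2 * v $ i) \<in> L" by blast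
  show "V \<in> tangent_space X (inv_diag y)"
    unfolding tangent_space_def V
  proof (intro CollectI ballI)
    fix f assume f: "f \<in> vanishing_ideal X"
    let ?u = "\<chi> i. (y $ i)\<^sup>2 * v $ i"
    let ?y = "\<lambda>t. \<chi> i. y $ i - t * ((y $ i)\<^sup>2 * v $ i)"
    have "\<forall>\<^sub>F t in nhds 0. f (inv_diag (?y t)) = 0"
      using eventually_curve_nonzero[OF ynz, of ?u]
    proof eventually_elim
      case (elim t)
      have "?y t = y - t *s ?u" by (simp add: vec_eq_iff)
      also have "\<dots> \<in> L" using L v y by (auto simp: torus_def intro: vec.subspace_diff vec.subspace_scale)
      finally have "?y t \<in> torus L" using elim by (simp add: torus_def)
      then show ?case using f by (simp add: ideal_iff)
    qed
    then have "((\<lambda>t. f (inv_diag (?y t))) has_field_derivative 0) (at 0) \<longleftrightarrow> ((\<lambda>_. 0) has_field_derivative (0::complex)) (at (0::complex))"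
      by (rule DERIV_cong_ev[OF refl _ refl])
    then have der0: "((\<lambda>t. f (inv_diag (?y t))) has_field_derivative 0) (at 0)" by simp
    have pf: "poly_fun f" using f by (simp add: ideal_iff)
    show "dir_deriv f (inv_diag y) (diag_mat v) = 0"
      by (rule DERIV_unique[OF chain_curve[OF pf ynz] der0])
  qed
qed

lemma dim_tangent_space:
  assumes y: "y \<in> torus L"
  shows "cmat.dim (tangent_space X (inv_diag y)) = vec.dim L"
proof -
  have ynz: "y $ i \<noteq> 0" for i using y by (simp add: torus_def)
  define g where "g u = diag_mat (\<chi> i. u $ i / (y $ i)\<^sup>2)" for u :: "complex^'n"
  interpret vp: vector_space_pair "(*s) :: complex \<Rightarrow> complex^'n \<Rightarrow> complex^'n" "cscale :: complex \<Rightarrow> complex^'n^'n \<Rightarrow> complex^'n^'n" ..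
  have lin: "Vector_Spaces.linear (*s) cscale g"
    by unfold_locales (auto simp: g_def vec_eq_iff diag_mat_nth cscale_nth add_divide_distrib)
  have inj: "inj g"
  proof (rule injI)
    fix u u' assume "g u = g u'"
    then have "g u $ i $ i = g u' $ i $ i" for i by simp
    then show "u = u'" using ynz by (simp add: g_def diag_mat_nth vec_eq_iff)
  qed
  have T: "tangent_space X (inv_diag y) = g ` L"
    unfolding tangent_space_eq[OF y]
  proof (intro equalityI subsetI)
    fix V assume "V \<in> diag_mat ` {v. (\<chi> i. (y $ i)\<^sup>2 * v $ i) \<in> L}"
    then obtain v where "V = diag_mat v" "(\<chi> i. (y $ i)\<^sup>2 * v $ i) \<in> L" by blast
    moreover from this have "V = g (\<chi> i. (y $ i)\<^sup>2 * v $ i)" using ynz by (simp add: g_def)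
    ultimately show "V \<in> g ` L" by blast
  next
    fix V assume "V \<in> g ` L"
    then obtain u where u: "V = g u" "u \<in> L" by blast
    have "(\<chi> i. (y $ i)\<^sup>2 * (\<chi> i. u $ i / (y $ i)\<^sup>2) $ i) = u" using ynz by (simp add: vec_eq_iff)
    then show "V \<in> diag_mat ` {v. (\<chi> i. (y $ i)\<^sup>2 * v $ i) \<in> L}"
      unfolding u(1) g_def using u(2) by (intro imageI) simp
  qed
  obtain Bs where Bs: "Bs \<subseteq> L" "vec.independent Bs" "L \<subseteq> vec.span Bs" "card Bs = vec.dim L"
    by (rule vec.basis_exists)
  have "vec.span Bs = L" using Bs L by (simp add: vec.span_minimal subset_antisym)
  then have span1: "cmat.span (g ` Bs) = g ` L" using vp.linear_span_image[OF lin] by simp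
  have spanL: "vec.span L = L" using L by (simp add: vec.span_eq_iff)
  have span2: "cmat.span (g ` L) = g ` L" using vp.linear_span_image[OF lin, of L] by (simp only: spanL)
  have ind: "cmat.independent (g ` Bs)"
    using vp.linear_independent_injective_image[OF lin Bs(2)] inj inj_on_subset by blast
  have "cmat.dim (g ` L) = card (g ` Bs)" by (rule cmat.dim_eq_card[OF trans[OF span1 span2[symmetric]] ind])
  also have "card (g ` Bs) = vec.dim L" using Bs(4) inj by (metis card_image inj_on_subset subset_UNIV)
  finally show ?thesis unfolding T .
qed

end

section \<open>The local dimension\<close>

lemma rational_pullback:
  fixes y :: "'p \<Rightarrow> complex^'n"
  assumes "poly_fun f" and y: "\<And>i. pfun x K (\<lambda>p. y p $ i)"
  shows "\<exists>N. pfun x K (\<lambda>p. f (inv_diag (y p)) * (\<Prod>i\<in>UNIV. y p $ i) ^ N)"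
  using assms(1)
proof induction
  case (const c)
  show ?case by (rule exI[of _ 0]) (simp add: pfun.const)
next
  case (coord a b)
  show ?case
  proof (cases "a = b")
    case True
    have "1 / y p $ a * (\<Prod>i\<in>UNIV. y p $ i) ^ 2 = (\<Prod>i\<in>UNIV. y p $ i) * (\<Prod>i\<in>UNIV - {a}. y p $ i)" for p
    proof -
      have "(\<Prod>i\<in>UNIV. y p $ i) = y p $ a * (\<Prod>i\<in>UNIV - {a}. y p $ i)" by (rule prod.remove) auto
      then show ?thesis by (simp add: power2_eq_square)
    qed
    moreover have "pfun x K (\<lambda>p. (\<Prod>i\<in>UNIV. y p $ i) * (\<Prod>i\<in>UNIV - {a}. y p $ i))"
      by (intro pfun_intros y)
    ultimately show ?thesis using True by (intro exI[of _ 2]) (simp add: inv_diag_nth)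
  next
    case False
    then show ?thesis by (intro exI[of _ 0]) (simp add: inv_diag_nth pfun.const)
  qed
next
  case (add f g)
  then obtain N M where N: "pfun x K (\<lambda>p. f (inv_diag (y p)) * (\<Prod>i\<in>UNIV. y p $ i) ^ N)"
    and M: "pfun x K (\<lambda>p. g (inv_diag (y p)) * (\<Prod>i\<in>UNIV. y p $ i) ^ M)" by auto
  have "pfun x K (\<lambda>p. f (inv_diag (y p)) * (\<Prod>i\<in>UNIV. y p $ i) ^ N * (\<Prod>i\<in>UNIV. y p $ i) ^ M
      + g (inv_diag (y p)) * (\<Prod>i\<in>UNIV. y p $ i) ^ M * (\<Prod>i\<in>UNIV. y p $ i) ^ N)"
    by (intro pfun.add pfun.mult N M pfun_power pfun_prod y)
  then show ?case by (intro exI[of _ "N + M"]) (simp add: power_add algebra_simps)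
next
  case (mult f g)
  then obtain N M where N: "pfun x K (\<lambda>p. f (inv_diag (y p)) * (\<Prod>i\<in>UNIV. y p $ i) ^ N)"
    and M: "pfun x K (\<lambda>p. g (inv_diag (y p)) * (\<Prod>i\<in>UNIV. y p $ i) ^ M)" by auto
  have "pfun x K (\<lambda>p. (f (inv_diag (y p)) * (\<Prod>i\<in>UNIV. y p $ i) ^ N) * (g (inv_diag (y p)) * (\<Prod>i\<in>UNIV. y p $ i) ^ M))"
    by (intro pfun.mult N M)
  then show ?case by (intro exI[of _ "N + M"]) (simp add: power_add algebra_simps)
qed

lemma zariski_closed_zero_set:
  assumes "zariski_closed Z" "poly_fun f" shows "zariski_closed {K\<in>Z. f K = 0}"
  unfolding zariski_closed_def
proof (intro equalityI zariski_closure_superset subsetI)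
  fix K assume K: "K \<in> zariski_closure {K\<in>Z. f K = 0}"
  have "f \<in> vanishing_ideal {K\<in>Z. f K = 0}" using assms(2) by (simp add: vanishing_ideal_def)
  then have "f K = 0" using K by (simp add: zariski_closure_def)
  moreover have "zariski_closure {K\<in>Z. f K = 0} \<subseteq> zariski_closure Z" by (rule zariski_closure_mono) auto
  then have "K \<in> Z" using K assms(1) by (auto simp: zariski_closed_def)
  ultimately show "K \<in> {K\<in>Z. f K = 0}" by simp
qed

lemma irreducible_closed_domain:
  assumes Z: "irreducible_closed Z" and fg: "poly_fun f" "poly_fun g"
    and prod: "\<And>K. K \<in> Z \<Longrightarrow> f K * g K = 0" and P: "P \<in> Z" "f P \<noteq> 0" and K: "K \<in> Z"
  shows "g K = 0"
proof -
  have closed: "zariski_closed Z" using Z by (simp add: irreducible_closed_def)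
  have eq: "Z = {K\<in>Z. f K = 0} \<union> {K\<in>Z. g K = 0}" using prod by auto
  have "zariski_closed {K\<in>Z. f K = 0} \<and> zariski_closed {K\<in>Z. g K = 0} \<and> Z = {K\<in>Z. f K = 0} \<union> {K\<in>Z. g K = 0}"
    using zariski_closed_zero_set[OF closed] fg eq by blast
  then have "Z = {K\<in>Z. f K = 0} \<or> Z = {K\<in>Z. g K = 0}"
    using Z unfolding irreducible_closed_def by blast
  then show ?thesis using P K by auto
qed

lemma vanishing_separation:
  assumes "zariski_closed Z" "P \<notin> Z"
  obtains f where "f \<in> vanishing_ideal Z" "f P \<noteq> 0"
proof -
  have "P \<notin> zariski_closure Z" using assms by (simp add: zariski_closed_def)
  then show thesis using that by (auto simp: zariski_closure_def)
qed

lemma poly_fun_monomial_sum: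
  assumes "\<And>i. i \<in> J \<Longrightarrow> poly_fun (f i)"
  shows "poly_fun (\<lambda>K. \<Sum>e\<in>S. c e * (\<Prod>i\<in>J. f i K ^ e i))"
  using assms by (intro poly_fun_sum poly_fun.mult poly_fun.const poly_fun_prod poly_fun_power)

text \<open>Splitting off the highest power of the last function \<open>f k\<close>, which is not identically zero on
  the larger and vanishes on the smaller of two irreducible sets, turns a relation for
  \<open>f 0, \<dots>, f k\<close> on the larger set into one for \<open>f 0, \<dots>, f (k - 1)\<close> on the smaller set.\<close>

lemma relation_descent:
  fixes f :: "nat \<Rightarrow> complex^'n^'n \<Rightarrow> complex"
  assumes Z: "irreducible_closed Z" and sub: "Z' \<subseteq> Z"
    and f: "\<And>i. i \<le> k \<Longrightarrow> poly_fun (f i)" and fk: "\<And>K. K \<in> Z' \<Longrightarrow> f k K = 0" and P: "P \<in> Z" "f k P \<noteq> 0"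
    and c: "\<exists>e\<in>PiE {..<Suc k} (\<lambda>_. {..M}). c e \<noteq> 0"
    and rel: "\<And>K. K \<in> Z \<Longrightarrow> (\<Sum>e\<in>PiE {..<Suc k} (\<lambda>_. {..M}). c e * (\<Prod>i<Suc k. f i K ^ e i)) = 0"
  shows "\<exists>c'. (\<exists>e\<in>PiE {..<k} (\<lambda>_. {..M}). c' e \<noteq> 0) \<and>
    (\<forall>K\<in>Z'. (\<Sum>e\<in>PiE {..<k} (\<lambda>_. {..M}). c' e * (\<Prod>i<k. f i K ^ e i)) = 0)"
proof -
  let ?E = "PiE {..<k} (\<lambda>_. {..M}) :: (nat \<Rightarrow> nat) set" and ?E' = "PiE {..<Suc k} (\<lambda>_. {..M}) :: (nat \<Rightarrow> nat) set"
  define Pj where "Pj j K = (\<Sum>e\<in>?E. c (e(k := j)) * (\<Prod>i<k. f i K ^ e i))" for j K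
  have "?E' = (\<lambda>(j, e). e(k := j)) ` ({..M} \<times> ?E)"
    unfolding lessThan_Suc PiE_insert_eq by simp
  moreover have inj: "inj_on (\<lambda>(j, e). e(k := j)) ({..M} \<times> ?E)"
    using inj_combinator[of k "{..<k}" "\<lambda>_. {..M}"] by (simp add: inj_on_def)
  ultimately have expand: "(\<Sum>e\<in>?E'. c e * (\<Prod>i<Suc k. f i K ^ e i)) = (\<Sum>j\<le>M. Pj j K * f k K ^ j)" for K
  proof -
    have "(\<Sum>e\<in>?E'. c e * (\<Prod>i<Suc k. f i K ^ e i))
        = (\<Sum>(j, e)\<in>{..M} \<times> ?E. c (e(k := j)) * (\<Prod>i<Suc k. f i K ^ (e(k := j)) i))"
      unfolding \<open>?E' = _\<close> by (subst sum.reindex[OF inj]) (simp add: case_prod_beta o_def)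
    also have "\<dots> = (\<Sum>j\<le>M. \<Sum>e\<in>?E. c (e(k := j)) * (\<Prod>i<Suc k. f i K ^ (e(k := j)) i))"
      by (rule sum.cartesian_product[symmetric])
    also have "\<dots> = (\<Sum>j\<le>M. Pj j K * f k K ^ j)"
      unfolding Pj_def sum_distrib_right
    proof (intro sum.cong refl)
      fix j e
      have "(\<Prod>i<k. f i K ^ (e(k := j)) i) = (\<Prod>i<k. f i K ^ e i)" by (intro prod.cong) auto
      then show "c (e(k := j)) * (\<Prod>i<Suc k. f i K ^ (e(k := j)) i) = c (e(k := j)) * (\<Prod>i<k. f i K ^ e i) * f k K ^ j"
        by simp
    qed
    finally show ?thesis .
  qed
  have "\<exists>j. \<exists>e\<in>?E. j \<le> M \<and> c (e(k := j)) \<noteq> 0"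
    using c unfolding \<open>?E' = _\<close> by auto
  then have ex: "\<exists>j. j \<le> M \<and> (\<exists>e\<in>?E. c (e(k := j)) \<noteq> 0)" by blast
  define j0 where "j0 = (LEAST j. j \<le> M \<and> (\<exists>e\<in>?E. c (e(k := j)) \<noteq> 0))"
  have j0: "j0 \<le> M" "\<exists>e\<in>?E. c (e(k := j0)) \<noteq> 0" using LeastI_ex[OF ex] by (auto simp: j0_def)
  have P0: "Pj j K = 0" if "j < j0" for j K
    using not_less_Least[OF that[unfolded j0_def]] that j0(1) unfolding Pj_def by (intro sum.neutral) auto
  define R where "R K = (\<Sum>j=j0..M. Pj j K * f k K ^ (j - j0))" for K
  have pP: "poly_fun (Pj j)" for j
    unfolding Pj_def[abs_def] using f by (intro poly_fun_monomial_sum) auto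
  have "poly_fun R"
    unfolding R_def[abs_def] using f by (intro poly_fun_sum poly_fun.mult pP poly_fun_power) auto
  moreover have "poly_fun (\<lambda>K. f k K ^ j0)" using f by (intro poly_fun_power) auto
  moreover have "f k K ^ j0 * R K = 0" if "K \<in> Z" for K
  proof -
    have "0 = (\<Sum>j\<le>M. Pj j K * f k K ^ j)" using rel[OF that] by (simp only: expand)
    also have "\<dots> = (\<Sum>j=j0..M. Pj j K * f k K ^ j)"
      by (rule sum.mono_neutral_right) (auto simp: P0 not_le)
    also have "\<dots> = f k K ^ j0 * R K"
      unfolding R_def sum_distrib_left by (intro sum.cong) (auto simp: mult.left_commute simp flip: power_add)
    finally show ?thesis by simp
  qed
  ultimately have R0: "R K = 0" if "K \<in> Z" for K
    using irreducible_closed_domain[OF Z, of "\<lambda>K. f k K ^ j0" R P K] P that by simp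
  have "Pj j0 K = 0" if "K \<in> Z'" for K
  proof -
    have "R K = Pj j0 K"
      unfolding R_def using j0(1) fk[OF that] by (subst sum.remove[of _ j0]) (auto intro!: sum.neutral)
    then show ?thesis using R0 sub that by auto
  qed
  then show ?thesis using j0(2) unfolding Pj_def by (intro exI[of _ "\<lambda>e. c (e(k := j0))"]) simp
qed

context diagonal_model
begin

text \<open>The set is the inverse of an open part of an affine space. Given two proper closed parts
  covering it, the line through witnesses \<open>z1\<close> and \<open>z2\<close> off them has a
  parameter at which both witnessing functions and the product of the coordinates are
  nonzero.\<close>

lemma irreducible_affine_piece:
  assumes y: "y \<in> torus L" and W: "vec.subspace W"
  shows "irreducible_closed (zariski_closure (inv_diag ` {z. (\<forall>i. z $ i \<noteq> 0) \<and> z - y \<in> W}))" (is "irreducible_closed (zariski_closure ?G)")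
  unfolding irreducible_closed_def
proof (intro conjI allI impI)
  show "zariski_closed (zariski_closure ?G)" by (rule zariski_closed_closure)
  have "y - y \<in> W" using vec.subspace_0[OF W] by simp
  then have "inv_diag y \<in> ?G" using y by (intro imageI) (simp add: torus_def)
  then have "inv_diag y \<in> zariski_closure ?G" by (rule subsetD[OF zariski_closure_superset])
  then show "zariski_closure ?G \<noteq> {}" by (rule ex_in_conv[THEN iffD1, OF exI])
  fix A B assume AB: "zariski_closed A \<and> zariski_closed B \<and> zariski_closure ?G = A \<union> B"
  have witness: "\<exists>f z. f \<in> vanishing_ideal C \<and> (\<forall>i. z $ i \<noteq> 0) \<and> z - y \<in> W \<and> f (inv_diag z) \<noteq> 0"
    if C: "zariski_closed C" "C \<subseteq> zariski_closure ?G" "zariski_closure ?G \<noteq> C" for C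
  proof -
    obtain P where "P \<in> zariski_closure ?G" "P \<notin> C" using C by blast
    then obtain f where f: "f \<in> vanishing_ideal C" "f P \<noteq> 0" using vanishing_separation[OF C(1)] by blast
    have "f \<notin> vanishing_ideal ?G" using f(2) \<open>P \<in> zariski_closure ?G\<close> by (auto simp: zariski_closure_def)
    then show ?thesis using f(1) by (auto simp: vanishing_ideal_def)
  qed
  show "zariski_closure ?G = A \<or> zariski_closure ?G = B"
  proof (rule ccontr)
    assume contr: "\<not> ?thesis"
    obtain f z1 where f: "f \<in> vanishing_ideal A" "\<forall>i. z1 $ i \<noteq> 0" "z1 - y \<in> W" "f (inv_diag z1) \<noteq> 0"
      using witness[of A] AB contr by auto
    obtain g z2 where g: "g \<in> vanishing_ideal B" "\<forall>i. z2 $ i \<noteq> 0" "z2 - y \<in> W" "g (inv_diag z2) \<noteq> 0"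
      using witness[of B] AB contr by auto
    define l where "l t = z1 + t *s (z2 - z1)" for t
    have comp: "\<And>i. pfun (\<lambda>_ t. t) {()} (\<lambda>t. l t $ i)"
    proof -
      have "pfun (\<lambda>_ t. t) {()} (\<lambda>t::complex. t)" by (rule pfun.gen) simp
      then show "pfun (\<lambda>_ t. t) {()} (\<lambda>t. l t $ i)" for i
        by (simp add: l_def) (intro pfun_intros)
    qed
    let ?d = "\<lambda>t. \<Prod>i\<in>UNIV. l t $ i"
    have to_poly: "\<exists>q. \<forall>t. h t = poly q t" if "pfun (\<lambda>_ t. t) {()} h" for h :: "complex \<Rightarrow> complex"
      by (rule pfun_line[OF that, where \<gamma> = "\<lambda>t. t"]) (auto intro: exI[of _ "[:0, 1:]"])
    have pfg: "poly_fun f" "poly_fun g" using f g by (auto simp: vanishing_ideal_def)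
    obtain N where N: "pfun (\<lambda>_ t. t) {()} (\<lambda>t. f (inv_diag (l t)) * ?d t ^ N)"
      using rational_pullback[of f "\<lambda>_ t. t" "{()}" l, OF pfg(1) comp] by blast
    obtain M where M: "pfun (\<lambda>_ t. t) {()} (\<lambda>t. g (inv_diag (l t)) * ?d t ^ M)"
      using rational_pullback[of g "\<lambda>_ t. t" "{()}" l, OF pfg(2) comp] by blast
    obtain p where p: "\<And>t. f (inv_diag (l t)) * ?d t ^ N = poly p t" using to_poly[OF N] by blast
    obtain q where q: "\<And>t. g (inv_diag (l t)) * ?d t ^ M = poly q t" using to_poly[OF M] by blast
    have "pfun (\<lambda>_ t. t) {()} ?d" by (intro pfun_prod comp)
    from to_poly[OF this] obtain d where d: "\<And>t. ?d t = poly d t" by blast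
    have l01: "l 0 = z1" "l 1 = z2" by (simp_all add: l_def)
    have "poly p 0 \<noteq> 0" unfolding p[symmetric] using f l01 by simp
    moreover have "poly q 1 \<noteq> 0" unfolding q[symmetric] using g l01 by simp
    moreover have "poly d 0 \<noteq> 0" unfolding d[symmetric] using f l01 by simp
    ultimately have "p * q * d \<noteq> 0" by auto
    then obtain t where t: "poly (p * q * d) t \<noteq> 0"
      using poly_nonzero_on_infinite[of "p * q * d" UNIV] infinite_UNIV_char_0 by auto
    then have nz: "f (inv_diag (l t)) \<noteq> 0" "g (inv_diag (l t)) \<noteq> 0" "?d t \<noteq> 0"
      using p[of t] q[of t] d[of t] by auto
    have "l t - y = (z1 - y) + t *s ((z2 - y) - (z1 - y))" by (simp add: l_def)
    also have "\<dots> \<in> W" by (rule vec.subspace_add[OF W f(3) vec.subspace_scale[OF W vec.subspace_diff[OF W g(3) f(3)]]])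
    finally have "l t - y \<in> W" .
    then have "inv_diag (l t) \<in> ?G" using nz(3) by (intro imageI) simp
    then have "inv_diag (l t) \<in> zariski_closure ?G" by (rule subsetD[OF zariski_closure_superset])
    then have "inv_diag (l t) \<in> A \<union> B" using AB by simp
    then show False using f(1) g(1) nz by (auto simp: vanishing_ideal_def)
  qed
qed

lemma affine_piece_strict:
  assumes y: "y \<in> torus L" and W: "vec.subspace W" and W': "vec.subspace W'" "W \<subset> W'"
  shows "zariski_closure (inv_diag ` {z. (\<forall>i. z $ i \<noteq> 0) \<and> z - y \<in> W})
    \<subset> zariski_closure (inv_diag ` {z. (\<forall>i. z $ i \<noteq> 0) \<and> z - y \<in> W'})" (is "zariski_closure ?G \<subset> zariski_closure ?G'")
proof (rule psubsetI)
  show "zariski_closure ?G \<subseteq> zariski_closure ?G'" using W'(2) by (intro zariski_closure_mono image_mono) auto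
  obtain u where u: "u \<in> W'" "u \<notin> W" using W'(2) by blast
  then have "u \<notin> orth (orth W)" using orth_orth[OF W] by simp
  then obtain c where c: "c \<in> orth W" "bil c u \<noteq> 0" unfolding orth_def[of "orth W"] by blast
  have ynz: "y $ i \<noteq> 0" for i using y by (simp add: torus_def)
  have "\<forall>\<^sub>F t in nhds (0::complex). \<forall>i. y $ i - t * u $ i \<noteq> 0" by (rule eventually_curve_nonzero[OF ynz])
  then obtain U where U: "open U" "(0::complex) \<in> U" "\<And>t. t \<in> U \<Longrightarrow> \<forall>i. y $ i - t * u $ i \<noteq> 0"
    unfolding eventually_nhds by blast
  have "infinite U" using interior_limit_point[of 0 U] islimpt_finite[of U 0] interior_open[OF U(1)] U(2) by auto
  then have "infinite (U - {0})" by simp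
  then obtain t where t: "t \<in> U" "t \<noteq> 0" by (metis DiffE finite.emptyI insertI1 ex_in_conv)
  let ?z = "y - t *s u"
  have znz: "\<forall>i. ?z $ i \<noteq> 0" using U(3)[OF t(1)] by simp
  \<comment> \<open>The second term recentres the relation at \<open>y\<close>: on the inverse of
    \<open>z\<close> the value is a unit times \<open>bil c (z - y)\<close>, which vanishes when
    \<open>z - y\<close> lies in \<open>W\<close> but not along \<open>u\<close>.\<close>
  define f where "f K = circuit_poly c K - bil c y * (\<Prod>i\<in>UNIV. K $ i $ i)" for K :: "complex^'n^'n"
  have pf: "poly_fun f"
    unfolding f_def[abs_def] circuit_poly_def by (intro poly_fun_intros)
  have f_val: "f (inv_diag z) = (\<Prod>j\<in>UNIV. 1 / z $ j) * bil c (z - y)" if "\<forall>i. z $ i \<noteq> 0" for z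
    using that by (simp add: f_def circuit_poly_inv_diag inv_diag_nth bil_diff_right algebra_simps)
  have zy: "?z - y = (- t) *s u" by (simp add: vec_eq_iff)
  have "f \<in> vanishing_ideal ?G"
    using pf c(1) by (auto simp: vanishing_ideal_def f_val orth_def bil_commute)
  moreover have "f (inv_diag ?z) \<noteq> 0"
    unfolding f_val[OF znz] zy bil_scale_right using znz c(2) t(2) by simp
  ultimately have "inv_diag ?z \<notin> zariski_closure ?G" by (auto simp: zariski_closure_def)
  moreover have "?z - y \<in> W'" unfolding zy using W'(1) u(1) vec.subspace_scale by metis
  then have "inv_diag ?z \<in> ?G'" using znz by (intro imageI) simp
  then have "inv_diag ?z \<in> zariski_closure ?G'" by (rule subsetD[OF zariski_closure_superset])
  ultimately show "zariski_closure ?G \<noteq> zariski_closure ?G'" by blast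
qed

lemma subspace_flag: "\<exists>W. (\<forall>i\<le>vec.dim L. vec.subspace (W i) \<and> W i \<subseteq> L) \<and> (\<forall>i<vec.dim L. W i \<subset> W (Suc i))"
proof -
  obtain Q R :: "complex^'n^'n" and I where QR: "Q ** R = mat 1" "R ** Q = mat 1" "card I = vec.dim L"
    and VI: "L = (*v) Q ` {z. \<forall>i. i \<notin> I \<longrightarrow> z $ i = 0}"
    by (rule subspace_adapted_basis[OF L])
  obtain h where h: "bij_betw h {..<vec.dim L} I"
    using QR(3) by (metis card_lessThan finite finite_same_card_bij finite_lessThan)
  define W where "W k = (*v) Q ` {z. \<forall>i. i \<notin> h ` {..<k} \<longrightarrow> z $ i = 0}" for k
  have "vec.subspace (W k)" for k
    unfolding W_def by (rule vec.linear_subspace_image) (auto simp: vec.subspace_def)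
  moreover have "W k \<subseteq> L" if "k \<le> vec.dim L" for k
  proof -
    have "h ` {..<k} \<subseteq> I" using h that by (auto simp: bij_betw_def)
    then show ?thesis unfolding W_def VI by (intro image_mono) blast
  qed
  moreover have "W k \<subset> W (Suc k)" if k: "k < vec.dim L" for k
  proof (rule psubsetI)
    show "W k \<subseteq> W (Suc k)" unfolding W_def by (intro image_mono) (auto simp: lessThan_Suc)
    have "h k \<notin> h ` {..<k}"
    proof
      assume "h k \<in> h ` {..<k}"
      then obtain j where j: "j < k" "h k = h j" by auto
      have "k = j" by (rule inj_onD[OF bij_betw_imp_inj_on[OF h] j(2)]) (use j k in auto)
      then show False using j by simp
    qed
    have "Q *v axis (h k) 1 \<in> W (Suc k)" unfolding W_def by (intro imageI) (auto simp: axis_def)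
    moreover have "Q *v axis (h k) 1 \<notin> W k"
    proof
      assume "Q *v axis (h k) 1 \<in> W k"
      then obtain z where z: "Q *v axis (h k) 1 = Q *v z" "\<forall>i. i \<notin> h ` {..<k} \<longrightarrow> z $ i = 0" unfolding W_def by blast
      have "axis (h k) 1 = z"
        using arg_cong[OF z(1), of "(*v) R"] by (simp add: matrix_vector_mul_assoc QR(2))
      then have "z $ h k = 1" by (auto simp: axis_def)
      then show False using z(2) \<open>h k \<notin> h ` {..<k}\<close> by simp
    qed
    ultimately show "W k \<noteq> W (Suc k)" by blast
  qed
  ultimately show ?thesis by (intro exI[of _ W]) blast
qed

text \<open>The torus is parametrized by \<open>vec.dim L\<close> variables with denominators powers
  of \<open>\<delta>\<close>, the exponent \<open>?N\<close> clearing all of them at once. One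
  function more than variables gives a relation, which passes to the closure.\<close>

lemma relation_on_X:
  fixes f :: "nat \<Rightarrow> complex^'n^'n \<Rightarrow> complex"
  assumes f: "\<And>i. i < Suc (vec.dim L) \<Longrightarrow> poly_fun (f i)"
  shows "\<exists>M c. (\<exists>e\<in>PiE {..<Suc (vec.dim L)} (\<lambda>_. {..M}). c e \<noteq> 0) \<and>
    (\<forall>K\<in>X. (\<Sum>e\<in>PiE {..<Suc (vec.dim L)} (\<lambda>_. {..M}). c e * (\<Prod>i<Suc (vec.dim L). f i K ^ e i)) = 0)"
proof -
  let ?r = "vec.dim L"
  obtain Q R :: "complex^'n^'n" and I where QR: "card I = ?r"
    and VI: "L = (*v) Q ` {z. \<forall>i. i \<notin> I \<longrightarrow> z $ i = 0}"
    by (rule subspace_adapted_basis[OF L])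
  define y where "y z = (\<chi> j. \<Sum>i\<in>I. Q $ j $ i * z $ i)" for z :: "complex^'n"
  define \<delta> where "\<delta> z = (\<Prod>i\<in>UNIV. y z $ i)" for z
  have vy: "pfun (\<lambda>i (s::complex^'n). s $ i) I (\<lambda>z. y z $ i)" for i
    by (simp add: y_def) (intro pfun_sum pfun.mult pfun.const pfun.gen)
  have v\<delta>: "pfun (\<lambda>i (s::complex^'n). s $ i) I \<delta>" unfolding \<delta>_def[abs_def] by (intro pfun_prod vy)
  have "\<forall>i\<in>{..<Suc ?r}. \<exists>N. pfun (\<lambda>i (s::complex^'n). s $ i) I (\<lambda>z. f i (inv_diag (y z)) * \<delta> z ^ N)"
    unfolding \<delta>_def using rational_pullback[OF f vy] by blast
  from bchoice[OF this] obtain N where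
    N: "\<forall>i\<in>{..<Suc ?r}. pfun (\<lambda>i (s::complex^'n). s $ i) I (\<lambda>z. f i (inv_diag (y z)) * \<delta> z ^ N i)" ..
  let ?N = "sum N {..<Suc ?r}"
  have "\<exists>M. \<forall>b. (\<forall>i\<in>{..<Suc ?r}. \<forall>k\<le>M. degree (b i k) \<le> M) \<longrightarrow>
     (\<exists>c. (\<exists>e\<in>PiE {..<Suc ?r} (\<lambda>_. {..M}). c e \<noteq> 0) \<and>
       (\<forall>z. \<delta> z ^ ?N \<noteq> 0 \<longrightarrow> (\<Sum>e\<in>PiE {..<Suc ?r} (\<lambda>_. {..M}). c e * (\<Prod>i\<in>{..<Suc ?r}. poly (b i (e i)) (f i (inv_diag (y z))))) = 0))"
  proof (rule algebraic_dependence)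
    show "card I < card {..<Suc ?r}" using QR by simp
    show "pfun (\<lambda>i (s::complex^'n). s $ i) I (\<lambda>z. \<delta> z ^ ?N)" by (intro pfun_power v\<delta>)
    fix i assume i: "i \<in> {..<Suc ?r}"
    then have "N i \<le> ?N" by (intro member_le_sum) auto
    have "pfun (\<lambda>i (s::complex^'n). s $ i) I (\<lambda>z. (f i (inv_diag (y z)) * \<delta> z ^ N i) * \<delta> z ^ (?N - N i))"
      by (rule pfun.mult[OF bspec[OF N i] pfun_power[OF v\<delta>]])
    then show "pfun (\<lambda>i (s::complex^'n). s $ i) I (\<lambda>z. f i (inv_diag (y z)) * \<delta> z ^ ?N)"
      using \<open>N i \<le> ?N\<close> by (simp add: mult.assoc flip: power_add)
  qed auto
  then obtain M where "\<forall>b. (\<forall>i\<in>{..<Suc ?r}. \<forall>k\<le>M. degree (b i k) \<le> M) \<longrightarrow>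
     (\<exists>c. (\<exists>e\<in>PiE {..<Suc ?r} (\<lambda>_. {..M}). c e \<noteq> 0) \<and>
       (\<forall>z. \<delta> z ^ ?N \<noteq> 0 \<longrightarrow> (\<Sum>e\<in>PiE {..<Suc ?r} (\<lambda>_. {..M}). c e * (\<Prod>i\<in>{..<Suc ?r}. poly (b i (e i)) (f i (inv_diag (y z))))) = 0))" ..
  from spec[OF this, of "\<lambda>_ k. monom 1 k"] obtain c where
    c: "\<exists>e\<in>PiE {..<Suc ?r} (\<lambda>_. {..M}). c e \<noteq> 0" and
    rel: "\<And>z. \<delta> z \<noteq> 0 \<Longrightarrow> (\<Sum>e\<in>PiE {..<Suc ?r} (\<lambda>_. {..M}). c e * (\<Prod>i<Suc ?r. f i (inv_diag (y z)) ^ e i)) = 0"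
    by (auto simp: degree_monom_eq poly_monom)
  define F where "F K = (\<Sum>e\<in>PiE {..<Suc ?r} (\<lambda>_. {..M}). c e * (\<Prod>i<Suc ?r. f i K ^ e i))" for K
  have "F \<in> vanishing_ideal X"
    unfolding ideal_iff
  proof (intro conjI ballI)
    show "poly_fun F" unfolding F_def[abs_def] using f by (intro poly_fun_monomial_sum) auto
    fix v assume v: "v \<in> torus L"
    then obtain z where z: "v = Q *v z" "\<And>i. i \<notin> I \<Longrightarrow> z $ i = 0" unfolding torus_def VI by blast
    have "y z = v"
      unfolding z(1) y_def matrix_vector_mult_def using z(2) by (auto simp: vec_eq_iff intro!: sum.mono_neutral_left)
    moreover from this have "\<delta> z \<noteq> 0" using v by (simp add: \<delta>_def torus_def)
    ultimately show "F (inv_diag v) = 0" using rel[of z] by (simp add: F_def)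
  qed
  then show ?thesis using c ideal_zero[of F] unfolding F_def by blast
qed

text \<open>In a chain that is too long, functions \<open>f i\<close> vanishing on
  \<open>Z i\<close> but not on \<open>Z (Suc i)\<close> are removed from a relation one at a time
  by \<open>relation_descent\<close>, until a nonzero constant has to vanish at
  \<open>P\<close>.\<close>

lemma chain_length:
  assumes Z: "\<And>i. i \<le> m \<Longrightarrow> irreducible_closed (Z i)" "\<And>i. i \<le> m \<Longrightarrow> P \<in> Z i" "\<And>i. i \<le> m \<Longrightarrow> Z i \<subseteq> X"
    and strict: "\<And>i. i < m \<Longrightarrow> Z i \<subset> Z (Suc i)"
  shows "m \<le> vec.dim L"
proof (rule ccontr)
  let ?r = "vec.dim L"
  assume "\<not> m \<le> ?r"
  then have m: "?r < m" by simp
  have "\<exists>f Q. f \<in> vanishing_ideal (Z i) \<and> Q \<in> Z (Suc i) \<and> f Q \<noteq> 0" if i: "i < Suc ?r" for i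
  proof -
    have "i < m" using i m by simp
    from strict[OF this] obtain Q where Q: "Q \<in> Z (Suc i)" "Q \<notin> Z i" by blast
    have "zariski_closed (Z i)" using Z(1)[of i] \<open>i < m\<close> by (simp add: irreducible_closed_def)
    from vanishing_separation[OF this Q(2)] show ?thesis using Q(1) by blast
  qed
  then have "\<exists>p. fst p \<in> vanishing_ideal (Z i) \<and> snd p \<in> Z (Suc i) \<and> fst p (snd p) \<noteq> 0" if "i < Suc ?r" for i
    using that by (simp add: split_paired_Ex)
  then have "\<forall>i\<in>{..<Suc ?r}. \<exists>p. fst p \<in> vanishing_ideal (Z i) \<and> snd p \<in> Z (Suc i) \<and> fst p (snd p) \<noteq> 0"
    by (intro ballI) (simp only: lessThan_iff)
  from bchoice[OF this] obtain p where
    p: "\<forall>i\<in>{..<Suc ?r}. fst (p i) \<in> vanishing_ideal (Z i) \<and> snd (p i) \<in> Z (Suc i) \<and> fst (p i) (snd (p i)) \<noteq> 0" ..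
  define f where "f i = fst (p i)" for i
  have f: "poly_fun (f i)" "\<And>K. K \<in> Z i \<Longrightarrow> f i K = 0" "snd (p i) \<in> Z (Suc i)" "f i (snd (p i)) \<noteq> 0" if "i < Suc ?r" for i
    using bspec[OF p, of i] that by (auto simp: f_def vanishing_ideal_def)
  obtain M c where c: "\<exists>e\<in>PiE {..<Suc ?r} (\<lambda>_. {..M}). c e \<noteq> (0::complex)"
    "\<forall>K\<in>X. (\<Sum>e\<in>PiE {..<Suc ?r} (\<lambda>_. {..M}). c e * (\<Prod>i<Suc ?r. f i K ^ e i)) = 0"
    using relation_on_X[of f, OF f(1)] by blast
  have "\<exists>c. (\<exists>e\<in>PiE {..<k} (\<lambda>_. {..M}). c e \<noteq> (0::complex)) \<and>
    (\<forall>K\<in>Z k. (\<Sum>e\<in>PiE {..<k} (\<lambda>_. {..M}). c e * (\<Prod>i<k. f i K ^ e i)) = 0)" if "k \<le> Suc ?r" for k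
    using that
  proof (induction rule: inc_induct)
    case base
    have "Z (Suc ?r) \<subseteq> X" using Z(3)[of "Suc ?r"] m by simp
    then show ?case using c by blast
  next
    case (step k)
    then obtain c' where c': "\<exists>e\<in>PiE {..<Suc k} (\<lambda>_. {..M}). c' e \<noteq> (0::complex)"
      "\<And>K. K \<in> Z (Suc k) \<Longrightarrow> (\<Sum>e\<in>PiE {..<Suc k} (\<lambda>_. {..M}). c' e * (\<Prod>i<Suc k. f i K ^ e i)) = 0" by blast
    show ?case
    proof (rule relation_descent[of "Z (Suc k)" "Z k" k f "snd (p k)" M c'])
      show "irreducible_closed (Z (Suc k))" using Z(1)[of "Suc k"] step m by simp
      show "Z k \<subseteq> Z (Suc k)" using strict[of k] step m by auto
      show "poly_fun (f i)" if "i \<le> k" for i using f(1)[of i] that step by simp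
      show "f k K = 0" if "K \<in> Z k" for K using f(2)[of k K] that step by simp
      show "snd (p k) \<in> Z (Suc k)" "f k (snd (p k)) \<noteq> 0" using f(3,4)[of k] step by simp_all
    qed (use c' in auto)
  qed
  \<comment> \<open>For \<open>k = 0\<close> the only exponent is the function on the empty set,
    represented by \<open>\<lambda>_. undefined\<close>, and the relation is a constant.\<close>
  from this[of 0] obtain c0 where "c0 (\<lambda>_. undefined) \<noteq> (0::complex)" "\<forall>K\<in>Z 0. c0 (\<lambda>_. undefined) = 0" by auto
  then show False using Z(2)[of 0] by auto
qed

lemma local_dim_inv_diag:
  assumes y: "y \<in> torus L" shows "local_dim X (inv_diag y) = enat (vec.dim L)"
  unfolding local_dim_def
proof (rule antisym)
  show "Sup {enat m | m. \<exists>Z. (\<forall>i\<le>m. irreducible_closed (Z i) \<and> inv_diag y \<in> Z i \<and> Z i \<subseteq> X) \<and> (\<forall>i<m. Z i \<subset> Z (Suc i))}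
      \<le> enat (vec.dim L)"
  proof (rule Sup_least)
    fix d assume "d \<in> {enat m | m. \<exists>Z. (\<forall>i\<le>m. irreducible_closed (Z i) \<and> inv_diag y \<in> Z i \<and> Z i \<subseteq> X) \<and> (\<forall>i<m. Z i \<subset> Z (Suc i))}"
    then obtain m Z where d: "d = enat m" and Z: "\<forall>i\<le>m. irreducible_closed (Z i) \<and> inv_diag y \<in> Z i \<and> Z i \<subseteq> X"
      "\<forall>i<m. Z i \<subset> Z (Suc i)" by auto
    have "m \<le> vec.dim L" by (rule chain_length[of m Z "inv_diag y"]) (use Z in auto)
    then show "d \<le> enat (vec.dim L)" by (simp add: d)
  qed
  obtain W where W: "\<forall>i\<le>vec.dim L. vec.subspace (W i) \<and> W i \<subseteq> L" "\<forall>i<vec.dim L. W i \<subset> W (Suc i)"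
    using subspace_flag by blast
  let ?Z = "\<lambda>i. zariski_closure (inv_diag ` {z. (\<forall>j. z $ j \<noteq> 0) \<and> z - y \<in> W i})"
  have "\<forall>i\<le>vec.dim L. irreducible_closed (?Z i) \<and> inv_diag y \<in> ?Z i \<and> ?Z i \<subseteq> X"
  proof (intro allI impI conjI)
    fix i assume i: "i \<le> vec.dim L"
    have Wi: "vec.subspace (W i)" "W i \<subseteq> L" using W(1) i by auto
    show "irreducible_closed (?Z i)" by (rule irreducible_affine_piece[OF y Wi(1)])
    have "y - y \<in> W i" using vec.subspace_0[OF Wi(1)] by simp
    then have "inv_diag y \<in> inv_diag ` {z. (\<forall>j. z $ j \<noteq> 0) \<and> z - y \<in> W i}" using y by (intro imageI) (simp add: torus_def)
    then show "inv_diag y \<in> ?Z i" by (rule subsetD[OF zariski_closure_superset])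
    show "?Z i \<subseteq> X" unfolding X_def
    proof (intro zariski_closure_mono image_mono subsetI)
      fix z assume "z \<in> {z. (\<forall>j. z $ j \<noteq> 0) \<and> z - y \<in> W i}"
      then have "z - y \<in> L" "\<forall>j. z $ j \<noteq> 0" using Wi(2) by auto
      moreover have "z = (z - y) + y" by simp
      ultimately have "z \<in> L" using L y vec.subspace_add[OF L, of "z - y" y] by (simp add: torus_def)
      then show "z \<in> torus L" using \<open>\<forall>j. z $ j \<noteq> 0\<close> by (simp add: torus_def)
    qed
  qed
  moreover have "\<forall>i<vec.dim L. ?Z i \<subset> ?Z (Suc i)"
  proof (intro allI impI)
    fix i assume i: "i < vec.dim L"
    then show "?Z i \<subset> ?Z (Suc i)" using W by (intro affine_piece_strict[OF y]) auto
  qed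
  ultimately show "enat (vec.dim L) \<le> Sup {enat m | m. \<exists>Z. (\<forall>i\<le>m. irreducible_closed (Z i) \<and> inv_diag y \<in> Z i \<and> Z i \<subseteq> X) \<and> (\<forall>i<m. Z i \<subset> Z (Suc i))}"
    by (intro Sup_upper CollectI exI[of _ "vec.dim L"] exI[of _ ?Z] conjI refl)
qed

lemma inv_diag_smooth: "y \<in> torus L \<Longrightarrow> inv_diag y \<in> smooth_locus X"
  by (simp add: smooth_locus_def inv_diag_in_X dim_tangent_space local_dim_inv_diag)

end

section \<open>Critical points\<close>

lemma ideal_generated_base:
  assumes "g \<in> G" shows "g \<in> ideal_generated G"
proof -
  have "g = (\<lambda>K. \<Sum>h\<in>{g}. (\<lambda>_ _. 1) h K * h K)" by simp
  then show ?thesis unfolding ideal_generated_def using assms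
    by (intro CollectI exI[of _ "{g}"] exI[of _ "\<lambda>_ _. 1"] conjI ballI poly_fun.const) auto
qed

lemma ideal_generated_mult:
  assumes "f \<in> ideal_generated G" "poly_fun p" shows "(\<lambda>K. p K * f K) \<in> ideal_generated G"
proof -
  obtain F a where F: "f = (\<lambda>K. \<Sum>g\<in>F. a g K * g K)" "finite F" "F \<subseteq> G" "\<forall>g\<in>F. poly_fun (a g)"
    using assms(1) unfolding ideal_generated_def by auto
  have "(\<lambda>K. p K * f K) = (\<lambda>K. \<Sum>g\<in>F. (\<lambda>g K. p K * a g K) g K * g K)"
    by (simp add: F(1) sum_distrib_left mult.assoc)
  moreover have "\<forall>g\<in>F. poly_fun ((\<lambda>g K. p K * a g K) g)" using F(4) assms(2) by (auto intro: poly_fun.mult)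
  ultimately show ?thesis unfolding ideal_generated_def using F(2,3) by (intro CollectI exI conjI)
qed

lemma ideal_generated_add:
  assumes "f \<in> ideal_generated G" "g \<in> ideal_generated G" shows "(\<lambda>K. f K + g K) \<in> ideal_generated G"
proof -
  obtain F a where F: "f = (\<lambda>K. \<Sum>g\<in>F. a g K * g K)" "finite F" "F \<subseteq> G" "\<forall>g\<in>F. poly_fun (a g)"
    using assms(1) unfolding ideal_generated_def by auto
  obtain F' a' where F': "g = (\<lambda>K. \<Sum>g\<in>F'. a' g K * g K)" "finite F'" "F' \<subseteq> G" "\<forall>g\<in>F'. poly_fun (a' g)"
    using assms(2) unfolding ideal_generated_def by auto
  define c where "c h K = (if h \<in> F then a h K else 0) + (if h \<in> F' then a' h K else 0)" for h K
  have 1: "(\<Sum>h\<in>F \<union> F'. (if h \<in> F then a h K else 0) * h K) = f K" for K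
    unfolding F(1) using F(2) F'(2) by (intro sum.mono_neutral_cong_right) auto
  have 2: "(\<Sum>h\<in>F \<union> F'. (if h \<in> F' then a' h K else 0) * h K) = g K" for K
    unfolding F'(1) using F(2) F'(2) by (intro sum.mono_neutral_cong_right) auto
  have "(\<lambda>K. f K + g K) = (\<lambda>K. \<Sum>h\<in>F \<union> F'. c h K * h K)"
    by (simp add: c_def distrib_right sum.distrib 1 2)
  moreover have "\<forall>h\<in>F \<union> F'. poly_fun (c h)"
    unfolding c_def[abs_def] using F(4) F'(4)
    by (intro ballI poly_fun.add poly_fun_if poly_fun.const) auto
  ultimately show ?thesis unfolding ideal_generated_def using F(2,3) F'(2,3)
    by (intro CollectI exI[of _ "F \<union> F'"] exI[of _ c]) auto
qed

lemma ideal_generated_zero: "(\<lambda>K. 0) \<in> ideal_generated G"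
  unfolding ideal_generated_def by (intro CollectI exI[of _ "{}"]) auto

lemma ideal_generated_sum:
  "(\<And>i. i \<in> A \<Longrightarrow> h i \<in> ideal_generated G) \<Longrightarrow> (\<lambda>K. \<Sum>i\<in>A. h i K) \<in> ideal_generated G"
  by (induction A rule: infinite_finite_induct) (auto intro: ideal_generated_zero ideal_generated_add)

text \<open>The coefficients are polynomial in \<open>K\<close>, and at \<open>K0\<close> they give
  the derivative (\<open>hadamard_dir_deriv\<close>); this links ideal membership, needed for
  multiplicities, with the linearized equations.\<close>

lemma hadamard:
  fixes f :: "complex^'n^'n \<Rightarrow> complex"
  assumes "poly_fun f"
  shows "\<exists>A. (\<forall>i j. poly_fun (A i j)) \<and> (\<forall>K. f K = f K0 + (\<Sum>i\<in>UNIV. \<Sum>j\<in>UNIV. A i j K * (K $ i $ j - K0 $ i $ j)))"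
  using assms
proof induction
  case (const c)
  show ?case by (intro exI[of _ "\<lambda>_ _ _. 0"]) (auto intro: poly_fun.const)
next
  case (coord a b)
  have "(\<Sum>j\<in>UNIV. (if i = a \<and> j = b then 1 else 0) * (K $ i $ j - K0 $ i $ j)) = (if i = a then K $ a $ b - K0 $ a $ b else 0)"
    for i and K :: "complex^'n^'n"
    by (cases "i = a") (simp_all add: if_distrib[of "\<lambda>x. x * _"] cong: if_cong)
  then show ?case
    by (intro exI[of _ "\<lambda>i j _. if i = a \<and> j = b then 1 else 0"]) (auto intro: poly_fun.const)
next
  case (add f g)
  then obtain A A' where A: "\<forall>i j. poly_fun (A i j)" "\<forall>K. f K = f K0 + (\<Sum>i\<in>UNIV. \<Sum>j\<in>UNIV. A i j K * (K $ i $ j - K0 $ i $ j))"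
    and A': "\<forall>i j. poly_fun (A' i j)" "\<forall>K. g K = g K0 + (\<Sum>i\<in>UNIV. \<Sum>j\<in>UNIV. A' i j K * (K $ i $ j - K0 $ i $ j))"
    by (elim exE conjE)
  show ?case
  proof (intro exI[of _ "\<lambda>i j K. A i j K + A' i j K"] conjI allI)
    show "poly_fun (\<lambda>K. A i j K + A' i j K)" for i j using A(1) A'(1) by (blast intro: poly_fun.add)
    show "f K + g K = f K0 + g K0 + (\<Sum>i\<in>UNIV. \<Sum>j\<in>UNIV. (A i j K + A' i j K) * (K $ i $ j - K0 $ i $ j))" for K
      unfolding spec[OF A(2), of K] spec[OF A'(2), of K] by (simp only: distrib_right sum.distrib ac_simps)
  qed
next
  case (mult f g)
  then obtain A A' where A: "\<forall>i j. poly_fun (A i j)" "\<forall>K. f K = f K0 + (\<Sum>i\<in>UNIV. \<Sum>j\<in>UNIV. A i j K * (K $ i $ j - K0 $ i $ j))"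
    and A': "\<forall>i j. poly_fun (A' i j)" "\<forall>K. g K = g K0 + (\<Sum>i\<in>UNIV. \<Sum>j\<in>UNIV. A' i j K * (K $ i $ j - K0 $ i $ j))"
    by (elim exE conjE)
  show ?case
  proof (intro exI[of _ "\<lambda>i j K. A i j K * g K + f K0 * A' i j K"] conjI allI)
    show "poly_fun (\<lambda>K. A i j K * g K + f K0 * A' i j K)" for i j
      using A(1) A'(1) mult.hyps by (intro poly_fun.add poly_fun.mult poly_fun.const) auto
    fix K
    have "(\<Sum>i\<in>UNIV. \<Sum>j\<in>UNIV. (A i j K * g K + f K0 * A' i j K) * (K $ i $ j - K0 $ i $ j))
        = (\<Sum>i\<in>UNIV. \<Sum>j\<in>UNIV. A i j K * (K $ i $ j - K0 $ i $ j)) * g K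
          + f K0 * (\<Sum>i\<in>UNIV. \<Sum>j\<in>UNIV. A' i j K * (K $ i $ j - K0 $ i $ j))"
      unfolding sum_distrib_left sum_distrib_right sum.distrib[symmetric]
      by (intro sum.cong refl) (simp add: algebra_simps)
    also have "\<dots> = (f K - f K0) * g K + f K0 * (g K - g K0)"
      using spec[OF A(2), of K] spec[OF A'(2), of K] by simp
    finally show "f K * g K = f K0 * g K0 + (\<Sum>i\<in>UNIV. \<Sum>j\<in>UNIV. (A i j K * g K + f K0 * A' i j K) * (K $ i $ j - K0 $ i $ j))"
      by (simp add: algebra_simps)
  qed
qed

text \<open>As \<open>g\<close> vanishes at 0, continuity of the other factor is enough: its
  derivative would only be multiplied by 0.\<close>

lemma DERIV_mult_vanishing:
  fixes D g :: "complex \<Rightarrow> complex"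
  assumes "isCont D 0" "(g has_field_derivative g') (at 0)" "g 0 = 0"
  shows "((\<lambda>t. D t * g t) has_field_derivative D 0 * g') (at 0)"
proof -
  obtain k where k: "\<And>z. g z - g 0 = k z * (z - 0)" "isCont k 0" "k 0 = g'"
    using assms(2) unfolding CARAT_DERIV by blast
  show ?thesis unfolding CARAT_DERIV
  proof (intro exI[of _ "\<lambda>t. D t * k t"] conjI allI)
    show "isCont (\<lambda>t. D t * k t) 0" by (rule isCont_mult[OF assms(1) k(2)])
  qed (use k(1,3) assms(3) in \<open>simp_all add: mult.assoc\<close>)
qed

lemma hadamard_dir_deriv:
  fixes f :: "complex^'n^'n \<Rightarrow> complex"
  assumes f: "poly_fun f" and A: "\<And>i j. poly_fun (A i j)"
    and expand: "\<And>K. f K = f K0 + (\<Sum>i\<in>UNIV. \<Sum>j\<in>UNIV. A i j K * (K $ i $ j - K0 $ i $ j))"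
  shows "dir_deriv f K0 V = (\<Sum>i\<in>UNIV. \<Sum>j\<in>UNIV. A i j K0 * V $ i $ j)"
proof -
  let ?h = "\<lambda>t. \<Sum>i\<in>UNIV. \<Sum>j\<in>UNIV. A i j (K0 + cscale t V) * V $ i $ j"
  have z: "K0 + cscale 0 V = K0" by (simp add: vec_eq_iff cscale_nth)
  have "isCont (\<lambda>t. A i j (K0 + cscale t V)) 0" for i j
  proof -
    obtain q where "\<forall>t. A i j (K0 + cscale t V) = poly q t" using poly_fun_line[OF A] by blast
    then show ?thesis by simp
  qed
  then have cont: "isCont ?h 0" by (intro continuous_intros) auto
  have "((\<lambda>t. f (K0 + cscale t V)) has_field_derivative ?h 0) (at 0)"
    unfolding CARAT_DERIV
  proof (intro exI[of _ ?h] conjI allI cont refl)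
    fix t
    have "f (K0 + cscale t V) = f K0 + t * ?h t"
      by (subst expand) (simp add: cscale_nth sum_distrib_left mult_ac)
    then show "f (K0 + cscale t V) - f (K0 + cscale 0 V) = ?h t * (t - 0)" by (simp add: z)
  qed
  then show ?thesis unfolding dir_deriv_def by (simp add: DERIV_imp_deriv z)
qed

lemma dir_deriv_det_inv_diag:
  assumes "\<And>i. y $ i \<noteq> 0"
  shows "dir_deriv det (inv_diag y) (diag_mat v) = (\<Prod>i\<in>UNIV. 1 / y $ i) * (\<Sum>i\<in>UNIV. v $ i * y $ i)"
proof -
  \<comment> \<open>Exponential entries have the required velocities and make the determinant a
    constant times a single exponential.\<close>
  define M where "M t = diag_mat (\<chi> i. exp (t * (v $ i * y $ i)) / y $ i)" for t
  have "((\<lambda>t. M t $ i $ j) has_field_derivative diag_mat v $ i $ j) (at 0)" for i j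
  proof (cases "i = j")
    case True
    have "((\<lambda>t. exp (t * (v $ i * y $ i)) / y $ i) has_field_derivative v $ i) (at 0)"
      using assms[of i] by (auto intro!: derivative_eq_intros)
    then show ?thesis using True by (simp add: M_def diag_mat_nth)
  qed (simp add: M_def diag_mat_nth)
  moreover have "poly_fun (det :: complex^'a^'a \<Rightarrow> complex)"
    using poly_fun_det[of "\<lambda>K. K"] by (simp add: poly_fun.coord)
  ultimately have "((\<lambda>t. det (M t)) has_field_derivative dir_deriv det (M 0) (diag_mat v)) (at 0)"
    by (intro poly_fun_chain)
  moreover have "M 0 = inv_diag y" by (simp add: M_def inv_diag_def)
  moreover have "det (M t) = exp (t * (\<Sum>i\<in>UNIV. v $ i * y $ i)) * (\<Prod>i\<in>UNIV. 1 / y $ i)" for t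
    by (simp add: M_def det_diag_mat exp_sum sum_distrib_left prod_dividef)
  ultimately have "((\<lambda>t. exp (t * (\<Sum>i\<in>UNIV. v $ i * y $ i)) * (\<Prod>i\<in>UNIV. 1 / y $ i))
      has_field_derivative dir_deriv det (inv_diag y) (diag_mat v)) (at 0)" by simp
  moreover have "((\<lambda>t. exp (t * (\<Sum>i\<in>UNIV. v $ i * y $ i)) * (\<Prod>i\<in>UNIV. 1 / y $ i))
      has_field_derivative (\<Prod>i\<in>UNIV. 1 / y $ i) * (\<Sum>i\<in>UNIV. v $ i * y $ i)) (at 0)"
    by (auto intro!: derivative_eq_intros)
  ultimately show ?thesis by (rule DERIV_unique)
qed

lemma det_inv_diag: "det (inv_diag y) = (\<Prod>i\<in>UNIV. 1 / y $ i)"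
  by (simp add: inv_diag_def det_diag_mat)

lemma trace_mult_diag_mat: "trace (S ** diag_mat v) = (\<Sum>i\<in>UNIV. S $ i $ i * v $ i)"
  by (simp add: trace_def matrix_matrix_mult_def diag_mat_nth if_distrib[of "(*) _"] cong: if_cong)

text \<open>The value of \<open>w\<close> forced by \<open>y + y\<^sup>2 w = s\<close>, with
  \<open>s\<close> the diagonal of \<open>S\<close>.\<close>

definition score_vec :: "complex^'n^'n \<Rightarrow> complex^'n \<Rightarrow> complex^'n" where
  "score_vec S y = (\<chi> i. S $ i $ i / (y $ i)\<^sup>2 - 1 / y $ i)"

context diagonal_model
begin

text \<open>One vector for each index, those in \<open>I\<close> spanning \<open>L\<close> and the
  others its annihilator: the resulting equations form a square system, as Cramer's rule
  requires.\<close>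

lemma orth_spanning:
  obtains I :: "'n set" and u :: "'n \<Rightarrow> complex^'n" where "\<And>k. k \<in> I \<Longrightarrow> u k \<in> L" "\<And>k. k \<notin> I \<Longrightarrow> u k \<in> orth L"
    "\<And>d. (\<And>k. k \<in> I \<Longrightarrow> bil (u k) d = 0) \<Longrightarrow> d \<in> orth L"
    "\<And>v. (\<And>k. k \<notin> I \<Longrightarrow> bil (u k) v = 0) \<Longrightarrow> v \<in> L"
proof -
  obtain Q R :: "complex^'n^'n" and I where QR: "Q ** R = mat 1" "R ** Q = mat 1"
    and VI: "L = (*v) Q ` {z. \<forall>i. i \<notin> I \<longrightarrow> z $ i = 0}"
    and WI: "orth L = (*v) (transpose R) ` {z. \<forall>i\<in>I. z $ i = 0}"
    by (rule subspace_adapted_basis[OF L])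
  define u where "u k = (if k \<in> I then Q *v axis k 1 else transpose R *v axis k 1)" for k
  have uQ: "bil (u k) d = (transpose Q *v d) $ k" if "k \<in> I" for k d
    using that by (simp add: u_def bil_matrix bil_commute[of "axis k 1"] bil_axis del: transpose_matrix_vector)
  have uR: "bil (u k) v = (R *v v) $ k" if "k \<notin> I" for k v
    using that by (simp add: u_def bil_matrix bil_commute[of "axis k 1"] bil_axis transpose_transpose del: transpose_matrix_vector)
  show thesis
  proof (rule that[of I u])
    show "u k \<in> L" if "k \<in> I" for k using that unfolding VI u_def by (auto simp: axis_def)
    show "u k \<in> orth L" if "k \<notin> I" for k
    proof -
      have "transpose R *v axis k 1 \<in> orth L" unfolding WI using that by (intro imageI) (auto simp: axis_def)
      then show ?thesis using that by (simp add: u_def del: transpose_matrix_vector)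
    qed
    show "d \<in> orth L" if d: "\<And>k. k \<in> I \<Longrightarrow> bil (u k) d = 0" for d
      unfolding orth_def
    proof (intro CollectI ballI)
      fix v assume "v \<in> L"
      then obtain z where z: "v = Q *v z" "\<And>i. i \<notin> I \<Longrightarrow> z $ i = 0" by (subst (asm) VI) auto
      have "bil v d = bil z (transpose Q *v d)" by (simp add: z(1) bil_matrix del: transpose_matrix_vector)
      also have "\<dots> = 0" unfolding bil_def
      proof (rule sum.neutral, rule ballI)
        fix i show "z $ i * (transpose Q *v d) $ i = 0"
          using z(2)[of i] d[of i] uQ[of i d] by (cases "i \<in> I") (auto simp del: transpose_matrix_vector)
      qed
      finally show "bil v d = 0" .
    qed
    show "v \<in> L" if v: "\<And>k. k \<notin> I \<Longrightarrow> bil (u k) v = 0" for v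
    proof -
      have "v = Q *v (R *v v)" by (simp add: matrix_vector_mul_assoc QR)
      moreover have "(R *v v) $ i = 0" if "i \<notin> I" for i using v[OF that] uR[OF that] by simp
      ultimately show ?thesis unfolding VI by blast
    qed
  qed
qed

lemma dloglik_inv_diag:
  assumes "\<And>i. y $ i \<noteq> 0"
  shows "dloglik S (inv_diag y) (diag_mat v) = - bil (\<chi> i. (y $ i)\<^sup>2 * v $ i) (score_vec S y)"
proof -
  have "(\<Prod>i\<in>UNIV. 1 / y $ i) \<noteq> 0" using assms by simp
  then have "dloglik S (inv_diag y) (diag_mat v) = (\<Sum>i\<in>UNIV. v $ i * y $ i) - (\<Sum>i\<in>UNIV. S $ i $ i * v $ i)"
    unfolding dloglik_def dir_deriv_det_inv_diag[OF assms] det_inv_diag trace_mult_diag_mat by simp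
  also have "\<dots> = (\<Sum>i\<in>UNIV. - ((y $ i)\<^sup>2 * v $ i * (S $ i $ i / (y $ i)\<^sup>2 - 1 / y $ i)))"
    unfolding sum_subtractf[symmetric]
  proof (rule sum.cong)
    fix i
    show "v $ i * y $ i - S $ i $ i * v $ i = - ((y $ i)\<^sup>2 * v $ i * (S $ i $ i / (y $ i)\<^sup>2 - 1 / y $ i))"
      using assms[of i] by (simp add: field_simps power2_eq_square)
  qed simp
  finally show ?thesis by (simp add: bil_def score_vec_def sum_negf)
qed

lemma critical_points_eq:
  "critical_points X S = inv_diag ` {y\<in>torus L. score_vec S y \<in> orth L}"
proof -
  have iff: "(\<forall>V\<in>tangent_space X (inv_diag y). dloglik S (inv_diag y) V = 0) \<longleftrightarrow> score_vec S y \<in> orth L"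
    if y: "y \<in> torus L" for y
  proof -
    have ynz: "y $ i \<noteq> 0" for i using y by (simp add: torus_def)
    have "(\<forall>V\<in>tangent_space X (inv_diag y). dloglik S (inv_diag y) V = 0) \<longleftrightarrow>
        (\<forall>v. (\<chi> i. (y $ i)\<^sup>2 * v $ i) \<in> L \<longrightarrow> bil (\<chi> i. (y $ i)\<^sup>2 * v $ i) (score_vec S y) = 0)"
      unfolding tangent_space_eq[OF y] by (simp add: dloglik_inv_diag[OF ynz])
    also have "\<dots> \<longleftrightarrow> (\<forall>u\<in>L. bil u (score_vec S y) = 0)"
    proof (intro iffI ballI allI impI)
      fix u assume h: "\<forall>v. (\<chi> i. (y $ i)\<^sup>2 * v $ i) \<in> L \<longrightarrow> bil (\<chi> i. (y $ i)\<^sup>2 * v $ i) (score_vec S y) = 0" and u: "u \<in> L"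
      have "(\<chi> i. (y $ i)\<^sup>2 * (\<chi> i. u $ i / (y $ i)\<^sup>2) $ i) = u" using ynz by (simp add: vec_eq_iff)
      then show "bil u (score_vec S y) = 0" using spec[OF h, of "\<chi> i. u $ i / (y $ i)\<^sup>2"] u by simp
    qed blast
    finally show ?thesis by (simp add: orth_def)
  qed
  show ?thesis
  proof (intro equalityI subsetI)
    fix K assume K: "K \<in> critical_points X S"
    then have "K \<in> X" "invertible K" by (auto simp: critical_points_def smooth_locus_def)
    then obtain y where y: "y \<in> torus L" "K = inv_diag y" by (rule invertible_in_X)
    then show "K \<in> inv_diag ` {y\<in>torus L. score_vec S y \<in> orth L}"
      using K iff[OF y(1)] by (auto simp: critical_points_def)
  next
    fix K assume "K \<in> inv_diag ` {y\<in>torus L. score_vec S y \<in> orth L}"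
    then obtain y where y: "y \<in> torus L" "score_vec S y \<in> orth L" "K = inv_diag y" by blast
    have "invertible K" using y(1) by (simp add: y(3) inv_diag_def invertible_diag_mat torus_def)
    then show "K \<in> critical_points X S"
      using inv_diag_smooth[OF y(1)] iff[OF y(1)] y(2) by (simp add: critical_points_def y(3))
  qed
qed

text \<open>The factor \<open>det K\<close> makes this field tangent also at the singular matrices of \<open>X\<close>, where it vanishes.\<close>

definition field :: "complex^'n \<Rightarrow> complex^'n^'n \<Rightarrow> complex^'n^'n" where
  "field u K = cscale (det K) (diag_mat (\<chi> i. (K $ i $ i)\<^sup>2 * u $ i))"

definition score :: "complex^'n^'n \<Rightarrow> complex^'n \<Rightarrow> complex^'n^'n \<Rightarrow> complex" where
  "score S u K = dir_deriv det K (field u K) - det K * trace (S ** field u K)"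

lemma poly_fun_det_id: "poly_fun (det :: complex^'n^'n \<Rightarrow> complex)"
  using poly_fun_det[of "\<lambda>K. K"] by (simp add: poly_fun.coord)

lemma poly_fun_field: "poly_fun (\<lambda>K. field u K $ i $ j)"
  unfolding field_def cscale_nth diag_mat_nth
  by (cases "i = j") (auto intro!: poly_fun_intros poly_fun_det_id)

lemma poly_fun_score: "poly_fun (score S u)"
proof (rule dir_deriv_gradient[OF poly_fun_det_id])
  fix p :: "'n \<Rightarrow> 'n \<Rightarrow> complex^'n^'n \<Rightarrow> complex"
  assume p: "\<And>i j. poly_fun (p i j)" "\<And>K V. dir_deriv det K V = (\<Sum>i\<in>UNIV. \<Sum>j\<in>UNIV. p i j K * V $ i $ j)"
  show "poly_fun (score S u)"
    unfolding score_def[abs_def] p(2) trace_def matrix_matrix_mult_def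
    by (simp, intro poly_fun_diff poly_fun_sum poly_fun.mult poly_fun.const p(1) poly_fun_field poly_fun_det_id)
qed

lemma field_inv_diag: "field u (inv_diag z) = diag_mat (\<chi> i. (\<Prod>j\<in>UNIV. 1 / z $ j) * (u $ i / (z $ i)\<^sup>2))"
  by (simp add: field_def det_inv_diag vec_eq_iff cscale_nth diag_mat_nth inv_diag_nth power_divide)

lemma score_inv_diag:
  assumes "\<And>i. z $ i \<noteq> 0"
  shows "score S u (inv_diag z) = (\<Prod>j\<in>UNIV. 1 / z $ j)\<^sup>2 * (\<Sum>i\<in>UNIV. u $ i * (1 / z $ i - S $ i $ i / (z $ i)\<^sup>2))"
proof -
  let ?P = "\<Prod>j\<in>UNIV. 1 / z $ j"
  have "score S u (inv_diag z) = ?P * ((\<Sum>i\<in>UNIV. ?P * (u $ i / (z $ i)\<^sup>2) * z $ i) - (\<Sum>i\<in>UNIV. S $ i $ i * (?P * (u $ i / (z $ i)\<^sup>2))))"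
    unfolding score_def field_inv_diag dir_deriv_det_inv_diag[OF assms] det_inv_diag trace_mult_diag_mat
    by (simp add: right_diff_distrib)
  also have "\<dots> = ?P * (\<Sum>i\<in>UNIV. ?P * (u $ i * (1 / z $ i - S $ i $ i / (z $ i)\<^sup>2)))"
    unfolding sum_subtractf[symmetric]
  proof (rule arg_cong[where f = "(*) ?P"], rule sum.cong)
    fix i
    show "?P * (u $ i / (z $ i)\<^sup>2) * z $ i - S $ i $ i * (?P * (u $ i / (z $ i)\<^sup>2)) = ?P * (u $ i * (1 / z $ i - S $ i $ i / (z $ i)\<^sup>2))"
      using assms[of i] by (simp add: right_diff_distrib power2_eq_square mult_ac)
  qed simp
  finally show ?thesis by (simp add: power2_eq_square sum_distrib_left mult.assoc)
qed

lemma field_tangent: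
  assumes "u \<in> L" shows "field u \<in> tangent_fields X"
  unfolding tangent_fields_def
proof (intro CollectI conjI allI ballI)
  show "poly_fun (\<lambda>K. field u K $ i $ j)" for i j by (rule poly_fun_field)
  fix K assume K: "K \<in> X"
  show "field u K \<in> tangent_space X K"
  proof (cases "invertible K")
    case True
    then obtain y where y: "y \<in> torus L" "K = inv_diag y" using invertible_in_X[OF K] by blast
    have "(\<chi> i. (y $ i)\<^sup>2 * (\<chi> i. (\<Prod>j\<in>UNIV. 1 / y $ j) * (u $ i / (y $ i)\<^sup>2)) $ i) = (\<Prod>j\<in>UNIV. 1 / y $ j) *s u"
      using y(1) by (simp add: vec_eq_iff torus_def)
    also have "\<dots> \<in> L" by (rule vec.subspace_scale[OF L assms])
    finally show ?thesis unfolding y(2) tangent_space_eq[OF y(1)] field_inv_diag by (intro imageI CollectI)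
  next
    case False
    then have "det K = 0" by (simp add: invertible_det_nz)
    then have "field u K = 0" by (simp add: field_def vec_eq_iff cscale_nth)
    then show ?thesis by (simp add: tangent_space_def dir_deriv_zero)
  qed
qed

lemma score_in_critical_ideal: "u \<in> L \<Longrightarrow> score S u \<in> critical_ideal X S"
  unfolding critical_ideal_def using field_tangent[of u]
  by (intro ideal_generated_base UnI2 CollectI exI[of _ "field u"]) (auto simp: score_def[abs_def])

lemma ideal_in_critical_ideal: "f \<in> vanishing_ideal X \<Longrightarrow> f \<in> critical_ideal X S"
  unfolding critical_ideal_def by (intro ideal_generated_base UnI1)

text \<open>At a critical point the sum in \<open>score_inv_diag\<close> is 0, so the determinant
  factor need not be differentiated, and only \<open>1 / z - s / z\<^sup>2\<close> is.\<close>

lemma dir_deriv_score: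
  assumes y: "y \<in> torus L" and u: "u \<in> L" and crit: "score_vec S y \<in> orth L"
  shows "dir_deriv (score S u) (inv_diag y) (diag_mat h)
    = (\<Prod>j\<in>UNIV. 1 / y $ j)\<^sup>2 * (\<Sum>i\<in>UNIV. u $ i * ((1 - 2 * S $ i $ i / y $ i) * h $ i))"
proof -
  have ynz: "y $ i \<noteq> 0" for i using y by (simp add: torus_def)
  let ?z = "\<lambda>t. \<chi> i. y $ i - t * ((y $ i)\<^sup>2 * h $ i)"
  let ?D = "\<lambda>t. (\<Prod>j\<in>UNIV. 1 / ?z t $ j)\<^sup>2"
  let ?g = "\<lambda>t. \<Sum>i\<in>UNIV. u $ i * (1 / ?z t $ i - S $ i $ i / (?z t $ i)\<^sup>2)"
  have "\<forall>\<^sub>F t in nhds 0. score S u (inv_diag (?z t)) = ?D t * ?g t"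
    using eventually_curve_nonzero[OF ynz, of "\<chi> i. (y $ i)\<^sup>2 * h $ i"]
    by eventually_elim (rule score_inv_diag, simp)
  note ev = DERIV_cong_ev[OF refl this refl]
  have cont: "isCont ?D 0" using ynz by (auto intro!: continuous_intros)
  have "((\<lambda>t. u $ i * (1 / ?z t $ i - S $ i $ i / (?z t $ i)\<^sup>2)) has_field_derivative
      u $ i * ((1 - 2 * S $ i $ i / y $ i) * h $ i)) (at 0)" for i
    using ynz[of i] by (auto intro!: derivative_eq_intros simp: field_simps power2_eq_square)
  then have der: "(?g has_field_derivative (\<Sum>i\<in>UNIV. u $ i * ((1 - 2 * S $ i $ i / y $ i) * h $ i))) (at 0)"
    by (rule DERIV_sum)
  have "?g 0 = - bil u (score_vec S y)"
    by (simp add: bil_def score_vec_def sum_negf[symmetric] algebra_simps)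
  also have "\<dots> = 0" using crit u by (simp add: orth_def)
  finally have "?g 0 = 0" .
  from DERIV_mult_vanishing[OF cont der this]
  have "((\<lambda>t. score S u (inv_diag (?z t))) has_field_derivative
      ?D 0 * (\<Sum>i\<in>UNIV. u $ i * ((1 - 2 * S $ i $ i / y $ i) * h $ i))) (at 0)" unfolding ev .
  from DERIV_unique[OF chain_curve[OF poly_fun_score ynz] this] show ?thesis by simp
qed

end

section \<open>Multiplicities\<close>

lemma ideal_generated_vanishes:
  assumes "\<And>g. g \<in> G \<Longrightarrow> g K = 0" "f \<in> ideal_generated G" shows "f K = 0"
proof -
  obtain F a where "f = (\<lambda>K. \<Sum>g\<in>F. a g K * g K)" "F \<subseteq> G"
    using assms(2) unfolding ideal_generated_def by auto
  then show ?thesis using assms(1) by (auto intro!: sum.neutral)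
qed

text \<open>Evaluation at \<open>K\<close> identifies the quotient with the complex numbers: any two
  functions have a nontrivial combination vanishing at \<open>K\<close>.\<close>

lemma colength_maximal_ideal:
  fixes K :: "complex^'n^'n"
  shows "colength {f. poly_fun f \<and> f K = 0} = 1"
  unfolding colength_def
proof (rule antisym)
  let ?Q = "{f :: complex^'n^'n \<Rightarrow> complex. poly_fun f \<and> f K = 0}"
  show "Sup {enat (card B) | B. finite B \<and> (\<forall>b\<in>B. poly_fun b) \<and> (\<forall>c. (\<lambda>K. \<Sum>b\<in>B. c b * b K) \<in> ?Q \<longrightarrow> (\<forall>b\<in>B. c b = 0))} \<le> 1"
  proof (rule Sup_least, clarify)
    fix B :: "(complex^'n^'n \<Rightarrow> complex) set"
    assume B: "finite B" "\<forall>b\<in>B. poly_fun b"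
      and ind: "\<forall>c. (\<lambda>K. \<Sum>b\<in>B. c b * b K) \<in> ?Q \<longrightarrow> (\<forall>b\<in>B. c b = 0)"
    have dep: "\<forall>b\<in>B. c b = 0" if "(\<Sum>b\<in>B. c b * b K) = 0" for c
      using spec[OF ind, of c] that B(2) by (auto intro!: poly_fun_sum poly_fun.mult poly_fun.const)
    have nz: "b K \<noteq> 0" if b: "b \<in> B" for b
    proof
      assume "b K = 0"
      then have "(\<Sum>b'\<in>B. (if b' = b then 1 else 0) * b' K) = 0"
        by (intro sum.neutral) auto
      from dep[OF this] b show False by auto
    qed
    have "b1 = b2" if b: "b1 \<in> B" "b2 \<in> B" for b1 b2
    proof (rule ccontr)
      assume ne: "b1 \<noteq> b2"
      define c where "c b = (if b = b1 then b2 K else 0) + (if b = b2 then - b1 K else 0)" for b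
      have "(\<Sum>b\<in>B. c b * b K) = (\<Sum>b\<in>B. (if b = b1 then b2 K * b1 K else 0)) + (\<Sum>b\<in>B. if b = b2 then - b1 K * b2 K else 0)"
        unfolding sum.distrib[symmetric] by (rule sum.cong) (auto simp: c_def)
      also have "\<dots> = 0" using b B(1) by simp
      finally have "c b1 = 0" using dep b(1) by blast
      then show False using ne nz[OF b(2)] by (simp add: c_def)
    qed
    then have "card B \<le> 1" using B(1) by (simp add: card_le_Suc0_iff_eq)
    then show "enat (card B) \<le> 1" by (simp add: one_enat_def)
  qed
  show "1 \<le> Sup {enat (card B) | B. finite B \<and> (\<forall>b\<in>B. poly_fun b) \<and> (\<forall>c. (\<lambda>K. \<Sum>b\<in>B. c b * b K) \<in> ?Q \<longrightarrow> (\<forall>b\<in>B. c b = 0))}"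
    by (rule Sup_upper, rule CollectI, rule exI[of _ "{\<lambda>_. 1}"]) (auto simp: one_enat_def intro: poly_fun.const)
qed

text \<open>Cramer's rule: the determinant of the coefficient matrix of a system of generators,
  a unit at \<open>K0\<close>, carries each coordinate difference into the ideal.\<close>

lemma localized_ideal_maximal:
  fixes K0 :: "complex^'n^'n" and N :: "complex^'n^'n \<Rightarrow> complex^'n^'n"
    and G :: "(complex^'n^'n \<Rightarrow> complex) set"
  defines "J \<equiv> ideal_generated G"
  assumes vanish: "\<And>f. f \<in> J \<Longrightarrow> f K0 = 0"
    and F: "\<And>k. F k \<in> J" and N: "\<And>k i. poly_fun (\<lambda>K. N K $ k $ i)"
    and expand: "\<And>k K. F k K = (\<Sum>i\<in>UNIV. N K $ k $ i * (K $ i $ i - K0 $ i $ i))"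
    and off: "\<And>i j. i \<noteq> j \<Longrightarrow> (\<lambda>K. K $ i $ j - K0 $ i $ j) \<in> J"
    and det: "det (N K0) \<noteq> 0"
  shows "localized_ideal J K0 = {f. poly_fun f \<and> f K0 = 0}"
proof -
  have detp: "poly_fun (\<lambda>K. det (N K))" by (rule poly_fun_det[OF N])
  have diag: "(\<lambda>K. det (N K) * (K $ i $ i - K0 $ i $ i)) \<in> J" for i
  proof -
    define x where "x K = (\<chi> i. K $ i $ i - K0 $ i $ i)" for K
    have row: "(N K *v x K) $ k = F k K" for K k
      by (simp add: matrix_vector_mult_def x_def expand)
    \<comment> \<open>Each permutation meets the replaced column \<open>i\<close> exactly once, in
      row \<open>inv p i\<close>, so the expansion is a combination of the \<open>F k\<close> with
      polynomial coefficients.\<close>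
    have "det (N K) * (K $ i $ i - K0 $ i $ i) = det (\<chi> k j. if j = i then F k K else N K $ k $ j)" for K
      using cramer_lemma[of i "N K" "x K"] unfolding row by (simp add: x_def mult.commute)
    also have "\<dots> K = (\<Sum>p | p permutes UNIV. (of_int (sign p) * (\<Prod>k\<in>UNIV - {inv p i}. N K $ k $ p k)) * F (inv p i) K)" for K
      unfolding det_def
    proof (rule sum.cong[OF refl])
      fix p assume "p \<in> {p. p permutes (UNIV :: 'n set)}"
      then have p: "p permutes UNIV" by simp
      have pk: "p k = i \<longleftrightarrow> k = inv p i" for k using permutes_inverses[OF p] by metis
      have "(\<Prod>k\<in>UNIV. (\<chi> k j. if j = i then F k K else N K $ k $ j) $ k $ p k)
          = F (inv p i) K * (\<Prod>k\<in>UNIV - {inv p i}. (\<chi> k j. if j = i then F k K else N K $ k $ j) $ k $ p k)"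
        by (subst prod.remove[of _ "inv p i"]) (simp_all add: permutes_inverses[OF p])
      also have "(\<Prod>k\<in>UNIV - {inv p i}. (\<chi> k j. if j = i then F k K else N K $ k $ j) $ k $ p k)
          = (\<Prod>k\<in>UNIV - {inv p i}. N K $ k $ p k)"
        by (rule prod.cong) (auto simp: pk)
      finally show "of_int (sign p) * (\<Prod>k\<in>UNIV. (\<chi> k j. if j = i then F k K else N K $ k $ j) $ k $ p k)
          = of_int (sign p) * (\<Prod>k\<in>UNIV - {inv p i}. N K $ k $ p k) * F (inv p i) K" by simp
    qed
    finally have eq: "(\<Sum>p | p permutes UNIV. (of_int (sign p) * (\<Prod>k\<in>UNIV - {inv p i}. N K $ k $ p k)) * F (inv p i) K)
       = det (N K) * (K $ i $ i - K0 $ i $ i)" for K by simp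
    have "(\<lambda>K. \<Sum>p | p permutes UNIV. (of_int (sign p) * (\<Prod>k\<in>UNIV - {inv p i}. N K $ k $ p k)) * F (inv p i) K) \<in> J"
      unfolding J_def
      by (intro ideal_generated_sum ideal_generated_mult F[unfolded J_def] poly_fun_intros N)
    then show ?thesis unfolding eq .
  qed
  have coord: "(\<lambda>K. det (N K) * (K $ i $ j - K0 $ i $ j)) \<in> J" for i j
  proof (cases "i = j")
    case False
    then show ?thesis using off[OF False] detp unfolding J_def by (intro ideal_generated_mult)
  qed (use diag in simp)
  show ?thesis
  proof (intro equalityI subsetI)
    fix f assume "f \<in> localized_ideal J K0"
    then obtain g where g: "poly_fun f" "g K0 \<noteq> 0" "(\<lambda>P. g P * f P) \<in> J"
      unfolding localized_ideal_def by blast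
    then show "f \<in> {f. poly_fun f \<and> f K0 = 0}" using vanish[OF g(3)] by simp
  next
    fix f assume "f \<in> {f. poly_fun f \<and> f K0 = 0}"
    then have f: "poly_fun f" "f K0 = 0" by simp_all
    obtain A where A: "\<forall>i j. poly_fun (A i j)" "\<forall>K. f K = f K0 + (\<Sum>i\<in>UNIV. \<Sum>j\<in>UNIV. A i j K * (K $ i $ j - K0 $ i $ j))"
      using hadamard[OF f(1), of K0] by blast
    have "(\<lambda>K. \<Sum>i\<in>UNIV. \<Sum>j\<in>UNIV. A i j K * (det (N K) * (K $ i $ j - K0 $ i $ j))) \<in> J"
      unfolding J_def by (intro ideal_generated_sum, rule ideal_generated_mult[OF coord[unfolded J_def]]) (use A(1) in blast)
    also have "(\<lambda>K. \<Sum>i\<in>UNIV. \<Sum>j\<in>UNIV. A i j K * (det (N K) * (K $ i $ j - K0 $ i $ j))) = (\<lambda>K. det (N K) * f K)"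
    proof
      fix K
      have "f K = (\<Sum>i\<in>UNIV. \<Sum>j\<in>UNIV. A i j K * (K $ i $ j - K0 $ i $ j))" using spec[OF A(2), of K] f(2) by simp
      then show "(\<Sum>i\<in>UNIV. \<Sum>j\<in>UNIV. A i j K * (det (N K) * (K $ i $ j - K0 $ i $ j))) = det (N K) * f K"
        by (simp add: sum_distrib_left mult.left_commute)
    qed
    finally show "f \<in> localized_ideal J K0"
      unfolding localized_ideal_def using f(1) detp det by blast
  qed
qed

context diagonal_model
begin

lemma critical_ideal_vanishes:
  assumes K: "K \<in> critical_points X S" and f: "f \<in> critical_ideal X S" shows "f K = 0"
  using _ f unfolding critical_ideal_def
proof (rule ideal_generated_vanishes)
  have KX: "K \<in> X" "det K \<noteq> 0" and crit: "\<And>V. V \<in> tangent_space X K \<Longrightarrow> dloglik S K V = 0"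
    using K by (auto simp: critical_points_def smooth_locus_def invertible_det_nz)
  fix g assume "g \<in> vanishing_ideal X \<union> {\<lambda>K. dir_deriv det K (\<theta> K) - det K * trace (S ** \<theta> K) | \<theta>. \<theta> \<in> tangent_fields X}"
  then show "g K = 0"
  proof
    assume "g \<in> vanishing_ideal X" then show ?thesis using ideal_zero KX(1) by blast
  next
    assume "g \<in> {\<lambda>K. dir_deriv det K (\<theta> K) - det K * trace (S ** \<theta> K) | \<theta>. \<theta> \<in> tangent_fields X}"
    then obtain \<theta> where g: "g = (\<lambda>K. dir_deriv det K (\<theta> K) - det K * trace (S ** \<theta> K))" and t: "\<theta> \<in> tangent_fields X"
      by blast
    have "dloglik S K (\<theta> K) = 0" using crit t KX(1) by (simp add: tangent_fields_def)
    then show ?thesis using KX(2) by (simp add: g dloglik_def field_simps)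
  qed
qed

text \<open>Scores for the spanning vectors of \<open>L\<close> and circuit polynomials for those of
  its annihilator give a square Jacobian. A kernel vector \<open>h\<close> yields
  \<open>dy = y\<^sup>2 h\<close> in \<open>L\<close> and \<open>dw = (1 - 2 s / y) h\<close> in
  \<open>orth L\<close>, which solve the linearized system identically, so \<open>nondeg\<close>
  gives \<open>h = 0\<close>.\<close>

lemma critical_mult_one:
  assumes y: "y \<in> torus L" and crit: "score_vec S y \<in> orth L"
    and nd: "nondeg UNIV L (cvec (\<chi> i. 1)) y (score_vec S y)"
  shows "critical_mult X S (inv_diag y) = 1"
proof -
  have ynz: "y $ i \<noteq> 0" for i using y by (simp add: torus_def)
  have K0: "inv_diag y \<in> critical_points X S" using y crit by (simp add: critical_points_eq)
  obtain I :: "'n set" and u :: "'n \<Rightarrow> complex^'n" where uL: "\<And>k. k \<in> I \<Longrightarrow> u k \<in> L" and uO: "\<And>k. k \<notin> I \<Longrightarrow> u k \<in> orth L"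
    and spO: "\<And>d. (\<And>k. k \<in> I \<Longrightarrow> bil (u k) d = 0) \<Longrightarrow> d \<in> orth L"
    and spL: "\<And>v. (\<And>k. k \<notin> I \<Longrightarrow> bil (u k) v = 0) \<Longrightarrow> v \<in> L"
  proof (rule orth_spanning)
    fix I :: "'n set" and u :: "'n \<Rightarrow> complex^'n"
    assume "\<And>k. k \<in> I \<Longrightarrow> u k \<in> L" "\<And>k. k \<notin> I \<Longrightarrow> u k \<in> orth L"
      "\<And>d. (\<And>k. k \<in> I \<Longrightarrow> bil (u k) d = 0) \<Longrightarrow> d \<in> orth L"
      "\<And>v. (\<And>k. k \<notin> I \<Longrightarrow> bil (u k) v = 0) \<Longrightarrow> v \<in> L"
    then show thesis by (rule that)
  qed
  define F where "F k = (if k \<in> I then score S (u k) else circuit_poly (u k))" for k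
  have FJ: "F k \<in> critical_ideal X S" for k
    using score_in_critical_ideal[OF uL] ideal_in_critical_ideal[OF circuit_poly_ideal[OF uO]] by (simp add: F_def)
  have Fp: "poly_fun (F k)" for k
    using poly_fun_score[of S "u k"] circuit_poly_ideal[OF uO, of k] by (auto simp: F_def vanishing_ideal_def)
  have F0: "F k (inv_diag y) = 0" for k by (rule critical_ideal_vanishes[OF K0 FJ])
  have "\<forall>k. \<exists>A. (\<forall>i j. poly_fun (A i j)) \<and> (\<forall>K. F k K = F k (inv_diag y) + (\<Sum>i\<in>UNIV. \<Sum>j\<in>UNIV. A i j K * (K $ i $ j - inv_diag y $ i $ j)))"
    using hadamard[OF Fp] by blast
  from choice[OF this] obtain A where A: "\<forall>k. (\<forall>i j. poly_fun (A k i j)) \<and> (\<forall>K. F k K = F k (inv_diag y) + (\<Sum>i\<in>UNIV. \<Sum>j\<in>UNIV. A k i j K * (K $ i $ j - inv_diag y $ i $ j)))" ..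
  have Ap: "poly_fun (A k i j)" for k i j using A by blast
  have AF: "F k K = F k (inv_diag y) + (\<Sum>i\<in>UNIV. \<Sum>j\<in>UNIV. A k i j K * (K $ i $ j - inv_diag y $ i $ j))" for k K using A by blast
  define N where "N K = (\<chi> k i. A k i i K)" for K
  have offJ: "(\<lambda>K. K $ i $ j - inv_diag y $ i $ j) \<in> critical_ideal X S" if "i \<noteq> j" for i j
    using ideal_in_critical_ideal[OF off_diagonal_ideal[OF that]] that by (simp add: inv_diag_nth)
  \<comment> \<open>The expansion of \<open>F k\<close> also involves off-diagonal entries; these
    lie in the ideal and are subtracted to reach the form needed for Cramer's rule.\<close>
  define F' where "F' k K = F k K + (\<Sum>i\<in>UNIV. \<Sum>j\<in>UNIV - {i}. - A k i j K * (K $ i $ j - inv_diag y $ i $ j))" for k K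
  have F'J: "F' k \<in> critical_ideal X S" for k
    unfolding F'_def[abs_def] using FJ offJ unfolding critical_ideal_def
  proof (intro ideal_generated_add ideal_generated_sum ideal_generated_mult)
    show "poly_fun (\<lambda>K. - A k i j K)" for i j using poly_fun.mult[OF poly_fun.const[of "-1"] Ap[of k i j]] by simp
  qed auto
  have F'eq: "F' k K = (\<Sum>i\<in>UNIV. N K $ k $ i * (K $ i $ i - inv_diag y $ i $ i))" for k K
  proof -
    have "(\<Sum>j\<in>UNIV. A k i j K * (K $ i $ j - inv_diag y $ i $ j)) = A k i i K * (K $ i $ i - inv_diag y $ i $ i)
        + (\<Sum>j\<in>UNIV - {i}. A k i j K * (K $ i $ j - inv_diag y $ i $ j))" for i
      by (subst sum.remove[of _ i]) auto
    then show ?thesis unfolding F'_def AF[of k K] F0 by (simp add: N_def sum.distrib sum_negf)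
  qed
  have "det (N (inv_diag y)) \<noteq> 0"
  proof -
    have "h = 0" if h: "N (inv_diag y) *v h = 0" for h
    proof -
      have dF: "dir_deriv (F k) (inv_diag y) (diag_mat h) = 0" for k
      proof -
        have "dir_deriv (F k) (inv_diag y) (diag_mat h) = (\<Sum>i\<in>UNIV. \<Sum>j\<in>UNIV. A k i j (inv_diag y) * diag_mat h $ i $ j)"
          by (rule hadamard_dir_deriv[OF Fp Ap AF])
        also have "\<dots> = (N (inv_diag y) *v h) $ k"
          by (simp add: N_def matrix_vector_mult_def diag_mat_nth if_distrib[of "(*) _"] cong: if_cong)
        finally show ?thesis by (simp add: h)
      qed
      have dy: "(\<chi> i. (y $ i)\<^sup>2 * h $ i) \<in> L"
      proof (rule spL)
        fix k assume k: "k \<notin> I"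
        have "dir_deriv (circuit_poly (u k)) (inv_diag y) (diag_mat h) = 0" using dF[of k] k by (simp add: F_def)
        then show "bil (u k) (\<chi> i. (y $ i)\<^sup>2 * h $ i) = 0"
          unfolding dir_deriv_circuit_poly[OF y uO[OF k]] using ynz by (simp add: bil_def)
      qed
      have dw: "(\<chi> i. (1 - 2 * S $ i $ i / y $ i) * h $ i) \<in> orth L"
      proof (rule spO)
        fix k assume k: "k \<in> I"
        have "dir_deriv (score S (u k)) (inv_diag y) (diag_mat h) = 0" using dF[of k] k by (simp add: F_def)
        then show "bil (u k) (\<chi> i. (1 - 2 * S $ i $ i / y $ i) * h $ i) = 0"
          unfolding dir_deriv_score[OF y uL[OF k] crit] using ynz by (simp add: bil_def)
      qed
      have "(1 + 2 * y $ i * (S $ i $ i / (y $ i)\<^sup>2 - 1 / y $ i)) * ((y $ i)\<^sup>2 * h $ i) + (y $ i)\<^sup>2 * ((1 - 2 * S $ i $ i / y $ i) * h $ i) = 0" for i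
        using ynz[of i] by (simp add: field_simps power2_eq_square)
      then have "(\<chi> i. (y $ i)\<^sup>2 * h $ i) = 0"
        using bspec[OF bspec[OF nd[unfolded nondeg_def] dy] dw] by (simp add: cvec_def score_vec_def)
      then show "h = 0" using ynz by (simp add: vec_eq_iff)
    qed
    then show ?thesis by (metis invertible_det_nz invertible_left_inverse matrix_left_invertible_ker)
  qed
  then have "localized_ideal (critical_ideal X S) (inv_diag y) = {f. poly_fun f \<and> f (inv_diag y) = 0}"
    unfolding critical_ideal_def
    by (intro localized_ideal_maximal[where F = F' and N = N] F'J[unfolded critical_ideal_def] F'eq offJ[unfolded critical_ideal_def]
       critical_ideal_vanishes[OF K0, unfolded critical_ideal_def]) (simp_all add: N_def Ap)
  then show ?thesis by (simp add: critical_mult_def colength_maximal_ideal)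
qed

text \<open>As \<open>s\<close> has no zero coordinate, every solution has \<open>y\<close> in the
  torus, so solutions correspond to critical points, each of multiplicity one.\<close>

lemma critical_count_eq:
  fixes S :: "complex^'n^'n"
  defines "s \<equiv> (\<chi> i. S $ i $ i)"
  assumes s: "\<forall>i. s $ i \<noteq> 0" and fin: "finite (sol UNIV L (cvec (\<chi> i. 1)) s)"
    and nd: "\<forall>(y, w)\<in>sol UNIV L (cvec (\<chi> i. 1)) s. nondeg UNIV L (cvec (\<chi> i. 1)) y w"
  shows "critical_count X S = enat (card (sol UNIV L (cvec (\<chi> i. 1)) s))"
proof -
  let ?a = "cvec (\<chi> i. 1) :: complex^'n"
  let ?Y = "{y\<in>torus L. score_vec S y \<in> orth L}"
  have iff: "(y, w) \<in> sol UNIV L ?a s \<longleftrightarrow> y \<in> ?Y \<and> w = score_vec S y" for y w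
  proof -
    have e: "y $ i + (y $ i)\<^sup>2 * w $ i = S $ i $ i \<longleftrightarrow> w $ i = S $ i $ i / (y $ i)\<^sup>2 - 1 / y $ i" if "y $ i \<noteq> 0" for i
      using that by (auto simp: field_simps power2_eq_square)
    have sol: "(y, w) \<in> sol UNIV L ?a s \<longleftrightarrow> y \<in> L \<and> w \<in> orth L \<and> (\<forall>i. y $ i + (y $ i)\<^sup>2 * w $ i = S $ i $ i)"
      by (simp add: sol_def phi_eq_iff cvec_def s_def)
    show ?thesis
    proof
      assume a: "(y, w) \<in> sol UNIV L ?a s"
      then have p: "y $ i + (y $ i)\<^sup>2 * w $ i = S $ i $ i" for i by (simp add: sol)
      have nz: "y $ i \<noteq> 0" for i
      proof
        assume "y $ i = 0"
        then have "S $ i $ i = 0" using p[of i] by simp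
        then show False using s by (simp add: s_def)
      qed
      have "w = score_vec S y" using p by (simp add: vec_eq_iff score_vec_def e[OF nz])
      then show "y \<in> ?Y \<and> w = score_vec S y" using a[unfolded sol] nz by (simp add: torus_def)
    next
      assume a: "y \<in> ?Y \<and> w = score_vec S y"
      then have nz: "y $ i \<noteq> 0" for i by (simp add: torus_def)
      show "(y, w) \<in> sol UNIV L ?a s" unfolding sol using a e[OF nz] by (auto simp: torus_def score_vec_def)
    qed
  qed
  have bij: "bij_betw (\<lambda>y. (y, score_vec S y)) ?Y (sol UNIV L ?a s)"
    by (rule bij_betwI[where g = fst]) (auto simp: iff)
  have finY: "finite ?Y" using bij_betw_finite[OF bij] fin by simp
  have mult: "critical_mult X S (inv_diag y) = 1" if "y \<in> ?Y" for y
    by (rule critical_mult_one) (use that nd iff[of y "score_vec S y"] in auto)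
  have "(\<Sum>K\<in>critical_points X S. critical_mult X S K) = (\<Sum>y\<in>?Y. critical_mult X S (inv_diag y))"
    unfolding critical_points_eq by (rule sum.reindex_cong[of inv_diag]) (auto simp: inj_on_def inv_diag_inject)
  also have "\<dots> = (\<Sum>y\<in>?Y. 1)" by (rule sum.cong) (auto simp: mult)
  also have "\<dots> = enat (card ?Y)" by (simp add: of_nat_eq_enat)
  finally show ?thesis using finY bij_betw_same_card[OF bij] by (simp add: critical_count_def critical_points_eq)
qed

end

section \<open>The reciprocal maximum likelihood degree\<close>

text \<open>\<open>T\<close> is the point at parameter \<open>\<i>\<close> of the line through its
  real and imaginary parts, so \<open>h\<close> is a nonzero polynomial on this line and is nonzero
  at some real parameter.\<close>

lemma real_symmetric_nonzero:
  fixes h :: "complex^'n^'n \<Rightarrow> complex"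
  assumes h: "poly_fun h" "h T \<noteq> 0" "transpose T = T"
  obtains S :: "real^'n^'n" where "transpose S = S" "h (map_matrix complex_of_real S) \<noteq> 0"
proof -
  define A where "A = map_matrix Re T"
  define B where "B = map_matrix Im T"
  let ?c = "map_matrix complex_of_real :: real^'n^'n \<Rightarrow> complex^'n^'n"
  obtain q where q: "\<And>t. h (?c A + cscale t (?c B)) = poly q t" using poly_fun_line[OF h(1)] by blast
  have "?c A + cscale \<i> (?c B) = T" by (simp add: vec_eq_iff cscale_nth A_def B_def map_matrix_def flip: complex_eq)
  then have "q \<noteq> 0" using q[of \<i>] h(2) by auto
  moreover have "infinite (range complex_of_real)" by (simp add: finite_image_iff inj_on_def infinite_UNIV_char_0)
  ultimately obtain z where "z \<in> range complex_of_real" "poly q z \<noteq> 0" by (rule poly_nonzero_on_infinite)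
  then obtain t where t: "poly q (complex_of_real t) \<noteq> 0" by blast
  show thesis
  proof (rule that[of "A + t *\<^sub>R B"])
    show "transpose (A + t *\<^sub>R B) = A + t *\<^sub>R B"
      using h(3) by (simp add: vec_eq_iff transpose_def A_def B_def map_matrix_def)
    have "?c (A + t *\<^sub>R B) = ?c A + cscale (of_real t) (?c B)" by (simp add: vec_eq_iff cscale_nth map_matrix_def)
    then show "h (?c (A + t *\<^sub>R B)) \<noteq> 0" using q[of "of_real t"] t by simp
  qed
qed

lemma pos_def_shift:
  fixes S :: "real^'n^'n"
  assumes S: "transpose S = S"
  obtains c where "\<And>u. c < u \<Longrightarrow> pos_def (S + u *\<^sub>R mat 1)"
proof -
  obtain c where c: "\<And>x. norm (S *v x) \<le> c * norm x"
    using linear_bounded[OF matrix_vector_mul_linear[of S]] by blast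
  show thesis
  proof (rule that[of c])
    fix u assume u: "c < u"
    have "0 < x \<bullet> ((S + u *\<^sub>R mat 1) *v x)" if x: "x \<noteq> 0" for x
    proof -
      have "\<bar>x \<bullet> (S *v x)\<bar> \<le> norm x * norm (S *v x)" by (rule Cauchy_Schwarz_ineq2)
      also have "\<dots> \<le> norm x * (c * norm x)" by (rule mult_left_mono[OF c]) simp
      also have "\<dots> < u * (x \<bullet> x)" using x u by (simp add: dot_square_norm power2_eq_square mult_ac)
      finally have "0 < x \<bullet> (S *v x) + u * (x \<bullet> x)" by linarith
      moreover have "(S + u *\<^sub>R mat 1) *v x = S *v x + u *\<^sub>R x"
        by (simp add: matrix_vector_mult_add_rdistrib scaleR_matrix_vector_assoc[symmetric])
      ultimately show ?thesis by (simp add: inner_add_right)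
    qed
    moreover have "transpose (S + u *\<^sub>R mat 1) = S + u *\<^sub>R mat 1"
      using S by (simp add: vec_eq_iff transpose_def mat_def eq_commute)
    ultimately show "pos_def (S + u *\<^sub>R mat 1)" by (simp add: pos_def_def)
  qed
qed

text \<open>Adding a large real multiple of the identity makes a real symmetric matrix positive
  definite, and a nonzero polynomial in that multiple cannot vanish at all large reals.\<close>

lemma pos_def_nonzero:
  fixes h :: "complex^'n^'n \<Rightarrow> complex"
  assumes h: "poly_fun h" "h T \<noteq> 0" "transpose T = T"
  obtains S :: "real^'n^'n" where "pos_def S" "h (map_matrix complex_of_real S) \<noteq> 0"
proof -
  let ?c = "map_matrix complex_of_real :: real^'n^'n \<Rightarrow> complex^'n^'n"
  obtain S :: "real^'n^'n" where S: "transpose S = S" "h (?c S) \<noteq> 0" by (rule real_symmetric_nonzero[OF h])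
  obtain c where c: "\<And>u. c < u \<Longrightarrow> pos_def (S + u *\<^sub>R mat 1)" using pos_def_shift[OF S(1)] by blast
  obtain q where q: "\<And>t. h (?c S + cscale t (mat 1)) = poly q t" using poly_fun_line[OF h(1)] by blast
  have "?c S + cscale 0 (mat 1) = ?c S" by (simp add: vec_eq_iff cscale_nth)
  then have "q \<noteq> 0" using q[of 0] S(2) by auto
  moreover have "infinite (complex_of_real ` {c<..})" by (simp add: finite_image_iff inj_on_def infinite_Ioi)
  ultimately obtain z where "z \<in> complex_of_real ` {c<..}" "poly q z \<noteq> 0" by (rule poly_nonzero_on_infinite)
  then obtain u where u: "c < u" "poly q (complex_of_real u) \<noteq> 0" by auto
  have "?c (S + u *\<^sub>R mat 1) = ?c S + cscale (of_real u) (mat 1)"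
    by (simp add: vec_eq_iff cscale_nth map_matrix_def mat_def)
  then show thesis using that[OF c[OF u(1)]] q[of "of_real u"] u(2) by simp
qed

lemma for_general_pos_def_common:
  fixes P Q :: "real^'n^'n \<Rightarrow> bool"
  assumes "for_general_pos_def P" "for_general_pos_def Q"
  obtains S where "P S" "Q S"
proof -
  obtain h T where h: "poly_fun h" "transpose T = T" "h T \<noteq> 0"
    and hP: "\<And>S. pos_def S \<Longrightarrow> h (map_matrix complex_of_real S) \<noteq> 0 \<Longrightarrow> P S"
    using assms(1) unfolding for_general_pos_def_def by blast
  obtain g U where g: "poly_fun g" "transpose U = U" "g U \<noteq> 0"
    and gQ: "\<And>S. pos_def S \<Longrightarrow> g (map_matrix complex_of_real S) \<noteq> 0 \<Longrightarrow> Q S"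
    using assms(2) unfolding for_general_pos_def_def by blast
  obtain p where p: "\<And>t. h (T + cscale t (U - T)) = poly p t" using poly_fun_line[OF h(1)] by blast
  obtain q where q: "\<And>t. g (T + cscale t (U - T)) = poly q t" using poly_fun_line[OF g(1)] by blast
  have "T + cscale 0 (U - T) = T" "T + cscale 1 (U - T) = U" by (simp_all add: vec_eq_iff cscale_nth)
  then have "p * q \<noteq> 0" using p[of 0] q[of 1] h(3) g(3) by auto
  then obtain t where t: "poly (p * q) t \<noteq> 0" by (rule poly_nonzero_on_infinite[OF _ infinite_UNIV_char_0])
  have sym: "transpose (T + cscale t (U - T)) = T + cscale t (U - T)"
    using h(2) g(2) by (simp add: vec_eq_iff transpose_def cscale_nth)
  have "h (T + cscale t (U - T)) * g (T + cscale t (U - T)) \<noteq> 0" using t by (simp add: p q)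
  then obtain S :: "real^'n^'n" where "pos_def S" "h (map_matrix complex_of_real S) * g (map_matrix complex_of_real S) \<noteq> 0"
    by (rule pos_def_nonzero[OF poly_fun.mult[OF h(1) g(1)] _ sym])
  then show thesis using that[OF hP gQ, of S] by simp
qed

lemma rmld_eqI:
  assumes "has_rmld L d" shows "rmld L = d"
  unfolding rmld_def
proof (rule the_equality)
  show "has_rmld L d" by (rule assms)
  fix d' assume "has_rmld L d'"
  from for_general_pos_def_common[OF assms[unfolded has_rmld_def] this[unfolded has_rmld_def]]
  show "d' = d" by (metis enat.inject)
qed

text \<open>Only the diagonal of \<open>S\<close> enters the equations, so genericity of vectors is
  pulled back along the diagonal; \<open>diag_mat s0\<close> shows that the pulled-back polynomial
  is nonzero on symmetric matrices.\<close>

lemma has_rmld_gcount: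
  fixes L :: "(complex^'n) set"
  assumes L: "vec.subspace L" and d: "gcount UNIV L (cvec (\<chi> i. 1)) d"
  shows "has_rmld (diag_mat ` L) d"
proof -
  interpret diagonal_model L "reciprocal_variety (diag_mat ` L)"
    by unfold_locales (rule L, rule reciprocal_variety_eq)
  have "generic (\<lambda>s. (finite (sol UNIV L (cvec (\<chi> i. 1)) s) \<and> card (sol UNIV L (cvec (\<chi> i. 1)) s) = d
     \<and> (\<forall>(y, w)\<in>sol UNIV L (cvec (\<chi> i. 1)) s. nondeg UNIV L (cvec (\<chi> i. 1)) y w)) \<and> (\<forall>i\<in>UNIV. s $ i \<noteq> 0))"
    by (rule generic_conj[OF d[unfolded gcount_def] generic_nth_nonzero])
  then obtain h s0 where h: "vpoly h" "h s0 \<noteq> 0" and hP: "\<And>s. h s \<noteq> 0 \<Longrightarrow> (finite (sol UNIV L (cvec (\<chi> i. 1)) s) \<and> card (sol UNIV L (cvec (\<chi> i. 1)) s) = d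
     \<and> (\<forall>(y, w)\<in>sol UNIV L (cvec (\<chi> i. 1)) s. nondeg UNIV L (cvec (\<chi> i. 1)) y w)) \<and> (\<forall>i\<in>UNIV. s $ i \<noteq> 0)"
    unfolding generic_def by blast
  show ?thesis unfolding has_rmld_def for_general_pos_def_def
  proof (intro exI[of _ "\<lambda>S. h (\<chi> i. S $ i $ i)"] conjI exI[of _ "diag_mat s0"] allI impI)
    show "poly_fun (\<lambda>S. h (\<chi> i. S $ i $ i))"
      unfolding poly_fun_pfun by (rule pfun_comp[OF h(1)]) (simp add: poly_fun_pfun[symmetric] poly_fun.coord)
    show "transpose (diag_mat s0) = diag_mat s0" by (auto simp: vec_eq_iff transpose_def diag_mat_nth)
    have "(\<chi> i. diag_mat s0 $ i $ i) = s0" by (simp add: vec_eq_iff diag_mat_nth)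
    then show "h (\<chi> i. diag_mat s0 $ i $ i) \<noteq> 0" using h(2) by simp
    fix S :: "real^'n^'n"
    assume "pos_def S \<and> h (\<chi> i. map_matrix complex_of_real S $ i $ i) \<noteq> 0"
    note P = hP[OF conjunct2[OF this]]
    then show "critical_count (reciprocal_variety (diag_mat ` L)) (map_matrix complex_of_real S) = enat d"
      using critical_count_eq[of "map_matrix complex_of_real S"] by simp
  qed
qed

theorem theorem1p1:
  fixes L :: "(complex^'n) set" and r :: nat
  assumes "vec.subspace L"
    and "vec.dim L = r"
    and "\<And>i. \<not> L \<subseteq> {v. v $ i = 0}"
  shows "has_rmld (diag_mat ` L) (rmld (diag_mat ` L)) \<and>
    real (rmld (diag_mat ` L)) =
      (- 2) ^ r * poly (map_poly real_of_int (characteristic_poly (matroid_indep L))) (1 / 2)"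
proof -
  have "supported UNIV L" using assms(1) by (simp add: supported_def)
  moreover have "weights L (\<chi> i. 1)"
    by (auto simp: weights_def supp_def vec_eq_iff)
  ultimately obtain d where d: "gcount UNIV L (cvec (\<chi> i. 1)) d" "int d = rank_sum UNIV L"
    using gcount_rank_sum[of UNIV L "\<chi> i. 1"] by blast
  have rmld: "has_rmld (diag_mat ` L) d" by (rule has_rmld_gcount[OF assms(1) d(1)])
  have "real d = (- 2) ^ r * poly (map_poly real_of_int (characteristic_poly (matroid_indep L))) (1 / 2)"
    using characteristic_poly_rank_sum[OF assms(1)] by (simp add: assms(2) flip: d(2))
  then show ?thesis using rmld by (simp add: rmld_eqI[OF rmld])
qed

end
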